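(* Assume $q$ is not a root of unity. Then the group $\mathrm{Aut}(\mathfrak w)$ of weak Hopf algebra automorphisms of $\mathfrak w=\mathfrak w_q^{\mathsf d}(\mathfrak g)$ is $$\mathrm{Aut}(\mathfrak w_q^{\mathsf d}(\mathfrak g))=N\rtimes H,$$ where $N=(k^* )^n$ is the group of diagonal automorphisms $\phi_a$ and $H$ is the group of automorphisms of the Dynkin diagram of $\mathfrak g$, acting by the automorphisms $\sigma$.
   Context: Setting. $k$ is a field of characteristic $0$; $\mathfrak g$ is a finite-dimensional simple Lie algebra with root system $R$, simple roots $\alpha_1,\dots,\alpha_n$, Cartan matrix $(a_{ij})_{n\times n}$; $(\,,\,)$ is the Weyl-group-invariant scalar product with $(\alpha,\alpha)=2$ for all short roots; $d_i=(\alpha_i,\alpha_i)/2$, so $(\alpha_i,\alpha_j)=d_ia_{ij}=d_ja_{ji}$. $q\in k$, $q_i=q^{d_i}$, and $q_i\neq 0,\pm1$ for all $i$. $[m]_x=\frac{x^m-x^{-m}}{x-x^{-1}}$, $[m]!_x=[m]_x\cdots[1]_x$, $[0]!_x=1$, $\left[{m\atop s}\right]_x=\frac{[m]!_x}{[s]!_x[m-s]!_x}$ (a Laurent polynomial in $x$, evaluated at $x=q_i$ below). The algebra. Fix a binary sequence $\mathsf d=(\kappa_1,\dots,\kappa_n\,|\,\bar\kappa_1,\dots,\bar\kappa_n)\in\{0,1\}^{2n}$. $E_i$ is called type 1 if $\kappa_i=1$ and type 2 if $\kappa_i=0$; $F_i$ is type 1 if $\bar\kappa_i=1$ and type 2 if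 $\bar\kappa_i=0$. $\mathfrak w=\mathfrak w_q^{\mathsf d}(\mathfrak g)$ is the unital $k$-algebra generated by $E_i,F_i,K_i,\overline K_i$ ($1\le i\le n$) and $J$ with relations, for all $1\le i,j\le n$: $J=K_i\overline K_i$; $K_i\overline K_j=\overline K_jK_i$, $K_iK_j=K_jK_i$, $\overline K_i\overline K_j=\overline K_j\overline K_i$; $JK_i=K_i$, $J\overline K_i=\overline K_i$; if $E_i$ is type 1: $K_jE_i=q_i^{a_{ij}}E_iK_j$ and $E_i\overline K_j=q_i^{a_{ij}}\overline K_jE_i$; if $E_i$ is type 2: $K_jE_i\overline K_j=q_i^{a_{ij}}E_i$; the same for $F_i$ with $a_{ij}$ replaced by $-a_{ij}$; $E_iF_j-F_jE_i=\delta_{ij}\frac{K_i-\overline K_i}{q_i-q_i^{-1}}$; for $i\ne j$: $\sum_{s=0}^{1-a_{ij}}(-1)^s\left[{1-a_{ij}\atop s}\right]_{q_i}E_i^{1-a_{ij}-s}E_jE_i^s=0$ and the same relation with $F$ in place of $E$. The maps. $\Delta:\mathfrak w\to\mathfrak w\otimes\mathfrak w$ and $\varepsilon:\mathfrak w\to k$ are extended as unital algebra homomorphisms, $T:\mathfrak w\to\mathfrak w$ as an algebra anti-homomorphism, from: $\Delta(K_i)=K_i\otimes K_i$, $\Delta(\overline K_i)=\overline K_i\otimes\overline K_i$, $\Delta(J)=J\otimes J$; $\Delta(E_i)=1\otimes E_i+E_i\otimes K_i$ if $E_i$ is type 1, $\Delta(E_i)=J\otimes E_i+E_i\otimes K_i$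 if type 2; $\Delta(F_i)=F_i\otimes1+\overline K_i\otimes F_i$ if $F_i$ is type 1, $\Delta(F_i)=F_i\otimes J+\overline K_i\otimes F_i$ if type 2; $\varepsilon(E_i)=\varepsilon(F_i)=0$, $\varepsilon(K_i)=\varepsilon(\overline K_i)=\varepsilon(J)=1$; $T(1)=1$, $T(E_i)=-E_i\overline K_i$, $T(F_i)=-K_iF_i$, $T(K_i)=\overline K_i$, $T(\overline K_i)=K_i$, $T(J)=J$. With these, $\mathfrak w$ is a weak Hopf algebra (a bialgebra with $\mathrm{id}*T*\mathrm{id}=\mathrm{id}$, $T*\mathrm{id}*T=T$ for the convolution $*$). Automorphisms. A weak Hopf algebra automorphism of $\mathfrak w$ is an invertible algebra homomorphism $\varphi:\mathfrak w\to\mathfrak w$ with $(\varphi\otimes\varphi)\circ\Delta=\Delta\circ\varphi$, $\varepsilon=\varepsilon\circ\varphi$, $\varphi\circ T=T\circ\varphi$. For $a=(a_1,\dots,a_n)\in N=(k^* )^n$, $\phi_a$ is given by $\phi_a(K_i)=K_i$, $\phi_a(\overline K_i)=\overline K_i$, $\phi_a(E_i)=a_iE_i$, $\phi_a(F_i)=a_i^{-1}F_i$. $H$ is the group of automorphisms of the Dynkin diagram, i.e. bijections $\sigma$ of $\{1,\dots,n\}$ with $d_ia_{ij}=d_{\sigma(i)}a_{\sigma(i)\sigma(j)}$ for all $i,j$; $\sigma\in H$ is identified with the map given by $\sigma(K_i)=K_{\sigma(i)}$, $\sigma(\overline K_i)=\overline K_{\sigma(i)}$, $\sigma(E_i)=E_{\sigma(i)}$,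 $\sigma(F_i)=F_{\sigma(i)}$. $H$ acts on $N$ by $\sigma\cdot a=(a_{\sigma(1)},\dots,a_{\sigma(n)})$, and $\phi_a\sigma=\sigma\phi_{\sigma\cdot a}$.
   Formalization: H is taken to be the Dynkin diagram automorphisms σ preserving the types (κ_{σ(i)}=κ_i and κ̄_{σ(i)}=κ̄_i); other σ do not define maps of w, e.g. the flip of A_2 with E_1 of type 1 and E_2 of type 2, since JE_2=E_2 but JE_1≠E_1. *)

theory Defs
  imports
    "HOL-Algebra.Module"
    "HOL-Algebra.QuotRing"
    "HOL-Algebra.Bij"
    "HOL-Library.Poly_Mapping"
    "HOL-Analysis.Euclidean_Space"
begin

unbundle inner_syntax

section \<open>Root systems and Cartan data\<close>

definition irreducible_root_system :: "'v::euclidean_space set \<Rightarrow> bool" where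
  "irreducible_root_system R \<longleftrightarrow>
     finite R \<and> R \<noteq> {} \<and> 0 \<notin> R \<and> span R = UNIV \<and>
     (\<forall>\<alpha>\<in>R. \<forall>\<beta>\<in>R. \<beta> - (2 * (\<alpha> \<bullet> \<beta>) / (\<alpha> \<bullet> \<alpha>)) *\<^sub>R \<alpha> \<in> R) \<and>
     (\<forall>\<alpha>\<in>R. \<forall>\<beta>\<in>R. 2 * (\<alpha> \<bullet> \<beta>) / (\<alpha> \<bullet> \<alpha>) \<in> \<int>) \<and>
     (\<forall>\<alpha>\<in>R. \<forall>c. c *\<^sub>R \<alpha> \<in> R \<longrightarrow> c = 1 \<or> c = -1) \<and>
     \<not> (\<exists>A B. A \<noteq> {} \<and> B \<noteq> {} \<and> A \<union> B = R \<and> (\<forall>\<alpha>\<in>A. \<forall>\<beta>\<in>B. \<alpha> \<bullet> \<beta> = 0))"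

definition simple_roots :: "'v::euclidean_space set \<Rightarrow> ('i::finite \<Rightarrow> 'v) \<Rightarrow> bool" where
  "simple_roots R \<alpha> \<longleftrightarrow>
     inj \<alpha> \<and> range \<alpha> \<subseteq> R \<and> independent (range \<alpha>) \<and>
     (\<forall>\<beta>\<in>R. \<exists>c :: 'i \<Rightarrow> int. \<beta> = (\<Sum>i\<in>UNIV. of_int (c i) *\<^sub>R \<alpha> i) \<and>
        ((\<forall>i. 0 \<le> c i) \<or> (\<forall>i. c i \<le> 0)))"

text \<open>The simple Lie algebra enters only through its root system \<open>R\<close>, realised in a Euclidean
  space whose inner product is the Weyl-group-invariant scalar product, scaled so that
  \<open>(\<alpha>, \<alpha>) = 2\<close> for the short roots. A root is short if it has minimal length, so in the simply
  laced case every root is short. The rank is \<open>CARD('i)\<close>.\<close>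

definition cartan_data ::
    "'v::euclidean_space set \<Rightarrow> ('i::finite \<Rightarrow> 'v) \<Rightarrow> ('i \<Rightarrow> 'i \<Rightarrow> int) \<Rightarrow> ('i \<Rightarrow> nat) \<Rightarrow> bool" where
  "cartan_data R \<alpha> a d \<longleftrightarrow>
     irreducible_root_system R \<and> simple_roots R \<alpha> \<and>
     (\<forall>\<beta>\<in>R. (\<forall>\<gamma>\<in>R. norm \<beta> \<le> norm \<gamma>) \<longrightarrow> \<beta> \<bullet> \<beta> = 2) \<and>
     (\<forall>i j. of_int (a i j) = 2 * (\<alpha> i \<bullet> \<alpha> j) / (\<alpha> i \<bullet> \<alpha> i)) \<and>
     (\<forall>i. of_nat (d i) = (\<alpha> i \<bullet> \<alpha> i) / 2)"


section \<open>Quantum integers\<close>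

definition q_int :: "'k::field \<Rightarrow> nat \<Rightarrow> 'k" where
  "q_int x m = (x ^ m - inverse x ^ m) / (x - inverse x)"

definition q_fact :: "'k::field \<Rightarrow> nat \<Rightarrow> 'k" where
  "q_fact x m = (\<Prod>r=1..m. q_int x r)"

text \<open>The quotient of quantum factorials equals the value at \<open>x\<close> of the corresponding Laurent
  polynomial only if \<open>x\<close> is nonzero, not \<open>1\<close> or \<open>-1\<close>, and not a root of unity.\<close>

definition q_binom :: "'k::field \<Rightarrow> nat \<Rightarrow> nat \<Rightarrow> 'k" where
  "q_binom x m s = q_fact x m / (q_fact x s * q_fact x (m - s))"


section \<open>Algebras over a field\<close>

text \<open>A unital associative algebra over the field \<open>'k\<close> is represented by a record of type
  \<open>('k, 'a) module\<close>, all of \<open>'k\<close> acting as scalars; the locale \<open>algebra\<close> of the library covers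
  only commutative algebras.\<close>

definition alg_hom :: "('k, 'a) module \<Rightarrow> ('k, 'b) module \<Rightarrow> ('a \<Rightarrow> 'b) set" where
  "alg_hom A B = {h \<in> ring_hom A B. \<forall>c. \<forall>x \<in> carrier A. h (c \<odot>\<^bsub>A\<^esub> x) = c \<odot>\<^bsub>B\<^esub> h x}"

definition base_alg :: "('k::field, 'k) module" where
  "base_alg = \<lparr>carrier = UNIV, mult = (*), one = 1, zero = 0, add = (+), smult = (*)\<rparr>"

definition monoid_alg :: "('u, 'm) monoid_scheme \<Rightarrow> ('k::field, 'u \<Rightarrow>\<^sub>0 'k) module" where
  "monoid_alg M =
    \<lparr>carrier = {p. Poly_Mapping.keys p \<subseteq> carrier M},
     mult = (\<lambda>p r. \<Sum>u\<in>Poly_Mapping.keys p. \<Sum>v\<in>Poly_Mapping.keys r.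
               Poly_Mapping.single (u \<otimes>\<^bsub>M\<^esub> v) (Poly_Mapping.lookup p u * Poly_Mapping.lookup r v)),
     one = Poly_Mapping.single \<one>\<^bsub>M\<^esub> 1,
     zero = 0,
     add = (+),
     smult = (\<lambda>c. Poly_Mapping.map ((*) c))\<rparr>"

definition lin_ext :: "('k::field, 'b) module \<Rightarrow> ('u \<Rightarrow> 'b) \<Rightarrow> ('u \<Rightarrow>\<^sub>0 'k) \<Rightarrow> 'b" where
  "lin_ext B f p = (\<Oplus>\<^bsub>B\<^esub>u\<in>Poly_Mapping.keys p. Poly_Mapping.lookup p u \<odot>\<^bsub>B\<^esub> f u)"

definition quot_alg :: "('k, 'a) module \<Rightarrow> 'a set \<Rightarrow> ('k, 'a set) module" where
  "quot_alg A I =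
    \<lparr>carrier = carrier (A Quot I), mult = mult (A Quot I), one = one (A Quot I),
     zero = zero (A Quot I), add = add (A Quot I),
     smult = (\<lambda>c X. \<Union>x\<in>X. I +>\<^bsub>A\<^esub> (c \<odot>\<^bsub>A\<^esub> x))\<rparr>"


subsection \<open>Presentations by generators and relations\<close>

definition free_alg :: "('k::field, 'g list \<Rightarrow>\<^sub>0 'k) module" where
  "free_alg = monoid_alg \<lparr>carrier = UNIV, mult = (@), one = []\<rparr>"

definition presented_alg :: "('g list \<Rightarrow>\<^sub>0 'k::field) set \<Rightarrow> ('k, ('g list \<Rightarrow>\<^sub>0 'k) set) module" where
  "presented_alg S = quot_alg free_alg (Idl\<^bsub>free_alg\<^esub> S)"

definition gen_class :: "('g list \<Rightarrow>\<^sub>0 'k::field) set \<Rightarrow> 'g \<Rightarrow> ('g list \<Rightarrow>\<^sub>0 'k) set" where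
  "gen_class S x = Idl\<^bsub>free_alg\<^esub> S +>\<^bsub>free_alg\<^esub> Poly_Mapping.single [x] 1"

definition word_prod :: "('k, 'b) module \<Rightarrow> ('g \<Rightarrow> 'b) \<Rightarrow> 'g list \<Rightarrow> 'b" where
  "word_prod B f u = foldr (\<lambda>x y. f x \<otimes>\<^bsub>B\<^esub> y) u \<one>\<^bsub>B\<^esub>"

text \<open>The algebra homomorphism (respectively anti-homomorphism) into \<open>B\<close> with prescribed values
  on the generators. The representative is arbitrary; the choice is immaterial whenever the
  prescribed values satisfy the relations.\<close>

definition extend_hom ::
    "('g list \<Rightarrow>\<^sub>0 'k::field) set \<Rightarrow> ('k, 'b) module \<Rightarrow> ('g \<Rightarrow> 'b) \<Rightarrow> ('g list \<Rightarrow>\<^sub>0 'k) set \<Rightarrow> 'b" where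
  "extend_hom S B f =
     (\<lambda>X \<in> carrier (presented_alg S). lin_ext B (word_prod B f) (SOME p. p \<in> X))"

definition extend_antihom ::
    "('g list \<Rightarrow>\<^sub>0 'k::field) set \<Rightarrow> ('k, 'b) module \<Rightarrow> ('g \<Rightarrow> 'b) \<Rightarrow> ('g list \<Rightarrow>\<^sub>0 'k) set \<Rightarrow> 'b" where
  "extend_antihom S B f =
     (\<lambda>X \<in> carrier (presented_alg S). lin_ext B (\<lambda>u. word_prod B f (rev u)) (SOME p. p \<in> X))"


subsection \<open>Tensor products\<close>

text \<open>The free vector space on \<open>carrier A \<times> carrier B\<close>, with product
  \<open>(x, y) (x', y') = (x x', y y')\<close>, modulo bilinearity. The span of the bilinearity relations is
  already a two-sided ideal, so passing to the generated ideal adds nothing.\<close>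

definition bilin_rels ::
    "('k::field, 'a) module \<Rightarrow> ('k, 'b) module \<Rightarrow> ('a \<times> 'b \<Rightarrow>\<^sub>0 'k) set" where
  "bilin_rels A B =
     {Poly_Mapping.single (x \<oplus>\<^bsub>A\<^esub> x', y) 1 - Poly_Mapping.single (x, y) 1 - Poly_Mapping.single (x', y) 1
        | x x' y. x \<in> carrier A \<and> x' \<in> carrier A \<and> y \<in> carrier B} \<union>
     {Poly_Mapping.single (x, y \<oplus>\<^bsub>B\<^esub> y') 1 - Poly_Mapping.single (x, y) 1 - Poly_Mapping.single (x, y') 1
        | x y y'. x \<in> carrier A \<and> y \<in> carrier B \<and> y' \<in> carrier B} \<union>
     {Poly_Mapping.single (c \<odot>\<^bsub>A\<^esub> x, y) 1 - Poly_Mapping.single (x, y) c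
        | c x y. x \<in> carrier A \<and> y \<in> carrier B} \<union>
     {Poly_Mapping.single (x, c \<odot>\<^bsub>B\<^esub> y) 1 - Poly_Mapping.single (x, y) c
        | c x y. x \<in> carrier A \<and> y \<in> carrier B}"

definition tensor_ideal ::
    "('k::field, 'a) module \<Rightarrow> ('k, 'b) module \<Rightarrow> ('a \<times> 'b \<Rightarrow>\<^sub>0 'k) set" where
  "tensor_ideal A B = Idl\<^bsub>monoid_alg (A \<times>\<times> B)\<^esub> (bilin_rels A B)"

definition tensor_alg ::
    "('k::field, 'a) module \<Rightarrow> ('k, 'b) module \<Rightarrow> ('k, ('a \<times> 'b \<Rightarrow>\<^sub>0 'k) set) module" where
  "tensor_alg A B = quot_alg (monoid_alg (A \<times>\<times> B)) (tensor_ideal A B)"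

definition pure_tensor ::
    "('k::field, 'a) module \<Rightarrow> ('k, 'b) module \<Rightarrow> 'a \<Rightarrow> 'b \<Rightarrow> ('a \<times> 'b \<Rightarrow>\<^sub>0 'k) set" where
  "pure_tensor A B x y =
     tensor_ideal A B +>\<^bsub>monoid_alg (A \<times>\<times> B)\<^esub> Poly_Mapping.single (x, y) 1"

text \<open>The map \<open>f \<otimes> g : A \<otimes> A \<rightarrow> B \<otimes> B\<close>, for linear maps \<open>f, g : A \<rightarrow> B\<close>.\<close>

definition tensor_map ::
    "('k::field, 'a) module \<Rightarrow> ('k, 'b) module \<Rightarrow> ('a \<Rightarrow> 'b) \<Rightarrow> ('a \<Rightarrow> 'b) \<Rightarrow>
     ('a \<times> 'a \<Rightarrow>\<^sub>0 'k) set \<Rightarrow> ('b \<times> 'b \<Rightarrow>\<^sub>0 'k) set" where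
  "tensor_map A B f g =
     (\<lambda>X \<in> carrier (tensor_alg A A).
        lin_ext (tensor_alg B B) (\<lambda>(x, y). pure_tensor B B (f x) (g y)) (SOME p. p \<in> X))"


section \<open>The weak quantum algebra\<close>

datatype 'i gen = gE 'i | gF 'i | gK 'i | gKbar 'i | gJ

abbreviation mono :: "'k::zero \<Rightarrow> 'g list \<Rightarrow> ('g list \<Rightarrow>\<^sub>0 'k)" where
  "mono c u \<equiv> Poly_Mapping.single u c"

text \<open>A relation \<open>lhs = rhs\<close> is recorded as the element \<open>lhs - rhs\<close> of the free algebra.
  \<open>\<kappa> i\<close> (respectively \<open>\<kappa>' i\<close>) states that \<open>E\<^sub>i\<close> (respectively \<open>F\<^sub>i\<close>) is of type 1, i.e. that the
  corresponding entry of the binary sequence is 1. The scalar \<open>q\<^sub>i\<close> is \<open>q ^ d i\<close>.\<close>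

inductive_set w_rels ::
    "('i \<Rightarrow> 'i \<Rightarrow> int) \<Rightarrow> ('i \<Rightarrow> nat) \<Rightarrow> 'k::field \<Rightarrow> ('i \<Rightarrow> bool) \<Rightarrow> ('i \<Rightarrow> bool) \<Rightarrow>
     ('i gen list \<Rightarrow>\<^sub>0 'k) set"
  for a d q \<kappa> \<kappa>' where
  J_def: "mono 1 [gJ] - mono 1 [gK i, gKbar i] \<in> w_rels a d q \<kappa> \<kappa>'"
| K_Kbar: "mono 1 [gK i, gKbar j] - mono 1 [gKbar j, gK i] \<in> w_rels a d q \<kappa> \<kappa>'"
| K_K: "mono 1 [gK i, gK j] - mono 1 [gK j, gK i] \<in> w_rels a d q \<kappa> \<kappa>'"
| Kbar_Kbar: "mono 1 [gKbar i, gKbar j] - mono 1 [gKbar j, gKbar i] \<in> w_rels a d q \<kappa> \<kappa>'"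
| J_K: "mono 1 [gJ, gK i] - mono 1 [gK i] \<in> w_rels a d q \<kappa> \<kappa>'"
| J_Kbar: "mono 1 [gJ, gKbar i] - mono 1 [gKbar i] \<in> w_rels a d q \<kappa> \<kappa>'"
| E_type1_K: "\<kappa> i \<Longrightarrow>
    mono 1 [gK j, gE i] - mono ((q ^ d i) powi a i j) [gE i, gK j] \<in> w_rels a d q \<kappa> \<kappa>'"
| E_type1_Kbar: "\<kappa> i \<Longrightarrow>
    mono 1 [gE i, gKbar j] - mono ((q ^ d i) powi a i j) [gKbar j, gE i] \<in> w_rels a d q \<kappa> \<kappa>'"
| E_type2: "\<not> \<kappa> i \<Longrightarrow>
    mono 1 [gK j, gE i, gKbar j] - mono ((q ^ d i) powi a i j) [gE i] \<in> w_rels a d q \<kappa> \<kappa>'"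
| F_type1_K: "\<kappa>' i \<Longrightarrow>
    mono 1 [gK j, gF i] - mono ((q ^ d i) powi (- a i j)) [gF i, gK j] \<in> w_rels a d q \<kappa> \<kappa>'"
| F_type1_Kbar: "\<kappa>' i \<Longrightarrow>
    mono 1 [gF i, gKbar j] - mono ((q ^ d i) powi (- a i j)) [gKbar j, gF i] \<in> w_rels a d q \<kappa> \<kappa>'"
| F_type2: "\<not> \<kappa>' i \<Longrightarrow>
    mono 1 [gK j, gF i, gKbar j] - mono ((q ^ d i) powi (- a i j)) [gF i] \<in> w_rels a d q \<kappa> \<kappa>'"
| E_F: "mono 1 [gE i, gF j] - mono 1 [gF j, gE i] -
    (if i = j
     then mono (1 / (q ^ d i - inverse (q ^ d i))) [gK i] -
          mono (1 / (q ^ d i - inverse (q ^ d i))) [gKbar i]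
     else 0) \<in> w_rels a d q \<kappa> \<kappa>'"
| Serre_E: "i \<noteq> j \<Longrightarrow>
    (\<Sum>s=0..nat (1 - a i j).
       mono ((-1) ^ s * q_binom (q ^ d i) (nat (1 - a i j)) s)
         (replicate (nat (1 - a i j) - s) (gE i) @ [gE j] @ replicate s (gE i)))
    \<in> w_rels a d q \<kappa> \<kappa>'"
| Serre_F: "i \<noteq> j \<Longrightarrow>
    (\<Sum>s=0..nat (1 - a i j).
       mono ((-1) ^ s * q_binom (q ^ d i) (nat (1 - a i j)) s)
         (replicate (nat (1 - a i j) - s) (gF i) @ [gF j] @ replicate s (gF i)))
    \<in> w_rels a d q \<kappa> \<kappa>'"

type_synonym ('i, 'k) w_elem = "('i gen list \<Rightarrow>\<^sub>0 'k) set"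

definition w_alg ::
    "('i \<Rightarrow> 'i \<Rightarrow> int) \<Rightarrow> ('i \<Rightarrow> nat) \<Rightarrow> 'k::field \<Rightarrow> ('i \<Rightarrow> bool) \<Rightarrow> ('i \<Rightarrow> bool) \<Rightarrow>
     ('k, ('i, 'k) w_elem) module" where
  "w_alg a d q \<kappa> \<kappa>' = presented_alg (w_rels a d q \<kappa> \<kappa>')"

definition w_gen ::
    "('i \<Rightarrow> 'i \<Rightarrow> int) \<Rightarrow> ('i \<Rightarrow> nat) \<Rightarrow> 'k::field \<Rightarrow> ('i \<Rightarrow> bool) \<Rightarrow> ('i \<Rightarrow> bool) \<Rightarrow>
     'i gen \<Rightarrow> ('i, 'k) w_elem" where
  "w_gen a d q \<kappa> \<kappa>' = gen_class (w_rels a d q \<kappa> \<kappa>')"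

definition w_comult ::
    "('i \<Rightarrow> 'i \<Rightarrow> int) \<Rightarrow> ('i \<Rightarrow> nat) \<Rightarrow> 'k::field \<Rightarrow> ('i \<Rightarrow> bool) \<Rightarrow> ('i \<Rightarrow> bool) \<Rightarrow>
     ('i, 'k) w_elem \<Rightarrow> (('i, 'k) w_elem \<times> ('i, 'k) w_elem \<Rightarrow>\<^sub>0 'k) set" where
  "w_comult a d q \<kappa> \<kappa>' =
     (let W = w_alg a d q \<kappa> \<kappa>'; WW = tensor_alg W W; x = w_gen a d q \<kappa> \<kappa>';
          t = pure_tensor W W; u = \<one>\<^bsub>W\<^esub>
      in extend_hom (w_rels a d q \<kappa> \<kappa>') WW
           (\<lambda>g. case g of
              gE i \<Rightarrow> t (if \<kappa> i then u else x gJ) (x (gE i)) \<oplus>\<^bsub>WW\<^esub> t (x (gE i)) (x (gK i))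
            | gF i \<Rightarrow> t (x (gF i)) (if \<kappa>' i then u else x gJ) \<oplus>\<^bsub>WW\<^esub> t (x (gKbar i)) (x (gF i))
            | gK i \<Rightarrow> t (x (gK i)) (x (gK i))
            | gKbar i \<Rightarrow> t (x (gKbar i)) (x (gKbar i))
            | gJ \<Rightarrow> t (x gJ) (x gJ)))"

definition w_counit ::
    "('i \<Rightarrow> 'i \<Rightarrow> int) \<Rightarrow> ('i \<Rightarrow> nat) \<Rightarrow> 'k::field \<Rightarrow> ('i \<Rightarrow> bool) \<Rightarrow> ('i \<Rightarrow> bool) \<Rightarrow>
     ('i, 'k) w_elem \<Rightarrow> 'k" where
  "w_counit a d q \<kappa> \<kappa>' =
     extend_hom (w_rels a d q \<kappa> \<kappa>') base_alg
       (\<lambda>g. case g of gE i \<Rightarrow> 0 | gF i \<Rightarrow> 0 | gK i \<Rightarrow> 1 | gKbar i \<Rightarrow> 1 | gJ \<Rightarrow> 1)"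

definition w_antipode ::
    "('i \<Rightarrow> 'i \<Rightarrow> int) \<Rightarrow> ('i \<Rightarrow> nat) \<Rightarrow> 'k::field \<Rightarrow> ('i \<Rightarrow> bool) \<Rightarrow> ('i \<Rightarrow> bool) \<Rightarrow>
     ('i, 'k) w_elem \<Rightarrow> ('i, 'k) w_elem" where
  "w_antipode a d q \<kappa> \<kappa>' =
     (let W = w_alg a d q \<kappa> \<kappa>'; x = w_gen a d q \<kappa> \<kappa>'
      in extend_antihom (w_rels a d q \<kappa> \<kappa>') W
           (\<lambda>g. case g of
              gE i \<Rightarrow> \<ominus>\<^bsub>W\<^esub> (x (gE i) \<otimes>\<^bsub>W\<^esub> x (gKbar i))
            | gF i \<Rightarrow> \<ominus>\<^bsub>W\<^esub> (x (gK i) \<otimes>\<^bsub>W\<^esub> x (gF i))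
            | gK i \<Rightarrow> x (gKbar i)
            | gKbar i \<Rightarrow> x (gK i)
            | gJ \<Rightarrow> x gJ))"


section \<open>Automorphisms\<close>

definition weak_hopf_auts ::
    "('i \<Rightarrow> 'i \<Rightarrow> int) \<Rightarrow> ('i \<Rightarrow> nat) \<Rightarrow> 'k::field \<Rightarrow> ('i \<Rightarrow> bool) \<Rightarrow> ('i \<Rightarrow> bool) \<Rightarrow>
     (('i, 'k) w_elem \<Rightarrow> ('i, 'k) w_elem) set" where
  "weak_hopf_auts a d q \<kappa> \<kappa>' =
     (let W = w_alg a d q \<kappa> \<kappa>'; \<Delta> = w_comult a d q \<kappa> \<kappa>';
          \<epsilon> = w_counit a d q \<kappa> \<kappa>'; T = w_antipode a d q \<kappa> \<kappa>'
      in {\<phi> \<in> alg_hom W W \<inter> Bij (carrier W).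
            \<forall>x \<in> carrier W.
              tensor_map W W \<phi> \<phi> (\<Delta> x) = \<Delta> (\<phi> x) \<and> \<epsilon> x = \<epsilon> (\<phi> x) \<and> \<phi> (T x) = T (\<phi> x)})"

definition Aut_w ::
    "('i \<Rightarrow> 'i \<Rightarrow> int) \<Rightarrow> ('i \<Rightarrow> nat) \<Rightarrow> 'k::field \<Rightarrow> ('i \<Rightarrow> bool) \<Rightarrow> ('i \<Rightarrow> bool) \<Rightarrow>
     (('i, 'k) w_elem \<Rightarrow> ('i, 'k) w_elem) monoid" where
  "Aut_w a d q \<kappa> \<kappa>' =
     BijGroup (carrier (w_alg a d q \<kappa> \<kappa>')) \<lparr>carrier := weak_hopf_auts a d q \<kappa> \<kappa>'\<rparr>"

definition diag_group :: "('i \<Rightarrow> 'k::field) monoid" where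
  "diag_group =
     \<lparr>carrier = {b. \<forall>i. b i \<noteq> 0}, mult = (\<lambda>b c i. b i * c i), one = (\<lambda>i. 1)\<rparr>"

definition dynkin_auts :: "('i \<Rightarrow> 'i \<Rightarrow> int) \<Rightarrow> ('i \<Rightarrow> nat) \<Rightarrow> ('i \<Rightarrow> 'i) set" where
  "dynkin_auts a d =
     {\<sigma>. bij \<sigma> \<and> (\<forall>i j. int (d i) * a i j = int (d (\<sigma> i)) * a (\<sigma> i) (\<sigma> j))}"

text \<open>The assignment \<open>E\<^sub>i \<mapsto> E\<^bsub>\<sigma>(i)\<^esub>\<close>, \<open>F\<^sub>i \<mapsto> F\<^bsub>\<sigma>(i)\<^esub>\<close>, \<open>K\<^sub>i \<mapsto> K\<^bsub>\<sigma>(i)\<^esub>\<close> respects the relations only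
  if \<open>\<sigma>\<close> preserves the types of the generators: \<open>E\<^sub>i\<close> of type 2 satisfies \<open>J E\<^sub>i = E\<^sub>i\<close>, and \<open>E\<^sub>i\<close> of
  type 1 does not. If the binary sequence is invariant under all diagram automorphisms, for
  instance if it is constant on the \<open>E\<^sub>i\<close> and on the \<open>F\<^sub>i\<close>, this is the whole group.\<close>

definition diagram_group ::
    "('i \<Rightarrow> 'i \<Rightarrow> int) \<Rightarrow> ('i \<Rightarrow> nat) \<Rightarrow> ('i \<Rightarrow> bool) \<Rightarrow> ('i \<Rightarrow> bool) \<Rightarrow> ('i \<Rightarrow> 'i) monoid" where
  "diagram_group a d \<kappa> \<kappa>' =
     \<lparr>carrier = {\<sigma> \<in> dynkin_auts a d. \<forall>i. \<kappa> (\<sigma> i) = \<kappa> i \<and> \<kappa>' (\<sigma> i) = \<kappa>' i},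
      mult = (\<circ>), one = id\<rparr>"

definition diag_aut ::
    "('i \<Rightarrow> 'i \<Rightarrow> int) \<Rightarrow> ('i \<Rightarrow> nat) \<Rightarrow> 'k::field \<Rightarrow> ('i \<Rightarrow> bool) \<Rightarrow> ('i \<Rightarrow> bool) \<Rightarrow>
     ('i \<Rightarrow> 'k) \<Rightarrow> ('i, 'k) w_elem \<Rightarrow> ('i, 'k) w_elem" where
  "diag_aut a d q \<kappa> \<kappa>' b =
     (let W = w_alg a d q \<kappa> \<kappa>'; x = w_gen a d q \<kappa> \<kappa>'
      in extend_hom (w_rels a d q \<kappa> \<kappa>') W
           (\<lambda>g. case g of
              gE i \<Rightarrow> b i \<odot>\<^bsub>W\<^esub> x (gE i)
            | gF i \<Rightarrow> inverse (b i) \<odot>\<^bsub>W\<^esub> x (gF i)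
            | gK i \<Rightarrow> x (gK i)
            | gKbar i \<Rightarrow> x (gKbar i)
            | gJ \<Rightarrow> x gJ))"

definition diagram_aut ::
    "('i \<Rightarrow> 'i \<Rightarrow> int) \<Rightarrow> ('i \<Rightarrow> nat) \<Rightarrow> 'k::field \<Rightarrow> ('i \<Rightarrow> bool) \<Rightarrow> ('i \<Rightarrow> bool) \<Rightarrow>
     ('i \<Rightarrow> 'i) \<Rightarrow> ('i, 'k) w_elem \<Rightarrow> ('i, 'k) w_elem" where
  "diagram_aut a d q \<kappa> \<kappa>' \<sigma> =
     extend_hom (w_rels a d q \<kappa> \<kappa>') (w_alg a d q \<kappa> \<kappa>') (\<lambda>g. w_gen a d q \<kappa> \<kappa>' (map_gen \<sigma> g))"

definition semidirect_product ::
    "('n, 'x) monoid_scheme \<Rightarrow> ('h, 'y) monoid_scheme \<Rightarrow> ('h \<Rightarrow> 'n \<Rightarrow> 'n) \<Rightarrow> ('n \<times> 'h) monoid" where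
  "semidirect_product N H \<theta> =
     \<lparr>carrier = carrier N \<times> carrier H,
      mult = (\<lambda>(n, h) (n', h'). (n \<otimes>\<^bsub>N\<^esub> \<theta> h n', h \<otimes>\<^bsub>H\<^esub> h')),
      one = (\<one>\<^bsub>N\<^esub>, \<one>\<^bsub>H\<^esub>)\<rparr>"

text \<open>\<open>\<sigma> \<cdot> b = b \<circ> \<sigma>\<close> is a right action, and \<open>\<phi>\<^sub>b \<sigma> = \<sigma> \<phi>\<^bsub>\<sigma> \<cdot> b\<^esub>\<close>; so conjugation by \<open>\<sigma>\<close> on the
  diagonal automorphisms, which is the left action defining the semidirect product with the normal
  factor on the left, is \<open>b \<mapsto> \<sigma>\<inverse> \<cdot> b\<close>.\<close>

definition perm_action :: "('i \<Rightarrow> 'i) \<Rightarrow> ('i \<Rightarrow> 'k) \<Rightarrow> ('i \<Rightarrow> 'k)" where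
  "perm_action \<sigma> b = b \<circ> \<sigma>"

end

theory Submission
  imports Defs
begin

text \<open>Filter \<open>w\<close> by the number of letters \<open>E\<^sub>i\<close>, \<open>F\<^sub>i\<close> in a word. Modulo lower terms the coproduct of
  a word has a single component with the word itself in one factor, and the other factor is a word in the
  \<open>K\<^sub>i\<close>, \<open>K\<^sub>i\<close>-bar and \<open>J\<close>. Linear functionals, above all the characters given by the highest weights of simple
  Verma quotients, separate these words; hence the group-like elements are exactly these words, and
  skew-primitive elements are controlled by their top degree.

  An automorphism \<open>\<phi>\<close> therefore maps \<open>K\<^sub>i\<close> to a word with integral exponent vector. As \<open>\<phi> E\<^sub>i\<close> is
  skew-primitive and does not commute with \<open>\<phi> K\<^sub>i\<close>, the exponents are nonnegative with positive sum. The same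
  holds for the inverse of \<open>\<phi>\<close>, so the exponent matrix is a permutation matrix. Then \<open>\<phi> E\<^sub>i\<close> has degree
  one; weights under conjugation by the \<open>K\<^sub>j\<close> exclude contributions of \<open>F\<close>, the antipode excludes multiples
  of \<open>1 - J\<close>, and what remains is a multiple of \<open>E\<close>. Comparing the weights shows that the permutation is
  a diagram automorphism.\<close>

text \<open>No basis of the algebra is at hand, and different words may name the same element.
  Statements about leading terms therefore assert that some representative is supported on certain
  words, and coefficients are compared only through linear functionals, obtained by descent from the
  free algebra or as matrix coefficients of representations. A representation has to satisfy the
  Serre relations, which are awkward as alternating sums. Rewritten as iterated q-commutators they
  become products of commuting factors, so coproduct, antipode and commutation with the opposite
  generators can be followed one factor at a time. The dual of a Verma module is used because its
  vectors are plain functions on words; the part generated by one functional replaces a quotient by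
  a maximal submodule. Weights see only exponents and cannot tell the unit from \<open>J\<close>;
  the character that kills every generator can. Since no \<open>K i\<close> is invertible, elements
  are compared after multiplication by \<open>J\<close>. For generators of type 2 nothing is lost by
  this, for type 1 a multiple of \<open>1 - J\<close>.\<close>

lemma lookup_scale [simp]:
  "Poly_Mapping.lookup (Poly_Mapping.map ((*) c) p) u = (c::'k::field) * Poly_Mapping.lookup p u"
  by (simp add: Poly_Mapping.map.rep_eq when_def)

lemma keys_scale: "Poly_Mapping.keys (Poly_Mapping.map ((*) (c::'k::field)) p) \<subseteq> Poly_Mapping.keys p"
  by (auto simp: in_keys_iff)

text \<open>The bound on the support is kept in the induction because a monoid algebra consists only
  of the functions supported in the carrier of its monoid.\<close>

lemma poly_mapping_induct_on [consumes 1, case_names zero add]: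
  fixes p :: "'u \<Rightarrow>\<^sub>0 'k::ab_group_add"
  assumes "Poly_Mapping.keys p \<subseteq> U" and "P 0"
    and add: "\<And>u c p. u \<in> U \<Longrightarrow> Poly_Mapping.keys p \<subseteq> U \<Longrightarrow> P p \<Longrightarrow> P (Poly_Mapping.single u c + p)"
  shows "P p"
proof -
  have "\<forall>p. Poly_Mapping.keys p \<subseteq> S \<longrightarrow> P p" if "finite S" "S \<subseteq> U" for S
    using that
  proof (induction S)
    case empty
    have "p = 0" if "Poly_Mapping.keys p \<subseteq> {}" for p :: "'u \<Rightarrow>\<^sub>0 'k"
      using that by simp
    with \<open>P 0\<close> show ?case by auto
  next
    case (insert u S)
    show ?case
    proof (intro allI impI)
      fix p :: "'u \<Rightarrow>\<^sub>0 'k" assume p: "Poly_Mapping.keys p \<subseteq> insert u S"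
      define r where "r = p - Poly_Mapping.single u (Poly_Mapping.lookup p u)"
      have "Poly_Mapping.keys r \<subseteq> S"
        using p insert.hyps by (auto simp: r_def in_keys_iff lookup_minus lookup_single when_def split: if_splits)
      then have "P r" "Poly_Mapping.keys r \<subseteq> U" using insert by auto
      then have "P (Poly_Mapping.single u (Poly_Mapping.lookup p u) + r)" using add insert by blast
      then show "P p" by (simp add: r_def)
    qed
  qed
  then show ?thesis using assms(1) finite_keys by blast
qed

lemma keys_add_subset:
  "Poly_Mapping.keys p \<subseteq> U \<Longrightarrow> Poly_Mapping.keys r \<subseteq> U \<Longrightarrow> Poly_Mapping.keys (p + r) \<subseteq> U"
  using Poly_Mapping.keys_add[of p r] by blast

section \<open>Associative algebras\<close>

locale kalg = ring A for A :: "('k::field, 'a) module" (structure) +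
  assumes smult_closed [simp, intro]: "x \<in> carrier A \<Longrightarrow> c \<odot> x \<in> carrier A"
    and smult_l_distr: "x \<in> carrier A \<Longrightarrow> (b + c) \<odot> x = b \<odot> x \<oplus> c \<odot> x"
    and smult_r_distr: "\<lbrakk>x \<in> carrier A; y \<in> carrier A\<rbrakk> \<Longrightarrow> c \<odot> (x \<oplus> y) = c \<odot> x \<oplus> c \<odot> y"
    and smult_smult [simp]: "x \<in> carrier A \<Longrightarrow> b \<odot> (c \<odot> x) = (b * c) \<odot> x"
    and smult_one [simp]: "x \<in> carrier A \<Longrightarrow> 1 \<odot> x = x"
    and mult_smult_l [simp]: "\<lbrakk>x \<in> carrier A; y \<in> carrier A\<rbrakk> \<Longrightarrow> (c \<odot> x) \<otimes> y = c \<odot> (x \<otimes> y)"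
    and mult_smult_r [simp]: "\<lbrakk>x \<in> carrier A; y \<in> carrier A\<rbrakk> \<Longrightarrow> x \<otimes> (c \<odot> y) = c \<odot> (x \<otimes> y)"
begin

lemma smult_0_left [simp]: assumes "x \<in> carrier A" shows "0 \<odot> x = \<zero>"
proof -
  have "0 \<odot> x \<oplus> 0 \<odot> x = 0 \<odot> x" using assms smult_l_distr[of x 0 0] by simp
  then show ?thesis using assms by (simp add: add.l_cancel_one)
qed

lemma smult_0_right [simp]: "c \<odot> \<zero> = \<zero>"
proof -
  have "c \<odot> \<zero> \<oplus> c \<odot> \<zero> = c \<odot> \<zero>" using smult_r_distr[of \<zero> \<zero> c] by simp
  then show ?thesis by (simp add: add.l_cancel_one)
qed

lemma a_inv_smult: assumes "x \<in> carrier A" shows "\<ominus> x = (-1) \<odot> x"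
proof -
  have "(-1) \<odot> x \<oplus> x = \<zero>" using assms smult_l_distr[of x "-1" 1] by simp
  then show ?thesis using assms by (simp add: minus_equality)
qed

lemma minus_smult: "\<lbrakk>x \<in> carrier A; y \<in> carrier A\<rbrakk> \<Longrightarrow> x \<ominus> y = x \<oplus> (-1) \<odot> y"
  by (simp add: a_minus_def a_inv_smult)

lemma minus_eq_zero_iff: "\<lbrakk>x \<in> carrier A; y \<in> carrier A\<rbrakk> \<Longrightarrow> x \<ominus> y = \<zero> \<longleftrightarrow> x = y"
  unfolding a_minus_def by (metis add.inv_closed minus_equality minus_minus r_neg)

lemma smult_minus: "\<lbrakk>x \<in> carrier A; y \<in> carrier A\<rbrakk> \<Longrightarrow> c \<odot> (x \<ominus> y) = c \<odot> x \<ominus> c \<odot> y"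
  by (simp add: minus_smult smult_r_distr)

lemma smult_finsum: "\<lbrakk>finite S; f \<in> S \<rightarrow> carrier A\<rbrakk> \<Longrightarrow> c \<odot> (\<Oplus>u\<in>S. f u) = (\<Oplus>u\<in>S. c \<odot> f u)"
  by (induction S rule: finite_induct) (auto simp: smult_r_distr Pi_def)

lemma smult_eq_zero_iff: "x \<in> carrier A \<Longrightarrow> c \<odot> x = \<zero> \<longleftrightarrow> c = 0 \<or> x = \<zero>"
  by (metis left_inverse smult_0_left smult_0_right smult_one smult_smult)

lemma lin_ext_superset:
  assumes "finite S" "Poly_Mapping.keys p \<subseteq> S" "f \<in> S \<rightarrow> carrier A"
  shows "lin_ext A f p = (\<Oplus>u\<in>S. Poly_Mapping.lookup p u \<odot> f u)"
  unfolding lin_ext_def using assms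
  by (intro add.finprod_mono_neutral_cong_left) (auto simp: in_keys_iff Pi_def)

lemma lin_ext_closed [intro, simp]: "f \<in> U \<rightarrow> carrier A \<Longrightarrow> Poly_Mapping.keys p \<subseteq> U \<Longrightarrow> lin_ext A f p \<in> carrier A"
  unfolding lin_ext_def by (rule add.finprod_closed) auto

lemma lin_ext_add:
  assumes "f \<in> U \<rightarrow> carrier A" "Poly_Mapping.keys p \<subseteq> U" "Poly_Mapping.keys r \<subseteq> U"
  shows "lin_ext A f (p + r) = lin_ext A f p \<oplus> lin_ext A f r"
proof -
  let ?S = "Poly_Mapping.keys p \<union> Poly_Mapping.keys r"
  have f: "f \<in> ?S \<rightarrow> carrier A" using assms by auto
  have "lin_ext A f (p + r) = (\<Oplus>u\<in>?S. Poly_Mapping.lookup (p + r) u \<odot> f u)"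
    using f by (intro lin_ext_superset) (auto simp: Poly_Mapping.keys_add)
  also have "\<dots> = (\<Oplus>u\<in>?S. Poly_Mapping.lookup p u \<odot> f u \<oplus> Poly_Mapping.lookup r u \<odot> f u)"
    using f by (intro add.finprod_cong') (auto simp: lookup_add smult_l_distr Pi_iff)
  also have "\<dots> = (\<Oplus>u\<in>?S. Poly_Mapping.lookup p u \<odot> f u) \<oplus> (\<Oplus>u\<in>?S. Poly_Mapping.lookup r u \<odot> f u)"
    using f by (intro add.finprod_multf) auto
  also have "\<dots> = lin_ext A f p \<oplus> lin_ext A f r"
    using f lin_ext_superset[of ?S p f] lin_ext_superset[of ?S r f] by simp
  finally show ?thesis .
qed

lemma lin_ext_scale:
  assumes "f \<in> U \<rightarrow> carrier A" "Poly_Mapping.keys p \<subseteq> U"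
  shows "lin_ext A f (Poly_Mapping.map ((*) c) p) = c \<odot> lin_ext A f p"
proof -
  let ?S = "Poly_Mapping.keys p"
  have f: "f \<in> ?S \<rightarrow> carrier A" using assms by auto
  have "lin_ext A f (Poly_Mapping.map ((*) c) p) = (\<Oplus>u\<in>?S. (c * Poly_Mapping.lookup p u) \<odot> f u)"
    using f lin_ext_superset[of ?S "Poly_Mapping.map ((*) c) p" f] by (simp add: keys_scale)
  also have "\<dots> = (\<Oplus>u\<in>?S. c \<odot> (Poly_Mapping.lookup p u \<odot> f u))"
    using f by (intro add.finprod_cong') (auto simp: Pi_iff)
  also have "\<dots> = c \<odot> lin_ext A f p"
    using f unfolding lin_ext_def by (subst smult_finsum) auto
  finally show ?thesis .
qed

lemma lin_ext_single [simp]: "f u \<in> carrier A \<Longrightarrow> lin_ext A f (Poly_Mapping.single u c) = c \<odot> f u"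
  using lin_ext_superset[of "{u}" "Poly_Mapping.single u c" f] by simp

lemma lin_ext_zero [simp]: "lin_ext A f 0 = \<zero>"
  by (simp add: lin_ext_def)

end

section \<open>Linear maps and algebra homomorphisms\<close>

definition klin :: "('k::field, 'a) module \<Rightarrow> ('k, 'b) module \<Rightarrow> ('a \<Rightarrow> 'b) set" where
  "klin A B = {h \<in> carrier A \<rightarrow> carrier B.
     (\<forall>x \<in> carrier A. \<forall>y \<in> carrier A. h (x \<oplus>\<^bsub>A\<^esub> y) = h x \<oplus>\<^bsub>B\<^esub> h y) \<and>
     (\<forall>c. \<forall>x \<in> carrier A. h (c \<odot>\<^bsub>A\<^esub> x) = c \<odot>\<^bsub>B\<^esub> h x)}"

lemma klinI:
  assumes "\<And>x. x \<in> carrier A \<Longrightarrow> h x \<in> carrier B"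
    and "\<And>x y. x \<in> carrier A \<Longrightarrow> y \<in> carrier A \<Longrightarrow> h (x \<oplus>\<^bsub>A\<^esub> y) = h x \<oplus>\<^bsub>B\<^esub> h y"
    and "\<And>c x. x \<in> carrier A \<Longrightarrow> h (c \<odot>\<^bsub>A\<^esub> x) = c \<odot>\<^bsub>B\<^esub> h x"
  shows "h \<in> klin A B"
  using assms by (auto simp: klin_def)

lemma
  assumes "h \<in> klin A B"
  shows klin_closed: "x \<in> carrier A \<Longrightarrow> h x \<in> carrier B"
    and klin_add: "x \<in> carrier A \<Longrightarrow> y \<in> carrier A \<Longrightarrow> h (x \<oplus>\<^bsub>A\<^esub> y) = h x \<oplus>\<^bsub>B\<^esub> h y"
    and klin_smult: "x \<in> carrier A \<Longrightarrow> h (c \<odot>\<^bsub>A\<^esub> x) = c \<odot>\<^bsub>B\<^esub> h x"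
  using assms by (auto simp: klin_def)

lemma
  assumes "h \<in> klin A B" "kalg A" "kalg B"
  shows klin_zero: "h \<zero>\<^bsub>A\<^esub> = \<zero>\<^bsub>B\<^esub>"
    and klin_minus: "x \<in> carrier A \<Longrightarrow> y \<in> carrier A \<Longrightarrow> h (x \<ominus>\<^bsub>A\<^esub> y) = h x \<ominus>\<^bsub>B\<^esub> h y"
    and klin_a_inv: "x \<in> carrier A \<Longrightarrow> h (\<ominus>\<^bsub>A\<^esub> x) = \<ominus>\<^bsub>B\<^esub> h x"
proof -
  interpret A: kalg A by fact
  interpret B: kalg B by fact
  have "h (0 \<odot>\<^bsub>A\<^esub> \<zero>\<^bsub>A\<^esub>) = 0 \<odot>\<^bsub>B\<^esub> h \<zero>\<^bsub>A\<^esub>" using klin_smult[OF assms(1)] by blast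
  then show "h \<zero>\<^bsub>A\<^esub> = \<zero>\<^bsub>B\<^esub>" using klin_closed[OF assms(1)] by simp
  show "x \<in> carrier A \<Longrightarrow> y \<in> carrier A \<Longrightarrow> h (x \<ominus>\<^bsub>A\<^esub> y) = h x \<ominus>\<^bsub>B\<^esub> h y"
    using klin_closed[OF assms(1)] klin_add[OF assms(1)] klin_smult[OF assms(1)]
    by (simp add: A.minus_smult B.minus_smult)
  show "x \<in> carrier A \<Longrightarrow> h (\<ominus>\<^bsub>A\<^esub> x) = \<ominus>\<^bsub>B\<^esub> h x"
    using klin_closed[OF assms(1)] klin_smult[OF assms(1)]
    by (simp add: A.a_inv_smult B.a_inv_smult)
qed

lemma klin_comp: "\<lbrakk>f \<in> klin A B; g \<in> klin B C\<rbrakk> \<Longrightarrow> (\<lambda>x. g (f x)) \<in> klin A C"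
  by (auto simp: klin_def Pi_def)

lemma alg_hom_klin: "alg_hom A B \<subseteq> klin A B"
  by (auto simp: alg_hom_def klin_def ring_hom_def)

lemma alg_hom_iff:
  "h \<in> alg_hom A B \<longleftrightarrow> h \<in> klin A B \<and>
     (\<forall>x \<in> carrier A. \<forall>y \<in> carrier A. h (x \<otimes>\<^bsub>A\<^esub> y) = h x \<otimes>\<^bsub>B\<^esub> h y) \<and> h \<one>\<^bsub>A\<^esub> = \<one>\<^bsub>B\<^esub>"
  by (auto simp: alg_hom_def klin_def ring_hom_def)

lemma
  assumes "h \<in> alg_hom A B"
  shows alg_hom_closed: "x \<in> carrier A \<Longrightarrow> h x \<in> carrier B"
    and alg_hom_add: "x \<in> carrier A \<Longrightarrow> y \<in> carrier A \<Longrightarrow> h (x \<oplus>\<^bsub>A\<^esub> y) = h x \<oplus>\<^bsub>B\<^esub> h y"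
    and alg_hom_mult: "x \<in> carrier A \<Longrightarrow> y \<in> carrier A \<Longrightarrow> h (x \<otimes>\<^bsub>A\<^esub> y) = h x \<otimes>\<^bsub>B\<^esub> h y"
    and alg_hom_smult: "x \<in> carrier A \<Longrightarrow> h (c \<odot>\<^bsub>A\<^esub> x) = c \<odot>\<^bsub>B\<^esub> h x"
    and alg_hom_one: "h \<one>\<^bsub>A\<^esub> = \<one>\<^bsub>B\<^esub>"
  using assms by (auto simp: alg_hom_def ring_hom_def)

lemma alg_hom_comp:
  fixes A :: "('k::field, 'a) module" and B :: "('k, 'b) module" and C :: "('k, 'c) module"
  shows "\<lbrakk>f \<in> alg_hom A B; g \<in> alg_hom B C\<rbrakk> \<Longrightarrow> (\<lambda>x. g (f x)) \<in> alg_hom A C"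
  using klin_comp[of f A B g C] by (auto simp: alg_hom_iff klin_closed)

text \<open>The kernel is an ideal, so vanishing on \<open>S\<close> extends to the ideal generated
  by \<open>S\<close>.\<close>

lemma alg_hom_Idl:
  assumes "kalg A" "kalg B" "h \<in> alg_hom A B" "S \<subseteq> carrier A" "\<And>s. s \<in> S \<Longrightarrow> h s = \<zero>\<^bsub>B\<^esub>"
    and "x \<in> Idl\<^bsub>A\<^esub> S"
  shows "h x = \<zero>\<^bsub>B\<^esub>"
proof -
  interpret A: kalg A by fact
  interpret B: kalg B by fact
  have "h \<in> ring_hom A B" using assms(3) by (simp add: alg_hom_def)
  then have hom: "ring_hom_ring A B h" by (rule ring_hom_ringI2[OF A.ring_axioms B.ring_axioms])
  have "S \<subseteq> a_kernel A B h" using assms(4,5) by (auto simp: a_kernel_def')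
  then have "Idl\<^bsub>A\<^esub> S \<subseteq> a_kernel A B h"
    by (rule A.genideal_minimal[OF ring_hom_ring.kernel_is_ideal[OF hom]])
  then show ?thesis using assms(6) by (auto simp: a_kernel_def')
qed

subsection \<open>Monoid algebras\<close>

text \<open>Summing over fixed finite sets instead of the supports makes the product visibly
  bilinear, although the support of a sum may shrink.\<close>

lemma monoid_alg_mult_superset:
  fixes p r :: "'u \<Rightarrow>\<^sub>0 'k::field"
  assumes "finite S" "finite T" "Poly_Mapping.keys p \<subseteq> S" "Poly_Mapping.keys r \<subseteq> T"
  shows "p \<otimes>\<^bsub>monoid_alg M\<^esub> r =
    (\<Sum>u\<in>S. \<Sum>v\<in>T. Poly_Mapping.single (u \<otimes>\<^bsub>M\<^esub> v) (Poly_Mapping.lookup p u * Poly_Mapping.lookup r v))"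
proof -
  have "p \<otimes>\<^bsub>monoid_alg M\<^esub> r = (\<Sum>u\<in>Poly_Mapping.keys p. \<Sum>v\<in>T.
      Poly_Mapping.single (u \<otimes>\<^bsub>M\<^esub> v) (Poly_Mapping.lookup p u * Poly_Mapping.lookup r v))"
    unfolding monoid_alg_def monoid.simps using assms
    by (intro sum.cong sum.mono_neutral_left refl) (auto simp: in_keys_iff)
  also have "\<dots> = (\<Sum>u\<in>S. \<Sum>v\<in>T.
      Poly_Mapping.single (u \<otimes>\<^bsub>M\<^esub> v) (Poly_Mapping.lookup p u * Poly_Mapping.lookup r v))"
    using assms by (intro sum.mono_neutral_left) (auto simp: in_keys_iff)
  finally show ?thesis .
qed

lemma monoid_alg_mult_add_l:
  fixes p p' r :: "'u \<Rightarrow>\<^sub>0 'k::field"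
  shows "(p + p') \<otimes>\<^bsub>monoid_alg M\<^esub> r = (p \<otimes>\<^bsub>monoid_alg M\<^esub> r) + (p' \<otimes>\<^bsub>monoid_alg M\<^esub> r)"
proof -
  let ?S = "Poly_Mapping.keys p \<union> Poly_Mapping.keys p'" and ?T = "Poly_Mapping.keys r"
  have "Poly_Mapping.keys (p + p') \<subseteq> ?S" by (rule Poly_Mapping.keys_add)
  then show ?thesis
    using monoid_alg_mult_superset[of ?S ?T "p + p'" r M] monoid_alg_mult_superset[of ?S ?T p r M]
      monoid_alg_mult_superset[of ?S ?T p' r M]
    by (simp add: lookup_add distrib_right single_add sum.distrib)
qed

lemma monoid_alg_mult_add_r:
  fixes p r r' :: "'u \<Rightarrow>\<^sub>0 'k::field"
  shows "p \<otimes>\<^bsub>monoid_alg M\<^esub> (r + r') = (p \<otimes>\<^bsub>monoid_alg M\<^esub> r) + (p \<otimes>\<^bsub>monoid_alg M\<^esub> r')"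
proof -
  let ?S = "Poly_Mapping.keys p" and ?T = "Poly_Mapping.keys r \<union> Poly_Mapping.keys r'"
  have "Poly_Mapping.keys (r + r') \<subseteq> ?T" by (rule Poly_Mapping.keys_add)
  then show ?thesis
    using monoid_alg_mult_superset[of ?S ?T p "r + r'" M] monoid_alg_mult_superset[of ?S ?T p r M]
      monoid_alg_mult_superset[of ?S ?T p r' M]
    by (simp add: lookup_add distrib_left single_add sum.distrib)
qed

lemma monoid_alg_mult_single [simp]:
  "Poly_Mapping.single u b \<otimes>\<^bsub>monoid_alg M\<^esub> Poly_Mapping.single v c
    = Poly_Mapping.single (u \<otimes>\<^bsub>M\<^esub> v) ((b::'k::field) * c)"
  using monoid_alg_mult_superset[of "{u}" "{v}" "Poly_Mapping.single u b" "Poly_Mapping.single v c" M]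
  by simp

lemma monoid_alg_mult_zero [simp]:
  "p \<otimes>\<^bsub>monoid_alg M\<^esub> (0 :: 'u \<Rightarrow>\<^sub>0 'k::field) = 0" "(0 :: 'u \<Rightarrow>\<^sub>0 'k::field) \<otimes>\<^bsub>monoid_alg M\<^esub> p = 0"
  by (simp_all add: monoid_alg_def)

lemma monoid_alg_simps [simp]:
  "carrier (monoid_alg M) = {p. Poly_Mapping.keys p \<subseteq> carrier M}"
  "\<one>\<^bsub>monoid_alg M\<^esub> = Poly_Mapping.single \<one>\<^bsub>M\<^esub> 1"
  "\<zero>\<^bsub>monoid_alg M\<^esub> = 0"
  "p \<oplus>\<^bsub>monoid_alg M\<^esub> r = p + r"
  "c \<odot>\<^bsub>monoid_alg M\<^esub> p = Poly_Mapping.map ((*) c) p"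
  by (simp_all add: monoid_alg_def)

lemma scale_add: "Poly_Mapping.map ((*) (c::'k::field)) (p + r) = Poly_Mapping.map ((*) c) p + Poly_Mapping.map ((*) c) r"
  by (rule poly_mapping_eqI) (simp add: lookup_add algebra_simps)

lemma scale_single [simp]: "Poly_Mapping.map ((*) (c::'k::field)) (Poly_Mapping.single u b) = Poly_Mapping.single u (c * b)"
  by (rule poly_mapping_eqI) (simp add: lookup_single when_def)

lemma scale_zero [simp]: "Poly_Mapping.map ((*) (c::'k::field)) 0 = 0"
  by (rule poly_mapping_eqI) simp

text \<open>Closure and associativity are multilinear, so each argument in turn is reduced to a
  monomial by induction on its support.\<close>

lemma kalg_monoid_alg:
  assumes "Group.monoid M"
  shows "kalg (monoid_alg M :: ('k::field, 'u \<Rightarrow>\<^sub>0 'k) module)" (is "kalg ?A")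
proof -
  interpret M: Group.monoid M by fact
  have mult_closed: "Poly_Mapping.keys (p \<otimes>\<^bsub>?A\<^esub> r) \<subseteq> carrier M"
    if "Poly_Mapping.keys p \<subseteq> carrier M" "Poly_Mapping.keys r \<subseteq> carrier M" for p r
    using that(1)
  proof (induction p rule: poly_mapping_induct_on)
    case (add u c p)
    from that(2) have "Poly_Mapping.keys (Poly_Mapping.single u c \<otimes>\<^bsub>?A\<^esub> r) \<subseteq> carrier M"
    proof (induction r rule: poly_mapping_induct_on)
      case (add v b r)
      have "Poly_Mapping.keys (Poly_Mapping.single (u \<otimes>\<^bsub>M\<^esub> v) (c * b)) \<subseteq> carrier M"
        using add.hyps \<open>u \<in> carrier M\<close> by simp
      then show ?case using add by (simp add: monoid_alg_mult_add_r keys_add_subset)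
    qed simp
    then show ?case using add by (simp add: monoid_alg_mult_add_l keys_add_subset)
  qed simp
  have assoc: "(p \<otimes>\<^bsub>?A\<^esub> r) \<otimes>\<^bsub>?A\<^esub> s = p \<otimes>\<^bsub>?A\<^esub> (r \<otimes>\<^bsub>?A\<^esub> s)"
    if "Poly_Mapping.keys p \<subseteq> carrier M" "Poly_Mapping.keys r \<subseteq> carrier M" "Poly_Mapping.keys s \<subseteq> carrier M" for p r s
    using that(1)
  proof (induction p rule: poly_mapping_induct_on)
    case (add u c p)
    from that(2) have "(Poly_Mapping.single u c \<otimes>\<^bsub>?A\<^esub> r) \<otimes>\<^bsub>?A\<^esub> s = Poly_Mapping.single u c \<otimes>\<^bsub>?A\<^esub> (r \<otimes>\<^bsub>?A\<^esub> s)"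
    proof (induction r rule: poly_mapping_induct_on)
      case (add v b r)
      from that(3) have "(Poly_Mapping.single u c \<otimes>\<^bsub>?A\<^esub> Poly_Mapping.single v b) \<otimes>\<^bsub>?A\<^esub> s
          = Poly_Mapping.single u c \<otimes>\<^bsub>?A\<^esub> (Poly_Mapping.single v b \<otimes>\<^bsub>?A\<^esub> s)"
        using \<open>u \<in> carrier M\<close> \<open>v \<in> carrier M\<close>
        by (induction s rule: poly_mapping_induct_on)
          (simp_all add: monoid_alg_mult_add_r M.m_assoc mult.assoc del: monoid_alg_simps)
      then show ?case using add by (simp add: monoid_alg_mult_add_r monoid_alg_mult_add_l)
    qed simp
    then show ?case using add by (simp add: monoid_alg_mult_add_l)
  qed simp
  have scale_l: "Poly_Mapping.map ((*) c) p \<otimes>\<^bsub>?A\<^esub> r = Poly_Mapping.map ((*) c) (p \<otimes>\<^bsub>?A\<^esub> r)"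
    and scale_r: "p \<otimes>\<^bsub>?A\<^esub> Poly_Mapping.map ((*) c) r = Poly_Mapping.map ((*) c) (p \<otimes>\<^bsub>?A\<^esub> r)" for c p r
  proof -
    have *: "Poly_Mapping.map ((*) c) (\<Sum>i\<in>I. f i) = (\<Sum>i\<in>I. Poly_Mapping.map ((*) c) (f i))"
      for I and f :: "'x \<Rightarrow> 'u \<Rightarrow>\<^sub>0 'k"
      by (induction I rule: infinite_finite_induct) (simp_all add: scale_add)
    show "Poly_Mapping.map ((*) c) p \<otimes>\<^bsub>?A\<^esub> r = Poly_Mapping.map ((*) c) (p \<otimes>\<^bsub>?A\<^esub> r)"
      using monoid_alg_mult_superset[of "Poly_Mapping.keys p" "Poly_Mapping.keys r" "Poly_Mapping.map ((*) c) p" r M]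
      using monoid_alg_mult_superset[of "Poly_Mapping.keys p" "Poly_Mapping.keys r" p r M]
      by (simp add: keys_scale * mult.assoc)
    show "p \<otimes>\<^bsub>?A\<^esub> Poly_Mapping.map ((*) c) r = Poly_Mapping.map ((*) c) (p \<otimes>\<^bsub>?A\<^esub> r)"
      using monoid_alg_mult_superset[of "Poly_Mapping.keys p" "Poly_Mapping.keys r" p "Poly_Mapping.map ((*) c) r" M]
      using monoid_alg_mult_superset[of "Poly_Mapping.keys p" "Poly_Mapping.keys r" p r M]
      by (simp add: keys_scale * mult.left_commute)
  qed
  have one: "Poly_Mapping.single \<one>\<^bsub>M\<^esub> 1 \<otimes>\<^bsub>?A\<^esub> p = p" "p \<otimes>\<^bsub>?A\<^esub> Poly_Mapping.single \<one>\<^bsub>M\<^esub> 1 = p"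
    if "Poly_Mapping.keys p \<subseteq> carrier M" for p
    using that by (induction p rule: poly_mapping_induct_on)
      (simp_all add: monoid_alg_mult_add_r monoid_alg_mult_add_l)
  have "Ring.ring ?A"
  proof (rule ringI)
    show "abelian_group ?A"
    proof (rule abelian_groupI)
      fix p assume "p \<in> carrier ?A"
      then show "\<exists>y\<in>carrier ?A. y \<oplus>\<^bsub>?A\<^esub> p = \<zero>\<^bsub>?A\<^esub>"
        by (intro bexI[of _ "- p"]) simp_all
    qed (simp_all add: keys_add_subset add.assoc add.commute)
    show "Group.monoid ?A"
      by (rule monoidI) (simp_all add: mult_closed assoc one)
  qed (simp_all add: monoid_alg_mult_add_r monoid_alg_mult_add_l)
  then show ?thesis
    by (intro kalg.intro kalg_axioms.intro)
      (auto simp: scale_l scale_r scale_add lookup_add algebra_simps intro!: poly_mapping_eqI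
        dest: subsetD[OF keys_scale])
qed

lemma lin_ext_klin:
  assumes "kalg B" "f \<in> carrier M \<rightarrow> carrier B"
  shows "lin_ext B f \<in> klin (monoid_alg M) B"
proof -
  interpret B: kalg B by fact
  show ?thesis using assms(2) by (intro klinI) (auto simp: B.lin_ext_add B.lin_ext_scale)
qed

text \<open>The universal property of the monoid algebra: by bilinearity, multiplicativity has to be
  known on monomials only.\<close>

lemma lin_ext_alg_hom:
  fixes B :: "('k::field, 'b) module"
  assumes "kalg B" "Group.monoid M" "f \<in> carrier M \<rightarrow> carrier B" "f \<one>\<^bsub>M\<^esub> = \<one>\<^bsub>B\<^esub>"
    and "\<And>u v. u \<in> carrier M \<Longrightarrow> v \<in> carrier M \<Longrightarrow> f (u \<otimes>\<^bsub>M\<^esub> v) = f u \<otimes>\<^bsub>B\<^esub> f v"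
  shows "lin_ext B f \<in> alg_hom (monoid_alg M) B"
proof -
  interpret B: kalg B by fact
  interpret M: Group.monoid M by fact
  interpret A: kalg "monoid_alg M" by (rule kalg_monoid_alg) fact
  have f: "\<And>u. u \<in> carrier M \<Longrightarrow> f u \<in> carrier B" using assms(3) by auto
  note * = B.lin_ext_add[OF assms(3)] B.lin_ext_closed[OF assms(3)]
  have closed: "Poly_Mapping.keys (p \<otimes>\<^bsub>monoid_alg M\<^esub> r) \<subseteq> carrier M"
    if "Poly_Mapping.keys p \<subseteq> carrier M" "Poly_Mapping.keys r \<subseteq> carrier M" for p r :: "_ \<Rightarrow>\<^sub>0 'k"
    using A.m_closed[of p r] that by simp
  have "lin_ext B f (p \<otimes>\<^bsub>monoid_alg M\<^esub> r) = lin_ext B f p \<otimes>\<^bsub>B\<^esub> lin_ext B f r"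
    if "Poly_Mapping.keys p \<subseteq> carrier M" "Poly_Mapping.keys r \<subseteq> carrier M" for p r
    using that(1)
  proof (induction p rule: poly_mapping_induct_on)
    case (add u c p)
    have u: "Poly_Mapping.keys (Poly_Mapping.single u c) \<subseteq> carrier M" using add by simp
    from that(2) have "lin_ext B f (Poly_Mapping.single u c \<otimes>\<^bsub>monoid_alg M\<^esub> r) = c \<odot>\<^bsub>B\<^esub> f u \<otimes>\<^bsub>B\<^esub> lin_ext B f r"
    proof (induction r rule: poly_mapping_induct_on)
      case (add v b r)
      then show ?case using \<open>u \<in> carrier M\<close> closed[OF u add.hyps(2)]
        by (simp add: monoid_alg_mult_add_r * f assms(5) B.r_distr B.smult_r_distr mult.commute
            monoid_alg_mult_single)
    qed (use f add in simp)
    then show ?case using add closed[OF u that(2)] closed[OF add.hyps(2) that(2)] that(2) u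
      by (simp add: monoid_alg_mult_add_l * f B.l_distr)
  qed (use that * in simp)
  then show ?thesis
    using lin_ext_klin[OF assms(1,3)] f by (auto simp: alg_hom_iff assms(4))
qed

lemma klin_eq_on_monoid_alg:
  assumes "f \<in> klin (monoid_alg M) B" "g \<in> klin (monoid_alg M) B"
    and "kalg B" "Group.monoid M"
    and "\<And>u. u \<in> carrier M \<Longrightarrow> f (Poly_Mapping.single u 1) = g (Poly_Mapping.single u 1)"
    and "p \<in> carrier (monoid_alg M)"
  shows "f p = g p"
proof -
  have "Poly_Mapping.keys p \<subseteq> carrier M" using assms(6) by simp
  then show ?thesis
  proof (induction p rule: poly_mapping_induct_on)
    case zero
    show ?case using klin_zero[OF assms(1) kalg_monoid_alg[OF assms(4)] assms(3)]
        klin_zero[OF assms(2) kalg_monoid_alg[OF assms(4)] assms(3)] by simp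
  next
    case (add u c p)
    have "h (Poly_Mapping.single u c + p) = c \<odot>\<^bsub>B\<^esub> h (Poly_Mapping.single u 1) \<oplus>\<^bsub>B\<^esub> h p"
      if "h \<in> klin (monoid_alg M) B" for h
      using klin_add[OF that, of "Poly_Mapping.single u c" p] klin_smult[OF that, of "Poly_Mapping.single u 1" c] add
      by simp
    from this[OF assms(1)] this[OF assms(2)] show ?case using assms(5) add by simp
  qed
qed

subsection \<open>Quotient algebras\<close>

context kalg begin

context fixes I assumes I: "ideal I A"
begin

interpretation I: ideal I A by (rule I)

text \<open>Ring ideals are automatically subspaces, since \<open>c \<odot> x\<close> is the product
  of \<open>c \<odot> \<one>\<close> and \<open>x\<close>.\<close>

lemma ideal_smult: "x \<in> I \<Longrightarrow> c \<odot> x \<in> I"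
  using I.I_l_closed[of x "c \<odot> \<one>"] I.Icarr by simp

lemma quot_alg_carrier: "carrier (quot_alg A I) = (\<lambda>x. I +> x) ` carrier A"
  by (auto simp: quot_alg_def FactRing_def A_RCOSETS_def')

lemma rcos_eq_iff: "x \<in> carrier A \<Longrightarrow> y \<in> carrier A \<Longrightarrow> I +> x = I +> y \<longleftrightarrow> x \<ominus> y \<in> I"
  using quotient_eq_iff_same_a_r_cos[OF I] by auto

lemma rcos_memD:
  assumes "y \<in> I +> x" "x \<in> carrier A" shows "y \<in> carrier A" "y \<ominus> x \<in> I"
proof -
  show y: "y \<in> carrier A" using assms I.a_elemrcos_carrier by blast
  have "I +> x = I +> y" using I.a_repr_independence'[OF assms] .
  then show "y \<ominus> x \<in> I" using rcos_eq_iff[OF y assms(2)] by simp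
qed

lemma rcos_self: "x \<in> carrier A \<Longrightarrow> x \<in> I +> x"
  by (rule I.a_rcos_self)

text \<open>The union in \<open>quot_alg\<close> runs over all representatives; they all yield the
  same coset, so the union is that coset.\<close>

lemma quot_smult:
  assumes "x \<in> carrier A" shows "c \<odot>\<^bsub>quot_alg A I\<^esub> (I +> x) = I +> (c \<odot> x)"
proof -
  have eq: "I +> (c \<odot> y) = I +> (c \<odot> x)" if "y \<in> I +> x" for y
  proof -
    note y = rcos_memD[OF that assms]
    have "c \<odot> y \<ominus> c \<odot> x \<in> I"
      using ideal_smult[OF y(2), of c] unfolding smult_minus[OF y(1) assms] .
    then show ?thesis using rcos_eq_iff[OF smult_closed[OF y(1)] smult_closed[OF assms]] by blast
  qed
  have "c \<odot>\<^bsub>quot_alg A I\<^esub> (I +> x) = (\<Union>y\<in>I +> x. I +> (c \<odot> y))"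
    unfolding quot_alg_def by simp
  also have "\<dots> = (\<Union>y\<in>I +> x. I +> (c \<odot> x))" by (rule SUP_cong[OF refl eq])
  also have "\<dots> = I +> (c \<odot> x)"
    by (rule SUP_const) (use rcos_self[OF assms] in blast)
  finally show ?thesis .
qed

lemma quot_mult: "x \<in> carrier A \<Longrightarrow> y \<in> carrier A \<Longrightarrow> (I +> x) \<otimes>\<^bsub>quot_alg A I\<^esub> (I +> y) = I +> (x \<otimes> y)"
  by (simp add: quot_alg_def FactRing_def I.rcoset_mult_add)

lemma quot_add: "x \<in> carrier A \<Longrightarrow> y \<in> carrier A \<Longrightarrow> (I +> x) \<oplus>\<^bsub>quot_alg A I\<^esub> (I +> y) = I +> (x \<oplus> y)"
  by (simp add: quot_alg_def FactRing_def I.a_rcos_sum)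

lemma quot_one: "\<one>\<^bsub>quot_alg A I\<^esub> = I +> \<one>"
  by (simp add: quot_alg_def FactRing_def)

lemma quot_zero: "\<zero>\<^bsub>quot_alg A I\<^esub> = I"
  by (simp add: quot_alg_def FactRing_def)

lemma kalg_quot_alg: "kalg (quot_alg A I)"
proof -
  have zero: "\<zero>\<^bsub>quot_alg A I\<^esub> = I +> \<zero>"
    using I.a_rcos_const[of \<zero>] by (simp add: quot_zero)
  note simps = quot_alg_carrier quot_mult quot_add quot_one zero
  have "Ring.ring (quot_alg A I)"
  proof (rule ringI)
    show "abelian_group (quot_alg A I)"
    proof (rule abelian_groupI)
      fix X assume "X \<in> carrier (quot_alg A I)"
      then obtain x where "x \<in> carrier A" "X = I +> x" by (auto simp: quot_alg_carrier)
      then show "\<exists>Y\<in>carrier (quot_alg A I). Y \<oplus>\<^bsub>quot_alg A I\<^esub> X = \<zero>\<^bsub>quot_alg A I\<^esub>"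
        by (intro bexI[of _ "I +> \<ominus> x"]) (simp_all add: simps l_neg)
    next
      fix X Y assume "X \<in> carrier (quot_alg A I)" "Y \<in> carrier (quot_alg A I)"
      then obtain x y where "x \<in> carrier A" "X = I +> x" "y \<in> carrier A" "Y = I +> y" by (auto simp: quot_alg_carrier)
      then show "X \<oplus>\<^bsub>quot_alg A I\<^esub> Y = Y \<oplus>\<^bsub>quot_alg A I\<^esub> X" by (simp add: simps a_comm)
    qed (auto simp: simps a_assoc)
    show "Group.monoid (quot_alg A I)"
      by (rule monoidI) (auto simp: simps m_assoc)
  qed (auto simp: simps l_distr r_distr)
  then show ?thesis
    by (intro kalg.intro kalg_axioms.intro)
      (auto simp: quot_alg_carrier quot_smult quot_mult quot_add smult_l_distr smult_r_distr)
qed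

lemma rcos_alg_hom: "(\<lambda>x. I +> x) \<in> alg_hom A (quot_alg A I)"
  by (auto simp: alg_hom_iff quot_mult quot_add quot_one quot_smult quot_alg_carrier intro: klinI)

text \<open>Two representatives differ by an element of \<open>I\<close>, which \<open>h\<close>
  kills, so the value does not depend on the choice made by \<open>SOME\<close>.\<close>

lemma klin_some_eq:
  assumes h: "h \<in> klin A B" and B: "kalg B" and z: "\<forall>x\<in>I. h x = \<zero>\<^bsub>B\<^esub>" and x: "x \<in> carrier A"
  shows "h (SOME p. p \<in> I +> x) = h x"
proof -
  have y: "(SOME p. p \<in> I +> x) \<in> I +> x" using rcos_self[OF x] some_in_eq by fast
  note yc = rcos_memD[OF y x]
  have "h (SOME p. p \<in> I +> x) \<ominus>\<^bsub>B\<^esub> h x = \<zero>\<^bsub>B\<^esub>"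
    by (rule trans[OF sym[OF klin_minus[OF h kalg_axioms B yc(1) x]] bspec[OF z yc(2)]])
  then show ?thesis
    using kalg.minus_eq_zero_iff[OF B klin_closed[OF h yc(1)] klin_closed[OF h x]] by simp
qed

lemma descend_eq:
  assumes "h \<in> klin A B" "kalg B" "\<forall>x\<in>I. h x = \<zero>\<^bsub>B\<^esub>" "x \<in> carrier A"
  shows "(\<lambda>X\<in>carrier (quot_alg A I). h (SOME p. p \<in> X)) (I +> x) = h x"
proof -
  have "I +> x \<in> carrier (quot_alg A I)" using assms(4) by (simp add: quot_alg_carrier)
  then show ?thesis using klin_some_eq[OF assms] by simp
qed

lemma descend_klin:
  assumes h: "h \<in> klin A B" and B: "kalg B" and z: "\<forall>x\<in>I. h x = \<zero>\<^bsub>B\<^esub>"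
  shows "(\<lambda>X\<in>carrier (quot_alg A I). h (SOME p. p \<in> X)) \<in> klin (quot_alg A I) B" (is "?h \<in> _")
proof (rule klinI)
  note eq = descend_eq[OF h B z]
  fix X Y c assume "X \<in> carrier (quot_alg A I)"
  then obtain x where x: "x \<in> carrier A" "X = I +> x" by (auto simp: quot_alg_carrier)
  show "?h X \<in> carrier B" unfolding x eq[OF x(1)] by (rule klin_closed[OF h x(1)])
  show "?h (c \<odot>\<^bsub>quot_alg A I\<^esub> X) = c \<odot>\<^bsub>B\<^esub> ?h X"
    unfolding x quot_smult[OF x(1)] eq[OF x(1)] eq[OF smult_closed[OF x(1)]] by (rule klin_smult[OF h x(1)])
  assume "Y \<in> carrier (quot_alg A I)"
  then obtain y where y: "y \<in> carrier A" "Y = I +> y" by (auto simp: quot_alg_carrier)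
  show "?h (X \<oplus>\<^bsub>quot_alg A I\<^esub> Y) = ?h X \<oplus>\<^bsub>B\<^esub> ?h Y"
    unfolding x y quot_add[OF x(1) y(1)] eq[OF x(1)] eq[OF y(1)] eq[OF a_closed[OF x(1) y(1)]]
    by (rule klin_add[OF h x(1) y(1)])
qed

lemma descend_alg_hom:
  assumes h: "h \<in> alg_hom A B" and B: "kalg B" and z: "\<forall>x\<in>I. h x = \<zero>\<^bsub>B\<^esub>"
  shows "(\<lambda>X\<in>carrier (quot_alg A I). h (SOME p. p \<in> X)) \<in> alg_hom (quot_alg A I) B" (is "?h \<in> _")
proof -
  have k: "h \<in> klin A B" using h alg_hom_klin by blast
  note eq = descend_eq[OF k B z]
  have "?h (X \<otimes>\<^bsub>quot_alg A I\<^esub> Y) = ?h X \<otimes>\<^bsub>B\<^esub> ?h Y"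
    if "X \<in> carrier (quot_alg A I)" "Y \<in> carrier (quot_alg A I)" for X Y
  proof -
    obtain x y where x: "x \<in> carrier A" "X = I +> x" and y: "y \<in> carrier A" "Y = I +> y"
      using \<open>X \<in> _\<close> \<open>Y \<in> _\<close> by (auto simp: quot_alg_carrier)
    show ?thesis
      unfolding x y quot_mult[OF x(1) y(1)] eq[OF x(1)] eq[OF y(1)] eq[OF m_closed[OF x(1) y(1)]]
      by (rule alg_hom_mult[OF h x(1) y(1)])
  qed
  moreover have "?h \<one>\<^bsub>quot_alg A I\<^esub> = \<one>\<^bsub>B\<^esub>"
    unfolding quot_one eq[OF one_closed] by (rule alg_hom_one[OF h])
  ultimately show ?thesis unfolding alg_hom_iff using descend_klin[OF k B z] by blast
qed

end

end

subsection \<open>Presented algebras\<close>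

lemma carrier_free_alg [simp]: "carrier free_alg = UNIV"
  by (simp add: free_alg_def)

lemma monoid_words: "Group.monoid \<lparr>carrier = UNIV, mult = (@), one = []\<rparr>"
  by (rule monoidI) simp_all

lemma kalg_free_alg: "kalg (free_alg :: ('k::field, 'g list \<Rightarrow>\<^sub>0 'k) module)"
  unfolding free_alg_def by (rule kalg_monoid_alg[OF monoid_words])

lemma free_alg_simps [simp]:
  "p \<oplus>\<^bsub>free_alg\<^esub> r = p + r" "c \<odot>\<^bsub>free_alg\<^esub> p = Poly_Mapping.map ((*) c) p"
  "\<one>\<^bsub>free_alg\<^esub> = Poly_Mapping.single [] 1" "\<zero>\<^bsub>free_alg\<^esub> = 0"
  "Poly_Mapping.single u b \<otimes>\<^bsub>free_alg\<^esub> Poly_Mapping.single v c = Poly_Mapping.single (u @ v) (b * c)"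
  by (simp_all add: free_alg_def)

lemma free_alg_minus [simp]: "p \<ominus>\<^bsub>free_alg\<^esub> r = p - (r :: 'g list \<Rightarrow>\<^sub>0 'k::field)"
proof -
  interpret kalg "free_alg :: ('k, 'g list \<Rightarrow>\<^sub>0 'k) module" by (rule kalg_free_alg)
  show ?thesis by (simp add: minus_smult) (rule poly_mapping_eqI, simp add: lookup_add lookup_minus)
qed

definition word_class :: "('g list \<Rightarrow>\<^sub>0 'k::field) set \<Rightarrow> 'g list \<Rightarrow> ('g list \<Rightarrow>\<^sub>0 'k) set" where
  "word_class S u = Idl\<^bsub>free_alg\<^esub> S +>\<^bsub>free_alg\<^esub> Poly_Mapping.single u 1"

lemma ideal_free: "ideal (Idl\<^bsub>free_alg\<^esub> S) (free_alg :: ('k::field, 'g list \<Rightarrow>\<^sub>0 'k) module)"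
  using ring.genideal_ideal[OF kalg.axioms(1)[OF kalg_free_alg]] by simp

lemma kalg_presented_alg: "kalg (presented_alg S)"
  unfolding presented_alg_def by (rule kalg.kalg_quot_alg[OF kalg_free_alg ideal_free])

lemma gen_class_eq: "gen_class S x = word_class S [x]"
  by (simp add: gen_class_def word_class_def)

lemma word_class_closed [simp]: "word_class S u \<in> carrier (presented_alg S)"
  by (simp add: presented_alg_def word_class_def kalg.quot_alg_carrier[OF kalg_free_alg ideal_free])

lemma gen_class_closed [simp]: "gen_class S x \<in> carrier (presented_alg S)"
  by (simp add: gen_class_eq)

lemma word_class_Nil: "word_class S [] = \<one>\<^bsub>presented_alg S\<^esub>"
  by (simp add: presented_alg_def word_class_def kalg.quot_one[OF kalg_free_alg ideal_free])

lemma word_class_append: "word_class S (u @ v) = word_class S u \<otimes>\<^bsub>presented_alg S\<^esub> word_class S v"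
  by (simp add: presented_alg_def word_class_def kalg.quot_mult[OF kalg_free_alg ideal_free])

lemma word_class_Cons: "word_class S (x # u) = gen_class S x \<otimes>\<^bsub>presented_alg S\<^esub> word_class S u"
  using word_class_append[of S "[x]" u] by (simp add: gen_class_eq)

definition poly_class :: "('g list \<Rightarrow>\<^sub>0 'k::field) set \<Rightarrow> ('g list \<Rightarrow>\<^sub>0 'k) \<Rightarrow> ('g list \<Rightarrow>\<^sub>0 'k) set" where
  "poly_class S p = Idl\<^bsub>free_alg\<^esub> S +>\<^bsub>free_alg\<^esub> p"

lemma poly_class_alg_hom: "poly_class S \<in> alg_hom free_alg (presented_alg S)"
  unfolding poly_class_def presented_alg_def
  by (rule kalg.rcos_alg_hom[OF kalg_free_alg ideal_free])

lemma poly_class_word: "poly_class S (Poly_Mapping.single u 1) = word_class S u"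
  by (simp add: poly_class_def word_class_def)

lemma poly_class_single: "poly_class S (Poly_Mapping.single u c) = c \<odot>\<^bsub>presented_alg S\<^esub> word_class S u"
proof -
  have "poly_class S (c \<odot>\<^bsub>free_alg\<^esub> Poly_Mapping.single u 1) = c \<odot>\<^bsub>presented_alg S\<^esub> poly_class S (Poly_Mapping.single u 1)"
    by (rule alg_hom_smult[OF poly_class_alg_hom]) simp
  then show ?thesis by (simp add: poly_class_word)
qed

lemma presented_alg_carrier: "carrier (presented_alg S) = range (poly_class S)"
  unfolding presented_alg_def poly_class_def
  using kalg.quot_alg_carrier[OF kalg_free_alg ideal_free] by simp

lemma poly_class_rel:
  fixes S :: "('g list \<Rightarrow>\<^sub>0 'k::field) set"
  assumes "p \<in> S" shows "poly_class S p = \<zero>\<^bsub>presented_alg S\<^esub>"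
proof -
  interpret F: kalg "free_alg :: ('k, 'g list \<Rightarrow>\<^sub>0 'k) module" by (rule kalg_free_alg)
  interpret I: ideal "Idl\<^bsub>free_alg\<^esub> S" "free_alg :: ('k, 'g list \<Rightarrow>\<^sub>0 'k) module" by (rule ideal_free)
  have "p \<in> Idl\<^bsub>free_alg\<^esub> S" using assms F.genideal_self'[of p] F.genideal_self[of S] by auto
  then show ?thesis
    by (simp add: poly_class_def presented_alg_def F.quot_zero[OF ideal_free] I.a_rcos_const)
qed

lemma klin_eq_on_presented:
  assumes "f \<in> klin (presented_alg S) B" "g \<in> klin (presented_alg S) B" "kalg B"
    and "\<And>u. f (word_class S u) = g (word_class S u)" "X \<in> carrier (presented_alg S)"
  shows "f X = g X"
proof -
  have *: "poly_class S \<in> klin free_alg (presented_alg S)"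
    using poly_class_alg_hom alg_hom_klin by blast
  have "f (poly_class S p) = g (poly_class S p)" for p
  proof (rule klin_eq_on_monoid_alg[OF _ _ assms(3) monoid_words])
    show "(\<lambda>p. f (poly_class S p)) \<in> klin (monoid_alg \<lparr>carrier = UNIV, mult = (@), one = []\<rparr>) B"
      "(\<lambda>p. g (poly_class S p)) \<in> klin (monoid_alg \<lparr>carrier = UNIV, mult = (@), one = []\<rparr>) B"
      using klin_comp[OF *] assms(1,2) unfolding free_alg_def by auto
    show "f (poly_class S (Poly_Mapping.single u 1)) = g (poly_class S (Poly_Mapping.single u 1))" for u
      using assms(4) by (simp add: poly_class_word)
  qed simp
  then show ?thesis using assms(5) by (auto simp: presented_alg_carrier)
qed

lemma alg_hom_eq_on_presented:
  assumes "f \<in> alg_hom (presented_alg S) B" "g \<in> alg_hom (presented_alg S) B" "kalg B"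
    and "\<And>x. f (gen_class S x) = g (gen_class S x)" "X \<in> carrier (presented_alg S)"
  shows "f X = g X"
proof (rule klin_eq_on_presented[OF _ _ assms(3) _ assms(5)])
  show "f (word_class S u) = g (word_class S u)" for u
  proof (induction u)
    case Nil show ?case using alg_hom_one assms(1,2) by (metis word_class_Nil)
  next
    case (Cons x u)
    then show ?case using alg_hom_mult[OF assms(1)] alg_hom_mult[OF assms(2)] assms(4)
      by (simp add: word_class_Cons)
  qed
qed (use assms alg_hom_klin in blast)+

text \<open>Makes linear maps on the quotient computable: the value on a class is read off from any
  representative and the values on words, although words need not be independent.\<close>

lemma klin_poly_class:
  assumes "f \<in> klin (presented_alg S) B" "kalg B"
  shows "f (poly_class S p) = lin_ext B (\<lambda>u. f (word_class S u)) p"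
proof (rule klin_eq_on_monoid_alg[OF _ _ assms(2) monoid_words])
  have *: "poly_class S \<in> klin free_alg (presented_alg S)"
    using poly_class_alg_hom alg_hom_klin by blast
  show "(\<lambda>p. f (poly_class S p)) \<in> klin (monoid_alg \<lparr>carrier = UNIV, mult = (@), one = []\<rparr>) B"
    using klin_comp[OF * assms(1)] unfolding free_alg_def .
  show "lin_ext B (\<lambda>u. f (word_class S u)) \<in> klin (monoid_alg \<lparr>carrier = UNIV, mult = (@), one = []\<rparr>) B"
    using klin_closed[OF assms(1)] by (intro lin_ext_klin assms(2)) simp
  interpret B: kalg B by fact
  show "f (poly_class S (Poly_Mapping.single u 1)) = lin_ext B (\<lambda>u. f (word_class S u)) (Poly_Mapping.single u 1)" for u
    using klin_closed[OF assms(1)] by (simp add: poly_class_word)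
qed simp

lemma word_prod_simps [simp]:
  "word_prod B f [] = \<one>\<^bsub>B\<^esub>" "word_prod B f (x # u) = f x \<otimes>\<^bsub>B\<^esub> word_prod B f u"
  by (simp_all add: word_prod_def)

lemma (in kalg) word_prod_closed [simp]: "(\<And>x. f x \<in> carrier A) \<Longrightarrow> word_prod A f u \<in> carrier A"
  by (induction u) auto

lemma (in kalg) word_prod_append:
  "(\<And>x. f x \<in> carrier A) \<Longrightarrow> word_prod A f (u @ v) = word_prod A f u \<otimes> word_prod A f v"
  by (induction u) (auto simp: m_assoc)

lemma word_class_eq_word_prod: "word_class S u = word_prod (presented_alg S) (gen_class S) u"
  by (induction u) (simp_all add: word_class_Nil word_class_Cons)

lemma word_prod_alg_hom:
  fixes B :: "('k::field, 'b) module"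
  assumes "kalg B" "\<And>x. f x \<in> carrier B"
  shows "lin_ext B (word_prod B f) \<in> alg_hom free_alg B"
proof -
  interpret B: kalg B by fact
  show ?thesis unfolding free_alg_def
    using assms by (intro lin_ext_alg_hom monoid_words) (auto simp: B.word_prod_append)
qed

text \<open>The universal property of the presentation. Relations are tested on the given generators
  of the ideal; the representative chosen in \<open>extend_hom\<close> is then irrelevant.\<close>

locale presented_hom = B: kalg B for B :: "('k::field, 'b) module" +
  fixes S :: "('g list \<Rightarrow>\<^sub>0 'k) set" and f :: "'g \<Rightarrow> 'b"
  assumes f_closed [simp]: "\<And>x. f x \<in> carrier B"
    and rels: "\<And>r. r \<in> S \<Longrightarrow> lin_ext B (word_prod B f) r = \<zero>\<^bsub>B\<^esub>"
begin

lemma hom: "lin_ext B (word_prod B f) \<in> alg_hom free_alg B"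
  by (rule word_prod_alg_hom[OF B.kalg_axioms f_closed])

lemma vanish: "\<forall>x \<in> Idl\<^bsub>free_alg\<^esub> S. lin_ext B (word_prod B f) x = \<zero>\<^bsub>B\<^esub>"
  using alg_hom_Idl[OF kalg_free_alg B.kalg_axioms hom _ rels] by simp

lemma extend_alg_hom: "extend_hom S B f \<in> alg_hom (presented_alg S) B"
  unfolding extend_hom_def presented_alg_def
  by (rule kalg.descend_alg_hom[OF kalg_free_alg ideal_free hom B.kalg_axioms vanish])

lemma extend_poly_class: "extend_hom S B f (poly_class S p) = lin_ext B (word_prod B f) p"
proof -
  have "lin_ext B (word_prod B f) \<in> klin free_alg B" using hom alg_hom_klin by blast
  from kalg.descend_eq[OF kalg_free_alg ideal_free this B.kalg_axioms vanish, of p]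
  show ?thesis unfolding extend_hom_def presented_alg_def poly_class_def by simp
qed

lemma extend_word_class: "extend_hom S B f (word_class S u) = word_prod B f u"
  using extend_poly_class[of "Poly_Mapping.single u 1"] by (simp add: poly_class_word)

lemma extend_gen_class [simp]: "extend_hom S B f (gen_class S x) = f x"
  using extend_word_class[of "[x]"] by (simp add: gen_class_eq)

end

section \<open>Opposite algebras and the ground field as an algebra\<close>

definition opp :: "('k, 'a) module \<Rightarrow> ('k, 'a) module" where
  "opp A = A\<lparr>mult := \<lambda>x y. y \<otimes>\<^bsub>A\<^esub> x\<rparr>"

lemma opp_simps [simp]:
  "carrier (opp A) = carrier A" "x \<otimes>\<^bsub>opp A\<^esub> y = y \<otimes>\<^bsub>A\<^esub> x" "x \<oplus>\<^bsub>opp A\<^esub> y = x \<oplus>\<^bsub>A\<^esub> y"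
  "c \<odot>\<^bsub>opp A\<^esub> x = c \<odot>\<^bsub>A\<^esub> x" "\<one>\<^bsub>opp A\<^esub> = \<one>\<^bsub>A\<^esub>" "\<zero>\<^bsub>opp A\<^esub> = \<zero>\<^bsub>A\<^esub>"
  by (simp_all add: opp_def)

lemma kalg_opp: assumes "kalg A" shows "kalg (opp A)"
proof -
  interpret kalg A by fact
  have "Ring.ring (opp A)"
  proof (rule ringI)
    show "abelian_group (opp A)"
    proof (rule abelian_groupI)
      fix x assume "x \<in> carrier (opp A)"
      then show "\<exists>y\<in>carrier (opp A). y \<oplus>\<^bsub>opp A\<^esub> x = \<zero>\<^bsub>opp A\<^esub>"
        by (intro bexI[of _ "\<ominus>\<^bsub>A\<^esub> x"]) (simp_all add: l_neg)
    qed (simp_all add: a_ac)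
    show "Group.monoid (opp A)" by (rule monoidI) (simp_all add: m_assoc)
  qed (simp_all add: l_distr r_distr)
  then show ?thesis
    by (intro kalg.intro kalg_axioms.intro) (simp_all add: smult_l_distr smult_r_distr)
qed

lemma lin_ext_opp: "lin_ext (opp A) f p = lin_ext A f p"
proof -
  have "add_monoid (opp A) = add_monoid A" by (simp add: opp_def)
  then show ?thesis by (simp add: lin_ext_def finsum_def)
qed

lemma (in kalg) word_prod_opp:
  "(\<And>x. f x \<in> carrier A) \<Longrightarrow> word_prod (opp A) f u = word_prod A f (rev u)"
  by (induction u) (simp_all add: word_prod_append)

text \<open>Reversing words is evaluation in the opposite algebra, so anti-homomorphisms obey the
  universal property already proved.\<close>

lemma extend_antihom_eq:
  fixes B :: "('k::field, 'b) module"
  assumes "kalg B" "\<And>x. f x \<in> carrier B"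
  shows "extend_antihom S B f = extend_hom S (opp B) f"
proof -
  interpret kalg B by fact
  have "word_prod (opp B) f = (\<lambda>u. word_prod B f (rev u))"
    by (rule ext) (rule word_prod_opp[OF assms(2)])
  then show ?thesis unfolding extend_antihom_def extend_hom_def by (simp add: lin_ext_opp)
qed

lemma kalg_base_alg: "kalg (base_alg :: ('k::field, 'k) module)"
proof -
  have "Ring.ring (base_alg :: ('k::field, 'k) module)"
  proof (rule ringI)
    show "abelian_group (base_alg :: ('k::field, 'k) module)"
    proof (rule abelian_groupI)
      fix x :: 'k
      show "\<exists>y\<in>carrier base_alg. y \<oplus>\<^bsub>base_alg\<^esub> x = \<zero>\<^bsub>base_alg\<^esub>"
        by (intro bexI[of _ "- x"]) (simp_all add: base_alg_def)
    qed (simp_all add: base_alg_def)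
    show "Group.monoid (base_alg :: ('k::field, 'k) module)"
      by (rule monoidI) (simp_all add: base_alg_def)
  qed (simp_all add: base_alg_def algebra_simps)
  then show ?thesis
    by (intro kalg.intro kalg_axioms.intro) (simp_all add: base_alg_def algebra_simps)
qed

lemma base_alg_simps [simp]:
  "carrier base_alg = UNIV" "x \<otimes>\<^bsub>base_alg\<^esub> y = x * y" "x \<oplus>\<^bsub>base_alg\<^esub> y = x + y"
  "c \<odot>\<^bsub>base_alg\<^esub> x = c * x" "\<one>\<^bsub>base_alg\<^esub> = 1" "\<zero>\<^bsub>base_alg\<^esub> = 0"
  by (simp_all add: base_alg_def)

lemma lin_ext_base: "lin_ext base_alg f p = (\<Sum>u\<in>Poly_Mapping.keys p. Poly_Mapping.lookup p u * f u)"
proof -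
  interpret kalg "base_alg :: ('a, 'a) module" by (rule kalg_base_alg)
  have "(\<Oplus>\<^bsub>base_alg\<^esub>u\<in>S. g u) = (\<Sum>u\<in>S. g u)" if "finite S" for S :: "'b set" and g :: "'b \<Rightarrow> 'a"
    using that by (induction S rule: finite_induct) simp_all
  then show ?thesis by (simp add: lin_ext_def)
qed

subsection \<open>Tensor products\<close>

lemma monoid_DirProd: "kalg A \<Longrightarrow> kalg B \<Longrightarrow> Group.monoid (A \<times>\<times> B)"
  by (intro DirProd_monoid) (simp_all add: kalg_def ring.is_monoid)

definition bilinear_map where
  "bilinear_map A B C \<beta> \<longleftrightarrow> (\<forall>x \<in> carrier A. \<beta> x \<in> klin B C) \<and> (\<forall>y \<in> carrier B. (\<lambda>x. \<beta> x y) \<in> klin A C)"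

text \<open>The map out of the tensor product induced by a bilinear map; \<open>tensor_map\<close>
  is the instance with values in another tensor product.\<close>

definition tensor_lin ::
    "('k::field, 'a) module \<Rightarrow> ('k, 'b) module \<Rightarrow> ('k, 'c) module \<Rightarrow> ('a \<Rightarrow> 'b \<Rightarrow> 'c) \<Rightarrow> ('a \<times> 'b \<Rightarrow>\<^sub>0 'k) set \<Rightarrow> 'c" where
  "tensor_lin A B C \<beta> = (\<lambda>X \<in> carrier (tensor_alg A B). lin_ext C (\<lambda>(x, y). \<beta> x y) (SOME p. p \<in> X))"

locale tensor = A: kalg A + B: kalg B for A :: "('k::field, 'a) module" and B :: "('k, 'b) module"
begin

abbreviation "M \<equiv> monoid_alg (A \<times>\<times> B) :: ('k, 'a \<times> 'b \<Rightarrow>\<^sub>0 'k) module"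
abbreviation "T \<equiv> tensor_alg A B"
abbreviation "t \<equiv> pure_tensor A B"

lemma kalg_M: "kalg M"
  by (intro kalg_monoid_alg monoid_DirProd A.kalg_axioms B.kalg_axioms)

sublocale M: kalg M by (rule kalg_M)

lemma bilin_rels_subset: "bilin_rels A B \<subseteq> carrier M"
  unfolding bilin_rels_def
  by (auto simp: in_keys_iff lookup_minus lookup_single when_def split: if_splits)

lemma ideal_tensor: "ideal (tensor_ideal A B) M"
  unfolding tensor_ideal_def by (rule M.genideal_ideal[OF bilin_rels_subset])

lemma kalg_T: "kalg T"
  unfolding tensor_alg_def by (rule M.kalg_quot_alg[OF ideal_tensor])

sublocale T: kalg T by (rule kalg_T)

lemma pure_closed [simp]: "x \<in> carrier A \<Longrightarrow> y \<in> carrier B \<Longrightarrow> t x y \<in> carrier T"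
  by (simp add: tensor_alg_def pure_tensor_def M.quot_alg_carrier[OF ideal_tensor])

lemma pure_mult [simp]:
  "\<lbrakk>x \<in> carrier A; y \<in> carrier B; x' \<in> carrier A; y' \<in> carrier B\<rbrakk> \<Longrightarrow>
    t x y \<otimes>\<^bsub>T\<^esub> t x' y' = t (x \<otimes>\<^bsub>A\<^esub> x') (y \<otimes>\<^bsub>B\<^esub> y')"
  by (simp add: tensor_alg_def pure_tensor_def M.quot_mult[OF ideal_tensor])

lemma pure_one: "\<one>\<^bsub>T\<^esub> = t \<one>\<^bsub>A\<^esub> \<one>\<^bsub>B\<^esub>"
  by (simp add: tensor_alg_def pure_tensor_def M.quot_one[OF ideal_tensor])

lemma M_minus [simp]: 
  assumes "p \<in> carrier M" "r \<in> carrier M" shows "p \<ominus>\<^bsub>M\<^esub> r = p - r"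
  by (subst M.minus_smult[OF assms], simp) (rule poly_mapping_eqI, simp add: lookup_add lookup_minus)

lemma bilin_rel_ideal: "p \<in> bilin_rels A B \<Longrightarrow> p \<in> tensor_ideal A B"
  using M.genideal_self[OF bilin_rels_subset] unfolding tensor_ideal_def by auto

lemma pure_add_l:
  assumes "x \<in> carrier A" "x' \<in> carrier A" "y \<in> carrier B"
  shows "t (x \<oplus>\<^bsub>A\<^esub> x') y = t x y \<oplus>\<^bsub>T\<^esub> t x' y"
proof -
  have "Poly_Mapping.single (x \<oplus>\<^bsub>A\<^esub> x', y) 1 - Poly_Mapping.single (x, y) 1 - Poly_Mapping.single (x', y) 1 \<in> tensor_ideal A B"
    using assms by (intro bilin_rel_ideal) (unfold bilin_rels_def, blast)
  then have "Poly_Mapping.single (x \<oplus>\<^bsub>A\<^esub> x', y) 1 \<ominus>\<^bsub>M\<^esub> (Poly_Mapping.single (x, y) 1 + Poly_Mapping.single (x', y) 1) \<in> tensor_ideal A B"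
    using assms M.a_closed[of "Poly_Mapping.single (x, y) 1" "Poly_Mapping.single (x', y) 1"] by (subst M_minus) (simp_all add: algebra_simps)
  then show ?thesis using assms M.a_closed[of "Poly_Mapping.single (x, y) 1" "Poly_Mapping.single (x', y) 1"]
    by (simp add: tensor_alg_def pure_tensor_def M.quot_add[OF ideal_tensor] M.rcos_eq_iff[OF ideal_tensor])
qed

lemma pure_add_r:
  assumes "x \<in> carrier A" "y \<in> carrier B" "y' \<in> carrier B"
  shows "t x (y \<oplus>\<^bsub>B\<^esub> y') = t x y \<oplus>\<^bsub>T\<^esub> t x y'"
proof -
  have "Poly_Mapping.single (x, y \<oplus>\<^bsub>B\<^esub> y') 1 - Poly_Mapping.single (x, y) 1 - Poly_Mapping.single (x, y') 1 \<in> tensor_ideal A B"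
    using assms by (intro bilin_rel_ideal) (unfold bilin_rels_def, blast)
  then have "Poly_Mapping.single (x, y \<oplus>\<^bsub>B\<^esub> y') 1 \<ominus>\<^bsub>M\<^esub> (Poly_Mapping.single (x, y) 1 + Poly_Mapping.single (x, y') 1) \<in> tensor_ideal A B"
    using assms M.a_closed[of "Poly_Mapping.single (x, y) 1" "Poly_Mapping.single (x, y') 1"] by (subst M_minus) (simp_all add: algebra_simps)
  then show ?thesis using assms M.a_closed[of "Poly_Mapping.single (x, y) 1" "Poly_Mapping.single (x, y') 1"]
    by (simp add: tensor_alg_def pure_tensor_def M.quot_add[OF ideal_tensor] M.rcos_eq_iff[OF ideal_tensor])
qed

lemma pure_smult_l [simp]:
  assumes "x \<in> carrier A" "y \<in> carrier B"
  shows "t (c \<odot>\<^bsub>A\<^esub> x) y = c \<odot>\<^bsub>T\<^esub> t x y"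
proof -
  have "Poly_Mapping.single (c \<odot>\<^bsub>A\<^esub> x, y) 1 - Poly_Mapping.single (x, y) c \<in> tensor_ideal A B"
    using assms by (intro bilin_rel_ideal) (unfold bilin_rels_def, blast)
  then have "Poly_Mapping.single (c \<odot>\<^bsub>A\<^esub> x, y) 1 \<ominus>\<^bsub>M\<^esub> Poly_Mapping.single (x, y) c \<in> tensor_ideal A B"
    using assms by (subst M_minus) simp_all
  then show ?thesis using assms
    by (simp add: tensor_alg_def pure_tensor_def M.quot_smult[OF ideal_tensor] M.rcos_eq_iff[OF ideal_tensor])
qed

lemma pure_smult_r [simp]:
  assumes "x \<in> carrier A" "y \<in> carrier B"
  shows "t x (c \<odot>\<^bsub>B\<^esub> y) = c \<odot>\<^bsub>T\<^esub> t x y"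
proof -
  have "Poly_Mapping.single (x, c \<odot>\<^bsub>B\<^esub> y) 1 - Poly_Mapping.single (x, y) c \<in> tensor_ideal A B"
    using assms by (intro bilin_rel_ideal) (unfold bilin_rels_def, blast)
  then have "Poly_Mapping.single (x, c \<odot>\<^bsub>B\<^esub> y) 1 \<ominus>\<^bsub>M\<^esub> Poly_Mapping.single (x, y) c \<in> tensor_ideal A B"
    using assms by (subst M_minus) simp_all
  then show ?thesis using assms
    by (simp add: tensor_alg_def pure_tensor_def M.quot_smult[OF ideal_tensor] M.rcos_eq_iff[OF ideal_tensor])
qed

lemma pure_klin_r: "x \<in> carrier A \<Longrightarrow> t x \<in> klin B T"
  by (rule klinI) (simp_all add: pure_add_r)

lemma pure_klin_l: "y \<in> carrier B \<Longrightarrow> (\<lambda>x. t x y) \<in> klin A T"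
  by (rule klinI) (simp_all add: pure_add_l)

lemma pure_zero_l [simp]: "y \<in> carrier B \<Longrightarrow> t \<zero>\<^bsub>A\<^esub> y = \<zero>\<^bsub>T\<^esub>"
  using klin_zero[OF pure_klin_l A.kalg_axioms kalg_T] by simp

lemma pure_zero_r [simp]: "x \<in> carrier A \<Longrightarrow> t x \<zero>\<^bsub>B\<^esub> = \<zero>\<^bsub>T\<^esub>"
  using klin_zero[OF pure_klin_r B.kalg_axioms kalg_T] by simp

lemma klin_eq_on_T:
  assumes "f \<in> klin T C" "g \<in> klin T C" "kalg C"
    and "\<And>x y. x \<in> carrier A \<Longrightarrow> y \<in> carrier B \<Longrightarrow> f (t x y) = g (t x y)" and "X \<in> carrier T"
  shows "f X = g X"
proof -
  let ?I = "tensor_ideal A B"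
  have h: "(\<lambda>p. ?I +>\<^bsub>M\<^esub> p) \<in> klin M T"
    using M.rcos_alg_hom[OF ideal_tensor] alg_hom_klin unfolding tensor_alg_def by blast
  have "f (?I +>\<^bsub>M\<^esub> p) = g (?I +>\<^bsub>M\<^esub> p)" if "p \<in> carrier M" for p
    using klin_comp[OF h assms(1)] klin_comp[OF h assms(2)] assms(3)
      monoid_DirProd[OF A.kalg_axioms B.kalg_axioms] _ that
    by (rule klin_eq_on_monoid_alg) (use assms(4) in \<open>auto simp: pure_tensor_def\<close>)
  then show ?thesis using assms(5) by (auto simp: tensor_alg_def M.quot_alg_carrier[OF ideal_tensor])
qed

context
  fixes C :: "('k, 'c) module"
  assumes C: "kalg C"
begin

interpretation C: kalg C by (rule C)

lemma bilinear_map_lin_ext: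
  assumes "bilinear_map A B C \<beta>"
  shows "lin_ext C (\<lambda>(x, y). \<beta> x y) \<in> klin M C"
    and "x \<in> carrier A \<Longrightarrow> y \<in> carrier B \<Longrightarrow> \<beta> x y \<in> carrier C"
  using assms unfolding bilinear_map_def
  by (auto intro!: lin_ext_klin[OF C] klin_closed[of _ B C])

text \<open>\<open>tensor_ideal\<close> is generated as a two-sided ideal, whereas the linear
  extension of a bilinear map is not multiplicative, so its kernel need not be an ideal. The common
  kernel \<open>J\<close> of all bilinear maps is one: multiplying by a monomial before applying a
  bilinear map gives again a bilinear map.\<close>

lemma bilinear_map_vanish:
  assumes "bilinear_map A B C \<beta>"
  shows "\<forall>p \<in> tensor_ideal A B. lin_ext C (\<lambda>(x, y). \<beta> x y) p = \<zero>\<^bsub>C\<^esub>"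
proof -
  let ?L = "\<lambda>\<beta>. lin_ext C (\<lambda>(x, y). \<beta> x y)"
  define J where "J = {p \<in> carrier M. \<forall>\<beta>. bilinear_map A B C \<beta> \<longrightarrow> ?L \<beta> p = \<zero>\<^bsub>C\<^esub>}"
  note Mdef [simp del] = monoid_alg_simps
  have L: "?L \<beta> (p \<oplus>\<^bsub>M\<^esub> r) = ?L \<beta> p \<oplus>\<^bsub>C\<^esub> ?L \<beta> r" "?L \<beta> (c \<odot>\<^bsub>M\<^esub> p) = c \<odot>\<^bsub>C\<^esub> ?L \<beta> p"
      "?L \<beta> p \<in> carrier C" "?L \<beta> \<zero>\<^bsub>M\<^esub> = \<zero>\<^bsub>C\<^esub>" "?L \<beta> (p \<ominus>\<^bsub>M\<^esub> r) = ?L \<beta> p \<ominus>\<^bsub>C\<^esub> ?L \<beta> r"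
      "?L \<beta> (\<ominus>\<^bsub>M\<^esub> p) = \<ominus>\<^bsub>C\<^esub> ?L \<beta> p"
    if "bilinear_map A B C \<beta>" "p \<in> carrier M" "r \<in> carrier M" for \<beta> p r c
  proof -
    note h = bilinear_map_lin_ext(1)[OF that(1)]
    show "?L \<beta> (p \<oplus>\<^bsub>M\<^esub> r) = ?L \<beta> p \<oplus>\<^bsub>C\<^esub> ?L \<beta> r" by (rule klin_add[OF h that(2,3)])
    show "?L \<beta> (c \<odot>\<^bsub>M\<^esub> p) = c \<odot>\<^bsub>C\<^esub> ?L \<beta> p" by (rule klin_smult[OF h that(2)])
    show "?L \<beta> p \<in> carrier C" by (rule klin_closed[OF h that(2)])
    show "?L \<beta> \<zero>\<^bsub>M\<^esub> = \<zero>\<^bsub>C\<^esub>" by (rule klin_zero[OF h kalg_M C])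
    show "?L \<beta> (p \<ominus>\<^bsub>M\<^esub> r) = ?L \<beta> p \<ominus>\<^bsub>C\<^esub> ?L \<beta> r" by (rule klin_minus[OF h kalg_M C that(2,3)])
    show "?L \<beta> (\<ominus>\<^bsub>M\<^esub> p) = \<ominus>\<^bsub>C\<^esub> ?L \<beta> p" by (rule klin_a_inv[OF h kalg_M C that(2)])
  qed
  have mult_l: "r \<otimes>\<^bsub>M\<^esub> p \<in> J" and mult_r: "p \<otimes>\<^bsub>M\<^esub> r \<in> J" if p: "p \<in> J" and r: "r \<in> carrier M" for p r
  proof -
    have pc: "p \<in> carrier M" using p by (simp add: J_def)
    have "r \<otimes>\<^bsub>M\<^esub> p \<in> J \<and> p \<otimes>\<^bsub>M\<^esub> r \<in> J"
    proof -
      have "Poly_Mapping.keys r \<subseteq> carrier (A \<times>\<times> B)" using r by (simp add: monoid_alg_simps)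
      then show ?thesis
      proof (induction r rule: poly_mapping_induct_on)
        case zero
        have "(0 :: 'a \<times> 'b \<Rightarrow>\<^sub>0 'k) = \<zero>\<^bsub>M\<^esub>" by (simp add: monoid_alg_simps)
        then show ?case using pc L(4) by (simp add: J_def) (simp add: monoid_alg_simps)
      next
        case (add u c r)
        obtain a b where u: "u = (a, b)" "a \<in> carrier A" "b \<in> carrier B" using add by auto
        let ?s = "Poly_Mapping.single (a, b) c"
        have rc: "r \<in> carrier M" "?s \<in> carrier M"
          using add u by (simp_all add: monoid_alg_simps)
        have "?L \<beta> (?s \<otimes>\<^bsub>M\<^esub> p) = \<zero>\<^bsub>C\<^esub>" "?L \<beta> (p \<otimes>\<^bsub>M\<^esub> ?s) = \<zero>\<^bsub>C\<^esub>" if \<beta>: "bilinear_map A B C \<beta>" for \<beta>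
        proof -
          \<comment> \<open>Multiplication by the monomial \<open>?s\<close>, from the left and from
            the right, is absorbed into new bilinear maps; an element \<open>p\<close> of
            \<open>J\<close> is killed by these as well.\<close>
          let ?b1 = "\<lambda>x y. c \<odot>\<^bsub>C\<^esub> \<beta> (a \<otimes>\<^bsub>A\<^esub> x) (b \<otimes>\<^bsub>B\<^esub> y)" and ?b2 = "\<lambda>x y. c \<odot>\<^bsub>C\<^esub> \<beta> (x \<otimes>\<^bsub>A\<^esub> a) (y \<otimes>\<^bsub>B\<^esub> b)"
          have \<beta>': "\<And>x y y'. x \<in> carrier A \<Longrightarrow> y \<in> carrier B \<Longrightarrow> y' \<in> carrier B \<Longrightarrow> \<beta> x (y \<oplus>\<^bsub>B\<^esub> y') = \<beta> x y \<oplus>\<^bsub>C\<^esub> \<beta> x y'"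
            "\<And>x x' y. x \<in> carrier A \<Longrightarrow> x' \<in> carrier A \<Longrightarrow> y \<in> carrier B \<Longrightarrow> \<beta> (x \<oplus>\<^bsub>A\<^esub> x') y = \<beta> x y \<oplus>\<^bsub>C\<^esub> \<beta> x' y"
            "\<And>d x y. x \<in> carrier A \<Longrightarrow> y \<in> carrier B \<Longrightarrow> \<beta> x (d \<odot>\<^bsub>B\<^esub> y) = d \<odot>\<^bsub>C\<^esub> \<beta> x y"
            "\<And>d x y. x \<in> carrier A \<Longrightarrow> y \<in> carrier B \<Longrightarrow> \<beta> (d \<odot>\<^bsub>A\<^esub> x) y = d \<odot>\<^bsub>C\<^esub> \<beta> x y"
            using \<beta> by (auto simp: bilinear_map_def klin_def)
          have 1: "bilinear_map A B C ?b1" "bilinear_map A B C ?b2"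
            unfolding bilinear_map_def using u \<beta>' bilinear_map_lin_ext(2)[OF \<beta>]
            by (auto intro!: klinI simp: A.r_distr A.l_distr B.r_distr B.l_distr C.smult_r_distr mult.commute)
          have "?L \<beta> (?s \<otimes>\<^bsub>M\<^esub> p) = ?L ?b1 p"
          proof (rule klin_eq_on_monoid_alg[where f = "\<lambda>p. ?L \<beta> (?s \<otimes>\<^bsub>M\<^esub> p)" and g = "?L ?b1", OF _ _ C _ _ pc])
            show "(\<lambda>p. ?L \<beta> (?s \<otimes>\<^bsub>M\<^esub> p)) \<in> klin M C"
              using L \<beta> rc by (intro klinI) (simp_all add: M.r_distr)
            show "?L ?b1 \<in> klin M C" using 1 bilinear_map_lin_ext(1) by auto
          qed (use monoid_DirProd[OF A.kalg_axioms B.kalg_axioms] u bilinear_map_lin_ext(2)[OF \<beta>] in auto)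
          then show "?L \<beta> (?s \<otimes>\<^bsub>M\<^esub> p) = \<zero>\<^bsub>C\<^esub>" using p 1 by (simp add: J_def)
          have "?L \<beta> (p \<otimes>\<^bsub>M\<^esub> ?s) = ?L ?b2 p"
          proof (rule klin_eq_on_monoid_alg[where f = "\<lambda>p. ?L \<beta> (p \<otimes>\<^bsub>M\<^esub> ?s)" and g = "?L ?b2", OF _ _ C _ _ pc])
            show "(\<lambda>p. ?L \<beta> (p \<otimes>\<^bsub>M\<^esub> ?s)) \<in> klin M C"
              using L \<beta> rc by (intro klinI) (simp_all add: M.l_distr)
            show "?L ?b2 \<in> klin M C" using 1 bilinear_map_lin_ext(1) by auto
          qed (use monoid_DirProd[OF A.kalg_axioms B.kalg_axioms] u bilinear_map_lin_ext(2)[OF \<beta>] in auto)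
          then show "?L \<beta> (p \<otimes>\<^bsub>M\<^esub> ?s) = \<zero>\<^bsub>C\<^esub>" using p 1 by (simp add: J_def)
        qed
        moreover have "Poly_Mapping.single u c + r = ?s \<oplus>\<^bsub>M\<^esub> r" by (simp add: u monoid_alg_simps)
        ultimately show ?case using add rc pc L by (auto simp: J_def M.l_distr M.r_distr)
      qed
    qed
    then show "r \<otimes>\<^bsub>M\<^esub> p \<in> J" "p \<otimes>\<^bsub>M\<^esub> r \<in> J" by auto
  qed
  have "ideal J M"
  proof (rule idealI)
    have "\<zero>\<^bsub>M\<^esub> \<in> J" using L(4) by (auto simp: J_def)
    then show "subgroup J (add_monoid M)"
      by (intro M.add.subgroupI) (use L in \<open>auto simp: J_def a_inv_def[symmetric]\<close>)
  qed (use M.ring_axioms mult_l mult_r in auto)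
  moreover have "bilin_rels A B \<subseteq> J"
  proof
    fix p assume p: "p \<in> bilin_rels A B"
    then have pc: "p \<in> carrier M" using bilin_rels_subset by auto
    have "?L \<beta> p = \<zero>\<^bsub>C\<^esub>" if \<beta>: "bilinear_map A B C \<beta>" for \<beta>
    proof -
      have s: "Poly_Mapping.single (x, y) c \<in> carrier M" if "x \<in> carrier A" "y \<in> carrier B" for x y c
        using that by (simp add: monoid_alg_simps)
      have m: "?L \<beta> (p - r) = ?L \<beta> p \<ominus>\<^bsub>C\<^esub> ?L \<beta> r" "p - r \<in> carrier M" if "p \<in> carrier M" "r \<in> carrier M" for p r
        using L(5)[OF \<beta> that] that M_minus[OF that] M.minus_closed[OF that] by simp_all
      have \<beta>': "\<And>x y y'. x \<in> carrier A \<Longrightarrow> y \<in> carrier B \<Longrightarrow> y' \<in> carrier B \<Longrightarrow> \<beta> x (y \<oplus>\<^bsub>B\<^esub> y') = \<beta> x y \<oplus>\<^bsub>C\<^esub> \<beta> x y'"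
            "\<And>x x' y. x \<in> carrier A \<Longrightarrow> x' \<in> carrier A \<Longrightarrow> y \<in> carrier B \<Longrightarrow> \<beta> (x \<oplus>\<^bsub>A\<^esub> x') y = \<beta> x y \<oplus>\<^bsub>C\<^esub> \<beta> x' y"
            "\<And>d x y. x \<in> carrier A \<Longrightarrow> y \<in> carrier B \<Longrightarrow> \<beta> x (d \<odot>\<^bsub>B\<^esub> y) = d \<odot>\<^bsub>C\<^esub> \<beta> x y"
            "\<And>d x y. x \<in> carrier A \<Longrightarrow> y \<in> carrier B \<Longrightarrow> \<beta> (d \<odot>\<^bsub>A\<^esub> x) y = d \<odot>\<^bsub>C\<^esub> \<beta> x y"
            using \<beta> by (auto simp: bilinear_map_def klin_def)
      have r: "(x \<oplus>\<^bsub>C\<^esub> y) \<ominus>\<^bsub>C\<^esub> x \<ominus>\<^bsub>C\<^esub> y = \<zero>\<^bsub>C\<^esub>" "x \<ominus>\<^bsub>C\<^esub> x = \<zero>\<^bsub>C\<^esub>" if "x \<in> carrier C" "y \<in> carrier C" for x y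
      proof -
        have "(x \<oplus>\<^bsub>C\<^esub> y) \<oplus>\<^bsub>C\<^esub> (\<ominus>\<^bsub>C\<^esub> x \<oplus>\<^bsub>C\<^esub> \<ominus>\<^bsub>C\<^esub> y) = \<zero>\<^bsub>C\<^esub>"
          using C.r_neg[of "x \<oplus>\<^bsub>C\<^esub> y"] C.minus_add[of x y] that by simp
        then show "(x \<oplus>\<^bsub>C\<^esub> y) \<ominus>\<^bsub>C\<^esub> x \<ominus>\<^bsub>C\<^esub> y = \<zero>\<^bsub>C\<^esub>" using that by (simp add: a_minus_def C.a_assoc)
        show "x \<ominus>\<^bsub>C\<^esub> x = \<zero>\<^bsub>C\<^esub>" using that by (simp add: C.minus_eq_zero_iff)
      qed
      show ?thesis
        using p unfolding bilin_rels_def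
        by (auto simp: s m \<beta>' r(1) C.minus_eq_zero_iff bilinear_map_lin_ext(2)[OF \<beta>])
    qed
    then show "p \<in> J" using pc by (simp add: J_def)
  qed
  ultimately have "tensor_ideal A B \<subseteq> J"
    unfolding tensor_ideal_def by (rule M.genideal_minimal)
  then show ?thesis using assms by (auto simp: J_def)
qed

lemma
  assumes "bilinear_map A B C \<beta>"
  shows tensor_lin_klin: "tensor_lin A B C \<beta> \<in> klin T C"
    and tensor_lin_pure: "x \<in> carrier A \<Longrightarrow> y \<in> carrier B \<Longrightarrow> tensor_lin A B C \<beta> (t x y) = \<beta> x y"
proof -
  show "tensor_lin A B C \<beta> \<in> klin T C"
    unfolding tensor_lin_def tensor_alg_def
    by (rule M.descend_klin[OF ideal_tensor bilinear_map_lin_ext(1)[OF assms] C bilinear_map_vanish[OF assms]])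
  assume xy: "x \<in> carrier A" "y \<in> carrier B"
  then have "Poly_Mapping.single (x, y) 1 \<in> carrier M" by simp
  from M.descend_eq[OF ideal_tensor bilinear_map_lin_ext(1)[OF assms] C bilinear_map_vanish[OF assms] this]
  have "tensor_lin A B C \<beta> (t x y) = lin_ext C (\<lambda>(x, y). \<beta> x y) (Poly_Mapping.single (x, y) 1)"
    unfolding tensor_lin_def tensor_alg_def pure_tensor_def .
  then show "tensor_lin A B C \<beta> (t x y) = \<beta> x y"
    using xy bilinear_map_lin_ext(2)[OF assms] by simp
qed

end

end

text \<open>Multiplicativity is bilinear in the two factors, and pure tensors span, so each factor
  in turn is reduced to a pure tensor.\<close>

lemma
  assumes "kalg A" "kalg B" "f \<in> alg_hom A B" "g \<in> alg_hom A B"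
  shows tensor_map_alg_hom: "tensor_map A B f g \<in> alg_hom (tensor_alg A A) (tensor_alg B B)"
    and tensor_map_pure: "x \<in> carrier A \<Longrightarrow> y \<in> carrier A \<Longrightarrow>
      tensor_map A B f g (pure_tensor A A x y) = pure_tensor B B (f x) (g y)"
proof -
  interpret A: tensor A A by (simp add: tensor_def assms)
  interpret B: tensor B B by (simp add: tensor_def assms)
  have fg [simp]: "x \<in> carrier A \<Longrightarrow> f x \<in> carrier B" "x \<in> carrier A \<Longrightarrow> g x \<in> carrier B" for x
    by (fact alg_hom_closed[OF assms(3)] alg_hom_closed[OF assms(4)])+
  have eq: "tensor_map A B f g = tensor_lin A A (tensor_alg B B) (\<lambda>x y. pure_tensor B B (f x) (g y))"
    by (simp add: tensor_map_def tensor_lin_def)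
  have "bilinear_map A A (tensor_alg B B) (\<lambda>x y. pure_tensor B B (f x) (g y))"
    unfolding bilinear_map_def
    using klin_comp[of f A B "\<lambda>x. B.t x _" B.T, OF _ B.pure_klin_l[OF fg(2)]]
      klin_comp[of g A B, OF _ B.pure_klin_r[OF fg(1)]] assms(3,4) alg_hom_klin[of A B]
    by blast
  note lin = A.tensor_lin_klin[OF B.kalg_T this, folded eq] A.tensor_lin_pure[OF B.kalg_T this, folded eq]
  then show pure: "x \<in> carrier A \<Longrightarrow> y \<in> carrier A \<Longrightarrow>
      tensor_map A B f g (pure_tensor A A x y) = pure_tensor B B (f x) (g y)" for x y by simp
  let ?h = "tensor_map A B f g"
  note h = klin_closed[OF lin(1)] klin_add[OF lin(1)] klin_smult[OF lin(1)]
  have 1: "?h (A.t x y \<otimes>\<^bsub>A.T\<^esub> Y) = ?h (A.t x y) \<otimes>\<^bsub>B.T\<^esub> ?h Y"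
    if "x \<in> carrier A" "y \<in> carrier A" "Y \<in> carrier A.T" for x y Y
  proof (rule A.klin_eq_on_T[where f = "\<lambda>Y. ?h (A.t x y \<otimes>\<^bsub>A.T\<^esub> Y)" and g = "\<lambda>Y. ?h (A.t x y) \<otimes>\<^bsub>B.T\<^esub> ?h Y", OF _ _ B.kalg_T _ that(3)])
  qed (use that h in \<open>auto intro!: klinI simp: A.T.r_distr B.T.r_distr pure alg_hom_mult[OF assms(3)] alg_hom_mult[OF assms(4)]\<close>)
  have "?h (X \<otimes>\<^bsub>A.T\<^esub> Y) = ?h X \<otimes>\<^bsub>B.T\<^esub> ?h Y" if "X \<in> carrier A.T" "Y \<in> carrier A.T" for X Y
  proof (rule A.klin_eq_on_T[where f = "\<lambda>X. ?h (X \<otimes>\<^bsub>A.T\<^esub> Y)" and g = "\<lambda>X. ?h X \<otimes>\<^bsub>B.T\<^esub> ?h Y", OF _ _ B.kalg_T _ that(1)])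
  qed (use that h 1 in \<open>auto intro!: klinI simp: A.T.l_distr B.T.l_distr\<close>)
  then show "?h \<in> alg_hom A.T B.T"
    using lin by (auto simp: alg_hom_iff A.pure_one B.pure_one alg_hom_one[OF assms(3)] alg_hom_one[OF assms(4)])
qed

section \<open>Quantum binomial coefficients and iterated q-commutators\<close>

context
  fixes v :: "'k::field"
  assumes v0: "v \<noteq> 0" and v_nonroot: "\<And>m. m > 0 \<Longrightarrow> v ^ m \<noteq> 1"
begin

lemma v_neq_inverse: "v - inverse v \<noteq> 0"
proof
  assume "v - inverse v = 0"
  then have "v = inverse v" by simp
  then have "v ^ 2 = 1" using v0 by (metis power2_eq_square right_inverse)
  then show False using v_nonroot[of 2] by simp
qed

lemma q_int_nonzero: assumes "r > 0" shows "q_int v r \<noteq> 0"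
proof -
  have "v ^ r \<noteq> inverse v ^ r"
  proof
    assume "v ^ r = inverse v ^ r"
    moreover have "v ^ r * inverse v ^ r = 1" using v0 by (simp add: power_mult_distrib[symmetric])
    ultimately have "v ^ r * v ^ r = 1" by metis
    then have "v ^ (r + r) = 1" by (simp add: power_add)
    then show False using v_nonroot[of "r + r"] assms by simp
  qed
  then show ?thesis using v_neq_inverse by (simp add: q_int_def)
qed

lemma q_fact_nonzero: "q_fact v m \<noteq> 0"
  unfolding q_fact_def using q_int_nonzero by (simp add: prod_zero_iff)

lemma q_fact_Suc: "q_fact v (Suc m) = q_fact v m * q_int v (Suc m)"
  by (simp add: q_fact_def)

lemma q_binom_0 [simp]: "q_binom v m 0 = 1" "q_binom v m m = 1"
  using q_fact_nonzero by (simp_all add: q_binom_def q_fact_def)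

lemma q_int_add: "q_int v (s + n) = v ^ s * q_int v n + inverse v ^ n * q_int v s"
proof -
  have "v ^ (s + n) - inverse v ^ (s + n)
      = v ^ s * (v ^ n - inverse v ^ n) + inverse v ^ n * (v ^ s - inverse v ^ s)"
    by (simp add: power_add algebra_simps)
  then show ?thesis by (simp add: q_int_def add_divide_distrib)
qed

text \<open>With \<open>m = Suc (s + n)\<close> this is \<open>q_int_add\<close> for
  \<open>Suc m = Suc s + Suc n\<close>, divided by common q-factorials.\<close>

lemma q_pascal:
  assumes "s < m"
  shows "q_binom v (Suc m) (Suc s) = v ^ Suc s * q_binom v m (Suc s) + inverse v ^ (m - s) * q_binom v m s"
proof -
  obtain n where m: "m = Suc (s + n)" using assms less_iff_Suc_add by auto
  have nz: "q_fact v r \<noteq> 0" "q_int v (Suc r) \<noteq> 0" for r using q_fact_nonzero q_int_nonzero by auto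
  have "q_int v (Suc m) = v ^ Suc s * q_int v (Suc n) + inverse v ^ Suc n * q_int v (Suc s)"
    using q_int_add[of "Suc s" "Suc n"] m by simp
  moreover have "q_binom v (Suc m) (Suc s) = q_fact v m * q_int v (Suc m) / (q_fact v s * q_int v (Suc s) * (q_fact v n * q_int v (Suc n)))"
    "q_binom v m (Suc s) = q_fact v m / (q_fact v s * q_int v (Suc s) * q_fact v n)"
    "q_binom v m s = q_fact v m / (q_fact v s * (q_fact v n * q_int v (Suc n)))"
    by (simp_all add: q_binom_def m q_fact_Suc)
  moreover have "X * (a * y + b * z) / (f * z * (g * y)) = a * (X / (f * z * g)) + b * (X / (f * (g * y)))"
    if "f \<noteq> 0" "g \<noteq> 0" "y \<noteq> 0" "z \<noteq> 0" for X a b f g y z :: 'k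
    using that by (simp add: field_simps)
  moreover have "m - s = Suc n" using m by simp
  ultimately show ?thesis using nz by (simp del: power_Suc)
qed

end

lemma q_int_inverse: "q_int (inverse v) m = q_int (v::'k::field) m"
proof -
  have "(inverse v ^ m - v ^ m) / (inverse v - v) = (- (v ^ m - inverse v ^ m)) / (- (v - inverse v))" by simp
  also have "\<dots> = (v ^ m - inverse v ^ m) / (v - inverse v)" by (rule minus_divide_divide)
  finally show ?thesis by (simp add: q_int_def)
qed

lemma q_binom_inverse: "q_binom (inverse v) m s = q_binom (v::'k::field) m s"
  by (simp add: q_binom_def q_fact_def q_int_inverse)

text \<open>With left and right multiplication by \<open>x\<close> written \<open>L\<close> and
  \<open>R\<close>, this is the product of the factors \<open>L - c t R\<close> for
  \<open>t < n\<close>, applied to \<open>y\<close>.\<close>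

primrec qcomm :: "('k::field, 'a) module \<Rightarrow> (nat \<Rightarrow> 'k) \<Rightarrow> 'a \<Rightarrow> 'a \<Rightarrow> nat \<Rightarrow> 'a" where
  "qcomm A c x y 0 = y"
| "qcomm A c x y (Suc n) = x \<otimes>\<^bsub>A\<^esub> qcomm A c x y n \<oplus>\<^bsub>A\<^esub> (- c n) \<odot>\<^bsub>A\<^esub> (qcomm A c x y n \<otimes>\<^bsub>A\<^esub> x)"

text \<open>The exponents \<open>m - 1, m - 3, ..., 1 - m\<close> are symmetric about zero. They are
  the roots at which the polynomial with coefficients \<open>(-1) ^ s * q_binom v m s\<close>
  factorises.\<close>

definition serre_coeff :: "'k::field \<Rightarrow> nat \<Rightarrow> nat \<Rightarrow> 'k" where
  "serre_coeff v m t = v powi (int m - 1 - 2 * int t)"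

lemma serre_coeff_inverse: "serre_coeff (inverse v) m t = inverse (serre_coeff v m t)"
  by (simp add: serre_coeff_def power_int_inverse)

lemma serre_coeff_Suc: "v \<noteq> 0 \<Longrightarrow> serre_coeff v m (Suc t) = serre_coeff v m t * v powi (-2)"
  by (simp add: serre_coeff_def power_int_add[symmetric] algebra_simps)

definition serre_elem :: "'k::field \<Rightarrow> nat \<Rightarrow> 'g \<Rightarrow> 'g \<Rightarrow> ('g list \<Rightarrow>\<^sub>0 'k)" where
  "serre_elem v m x y = (\<Sum>s=0..m. mono ((-1) ^ s * q_binom v m s) (replicate (m - s) x @ [y] @ replicate s x))"

lemma free_alg_mult_sum_l:
  "mono b u \<otimes>\<^bsub>free_alg\<^esub> (\<Sum>s\<in>S. mono (f s) (w s)) = (\<Sum>s\<in>S. mono (b * f s) (u @ w s))" (is ?l)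
  and free_alg_mult_sum_r:
  "(\<Sum>s\<in>S. mono (f s) (w s)) \<otimes>\<^bsub>free_alg\<^esub> mono b u = (\<Sum>s\<in>S. mono (f s * b) (w s @ u))" (is ?r)
  for b :: "'k::field"
proof -
  have s: "mono b u \<otimes>\<^bsub>free_alg\<^esub> mono b' u' = mono (b * b') (u @ u')" for b b' :: 'k and u u' :: "'b list"
    by simp
  show ?l by (induction S rule: infinite_finite_induct)
      (simp_all add: free_alg_def monoid_alg_mult_add_r)
  show ?r by (induction S rule: infinite_finite_induct)
      (simp_all add: free_alg_def monoid_alg_mult_add_l)
qed

lemma scale_sum: "Poly_Mapping.map ((*) (c::'k::field)) (\<Sum>s\<in>S. f s) = (\<Sum>s\<in>S. Poly_Mapping.map ((*) c) (f s))"
  by (induction S rule: infinite_finite_induct) (simp_all add: scale_add)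

text \<open>The q-binomial theorem: the factors \<open>L - c t R\<close>, with \<open>L\<close> and \<open>R\<close> left and right multiplication
  by \<open>x\<close>, multiply out to the Serre expression.\<close>

lemma serre_elem_eq_qcomm:
  fixes v :: "'k::field"
  assumes v0: "v \<noteq> 0" and nr: "\<And>m. m > 0 \<Longrightarrow> v ^ m \<noteq> 1"
  shows "serre_elem v m x y = qcomm free_alg (serre_coeff v m) (mono 1 [x]) (mono 1 [y]) m"
proof -
  \<comment> \<open>After \<open>n\<close> of the \<open>m\<close> factors the partial product is a
    q-binomial expansion in the variable \<open>v powi (int m - int n)\<close>; at
    \<open>n = m\<close> the variable is \<open>1\<close>, which leaves the Serre
    expression.\<close>
  define b where "b n = v powi (int m - int n)" for n
  have b_Suc: "b n = v * b (Suc n)" for n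
    using v0 power_int_add[of v 1 "int m - int (Suc n)"] by (simp add: b_def)
  have key: "qcomm free_alg (serre_coeff v m) (mono 1 [x]) (mono 1 [y]) n =
      (\<Sum>s\<le>n. mono ((-1) ^ s * q_binom v n s * b n ^ s) (replicate (n - s) x @ [y] @ replicate s x))" for n
  proof (induction n)
    case 0
    show ?case using q_binom_0[OF v0 nr] by simp
  next
    case (Suc n)
    let ?S = "qcomm free_alg (serre_coeff v m) (mono 1 [x]) (mono 1 [y])"
    let ?w = "\<lambda>s. replicate (Suc n - s) x @ [y] @ replicate s x"
    let ?f = "\<lambda>s. (-1) ^ s * q_binom v n s * b n ^ s"
    let ?g = "\<lambda>s. (-1) ^ s * q_binom v (Suc n) s * b (Suc n) ^ s"
    let ?c = "serre_coeff v m n"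
    \<comment> \<open>The next coefficient in terms of the new variable; the factor
      \<open>inverse v ^ n\<close> is what the q-Pascal rule needs to merge neighbouring
      terms.\<close>
    have c: "?c = b (Suc n) * inverse v ^ n"
      using v0 power_int_add[of v "int m - int (Suc n)" "- int n"]
      by (simp add: b_def serre_coeff_def power_int_minus power_inverse)
    have "?S (Suc n) = (\<Sum>s\<le>n. mono (?f s) (?w s)) + (\<Sum>s\<le>n. mono (- ?c * ?f s) (?w (Suc s)))"
      by (simp add: Suc.IH free_alg_mult_sum_l free_alg_mult_sum_r scale_sum replicate_append_same
          Suc_diff_le replicate_app_Cons_same)
    also have "\<dots> = mono (?f 0) (?w 0) + (\<Sum>s<n. mono (?f (Suc s)) (?w (Suc s)))
        + ((\<Sum>s<n. mono (- ?c * ?f s) (?w (Suc s))) + mono (- ?c * ?f n) (?w (Suc n)))"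
      unfolding lessThan_Suc_atMost[symmetric] sum.lessThan_Suc_shift[where g = "\<lambda>s. mono (?f s) (?w s)"] by simp
    also have "\<dots> = mono (?f 0) (?w 0) + (\<Sum>s<n. mono (?f (Suc s) + - ?c * ?f s) (?w (Suc s))) + mono (- ?c * ?f n) (?w (Suc n))"
      by (simp only: single_add sum.distrib add.assoc)
    also have "(\<Sum>s<n. mono (?f (Suc s) + - ?c * ?f s) (?w (Suc s))) = (\<Sum>s<n. mono (?g (Suc s)) (?w (Suc s)))"
    proof (rule sum.cong)
      fix s assume "s \<in> {..<n}"
      then have s: "s < n" by simp
      have "inverse v ^ n * v ^ s = inverse v ^ (n - s)"
      proof -
        have "inverse v ^ n = inverse v ^ (n - s) * inverse v ^ s"
          using s by (simp add: power_add[symmetric])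
        then show ?thesis using v0 by (simp add: power_mult_distrib[symmetric] mult.assoc)
      qed
      then have "?c * ?f s = (-1) ^ s * inverse v ^ (n - s) * q_binom v n s * b (Suc n) ^ Suc s"
        by (simp add: c b_Suc[of n] power_mult_distrib mult_ac)
      moreover have "?f (Suc s) = - ((-1) ^ s * v ^ Suc s * q_binom v n (Suc s) * b (Suc n) ^ Suc s)"
        by (simp add: b_Suc[of n] power_mult_distrib mult_ac del: power_Suc) simp
      ultimately have "?f (Suc s) + - ?c * ?f s = ?g (Suc s)"
        by (simp add: q_pascal[OF v0 nr s] algebra_simps del: power_Suc) (simp add: algebra_simps)
      then show "mono (?f (Suc s) + - ?c * ?f s) (?w (Suc s)) = mono (?g (Suc s)) (?w (Suc s))" by simp
    qed simp
    also have "- ?c * ?f n = ?g (Suc n)"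
    proof -
      have "?c * b n ^ n = b (Suc n) ^ Suc n"
        using v0 by (simp add: c b_Suc[of n] power_mult_distrib mult_ac power_inverse)
      then show ?thesis using q_binom_0[OF v0 nr] by (simp add: mult_ac)
    qed
    also have "?f 0 = ?g 0" using q_binom_0[OF v0 nr] by simp
    also have "mono (?g 0) (?w 0) + (\<Sum>s<n. mono (?g (Suc s)) (?w (Suc s))) + mono (?g (Suc n)) (?w (Suc n))
        = (\<Sum>s\<le>Suc n. mono (?g s) (?w s))"
      unfolding lessThan_Suc_atMost[symmetric] sum.lessThan_Suc_shift[where g = "\<lambda>s. mono (?g s) (?w s)"]
      by (simp add: add.assoc)
    finally show ?case .
  qed
  have "b m = 1" by (simp add: b_def)
  then show ?thesis unfolding key serre_elem_def by (simp add: atMost_atLeast0)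
qed

lemma alg_hom_qcomm:
  assumes "h \<in> alg_hom A B" "kalg A" "kalg B" "x \<in> carrier A" "y \<in> carrier A"
  shows "qcomm A c x y n \<in> carrier A" "h (qcomm A c x y n) = qcomm B c (h x) (h y) n"
proof -
  interpret A: kalg A by fact
  show closed: "qcomm A c x y n \<in> carrier A" for n using assms by (induction n) simp_all
  show "h (qcomm A c x y n) = qcomm B c (h x) (h y) n"
    by (induction n)
      (simp_all add: alg_hom_mult[OF assms(1)] alg_hom_add[OF assms(1)] alg_hom_smult[OF assms(1)] closed assms(4,5))
qed

context kalg begin

lemma qcomm_closed [simp]: "x \<in> carrier A \<Longrightarrow> y \<in> carrier A \<Longrightarrow> qcomm A c x y n \<in> carrier A"
  by (induction n) simp_all

lemma swap_assoc:
  "\<lbrakk>x \<otimes> y = k \<odot> (y \<otimes> x); x \<in> carrier A; y \<in> carrier A; z \<in> carrier A\<rbrakk> \<Longrightarrow> x \<otimes> (y \<otimes> z) = k \<odot> (y \<otimes> (x \<otimes> z))"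
  by (metis m_assoc m_closed mult_smult_l)

lemma smult_cancel [simp]: "x \<in> carrier A \<Longrightarrow> c \<odot> x \<oplus> (- c) \<odot> x = \<zero>" "x \<in> carrier A \<Longrightarrow> (- c) \<odot> x \<oplus> c \<odot> x = \<zero>"
  by (simp_all add: smult_l_distr[symmetric])

text \<open>\<open>serre_coeff v m (m - 1 - t)\<close> is inverse to \<open>serre_coeff v m t\<close> and the factors commute, so
  the factors may be taken in the opposite order.\<close>

lemma qcomm_serre_inverse:
  fixes v :: 'k
  assumes v0: "v \<noteq> 0" and nr: "\<And>m. m > 0 \<Longrightarrow> v ^ m \<noteq> 1" and "x \<in> carrier A" "y \<in> carrier A"
  shows "qcomm A (serre_coeff (inverse v) m) x y m = qcomm A (serre_coeff v m) x y m"
proof -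
  \<comment> \<open>The identity is universal in \<open>x\<close> and \<open>y\<close>. It holds in
    the free algebra on two letters, where the Serre expression depends on \<open>v\<close> only
    through q-binomials, and these are invariant under inversion of \<open>v\<close>.\<close>
  define f where "f b = (if b then x else y)" for b
  let ?h = "lin_ext A (word_prod A f)"
  have h: "?h \<in> alg_hom free_alg A"
    by (rule word_prod_alg_hom[OF kalg_axioms]) (simp add: f_def assms)
  have hx: "?h (mono 1 [True]) = x" "?h (mono 1 [False]) = y" using assms by (simp_all add: f_def)
  have nr': "inverse v ^ m \<noteq> 1" if "m > 0" for m
    using nr[OF that] by (simp add: power_inverse)
  have "?h (serre_elem u m True False) = qcomm A (serre_coeff u m) x y m" if "u = v \<or> u = inverse v" for u
  proof -
    have u: "u \<noteq> 0" "\<And>m. m > 0 \<Longrightarrow> u ^ m \<noteq> 1" using that v0 nr nr' by auto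
    show ?thesis
      using alg_hom_qcomm(2)[OF h kalg_free_alg kalg_axioms, of "mono 1 [True]" "mono 1 [False]"] hx
      by (simp add: serre_elem_eq_qcomm[OF u])
  qed
  moreover have "serre_elem (inverse v) m True False = serre_elem v m True False"
    by (simp add: serre_elem_def q_binom_inverse)
  ultimately show ?thesis by metis
qed

lemma qcomm_add_right:
  assumes "x \<in> carrier A" "y \<in> carrier A" "z \<in> carrier A"
  shows "qcomm A c x (y \<oplus> z) n = qcomm A c x y n \<oplus> qcomm A c x z n"
  by (induction n) (use assms in \<open>simp_all add: l_distr r_distr smult_r_distr a_ac\<close>)

text \<open>The summand \<open>y\<close> drops out: it moves past the \<open>n\<close>-th iterated
  commutator \<open>S\<close> with exactly the scalar \<open>c n\<close>, so its contribution
  \<open>y S - c n S y\<close> is zero at each stage. The recursion for \<open>c\<close> keeps this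
  in step.\<close>

lemma qcomm_add_left:
  assumes car: "x \<in> carrier A" "y \<in> carrier A" "z \<in> carrier A"
    and yx: "y \<otimes> x = w \<odot> (x \<otimes> y)" and yz: "y \<otimes> z = c 0 \<odot> (z \<otimes> y)" and c: "\<And>t. c (Suc t) = c t * w"
  shows "qcomm A c (x \<oplus> y) z n = qcomm A c x z n"
proof -
  let ?S = "qcomm A c x z"
  have 1: "y \<otimes> ?S n = c n \<odot> (?S n \<otimes> y)" for n
  proof (induction n)
    case 0 show ?case using yz by simp
  next
    case (Suc n)
    have "y \<otimes> (x \<otimes> ?S n) = (c n * w) \<odot> (x \<otimes> (?S n \<otimes> y))"
      using swap_assoc[OF yx] Suc car by (simp add: mult.commute)
    moreover have "y \<otimes> (?S n \<otimes> x) = (c n * w) \<odot> (?S n \<otimes> (x \<otimes> y))"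
      using swap_assoc[OF Suc] yx car by simp
    ultimately show ?case using car by (simp add: l_distr r_distr smult_r_distr c m_assoc mult_ac)
  qed
  show ?thesis
  proof (induction n)
    case (Suc n)
    have "qcomm A c (x \<oplus> y) z (Suc n) = (x \<otimes> ?S n \<oplus> (- c n) \<odot> (?S n \<otimes> x)) \<oplus> (c n \<odot> (?S n \<otimes> y) \<oplus> (- c n) \<odot> (?S n \<otimes> y))"
      using car by (simp add: Suc l_distr r_distr smult_r_distr 1 a_ac del: smult_cancel)
    then show ?case using car by simp
  qed simp
qed

text \<open>In the opposite algebra \<open>L\<close> and \<open>R\<close> change places, and
  \<open>R - c L\<close> is \<open>- c\<close> times \<open>L - inverse c R\<close>.\<close>

lemma qcomm_opp:
  assumes "x \<in> carrier A" "y \<in> carrier A" "\<And>t. c t \<noteq> 0"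
  shows "\<exists>k. qcomm (opp A) c x y n = k \<odot> qcomm A (\<lambda>t. inverse (c t)) x y n"
proof (induction n)
  case 0 show ?case using assms by (intro exI[of _ 1]) simp
next
  case (Suc n)
  then obtain k where k: "qcomm (opp A) c x y n = k \<odot> qcomm A (\<lambda>t. inverse (c t)) x y n" by blast
  have "qcomm (opp A) c x y (Suc n) = (- c n * k) \<odot> qcomm A (\<lambda>t. inverse (c t)) x y (Suc n)"
  proof -
    have *: "c n * k * inverse (c n) = k" using assms(3)[of n] by simp
    show ?thesis using assms(1,2) by (simp add: k * smult_r_distr a_comm)
  qed
  then show ?case by blast
qed

text \<open>The \<open>n\<close>-th power of \<open>k\<close> times \<open>l\<close>: the factors
  collected on the right in \<open>qcomm_twist\<close>, and in one tensor factor in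
  \<open>qcomm_pure_l\<close>.\<close>

primrec pow_mult :: "'a \<Rightarrow> 'a \<Rightarrow> nat \<Rightarrow> 'a" where
  "pow_mult k l 0 = l"
| "pow_mult k l (Suc n) = k \<otimes> pow_mult k l n"

lemma pow_mult_closed [simp]: "k \<in> carrier A \<Longrightarrow> l \<in> carrier A \<Longrightarrow> pow_mult k l n \<in> carrier A"
  by (induction n) simp_all

lemma pow_mult_commute: "\<lbrakk>k \<in> carrier A; l \<in> carrier A; k \<otimes> l = l \<otimes> k\<rbrakk> \<Longrightarrow> pow_mult k l n \<otimes> k = k \<otimes> pow_mult k l n"
  by (induction n) (simp_all add: m_assoc)

text \<open>The factors \<open>k\<close> and \<open>l\<close> can be pulled out on the right. The
  scalar \<beta> is the same for \<open>k\<close> past \<open>y\<close> and for \<open>l\<close>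
  past \<open>x\<close>, so both terms of each commutator acquire the same scalar and the commutator
  survives.\<close>

lemma qcomm_twist:
  assumes car: "x \<in> carrier A" "y \<in> carrier A" "k \<in> carrier A" "l \<in> carrier A"
    and kl: "k \<otimes> l = l \<otimes> k" and kx: "k \<otimes> x = \<alpha> \<odot> (x \<otimes> k)"
    and ky: "k \<otimes> y = \<beta> \<odot> (y \<otimes> k)" and lx: "l \<otimes> x = \<beta> \<odot> (x \<otimes> l)"
  shows "\<exists>\<mu>. qcomm A c (s \<odot> (x \<otimes> k)) (s' \<odot> (y \<otimes> l)) n = \<mu> \<odot> (qcomm A c x y n \<otimes> pow_mult k l n)"
proof (induction n)
  case 0 show ?case using car by auto
next
  case (Suc n)
  let ?S = "qcomm A c x y n" and ?z = "pow_mult k l n"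
  obtain \<mu> where \<mu>: "qcomm A c (s \<odot> (x \<otimes> k)) (s' \<odot> (y \<otimes> l)) n = \<mu> \<odot> (?S \<otimes> ?z)" using Suc by blast
  have kS: "k \<otimes> qcomm A c x y n = (\<alpha> ^ n * \<beta>) \<odot> (qcomm A c x y n \<otimes> k)" for n
  proof (induction n)
    case (Suc n)
    show ?case using car
      by (simp add: r_distr l_distr smult_r_distr swap_assoc[OF kx] swap_assoc[OF Suc] Suc kx m_assoc mult_ac)
  qed (simp add: ky)
  have zx: "pow_mult k l n \<otimes> x = (\<alpha> ^ n * \<beta>) \<odot> (x \<otimes> pow_mult k l n)" for n
  proof (induction n)
    case (Suc n)
    show ?case using car by (simp add: m_assoc Suc swap_assoc[OF kx] mult_ac)
  qed (simp add: lx)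
  have "(s \<odot> (x \<otimes> k)) \<otimes> (\<mu> \<odot> (?S \<otimes> ?z)) = (\<mu> * s * \<alpha> ^ n * \<beta>) \<odot> (x \<otimes> ?S \<otimes> (k \<otimes> ?z))"
    using car by (simp add: m_assoc swap_assoc[OF kS] mult_ac)
  moreover have "(\<mu> \<odot> (?S \<otimes> ?z)) \<otimes> (s \<odot> (x \<otimes> k)) = (\<mu> * s * \<alpha> ^ n * \<beta>) \<odot> (?S \<otimes> x \<otimes> (k \<otimes> ?z))"
    using car by (simp add: m_assoc swap_assoc[OF zx] pow_mult_commute kl mult_ac)
  ultimately have "qcomm A c (s \<odot> (x \<otimes> k)) (s' \<odot> (y \<otimes> l)) (Suc n) =
     (\<mu> * s * \<alpha> ^ n * \<beta>) \<odot> (qcomm A c x y (Suc n) \<otimes> pow_mult k l (Suc n))"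
    using car by (simp add: \<mu> l_distr smult_r_distr mult_ac)
  then show ?case by blast
qed

end

lemma (in tensor) qcomm_pure_l:
  assumes "x \<in> carrier A" "y \<in> carrier A" "k \<in> carrier B" "l \<in> carrier B" "k \<otimes>\<^bsub>B\<^esub> l = l \<otimes>\<^bsub>B\<^esub> k"
  shows "qcomm T c (t x k) (t y l) n = t (qcomm A c x y n) (B.pow_mult k l n)"
  by (induction n) (use assms in \<open>simp_all add: pure_add_l B.pow_mult_commute\<close>)

lemma (in tensor) qcomm_pure_r:
  assumes "x \<in> carrier B" "y \<in> carrier B" "k \<in> carrier A" "l \<in> carrier A" "k \<otimes>\<^bsub>A\<^esub> l = l \<otimes>\<^bsub>A\<^esub> k"
  shows "qcomm T c (t k x) (t l y) n = t (A.pow_mult k l n) (qcomm B c x y n)"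
  by (induction n) (use assms in \<open>simp_all add: pure_add_r A.pow_mult_commute\<close>)

section \<open>Representations of the defining relations\<close>

text \<open>The shape of a Serre expression under the coproduct, where \<open>x\<close> belongs to
  \<open>z'\<close> and \<open>y\<close> to \<open>z\<close>. Against \<open>z'\<close> the summand
  \<open>y\<close> drops out, against \<open>z\<close> the summand \<open>x\<close> does, and the
  two pure expressions vanish by assumption.\<close>

lemma (in kalg) qcomm_serre_sum:
  fixes v :: 'k
  assumes v0: "v \<noteq> 0" and nr: "\<And>m. m > 0 \<Longrightarrow> v ^ m \<noteq> 1"
    and car: "x \<in> carrier A" "y \<in> carrier A" "z \<in> carrier A" "z' \<in> carrier A"
    and xy: "x \<otimes> y = (v powi 2) \<odot> (y \<otimes> x)"
    and yz: "y \<otimes> z' = (v powi (int m - 1)) \<odot> (z' \<otimes> y)" and xz: "x \<otimes> z = (v powi (1 - int m)) \<odot> (z \<otimes> x)"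
    and S: "qcomm A (serre_coeff v m) x z' m = \<zero>" "qcomm A (serre_coeff v m) y z m = \<zero>"
  shows "qcomm A (serre_coeff v m) (x \<oplus> y) (z \<oplus> z') m = \<zero>"
proof -
  have nr': "inverse v ^ m \<noteq> 1" if "m > 0" for m
    using nr[OF that] by (simp add: power_inverse)
  have "v powi (-2) * v powi 2 = 1" using v0 by (simp add: power_int_minus)
  then have yx: "y \<otimes> x = (v powi (-2)) \<odot> (x \<otimes> y)" using car by (simp add: xy)
  have "qcomm A (serre_coeff v m) (x \<oplus> y) z' m = \<zero>"
    using qcomm_add_left[OF car(1,2,4) yx, of "serre_coeff v m"] yz S serre_coeff_Suc[OF v0]
    by (simp add: serre_coeff_def)
  \<comment> \<open>The scalars for \<open>x\<close> past \<open>y\<close> and \<open>z\<close> are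
    inverse to those for \<open>y\<close> past \<open>x\<close> and \<open>z'\<close>, so
    \<open>x\<close> drops out when the factors are taken in the opposite order.\<close>
  moreover have "qcomm A (serre_coeff (inverse v) m) (y \<oplus> x) z m = \<zero>"
  proof -
    have "inverse v powi - 2 = v powi 2" by (simp add: power_int_minus power_inverse)
    then have *: "serre_coeff (inverse v) m (Suc t) = serre_coeff (inverse v) m t * v powi 2" for t
      using serre_coeff_Suc[of "inverse v" m t] v0 by simp
    have "serre_coeff (inverse v) m 0 = v powi (1 - int m)"
      by (simp add: serre_coeff_inverse) (simp add: serre_coeff_def power_int_minus[symmetric])
    then have "qcomm A (serre_coeff (inverse v) m) (y \<oplus> x) z m = qcomm A (serre_coeff (inverse v) m) y z m"
      by (intro qcomm_add_left[OF car(2,1,3) xy]) (simp_all add: xz *)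
    then show ?thesis using qcomm_serre_inverse[OF v0 nr car(2,3)] S by simp
  qed
  then have "qcomm A (serre_coeff v m) (x \<oplus> y) z m = \<zero>"
    using qcomm_serre_inverse[OF v0 nr, of "y \<oplus> x" z] car by (simp add: a_comm)
  ultimately show ?thesis using car by (simp add: qcomm_add_right)
qed

section \<open>The parameters and the relations in terms of a symmetrised Cartan matrix\<close>

locale cartan_q =
  fixes a :: "'i::finite \<Rightarrow> 'i \<Rightarrow> int" and d :: "'i \<Rightarrow> nat" and q :: "'k::field" and \<kappa> \<kappa>' :: "'i \<Rightarrow> bool"
  assumes d_pos: "d i > 0" and d_sym: "int (d i) * a i j = int (d j) * a j i"
    and a_diag: "a i i = 2" and a_offdiag: "i \<noteq> j \<Longrightarrow> a i j \<le> 0"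
    and q0: "q \<noteq> 0" and q_nonroot: "m > 0 \<Longrightarrow> q ^ m \<noteq> 1"
begin

text \<open>\<open>P i j\<close> is \<open>q\<close> to the scalar product of the simple roots
  \<open>i\<close> and \<open>j\<close>, hence symmetric, and the scalar by which \<open>K j\<close>
  moves past \<open>E i\<close>; \<open>kq i\<close> is the coefficient in the commutator of
  \<open>E i\<close> and \<open>F i\<close>, and \<open>ms i j\<close> the number of factors in a
  Serre relation.\<close>

definition "P i j = (q ^ d i) powi a i j"
definition "kq i = 1 / (q ^ d i - inverse (q ^ d i))"
definition "ms i j = nat (1 - a i j)"
abbreviation "rels \<equiv> w_rels a d q \<kappa> \<kappa>'"

lemma P_powi: "P i j = q powi (int (d i) * a i j)"
  by (simp add: P_def power_int_mult)

lemma P_sym: "P i j = P j i"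
  by (simp add: P_powi d_sym)

lemma P_nonzero [simp]: "P i j \<noteq> 0"
  using q0 by (simp add: P_def)

lemma qd_nonzero: "q ^ d i \<noteq> 0"
  using q0 by simp

lemma qd_nonroot: "m > 0 \<Longrightarrow> (q ^ d i) ^ m \<noteq> 1"
  using q_nonroot[of "d i * m"] d_pos by (simp add: power_mult)

lemma kq_nonzero: "kq i \<noteq> 0"
  using v_neq_inverse[OF qd_nonzero qd_nonroot] by (simp add: kq_def)

lemma ms_int: "i \<noteq> j \<Longrightarrow> int (ms i j) = 1 - a i j"
  using a_offdiag[of i j] by (simp add: ms_def)

lemma P_ms: assumes "i \<noteq> j" shows "(q ^ d i) powi (int (ms i j) - 1) = inverse (P i j)" "(q ^ d i) powi (1 - int (ms i j)) = P i j"
  using ms_int[OF assms] by (simp_all add: P_def power_int_minus)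

lemma P_diag: "P i i = (q ^ d i) powi 2"
  by (simp add: P_def a_diag)

text \<open>Turns equalities of weights, which are scalars, back into equalities of integer
  exponents; this needs \<open>q\<close> not to be a root of unity.\<close>

lemma q_powi_inj: assumes "q powi x = q powi y" shows "x = y"
proof -
  have *: "x = y" if "x \<ge> y" "q powi x = q powi y" for x y
  proof (rule ccontr)
    assume "x \<noteq> y"
    have "q powi (x - y) = 1" using that q0 by (simp add: power_int_diff)
    moreover have "q powi (x - y) = q ^ nat (x - y)" using that by (simp add: power_int_def)
    ultimately show False using q_nonroot[of "nat (x - y)"] that \<open>x \<noteq> y\<close> by simp
  qed
  show ?thesis using *[OF _ assms] *[OF _ assms[symmetric]] by (metis linear)
qed

lemma P_diag_neq_1: "P i i \<noteq> 1"
  using q_powi_inj[of "int (d i) * a i i" 0] d_pos[of i] by (auto simp: P_powi a_diag)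

end

text \<open>All relations except those of Serre type, so that it applies to a module before the
  Serre elements are known to act as zero. Both types share the commutation rules with the
  \<open>K j\<close> and their partners; type 2 adds the absorption rules \<open>E2\<close> and
  \<open>F2\<close>.\<close>

locale wpre = cartan_q a d q \<kappa> \<kappa>' + kalg B
  for a :: "'i::finite \<Rightarrow> 'i \<Rightarrow> int" and d and q :: "'k::field" and \<kappa> \<kappa>' and B :: "('k, 'b) module" (structure) +
  fixes e :: "'i gen \<Rightarrow> 'b"
  assumes e_closed [simp]: "e g \<in> carrier B"
    and KL: "e (gK i) \<otimes> e (gKbar i) = e gJ"
    and LK: "e (gKbar j) \<otimes> e (gK i) = e (gK i) \<otimes> e (gKbar j)"
    and KK: "e (gK i) \<otimes> e (gK j) = e (gK j) \<otimes> e (gK i)"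
    and LL: "e (gKbar i) \<otimes> e (gKbar j) = e (gKbar j) \<otimes> e (gKbar i)"
    and JK [simp]: "e gJ \<otimes> e (gK i) = e (gK i)"
    and JL [simp]: "e gJ \<otimes> e (gKbar i) = e (gKbar i)"
    and KE: "e (gK j) \<otimes> e (gE i) = P i j \<odot> (e (gE i) \<otimes> e (gK j))"
    and LE: "e (gKbar j) \<otimes> e (gE i) = inverse (P i j) \<odot> (e (gE i) \<otimes> e (gKbar j))"
    and KF: "e (gK j) \<otimes> e (gF i) = inverse (P i j) \<odot> (e (gF i) \<otimes> e (gK j))"
    and LF: "e (gKbar j) \<otimes> e (gF i) = P i j \<odot> (e (gF i) \<otimes> e (gKbar j))"
    and E2: "\<not> \<kappa> i \<Longrightarrow> e (gE i) \<otimes> e gJ = e (gE i)"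
    and F2: "\<not> \<kappa>' i \<Longrightarrow> e (gF i) \<otimes> e gJ = e (gF i)"
    and EF_neq: "i \<noteq> j \<Longrightarrow> e (gE i) \<otimes> e (gF j) = e (gF j) \<otimes> e (gE i)"
    and EF_eq: "e (gE i) \<otimes> e (gF i) = e (gF i) \<otimes> e (gE i) \<oplus> (kq i \<odot> e (gK i) \<oplus> (- kq i) \<odot> e (gKbar i))"
begin

abbreviation "E i \<equiv> e (gE i)"
abbreviation "F i \<equiv> e (gF i)"
abbreviation "K i \<equiv> e (gK i)"
abbreviation "L i \<equiv> e (gKbar i)"
abbreviation "J \<equiv> e gJ"

lemma LK_eq: "L i \<otimes> K i = J"
  by (simp add: LK KL)

lemma KJ [simp]: "K i \<otimes> J = K i"
proof -
  have "K i \<otimes> (L i \<otimes> K i) = J \<otimes> K i" by (simp only: m_assoc[symmetric] KL e_closed)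
  then show ?thesis by (simp add: LK_eq)
qed

lemma LJ [simp]: "L i \<otimes> J = L i"
proof -
  have "L i \<otimes> (K i \<otimes> L i) = J \<otimes> L i" by (simp only: m_assoc[symmetric] LK_eq e_closed)
  then show ?thesis by (simp add: KL)
qed

lemma JJ [simp]: "J \<otimes> J = J"
  using m_assoc[of J "K undefined" "L undefined"] KL[of undefined] by simp

text \<open>\<open>J\<close> is the product of \<open>K i\<close> and \<open>L i\<close>, whose
  scalars against \<open>E i\<close> are inverse to each other.\<close>

lemma JE: "J \<otimes> E i = E i \<otimes> J"
proof -
  have "K i \<otimes> (L i \<otimes> E i) = E i \<otimes> (K i \<otimes> L i)"
    by (simp add: LE swap_assoc[OF KE])
  then show ?thesis by (simp add: m_assoc[symmetric] KL)
qed

lemma JF: "J \<otimes> F i = F i \<otimes> J"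
proof -
  have "K i \<otimes> (L i \<otimes> F i) = F i \<otimes> (K i \<otimes> L i)"
    by (simp add: LF swap_assoc[OF KF])
  then show ?thesis by (simp add: m_assoc[symmetric] KL)
qed

lemma assoc_rules:
  "x \<in> carrier B \<Longrightarrow> K j \<otimes> (E i \<otimes> x) = P i j \<odot> (E i \<otimes> (K j \<otimes> x))"
  "x \<in> carrier B \<Longrightarrow> L j \<otimes> (E i \<otimes> x) = inverse (P i j) \<odot> (E i \<otimes> (L j \<otimes> x))"
  "x \<in> carrier B \<Longrightarrow> K j \<otimes> (F i \<otimes> x) = inverse (P i j) \<odot> (F i \<otimes> (K j \<otimes> x))"
  "x \<in> carrier B \<Longrightarrow> L j \<otimes> (F i \<otimes> x) = P i j \<odot> (F i \<otimes> (L j \<otimes> x))"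
  "x \<in> carrier B \<Longrightarrow> L j \<otimes> (K i \<otimes> x) = K i \<otimes> (L j \<otimes> x)"
  "x \<in> carrier B \<Longrightarrow> K i \<otimes> (L i \<otimes> x) = J \<otimes> x"
  "x \<in> carrier B \<Longrightarrow> J \<otimes> (K i \<otimes> x) = K i \<otimes> x"
  "x \<in> carrier B \<Longrightarrow> J \<otimes> (L i \<otimes> x) = L i \<otimes> x"
  "x \<in> carrier B \<Longrightarrow> K i \<otimes> (J \<otimes> x) = K i \<otimes> x"
  "x \<in> carrier B \<Longrightarrow> L i \<otimes> (J \<otimes> x) = L i \<otimes> x"
  "x \<in> carrier B \<Longrightarrow> J \<otimes> (J \<otimes> x) = J \<otimes> x"
  "x \<in> carrier B \<Longrightarrow> J \<otimes> (E i \<otimes> x) = E i \<otimes> (J \<otimes> x)"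
  "x \<in> carrier B \<Longrightarrow> J \<otimes> (F i \<otimes> x) = F i \<otimes> (J \<otimes> x)"
  by (simp_all only: m_assoc[symmetric] KE LE KF LF LK KL JK JL KJ LJ JJ JE JF e_closed m_closed smult_closed mult_smult_l)

lemmas K_rules = KE LE KF LF KL LK JE JF assoc_rules

text \<open>The Chevalley involution. Exchanging \<open>E i\<close> with \<open>F i\<close> also
  exchanges their types, hence the swapped order of \<kappa> and \<open>\<kappa>'\<close>.\<close>

lemma wpre_swap:
  "wpre a d q \<kappa>' \<kappa> B (\<lambda>g. case g of gE i \<Rightarrow> F i | gF i \<Rightarrow> E i | gK i \<Rightarrow> L i | gKbar i \<Rightarrow> K i | gJ \<Rightarrow> J)"
proof -
  have e: "F i \<otimes> E i \<oplus> (kq i \<odot> K i \<oplus> (- kq i) \<odot> L i) \<oplus> (kq i \<odot> L i \<oplus> (- kq i) \<odot> K i) = F i \<otimes> E i" for i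
  proof -
    have "F i \<otimes> E i \<oplus> (kq i \<odot> K i \<oplus> (- kq i) \<odot> L i) \<oplus> (kq i \<odot> L i \<oplus> (- kq i) \<odot> K i)
      = F i \<otimes> E i \<oplus> (kq i \<odot> K i \<oplus> (- kq i) \<odot> K i) \<oplus> (kq i \<odot> L i \<oplus> (- kq i) \<odot> L i)"
      by (simp add: a_ac del: smult_cancel)
    then show ?thesis by simp
  qed
  show ?thesis
    by (intro wpre.intro wpre_axioms.intro cartan_q_axioms kalg_axioms) (simp_all add: K_rules KK LL F2 E2 EF_neq EF_eq e LK_eq P_sym split: gen.split)
qed

text \<open>A correction arises only where \<open>E k\<close> meets a letter of its own index. For
  \<open>k = j\<close> it is a product over the factors, one of which is zero; for
  \<open>k = i\<close> it is a sum over the factors whose terms cancel in pairs.\<close>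

lemma E_commutes_serre_F:
  assumes ij: "i \<noteq> j"
  defines "S \<equiv> qcomm B (serre_coeff (q ^ d i) (ms i j)) (F i) (F j)"
  shows "E k \<otimes> S (ms i j) = S (ms i j) \<otimes> E k"
proof -
  let ?v = "q ^ d i" and ?m = "ms i j"
  let ?c = "serre_coeff ?v ?m"
  have S_Suc: "S (Suc n) = F i \<otimes> S n \<oplus> (- ?c n) \<odot> (S n \<otimes> F i)" and S0: "S 0 = F j" for n
    by (simp_all add: S_def)
  have S [simp]: "S n \<in> carrier B" for n by (simp add: S_def)
  have m: "int ?m = 1 - a i j" by (rule ms_int[OF ij])
  then have mpos: "?m > 0" using a_offdiag[OF ij] by linarith
  consider "k \<noteq> i" "k \<noteq> j" | "k = j" | "k = i" by blast
  then show ?thesis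
  proof cases
    case 1
    have "E k \<otimes> S n = S n \<otimes> E k" for n
    proof (induction n)
      case (Suc n)
      have "E k \<otimes> (F i \<otimes> x) = F i \<otimes> (E k \<otimes> x)" if "x \<in> carrier B" for x
        using that 1 EF_neq[of k i] by (simp add: m_assoc[symmetric])
      moreover have "E k \<otimes> (S n \<otimes> x) = S n \<otimes> (E k \<otimes> x)" if "x \<in> carrier B" for x
        using that Suc by (simp add: m_assoc[symmetric])
      ultimately show ?case using 1 EF_neq[of k i] Suc by (simp add: S_Suc r_distr l_distr smult_r_distr m_assoc)
    qed (use 1 EF_neq in \<open>simp add: S0\<close>)
    then show ?thesis .
  next
    case 2
    \<comment> \<open>\<open>T n\<close> is the commutator of \<open>E j\<close> with
      \<open>S n\<close>. Moving \<open>K j\<close> or \<open>L j\<close> past \<open>F i\<close>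
      costs \<open>inverse (P i j)\<close> or \<open>P i j\<close>, so on each summand the
      \<open>t\<close>-th factor acts as left multiplication by \<open>F i\<close> up to the scalar
      shown.\<close>
    define \<gamma> where "\<gamma> n = kq j * (\<Prod>t<n. 1 - ?c t * inverse (P i j))" for n
    define \<delta> where "\<delta> n = - kq j * (\<Prod>t<n. 1 - ?c t * P i j)" for n
    define T where "T n = \<gamma> n \<odot> (pow_mult (F i) (K j) n) \<oplus> \<delta> n \<odot> (pow_mult (F i) (L j) n)" for n
    have T [simp]: "T n \<in> carrier B" for n by (simp add: T_def)
    have pK: "pow_mult (F i) (K j) n \<otimes> F i = inverse (P i j) \<odot> (F i \<otimes> pow_mult (F i) (K j) n)"
      "pow_mult (F i) (L j) n \<otimes> F i = P i j \<odot> (F i \<otimes> pow_mult (F i) (L j) n)" for n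
      by (induction n) (simp_all add: KF LF m_assoc)
    have T_Suc: "F i \<otimes> T n \<oplus> (- ?c n) \<odot> (T n \<otimes> F i) = T (Suc n)" for n
    proof -
      let ?x = "F i \<otimes> pow_mult (F i) (K j) n" and ?y = "F i \<otimes> pow_mult (F i) (L j) n"
      have "F i \<otimes> T n \<oplus> (- ?c n) \<odot> (T n \<otimes> F i) = (\<gamma> n \<odot> ?x \<oplus> (- ?c n * \<gamma> n * inverse (P i j)) \<odot> ?x)
          \<oplus> (\<delta> n \<odot> ?y \<oplus> (- ?c n * \<delta> n * P i j) \<odot> ?y)"
        by (simp add: T_def l_distr r_distr smult_r_distr pK a_ac mult.assoc)
      also have "\<dots> = (\<gamma> n + - ?c n * \<gamma> n * inverse (P i j)) \<odot> ?x \<oplus> (\<delta> n + - ?c n * \<delta> n * P i j) \<odot> ?y"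
        by (simp add: smult_l_distr[symmetric])
      also have "\<gamma> n + - ?c n * \<gamma> n * inverse (P i j) = \<gamma> (Suc n)" by (simp add: \<gamma>_def algebra_simps)
      also have "\<delta> n + - ?c n * \<delta> n * P i j = \<delta> (Suc n)" by (simp add: \<delta>_def algebra_simps)
      finally show ?thesis by (simp add: T_def)
    qed
    have E: "E j \<otimes> (F i \<otimes> x) = F i \<otimes> (E j \<otimes> x)" if "x \<in> carrier B" for x
      using that ij EF_neq[of j i] by (simp add: m_assoc[symmetric])
    have "E j \<otimes> S n = S n \<otimes> E j \<oplus> T n" for n
    proof (induction n)
      case 0
      show ?case by (simp add: S0 T_def \<gamma>_def \<delta>_def EF_eq)
    next
      case (Suc n)
      have ESF: "E j \<otimes> (S n \<otimes> F i) = S n \<otimes> (F i \<otimes> E j) \<oplus> T n \<otimes> F i"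
        using Suc EF_neq[of j i] ij by (simp add: m_assoc[symmetric] l_distr) (simp add: m_assoc)
      have "E j \<otimes> S (Suc n) = S (Suc n) \<otimes> E j \<oplus> (F i \<otimes> T n \<oplus> (- ?c n) \<odot> (T n \<otimes> F i))"
        by (simp add: S_Suc r_distr l_distr smult_r_distr E Suc ESF m_assoc a_ac)
      then show ?case by (simp add: T_Suc)
    qed
    moreover have "T ?m = \<zero>"
    proof -
      \<comment> \<open>The two ends of the exponent range: the last factor annihilates the
        \<open>K j\<close> part, the first one the \<open>L j\<close> part.\<close>
      have "?c (?m - 1) * inverse (P i j) = 1" "?c 0 * P i j = 1"
        using m mpos P_ms[OF ij] by (simp_all add: serre_coeff_def of_nat_diff algebra_simps)
      then have "1 - ?c (?m - 1) * inverse (P i j) = 0" "1 - ?c 0 * P i j = 0" by simp_all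
      then have "(\<Prod>t<?m. 1 - ?c t * inverse (P i j)) = 0" "(\<Prod>t<?m. 1 - ?c t * P i j) = 0"
        using mpos by (intro prod_zero bexI[of _ "?m - 1"] bexI[of _ 0]; simp)+
      then have "\<gamma> ?m = 0" "\<delta> ?m = 0" by (simp_all add: \<gamma>_def \<delta>_def)
      then show ?thesis by (simp add: T_def)
    qed
    ultimately show ?thesis using 2 by simp
  next
    case 3
    \<comment> \<open>The commutator of \<open>E i\<close> with \<open>S n\<close> is
      \<open>\<gamma> n\<close> times \<open>R n\<close>, that is, \<open>S (n - 1)\<close> with
      \<open>L i\<close> on the right; \<open>R 0\<close> is zero because \<open>S 0 = F j\<close>
      commutes with \<open>E i\<close>. The terms in \<open>K i\<close> cancel at each stage, as
      \<open>K i\<close> moves past \<open>S n\<close> with the scalar \<open>?c n\<close>.\<close>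
    define \<gamma> where "\<gamma> n = kq i * (\<Sum>t<n. ?c t - inverse (?c t))" for n
    define R where "R n = (case n of 0 \<Rightarrow> \<zero> | Suc n \<Rightarrow> S n \<otimes> L i)" for n
    have R [simp]: "R n \<in> carrier B" "R (Suc n) = S n \<otimes> L i" for n by (simp_all add: R_def split: nat.split)
    have c: "?c n = inverse (P i j) * ?v powi (- 2 * int n)" for n
      using m qd_nonzero[of i] by (simp add: serre_coeff_def P_def power_int_add[symmetric] power_int_minus[symmetric] del: power_int_mult_distrib_numeral1)
    have cnz: "?c n \<noteq> 0" for n using qd_nonzero by (simp add: serre_coeff_def)
    have cS: "?c (Suc n) * P i i = ?c n" for n
      using serre_coeff_Suc[OF qd_nonzero, of i ?m n] qd_nonzero[of i] by (simp add: P_diag power_int_minus)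
    have KS: "K i \<otimes> S n = ?c n \<odot> (S n \<otimes> K i)" "L i \<otimes> S n = inverse (?c n) \<odot> (S n \<otimes> L i)" for n
    proof (induction n)
      case 0
      { case 1 show ?case using c[of 0] by (simp add: S0 KF P_sym) }
      { case 2 show ?case using c[of 0] by (simp add: S0 LF P_sym) }
    next
      case (Suc n)
      have c': "?c (Suc n) = inverse (P i i) * ?c n" "inverse (?c (Suc n)) = P i i * inverse (?c n)"
        using cnz[of "Suc n"] by (simp_all add: cS[of n, symmetric])
      { case 1 show ?case
          by (simp add: S_Suc r_distr l_distr smult_r_distr K_rules swap_assoc[OF Suc(1)] Suc(1) m_assoc c' mult_ac) }
      { case 2 show ?case
          by (simp add: S_Suc r_distr l_distr smult_r_distr K_rules swap_assoc[OF Suc(2)] Suc(2) m_assoc c' mult_ac) }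
    qed
    have RS: "F i \<otimes> R n \<oplus> (- ?c n) \<odot> (R n \<otimes> F i) = R (Suc n)" if "n > 0" for n
    proof -
      obtain r where n: "n = Suc r" using \<open>n > 0\<close> gr0_conv_Suc by auto
      show ?thesis using cS[of r] by (simp add: n S_Suc LF m_assoc l_distr)
    qed
    have "E i \<otimes> S n = S n \<otimes> E i \<oplus> \<gamma> n \<odot> R n" for n
    proof (induction n)
      case 0 show ?case using EF_neq[OF ij] by (simp add: S0 \<gamma>_def)
    next
      case (Suc n)
      have FR: "\<gamma> n \<odot> (F i \<otimes> R n) \<oplus> (- ?c n * \<gamma> n) \<odot> (R n \<otimes> F i) = \<gamma> n \<odot> R (Suc n)"
      proof (cases "n = 0")
        case True then show ?thesis by (simp add: \<gamma>_def)
      next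
        case False
        have "\<gamma> n \<odot> (F i \<otimes> R n \<oplus> (- ?c n) \<odot> (R n \<otimes> F i)) = \<gamma> n \<odot> (F i \<otimes> R n) \<oplus> (- ?c n * \<gamma> n) \<odot> (R n \<otimes> F i)"
          by (simp add: smult_r_distr mult.commute)
        then show ?thesis using RS[of n] False by simp
      qed
      have 1: "E i \<otimes> (F i \<otimes> S n) = F i \<otimes> (S n \<otimes> E i) \<oplus> \<gamma> n \<odot> (F i \<otimes> R n)
          \<oplus> ((kq i * ?c n) \<odot> (S n \<otimes> K i) \<oplus> (- kq i * inverse (?c n)) \<odot> (S n \<otimes> L i))"
      proof -
        have "E i \<otimes> (F i \<otimes> S n) = F i \<otimes> (E i \<otimes> S n) \<oplus> (kq i \<odot> (K i \<otimes> S n) \<oplus> (- kq i) \<odot> (L i \<otimes> S n))"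
          by (simp add: m_assoc[symmetric] EF_eq l_distr)
        then show ?thesis by (simp add: Suc KS r_distr)
      qed
      have 2: "E i \<otimes> (S n \<otimes> F i) = S n \<otimes> (F i \<otimes> E i) \<oplus> (kq i \<odot> (S n \<otimes> K i) \<oplus> (- kq i) \<odot> (S n \<otimes> L i))
          \<oplus> \<gamma> n \<odot> (R n \<otimes> F i)"
      proof -
        have "E i \<otimes> (S n \<otimes> F i) = S n \<otimes> (E i \<otimes> F i) \<oplus> \<gamma> n \<odot> (R n \<otimes> F i)"
          by (simp add: m_assoc[symmetric] Suc l_distr)
        then show ?thesis by (simp add: EF_eq r_distr)
      qed
      let ?x = "S n \<otimes> K i" and ?y = "S n \<otimes> L i"
      have "E i \<otimes> S (Suc n) = S (Suc n) \<otimes> E i \<oplus> (\<gamma> n \<odot> (F i \<otimes> R n) \<oplus> (- ?c n * \<gamma> n) \<odot> (R n \<otimes> F i))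
          \<oplus> ((kq i * ?c n) \<odot> ?x \<oplus> (- (kq i * ?c n)) \<odot> ?x)
          \<oplus> ((- kq i * inverse (?c n)) \<odot> ?y \<oplus> (?c n * kq i) \<odot> ?y)"
        by (simp add: S_Suc r_distr l_distr smult_r_distr 1 2 m_assoc a_ac mult.commute del: smult_cancel)
      also have "\<dots> = S (Suc n) \<otimes> E i \<oplus> (\<gamma> n \<odot> ?y \<oplus> (- kq i * inverse (?c n) + ?c n * kq i) \<odot> ?y)"
        using FR by (simp add: smult_l_distr[symmetric] a_assoc)
      also have "\<dots> = S (Suc n) \<otimes> E i \<oplus> (\<gamma> n + (- kq i * inverse (?c n) + ?c n * kq i)) \<odot> ?y"
        by (simp add: smult_l_distr[symmetric] a_assoc)
      also have "\<gamma> n + (- kq i * inverse (?c n) + ?c n * kq i) = \<gamma> (Suc n)"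
        by (simp add: \<gamma>_def algebra_simps)
      finally show ?case by simp
    qed
    moreover have "\<gamma> ?m = 0"
    proof -
      \<comment> \<open>Reversing the order of the factors inverts each coefficient.\<close>
      have "(\<Sum>t<?m. inverse (?c t)) = (\<Sum>t<?m. ?c (?m - Suc t))"
      proof (rule sum.cong)
        fix t assume "t \<in> {..<?m}"
        then have "int ?m - 1 - 2 * int (?m - Suc t) = - (int ?m - 1 - 2 * int t)" by (simp add: of_nat_diff)
        then show "inverse (?c t) = ?c (?m - Suc t)" by (simp only: serre_coeff_def power_int_minus)
      qed simp
      also have "\<dots> = (\<Sum>t<?m. ?c t)" by (rule sum.nat_diff_reindex)
      finally show ?thesis by (simp add: \<gamma>_def sum_subtractf)
    qed
    ultimately show ?thesis using 3 by simp
  qed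
qed

lemma F_commutes_serre_E:
  assumes ij: "i \<noteq> j"
  shows "F k \<otimes> qcomm B (serre_coeff (q ^ d i) (ms i j)) (E i) (E j) (ms i j)
    = qcomm B (serre_coeff (q ^ d i) (ms i j)) (E i) (E j) (ms i j) \<otimes> F k"
  using wpre.E_commutes_serre_F[OF wpre_swap ij, of k] by simp

end

locale wrel = wpre +
  assumes serre_E: "i \<noteq> j \<Longrightarrow> qcomm B (serre_coeff (q ^ d i) (ms i j)) (E i) (E j) (ms i j) = \<zero>"
    and serre_F: "i \<noteq> j \<Longrightarrow> qcomm B (serre_coeff (q ^ d i) (ms i j)) (F i) (F j) (ms i j) = \<zero>"

text \<open>Since \<open>j\<close> is a unit on both sides for \<open>k\<close> and
  \<open>l\<close>, it is absorbed by the product of \<open>k\<close>, \<open>x\<close>,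
  \<open>l\<close>, hence by \<open>x\<close>; multiplying the relation by \<open>k\<close> or
  \<open>l\<close> then gives the commutation rules of type 1.\<close>

lemma (in kalg) type2_rules:
  assumes "x \<in> carrier A" "k \<in> carrier A" "l \<in> carrier A" "j \<in> carrier A" "p \<noteq> 0"
    and rel: "k \<otimes> x \<otimes> l = p \<odot> x" and j: "k \<otimes> l = j" "l \<otimes> k = j" "j \<otimes> k = k" "j \<otimes> l = l"
  shows "x \<otimes> j = x" "k \<otimes> x = p \<odot> (x \<otimes> k)" "x \<otimes> l = p \<odot> (l \<otimes> x)"
proof -
  have x: "x = inverse p \<odot> (k \<otimes> x \<otimes> l)" using rel assms(1,5) by simp
  have lj: "l \<otimes> j = l" using j m_assoc[of l k l] assms(2,3) by metis
  have "j \<otimes> (k \<otimes> x \<otimes> l) = k \<otimes> x \<otimes> l" using j(3) assms(1-4) by (metis m_assoc m_closed)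
  moreover have "(k \<otimes> x \<otimes> l) \<otimes> j = k \<otimes> x \<otimes> l" using lj assms(1-4) by (metis m_assoc m_closed)
  ultimately have "j \<otimes> (p \<odot> x) = p \<odot> x" "(p \<odot> x) \<otimes> j = p \<odot> x" by (simp_all only: rel)
  then have px: "p \<odot> (j \<otimes> x) = p \<odot> x" "p \<odot> (x \<otimes> j) = p \<odot> x" using assms by simp_all
  have inv: "inverse p \<odot> (p \<odot> y) = y" if "y \<in> carrier A" for y using assms(5) that by simp
  have jx: "j \<otimes> x = x" and xj: "x \<otimes> j = x"
    using px inv[of "j \<otimes> x"] inv[of "x \<otimes> j"] inv[of x] assms by (metis m_closed)+
  show "x \<otimes> j = x" by (rule xj)
  have "(k \<otimes> x \<otimes> l) \<otimes> k = k \<otimes> (x \<otimes> j)" using j(2) assms(1-4) by (metis m_assoc m_closed)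
  then have "(p \<odot> x) \<otimes> k = k \<otimes> x" by (simp only: rel xj)
  then show "k \<otimes> x = p \<odot> (x \<otimes> k)" using assms(1,2) by simp
  have "l \<otimes> (k \<otimes> x \<otimes> l) = j \<otimes> (x \<otimes> l)" using assms j by (metis m_assoc m_closed)
  then have "l \<otimes> (p \<odot> x) = (j \<otimes> x) \<otimes> l" using assms(1-4) by (simp only: rel m_assoc)
  then show "x \<otimes> l = p \<odot> (l \<otimes> x)" using assms(1,3) by (simp add: jx)
qed

section \<open>Equivalence of the presentation with the commutation rules\<close>

context cartan_q begin

context
  fixes B :: "('k, 'b) module" (structure) and e :: "'i gen \<Rightarrow> 'b"
  assumes B: "kalg B" and e_cl [simp]: "\<And>g. e g \<in> carrier B"
begin

interpretation B: kalg B by (rule B)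

abbreviation (input) "ev \<equiv> lin_ext B (word_prod B e)"

lemma ev_hom: "ev \<in> alg_hom free_alg B"
  by (rule word_prod_alg_hom[OF B e_cl])

lemma ev_mono: "ev (mono c u) = c \<odot> word_prod B e u"
  by (simp add: B.lin_ext_single)

lemma ev_diff: "ev (x - y) = ev x \<ominus> ev y"
  using klin_minus[OF subsetD[OF alg_hom_klin ev_hom] kalg_free_alg B, of x y] by simp

lemma ev_eq: "ev (mono 1 u - mono c v) = \<zero> \<longleftrightarrow> word_prod B e u = c \<odot> word_prod B e v"
  by (simp add: ev_diff ev_mono B.minus_eq_zero_iff)

lemma ev_serre:
  "ev (\<Sum>s=0..nat (1 - a i j). mono ((-1) ^ s * q_binom (q ^ d i) (nat (1 - a i j)) s)
      (replicate (nat (1 - a i j) - s) g @ g' # replicate s g))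
   = qcomm B (serre_coeff (q ^ d i) (ms i j)) (e g) (e g') (ms i j)"
proof -
  have "ev (mono 1 [g]) = e g" for g by (simp add: ev_mono)
  then show ?thesis
    using alg_hom_qcomm(2)[OF ev_hom kalg_free_alg B, of "mono 1 [g]" "mono 1 [g']" "serre_coeff (q ^ d i) (ms i j)" "ms i j"]
      serre_elem_eq_qcomm[OF qd_nonzero qd_nonroot, of i "ms i j" g g']
    unfolding serre_elem_def ms_def by simp
qed

lemma ev_EF: "ev (mono 1 u - mono 1 v - (mono c x - mono c y)) = \<zero>
    \<longleftrightarrow> word_prod B e u = word_prod B e v \<oplus> (c \<odot> word_prod B e x \<oplus> (- c) \<odot> word_prod B e y)"
proof -
  have "X \<ominus> Y \<ominus> (c \<odot> Z \<ominus> c \<odot> Z') = X \<ominus> (Y \<oplus> (c \<odot> Z \<oplus> (- c) \<odot> Z'))"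
    if "X \<in> carrier B" "Y \<in> carrier B" "Z \<in> carrier B" "Z' \<in> carrier B" for X Y Z Z'
    using that by (simp add: B.minus_smult B.smult_r_distr B.a_assoc)
  then show ?thesis by (simp add: ev_diff ev_mono B.minus_eq_zero_iff)
qed

text \<open>One half of the equivalence: a homomorphism out of the algebra is defined by
  establishing \<open>wrel\<close> for the images of the generators.\<close>

lemma wrel_rels:
  assumes "wrel a d q \<kappa> \<kappa>' B e" and r: "r \<in> rels"
  shows "ev r = \<zero>"
proof -
  interpret wrel a d q \<kappa> \<kappa>' B e by fact
  have KXL: "K j \<otimes> (E i \<otimes> L j) = P i j \<odot> (E i \<otimes> J)" "K j \<otimes> (F i \<otimes> L j) = inverse (P i j) \<odot> (F i \<otimes> J)" for i j
    by (simp_all add: K_rules)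
  show ?thesis using r
  proof cases
    case (E_F i j)
    show ?thesis
    proof (cases "i = j")
      case True
      show ?thesis unfolding E_F using True ev_EF[of "[gE i, gF i]"] EF_eq[of i] by (simp add: kq_def)
    next
      case False
      then show ?thesis unfolding E_F using ev_eq[where u = "[gE i, gF j]" and c = 1] EF_neq[OF False] by simp
    qed
  qed (simp_all add: ev_eq ev_serre serre_E serre_F KL LK KK LL KXL E2 F2 P_def[symmetric] power_int_minus,
      simp_all add: K_rules)
qed

text \<open>The other half, applied to the generators of the algebra itself. The relation of type 2
  is unpacked by \<open>type2_rules\<close>.\<close>

lemma rels_wrel:
  assumes ev: "\<And>r. r \<in> rels \<Longrightarrow> ev r = \<zero>"
  shows "wrel a d q \<kappa> \<kappa>' B e"
proof -
  have eq: "word_prod B e u = c \<odot> word_prod B e v" if "mono 1 u - mono c v \<in> rels" for u v c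
    using ev[OF that] ev_eq by simp
  note w = w_rels.intros[where a = a and d = d and q = q and \<kappa> = \<kappa> and \<kappa>' = \<kappa>']
  have KL: "e (gK i) \<otimes> e (gKbar i) = e gJ" for i using eq[OF w(1)[of i]] by simp
  have LK: "e (gKbar j) \<otimes> e (gK i) = e (gK i) \<otimes> e (gKbar j)" for i j using eq[OF w(2)[of i j]] by simp
  have KK: "e (gK i) \<otimes> e (gK j) = e (gK j) \<otimes> e (gK i)" for i j using eq[OF w(3)[of i j]] by simp
  have LL: "e (gKbar i) \<otimes> e (gKbar j) = e (gKbar j) \<otimes> e (gKbar i)" for i j using eq[OF w(4)[of i j]] by simp
  have JK: "e gJ \<otimes> e (gK i) = e (gK i)" for i using eq[OF w(5)[of i]] by simp
  have JL: "e gJ \<otimes> e (gKbar i) = e (gKbar i)" for i using eq[OF w(6)[of i]] by simp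
  have E2: "e (gK j) \<otimes> e (gE i) \<otimes> e (gKbar j) = P i j \<odot> e (gE i)" if "\<not> \<kappa> i" for i j
    using eq[OF w(9)[of i j]] that by (simp add: P_def B.m_assoc)
  have F2: "e (gK j) \<otimes> e (gF i) \<otimes> e (gKbar j) = inverse (P i j) \<odot> e (gF i)" if "\<not> \<kappa>' i" for i j
    using eq[OF w(12)[of i j]] that by (simp add: P_def B.m_assoc power_int_minus)
  note E2' = B.type2_rules[OF _ _ _ _ _ E2 KL _ JK JL] and F2' = B.type2_rules[OF _ _ _ _ _ F2 KL _ JK JL]
  have KE: "e (gK j) \<otimes> e (gE i) = P i j \<odot> (e (gE i) \<otimes> e (gK j))" for i j
    using eq[OF w(7)[of i j]] E2'(2)[of i j] by (cases "\<kappa> i") (simp_all add: P_def[symmetric] LK KL)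
  have EL: "e (gE i) \<otimes> e (gKbar j) = P i j \<odot> (e (gKbar j) \<otimes> e (gE i))" for i j
    using eq[OF w(8)[of i j]] E2'(3)[of i j] by (cases "\<kappa> i") (simp_all add: P_def[symmetric] LK KL)
  have KF: "e (gK j) \<otimes> e (gF i) = inverse (P i j) \<odot> (e (gF i) \<otimes> e (gK j))" for i j
    using eq[OF w(10)[of i j]] F2'(2)[of i j] by (cases "\<kappa>' i") (simp_all add: P_def[symmetric] power_int_minus LK KL)
  have FL: "e (gF i) \<otimes> e (gKbar j) = inverse (P i j) \<odot> (e (gKbar j) \<otimes> e (gF i))" for i j
    using eq[OF w(11)[of i j]] F2'(3)[of i j] by (cases "\<kappa>' i") (simp_all add: P_def[symmetric] power_int_minus LK KL)
  \<comment> \<open>\<open>J\<close> is the product of \<open>K j\<close> and \<open>L j\<close> for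
    every index \<open>j\<close>, so any one index will do.\<close>
  have EJ: "e (gE i) \<otimes> e gJ = e (gE i)" if "\<not> \<kappa> i" for i using E2'(1)[of i undefined] that by (simp add: LK KL)
  have FJ: "e (gF i) \<otimes> e gJ = e (gF i)" if "\<not> \<kappa>' i" for i using F2'(1)[of i undefined] that by (simp add: LK KL)
  have EF: "e (gE i) \<otimes> e (gF j) = e (gF j) \<otimes> e (gE i)" if "i \<noteq> j" for i j
    using ev[OF w(13)[of i j]] ev_eq[where u = "[gE i, gF j]" and c = 1] that by simp
  have EFi: "e (gE i) \<otimes> e (gF i) = e (gF i) \<otimes> e (gE i) \<oplus> (kq i \<odot> e (gK i) \<oplus> (- kq i) \<odot> e (gKbar i))" for i
    using ev[OF w(13)[of i i]] ev_EF[of "[gE i, gF i]"] by (simp add: kq_def)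
  show ?thesis
  proof (intro wrel.intro wpre.intro wpre_axioms.intro wrel_axioms.intro cartan_q_axioms B)
    fix i j :: 'i assume "i \<noteq> j"
    then show "qcomm B (serre_coeff (q ^ d i) (ms i j)) (e (gE i)) (e (gE j)) (ms i j) = \<zero>"
      "qcomm B (serre_coeff (q ^ d i) (ms i j)) (e (gF i)) (e (gF j)) (ms i j) = \<zero>"
      using ev[OF w(14)[of i j]] ev[OF w(15)[of i j]] by (simp_all add: ev_serre)
  qed (simp_all add: KL LK KK LL JK JL KE EL KF FL EJ FJ EF EFi)
qed

end

abbreviation "W \<equiv> w_alg a d q \<kappa> \<kappa>'"
abbreviation "w \<equiv> w_gen a d q \<kappa> \<kappa>'"

lemma kalg_W: "kalg W"
  by (simp add: w_alg_def kalg_presented_alg)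

lemma w_closed [simp]: "w g \<in> carrier W"
  by (simp add: w_alg_def w_gen_def)

lemma wrel_W: "wrel a d q \<kappa> \<kappa>' W w"
proof (rule rels_wrel[OF kalg_W w_closed])
  fix r assume "r \<in> rels"
  have "(\<lambda>x. x) \<in> klin (presented_alg rels) (presented_alg rels)" by (rule klinI) simp_all
  from klin_poly_class[OF this kalg_presented_alg, of r]
  have "poly_class rels r = lin_ext W (word_prod W w) r"
    unfolding w_alg_def w_gen_def word_class_eq_word_prod[abs_def] .
  then show "lin_ext W (word_prod W w) r = \<zero>\<^bsub>W\<^esub>"
    using poly_class_rel[OF \<open>r \<in> rels\<close>] by (simp add: w_alg_def)
qed

end

lemma (in wrel) presented_hom: "presented_hom B rels e"
  by (intro presented_hom.intro presented_hom_axioms.intro kalg_axioms e_closed wrel_rels wrel_axioms)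

section \<open>The structure maps respect the relations\<close>

context wrel begin

text \<open>The group-like left factor in the coproduct of \<open>E i\<close>; \<open>gl'\<close> is
  the right factor for \<open>F i\<close>. The coproduct depends on the types only through
  them.\<close>

definition "gl i = (if \<kappa> i then \<one> else J)"
definition "gl' i = (if \<kappa>' i then \<one> else J)"

lemma gl_closed [simp]: "gl i \<in> carrier B" "gl' i \<in> carrier B"
  by (simp_all add: gl_def gl'_def)

lemma gl_rules [simp]:
  "gl i \<otimes> K j = K j" "gl i \<otimes> L j = L j" "gl i \<otimes> J = J" "K j \<otimes> gl i = K j" "L j \<otimes> gl i = L j" "J \<otimes> gl i = J"
  "gl' i \<otimes> K j = K j" "gl' i \<otimes> L j = L j" "gl' i \<otimes> J = J" "K j \<otimes> gl' i = K j" "L j \<otimes> gl' i = L j" "J \<otimes> gl' i = J"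
  "gl i \<otimes> E j = E j \<otimes> gl i" "gl i \<otimes> F j = F j \<otimes> gl i" "gl' i \<otimes> E j = E j \<otimes> gl' i" "gl' i \<otimes> F j = F j \<otimes> gl' i"
  by (simp_all add: gl_def gl'_def JE JF)

lemma gl_commute: "gl i \<otimes> gl j = gl j \<otimes> gl i" "gl' i \<otimes> gl' j = gl' j \<otimes> gl' i"
  by (simp_all add: gl_def gl'_def)

sublocale TT: tensor B B
  by (rule tensor.intro[OF kalg_axioms kalg_axioms])

definition comult_gen where
  "comult_gen g = (case g of
       gE i \<Rightarrow> TT.t (gl i) (E i) \<oplus>\<^bsub>TT.T\<^esub> TT.t (E i) (K i)
     | gF i \<Rightarrow> TT.t (F i) (gl' i) \<oplus>\<^bsub>TT.T\<^esub> TT.t (L i) (F i)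
     | gK i \<Rightarrow> TT.t (K i) (K i) | gKbar i \<Rightarrow> TT.t (L i) (L i) | gJ \<Rightarrow> TT.t J J)"

lemma comult_gen_simps [simp]:
  "comult_gen (gE i) = TT.t (gl i) (E i) \<oplus>\<^bsub>TT.T\<^esub> TT.t (E i) (K i)"
  "comult_gen (gF i) = TT.t (F i) (gl' i) \<oplus>\<^bsub>TT.T\<^esub> TT.t (L i) (F i)"
  "comult_gen (gK i) = TT.t (K i) (K i)" "comult_gen (gKbar i) = TT.t (L i) (L i)" "comult_gen gJ = TT.t J J"
  by (simp_all add: comult_gen_def)

lemma comult_gen_closed: "comult_gen g \<in> carrier TT.T"
  by (cases g) simp_all

text \<open>Mixed terms cancel in the commutator of \<open>E i\<close> and \<open>F j\<close>, and
  \<open>qcomm_serre_sum\<close> reduces the Serre relations to those in a single tensor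
  factor.\<close>

lemma wrel_comult: "wrel a d q \<kappa> \<kappa>' TT.T comult_gen"
proof -
  note D = TT.T.l_distr TT.T.r_distr TT.T.smult_r_distr
  have EFc: "E i \<otimes> F j = F j \<otimes> E i \<oplus> (if i = j then kq i \<odot> K i \<oplus> (- kq i) \<odot> L i else \<zero>)" for i j
    using EF_neq EF_eq by simp
  have EL: "E i \<otimes> L j = P i j \<odot> (L j \<otimes> E i)" "F i \<otimes> K j = P i j \<odot> (K j \<otimes> F i)" for i j
    by (simp_all add: LE KF)
  have EFT: "comult_gen (gE i) \<otimes>\<^bsub>TT.T\<^esub> comult_gen (gF j) =
      comult_gen (gF j) \<otimes>\<^bsub>TT.T\<^esub> comult_gen (gE i) \<oplus>\<^bsub>TT.T\<^esub>
      (if i = j then kq i \<odot>\<^bsub>TT.T\<^esub> comult_gen (gK i) \<oplus>\<^bsub>TT.T\<^esub> (- kq i) \<odot>\<^bsub>TT.T\<^esub> comult_gen (gKbar i) else \<zero>\<^bsub>TT.T\<^esub>)" for i j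
  proof -
    \<comment> \<open>The scalars from \<open>L j\<close> past \<open>E i\<close> and from
      \<open>K i\<close> past \<open>F j\<close> are inverse to each other.\<close>
    have 1: "TT.t (L j) (F j) \<otimes>\<^bsub>TT.T\<^esub> TT.t (E i) (K i) = TT.t (E i) (K i) \<otimes>\<^bsub>TT.T\<^esub> TT.t (L j) (F j)"
      by (simp add: LE KF P_sym[of j i])
    have 2: "comult_gen (gE i) \<otimes>\<^bsub>TT.T\<^esub> comult_gen (gF j) =
       TT.t (F j \<otimes> gl i) (gl' j \<otimes> E i) \<oplus>\<^bsub>TT.T\<^esub> TT.t (L j) (E i \<otimes> F j) \<oplus>\<^bsub>TT.T\<^esub> TT.t (E i \<otimes> F j) (K i)
       \<oplus>\<^bsub>TT.T\<^esub> TT.t (E i) (K i) \<otimes>\<^bsub>TT.T\<^esub> TT.t (L j) (F j)"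
      by (simp add: D TT.T.a_ac)
    have 3: "comult_gen (gF j) \<otimes>\<^bsub>TT.T\<^esub> comult_gen (gE i) =
       TT.t (F j \<otimes> gl i) (gl' j \<otimes> E i) \<oplus>\<^bsub>TT.T\<^esub> TT.t (L j) (F j \<otimes> E i) \<oplus>\<^bsub>TT.T\<^esub> TT.t (F j \<otimes> E i) (K i)
       \<oplus>\<^bsub>TT.T\<^esub> TT.t (E i) (K i) \<otimes>\<^bsub>TT.T\<^esub> TT.t (L j) (F j)"
      unfolding 1[symmetric] by (simp add: D TT.T.a_ac)
    show ?thesis
    proof (cases "i = j")
      case False
      have "comult_gen (gE i) \<otimes>\<^bsub>TT.T\<^esub> comult_gen (gF j) = comult_gen (gF j) \<otimes>\<^bsub>TT.T\<^esub> comult_gen (gE i)"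
        by (simp only: 2 3 EF_neq[OF False])
      then show ?thesis using False by (simp add: comult_gen_closed del: comult_gen_simps)
    next
      case True
      \<comment> \<open>This mixed term arises once from each tensor factor, with opposite
        signs.\<close>
      let ?x = "TT.t (L i) (K i)"
      have "comult_gen (gE i) \<otimes>\<^bsub>TT.T\<^esub> comult_gen (gF j) = comult_gen (gF j) \<otimes>\<^bsub>TT.T\<^esub> comult_gen (gE i)
        \<oplus>\<^bsub>TT.T\<^esub> (kq i \<odot>\<^bsub>TT.T\<^esub> comult_gen (gK i) \<oplus>\<^bsub>TT.T\<^esub> (- kq i) \<odot>\<^bsub>TT.T\<^esub> comult_gen (gKbar i))
        \<oplus>\<^bsub>TT.T\<^esub> (kq i \<odot>\<^bsub>TT.T\<^esub> ?x \<oplus>\<^bsub>TT.T\<^esub> (- kq i) \<odot>\<^bsub>TT.T\<^esub> ?x)"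
        unfolding 2 3 using True
        by (simp add: EF_eq TT.pure_add_l TT.pure_add_r TT.T.a_ac del: TT.T.smult_cancel)
      then show ?thesis using True by (simp add: comult_gen_closed del: comult_gen_simps)
    qed
  qed
  have serre_cond: "qcomm TT.T (serre_coeff (q ^ d i) (ms i j)) (comult_gen (gE i)) (comult_gen (gE j)) (ms i j) = \<zero>\<^bsub>TT.T\<^esub>"
    "qcomm TT.T (serre_coeff (q ^ d i) (ms i j)) (comult_gen (gF i)) (comult_gen (gF j)) (ms i j) = \<zero>\<^bsub>TT.T\<^esub>"
    if ij: "i \<noteq> j" for i j
  proof -
    let ?S = "qcomm TT.T (serre_coeff (q ^ d i) (ms i j))"
    have 1: "?S (TT.t (E i) (K i)) (TT.t (E j) (K j)) (ms i j) = \<zero>\<^bsub>TT.T\<^esub>"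
      "?S (TT.t (F i) (gl' i)) (TT.t (F j) (gl' j)) (ms i j) = \<zero>\<^bsub>TT.T\<^esub>"
      by (simp_all add: TT.qcomm_pure_l KK gl_commute serre_E serre_F ij)
    have 2: "?S (TT.t (gl i) (E i)) (TT.t (gl j) (E j)) (ms i j) = \<zero>\<^bsub>TT.T\<^esub>"
      "?S (TT.t (L i) (F i)) (TT.t (L j) (F j)) (ms i j) = \<zero>\<^bsub>TT.T\<^esub>"
      by (simp_all add: TT.qcomm_pure_r LL gl_commute serre_E serre_F ij)
    have "?S (TT.t (E i) (K i) \<oplus>\<^bsub>TT.T\<^esub> TT.t (gl i) (E i)) (TT.t (gl j) (E j) \<oplus>\<^bsub>TT.T\<^esub> TT.t (E j) (K j)) (ms i j) = \<zero>\<^bsub>TT.T\<^esub>"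
      by (rule TT.T.qcomm_serre_sum[OF qd_nonzero qd_nonroot])
        (use 1 2 in \<open>simp_all add: P_ms[OF ij] P_diag KE P_sym[of j i]\<close>)
    then show "?S (comult_gen (gE i)) (comult_gen (gE j)) (ms i j) = \<zero>\<^bsub>TT.T\<^esub>" by (simp add: TT.T.a_comm)
    \<comment> \<open>For the \<open>F\<close> relations the component with \<open>L i\<close> takes
      the role that the component with \<open>K i\<close> has for the \<open>E\<close>
      relations.\<close>
    have "?S (TT.t (L i) (F i) \<oplus>\<^bsub>TT.T\<^esub> TT.t (F i) (gl' i)) (TT.t (F j) (gl' j) \<oplus>\<^bsub>TT.T\<^esub> TT.t (L j) (F j)) (ms i j) = \<zero>\<^bsub>TT.T\<^esub>"
      by (rule TT.T.qcomm_serre_sum[OF qd_nonzero qd_nonroot])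
        (use 1 2 in \<open>simp_all add: P_ms[OF ij] P_diag LF P_sym[of j i]\<close>)
    then show "?S (comult_gen (gF i)) (comult_gen (gF j)) (ms i j) = \<zero>\<^bsub>TT.T\<^esub>" by (simp add: TT.T.a_comm)
  qed
  have KK': "K j \<otimes> K i = K i \<otimes> K j" "L j \<otimes> L i = L i \<otimes> L j" "L j \<otimes> K i = K i \<otimes> L j" for i j
    by (simp_all add: KK LL LK)
  show ?thesis
  proof (intro wrel.intro wpre.intro wpre_axioms.intro wrel_axioms.intro cartan_q_axioms TT.kalg_T comult_gen_closed)
    fix i j
    show "comult_gen (gKbar j) \<otimes>\<^bsub>TT.T\<^esub> comult_gen (gK i) = comult_gen (gK i) \<otimes>\<^bsub>TT.T\<^esub> comult_gen (gKbar j)"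
      "comult_gen (gK i) \<otimes>\<^bsub>TT.T\<^esub> comult_gen (gK j) = comult_gen (gK j) \<otimes>\<^bsub>TT.T\<^esub> comult_gen (gK i)"
      "comult_gen (gKbar i) \<otimes>\<^bsub>TT.T\<^esub> comult_gen (gKbar j) = comult_gen (gKbar j) \<otimes>\<^bsub>TT.T\<^esub> comult_gen (gKbar i)"
      by (simp_all add: KK[of i j] LL[of i j] LK)
    show "comult_gen (gK j) \<otimes>\<^bsub>TT.T\<^esub> comult_gen (gE i) = P i j \<odot>\<^bsub>TT.T\<^esub> (comult_gen (gE i) \<otimes>\<^bsub>TT.T\<^esub> comult_gen (gK j))"
      "comult_gen (gK j) \<otimes>\<^bsub>TT.T\<^esub> comult_gen (gF i) = inverse (P i j) \<odot>\<^bsub>TT.T\<^esub> (comult_gen (gF i) \<otimes>\<^bsub>TT.T\<^esub> comult_gen (gK j))"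
      "comult_gen (gKbar j) \<otimes>\<^bsub>TT.T\<^esub> comult_gen (gE i) = inverse (P i j) \<odot>\<^bsub>TT.T\<^esub> (comult_gen (gE i) \<otimes>\<^bsub>TT.T\<^esub> comult_gen (gKbar j))"
      "comult_gen (gKbar j) \<otimes>\<^bsub>TT.T\<^esub> comult_gen (gF i) = P i j \<odot>\<^bsub>TT.T\<^esub> (comult_gen (gF i) \<otimes>\<^bsub>TT.T\<^esub> comult_gen (gKbar j))"
      by (simp_all add: D KE KF LE LF LK KK[of i j] LL[of i j])
  qed (simp_all add: D KL EFT serre_cond gl_def gl'_def E2 F2 del: comult_gen_simps(1,2) | simp add: D E2 F2 gl_def gl'_def)+
qed

definition antipode_gen where
  "antipode_gen g = (case g of
     gE i \<Rightarrow> \<ominus> (E i \<otimes> L i) | gF i \<Rightarrow> \<ominus> (K i \<otimes> F i) | gK i \<Rightarrow> L i | gKbar i \<Rightarrow> K i | gJ \<Rightarrow> J)"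

lemma antipode_gen_simps [simp]:
  "antipode_gen (gE i) = (- 1) \<odot> (E i \<otimes> L i)" "antipode_gen (gF i) = (- inverse (P i i)) \<odot> (F i \<otimes> K i)"
  "antipode_gen (gK i) = L i" "antipode_gen (gKbar i) = K i" "antipode_gen gJ = J"
  by (simp_all add: antipode_gen_def a_inv_smult KF)

lemma antipode_gen_closed: "antipode_gen g \<in> carrier B"
  by (cases g) simp_all

text \<open>For the Serre relations, \<open>qcomm_opp\<close> inverts the coefficients,
  \<open>qcomm_twist\<close> strips off the factors \<open>L i\<close> or \<open>K i\<close>, and
  \<open>qcomm_serre_inverse\<close> restores the original coefficients.\<close>

lemma wrel_antipode: "wrel a d q \<kappa> \<kappa>' (opp B) antipode_gen"
proof -
  have serre_opp: "qcomm (opp B) (serre_coeff (q ^ d i) (ms i j)) (antipode_gen (gE i)) (antipode_gen (gE j)) (ms i j) = \<zero>"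
    "qcomm (opp B) (serre_coeff (q ^ d i) (ms i j)) (antipode_gen (gF i)) (antipode_gen (gF j)) (ms i j) = \<zero>"
    if ij: "i \<noteq> j" for i j
  proof -
    let ?c = "serre_coeff (q ^ d i) (ms i j)"
    have c: "?c t \<noteq> 0" "(\<lambda>t. inverse (?c t)) = serre_coeff (inverse (q ^ d i)) (ms i j)" for t
      using qd_nonzero[of i] by (simp_all add: serre_coeff_def power_int_inverse fun_eq_iff)
    note inv = qcomm_serre_inverse[OF qd_nonzero qd_nonroot]
    obtain k where k: "qcomm (opp B) ?c (antipode_gen (gE i)) (antipode_gen (gE j)) (ms i j) =
        k \<odot> qcomm B (\<lambda>t. inverse (?c t)) (antipode_gen (gE i)) (antipode_gen (gE j)) (ms i j)"
      using qcomm_opp[of "antipode_gen (gE i)" "antipode_gen (gE j)" ?c] antipode_gen_closed c by metis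
    obtain \<mu> where "qcomm B (\<lambda>t. inverse (?c t)) (antipode_gen (gE i)) (antipode_gen (gE j)) (ms i j) =
        \<mu> \<odot> (qcomm B (\<lambda>t. inverse (?c t)) (E i) (E j) (ms i j) \<otimes> pow_mult (L i) (L j) (ms i j))"
      using qcomm_twist[of "E i" "E j" "L i" "L j" "inverse (P i i)" "inverse (P j i)" "\<lambda>t. inverse (?c t)" "- 1" "- 1" "ms i j"]
      by (auto simp: LL[of i j] LE P_sym[of i j])
    then show "qcomm (opp B) ?c (antipode_gen (gE i)) (antipode_gen (gE j)) (ms i j) = \<zero>"
      by (simp only: k c inv e_closed serre_E[OF ij]) simp
    obtain k' where k': "qcomm (opp B) ?c (antipode_gen (gF i)) (antipode_gen (gF j)) (ms i j) =
        k' \<odot> qcomm B (\<lambda>t. inverse (?c t)) (antipode_gen (gF i)) (antipode_gen (gF j)) (ms i j)"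
      using qcomm_opp[of "antipode_gen (gF i)" "antipode_gen (gF j)" ?c] antipode_gen_closed c by metis
    obtain \<mu>' where "qcomm B (\<lambda>t. inverse (?c t)) (antipode_gen (gF i)) (antipode_gen (gF j)) (ms i j) =
        \<mu>' \<odot> (qcomm B (\<lambda>t. inverse (?c t)) (F i) (F j) (ms i j) \<otimes> pow_mult (K i) (K j) (ms i j))"
      using qcomm_twist[of "F i" "F j" "K i" "K j" "inverse (P i i)" "inverse (P j i)" "\<lambda>t. inverse (?c t)" "- inverse (P i i)" "- inverse (P j j)" "ms i j"]
      by (auto simp: KK[of i j] KF P_sym[of i j])
    then show "qcomm (opp B) ?c (antipode_gen (gF i)) (antipode_gen (gF j)) (ms i j) = \<zero>"
      by (simp only: k' c inv e_closed serre_F[OF ij]) simp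
  qed
  have pinv: "P i j * (x * inverse (P i j)) = x" for i j x by simp
  have EFx: "E i \<otimes> (F i \<otimes> x) = F i \<otimes> (E i \<otimes> x) \<oplus> (kq i \<odot> (K i \<otimes> x) \<oplus> (- kq i) \<odot> (L i \<otimes> x))" if "x \<in> carrier B" for x i
    using that by (simp add: m_assoc[symmetric] EF_eq l_distr)
  have EFn: "E i \<otimes> (F j \<otimes> x) = F j \<otimes> (E i \<otimes> x)" if "x \<in> carrier B" "i \<noteq> j" for x i j
    using that by (simp add: m_assoc[symmetric] EF_neq)
  show ?thesis
  proof (intro wrel.intro wpre.intro wpre_axioms.intro wrel_axioms.intro cartan_q_axioms kalg_opp kalg_axioms)
    fix i j
    show "antipode_gen (gK i) \<otimes>\<^bsub>opp B\<^esub> antipode_gen (gK j) = antipode_gen (gK j) \<otimes>\<^bsub>opp B\<^esub> antipode_gen (gK i)"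
      "antipode_gen (gKbar i) \<otimes>\<^bsub>opp B\<^esub> antipode_gen (gKbar j) = antipode_gen (gKbar j) \<otimes>\<^bsub>opp B\<^esub> antipode_gen (gKbar i)"
      by (simp_all add: KK[of i j] LL[of i j])
    show "antipode_gen (gK j) \<otimes>\<^bsub>opp B\<^esub> antipode_gen (gE i) = P i j \<odot>\<^bsub>opp B\<^esub> (antipode_gen (gE i) \<otimes>\<^bsub>opp B\<^esub> antipode_gen (gK j))"
      "antipode_gen (gK j) \<otimes>\<^bsub>opp B\<^esub> antipode_gen (gF i) = inverse (P i j) \<odot>\<^bsub>opp B\<^esub> (antipode_gen (gF i) \<otimes>\<^bsub>opp B\<^esub> antipode_gen (gK j))"
      "antipode_gen (gKbar j) \<otimes>\<^bsub>opp B\<^esub> antipode_gen (gE i) = inverse (P i j) \<odot>\<^bsub>opp B\<^esub> (antipode_gen (gE i) \<otimes>\<^bsub>opp B\<^esub> antipode_gen (gKbar j))"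
      "antipode_gen (gKbar j) \<otimes>\<^bsub>opp B\<^esub> antipode_gen (gF i) = P i j \<odot>\<^bsub>opp B\<^esub> (antipode_gen (gF i) \<otimes>\<^bsub>opp B\<^esub> antipode_gen (gKbar j))"
      by (simp_all add: m_assoc K_rules LL[of i j] KK[of i j] mult_ac pinv)
    show "antipode_gen (gE i) \<otimes>\<^bsub>opp B\<^esub> antipode_gen (gF i) = antipode_gen (gF i) \<otimes>\<^bsub>opp B\<^esub> antipode_gen (gE i)
      \<oplus>\<^bsub>opp B\<^esub> (kq i \<odot>\<^bsub>opp B\<^esub> antipode_gen (gK i) \<oplus>\<^bsub>opp B\<^esub> (- kq i) \<odot>\<^bsub>opp B\<^esub> antipode_gen (gKbar i))"
    proof -
      let ?x = "K i" and ?y = "L i"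
      have "F i \<otimes> (E i \<otimes> J) \<oplus> (kq i \<odot> ?x \<oplus> (- kq i) \<odot> ?y) \<oplus> (kq i \<odot> ?y \<oplus> (- kq i) \<odot> ?x)
        = F i \<otimes> (E i \<otimes> J) \<oplus> (kq i \<odot> ?x \<oplus> (- kq i) \<odot> ?x) \<oplus> (kq i \<odot> ?y \<oplus> (- kq i) \<odot> ?y)"
        by (simp add: a_ac del: smult_cancel)
      then have "F i \<otimes> (E i \<otimes> J) \<oplus> (kq i \<odot> ?x \<oplus> (- kq i) \<odot> ?y) \<oplus> (kq i \<odot> ?y \<oplus> (- kq i) \<odot> ?x) = F i \<otimes> (E i \<otimes> J)"
        by simp
      then show ?thesis by (simp add: m_assoc K_rules EFx)
    qed
  qed (simp_all add: antipode_gen_closed[simplified] m_assoc K_rules serre_opp EFn E2 F2 P_sym mult_ac del: antipode_gen_simps(1,2) | simp add: m_assoc K_rules EFn P_sym mult_ac antipode_gen_closed del: mult_smult_l)+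
qed

section \<open>Diagonal maps, diagram maps and the counit on generators\<close>

definition diag_gen where
  "diag_gen b g = (case g of
     gE i \<Rightarrow> b i \<odot> E i | gF i \<Rightarrow> inverse (b i) \<odot> F i | gK i \<Rightarrow> K i | gKbar i \<Rightarrow> L i | gJ \<Rightarrow> J)"

lemma diag_gen_simps [simp]:
  "diag_gen b (gE i) = b i \<odot> E i" "diag_gen b (gF i) = inverse (b i) \<odot> F i"
  "diag_gen b (gK i) = K i" "diag_gen b (gKbar i) = L i" "diag_gen b gJ = J"
  by (simp_all add: diag_gen_def)

lemma diag_gen_closed [simp]: "diag_gen b g \<in> carrier B"
  by (cases g) simp_all

lemma qcomm_scale: "x \<in> carrier B \<Longrightarrow> y \<in> carrier B \<Longrightarrow> \<exists>\<mu>. qcomm B c (s \<odot> x) (s' \<odot> y) n = \<mu> \<odot> qcomm B c x y n"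
proof (induction n)
  case (Suc n)
  then obtain \<mu> where "qcomm B c (s \<odot> x) (s' \<odot> y) n = \<mu> \<odot> qcomm B c x y n" by auto
  then have "qcomm B c (s \<odot> x) (s' \<odot> y) (Suc n) = (\<mu> * s) \<odot> qcomm B c x y (Suc n)"
    using Suc by (simp add: smult_r_distr mult_ac)
  then show ?case by blast
qed auto

lemma wrel_diag:
  assumes b: "\<And>i. b i \<noteq> 0"
  shows "wrel a d q \<kappa> \<kappa>' B (diag_gen b)"
proof -
  have s: "qcomm B (serre_coeff (q ^ d i) (ms i j)) (x \<odot> E i) (y \<odot> E j) (ms i j) = \<zero>"
    "qcomm B (serre_coeff (q ^ d i) (ms i j)) (x \<odot> F i) (y \<odot> F j) (ms i j) = \<zero>" if "i \<noteq> j" for i j x y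
    using qcomm_scale[of "E i" "E j" "serre_coeff (q ^ d i) (ms i j)" x y "ms i j"]
      qcomm_scale[of "F i" "F j" "serre_coeff (q ^ d i) (ms i j)" x y "ms i j"] serre_E[OF that] serre_F[OF that] by auto
  show ?thesis
    by (intro wrel.intro wpre.intro wpre_axioms.intro wrel_axioms.intro cartan_q_axioms kalg_axioms)
      (simp_all add: s K_rules KK LL E2 F2 EF_neq EF_eq b mult_ac)
qed

text \<open>The diagonal entries \<open>a i i = 2\<close> show that \<sigma> preserves
  \<open>d\<close>, and then \<open>a\<close>; so all constants in the relations are
  preserved.\<close>

lemma wrel_diagram:
  assumes \<sigma>: "bij \<sigma>" "\<And>i j. int (d i) * a i j = int (d (\<sigma> i)) * a (\<sigma> i) (\<sigma> j)"
    and \<kappa>\<sigma>: "\<And>i. \<kappa> (\<sigma> i) = \<kappa> i" "\<And>i. \<kappa>' (\<sigma> i) = \<kappa>' i"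
  shows "wrel a d q \<kappa> \<kappa>' B (\<lambda>g. e (map_gen \<sigma> g))"
proof -
  have d: "d (\<sigma> i) = d i" for i using \<sigma>(2)[of i i] by (simp add: a_diag)
  have aa: "a (\<sigma> i) (\<sigma> j) = a i j" for i j using \<sigma>(2)[of i j] d_pos[of i] by (simp add: d)
  have eq: "P (\<sigma> i) (\<sigma> j) = P i j" "kq (\<sigma> i) = kq i" "ms (\<sigma> i) (\<sigma> j) = ms i j" for i j
    by (simp_all add: P_def kq_def ms_def aa d)
  have neq: "i \<noteq> j \<Longrightarrow> \<sigma> i \<noteq> \<sigma> j" for i j using \<sigma>(1) by (auto dest: bij_is_inj injD)
  show ?thesis
    using serre_E[OF neq] serre_F[OF neq]
    by (intro wrel.intro wpre.intro wpre_axioms.intro wrel_axioms.intro cartan_q_axioms kalg_axioms)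
      (simp_all add: K_rules KK LL E2 F2 \<kappa>\<sigma> EF_neq neq EF_eq eq d)
qed

end

lemma (in cartan_q) wrel_counit:
  "wrel a d q \<kappa> \<kappa>' base_alg (\<lambda>g. case g of gE i \<Rightarrow> 0 | gF i \<Rightarrow> 0 | gK i \<Rightarrow> 1 | gKbar i \<Rightarrow> 1 | gJ \<Rightarrow> 1)"
proof -
  have "qcomm (base_alg :: ('k, 'k) module) c 0 0 n = 0" for c n by (induction n) simp_all
  then show ?thesis
    by (intro wrel.intro wpre.intro wpre_axioms.intro wrel_axioms.intro cartan_q_axioms kalg_base_alg) simp_all
qed

section \<open>Verma modules\<close>

locale fun_subspace =
  fixes M :: "('s \<Rightarrow> 'k::field) set"
  assumes M_nonempty: "M \<noteq> {}"
    and M_add: "f \<in> M \<Longrightarrow> g \<in> M \<Longrightarrow> (\<lambda>w. f w + g w) \<in> M"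
    and M_scale: "f \<in> M \<Longrightarrow> (\<lambda>w. c * f w) \<in> M"
begin

lemma M_zero: "(\<lambda>w. 0) \<in> M"
  using M_nonempty M_scale[of _ 0] by auto

text \<open>Operators are extensional, so that operators agreeing on \<open>M\<close> are equal and
  the ring axioms hold as equations.\<close>

definition lin_op :: "(('s \<Rightarrow> 'k) \<Rightarrow> ('s \<Rightarrow> 'k)) \<Rightarrow> bool" where
  "lin_op T \<longleftrightarrow> T \<in> extensional M \<and> T \<in> M \<rightarrow> M \<and>
     (\<forall>f\<in>M. \<forall>g\<in>M. T (\<lambda>w. f w + g w) = (\<lambda>w. T f w + T g w)) \<and>
     (\<forall>f\<in>M. \<forall>c. T (\<lambda>w. c * f w) = (\<lambda>w. c * T f w))"

text \<open>The product is composition in the reverse order: operators act from the right.\<close>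

definition end_alg :: "('k, ('s \<Rightarrow> 'k) \<Rightarrow> ('s \<Rightarrow> 'k)) module" where
  "end_alg = \<lparr>carrier = {T. lin_op T}, mult = (\<lambda>S T. \<lambda>f\<in>M. T (S f)), one = (\<lambda>f\<in>M. f),
     zero = (\<lambda>f\<in>M. \<lambda>w. 0), add = (\<lambda>S T. \<lambda>f\<in>M. \<lambda>w. S f w + T f w), smult = (\<lambda>c T. \<lambda>f\<in>M. \<lambda>w. c * T f w)\<rparr>"

lemma end_alg_simps [simp]:
  "carrier end_alg = {T. lin_op T}" "S \<otimes>\<^bsub>end_alg\<^esub> T = (\<lambda>f\<in>M. T (S f))" "\<one>\<^bsub>end_alg\<^esub> = (\<lambda>f\<in>M. f)"
  "\<zero>\<^bsub>end_alg\<^esub> = (\<lambda>f\<in>M. \<lambda>w. 0)" "S \<oplus>\<^bsub>end_alg\<^esub> T = (\<lambda>f\<in>M. \<lambda>w. S f w + T f w)"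
  "c \<odot>\<^bsub>end_alg\<^esub> T = (\<lambda>f\<in>M. \<lambda>w. c * T f w)"
  by (simp_all add: end_alg_def)

lemma
  assumes "lin_op T"
  shows lin_op_ext: "T \<in> extensional M" and lin_op_mem: "f \<in> M \<Longrightarrow> T f \<in> M"
    and lin_op_add: "f \<in> M \<Longrightarrow> g \<in> M \<Longrightarrow> T (\<lambda>w. f w + g w) = (\<lambda>w. T f w + T g w)"
    and lin_op_scale: "f \<in> M \<Longrightarrow> T (\<lambda>w. c * f w) = (\<lambda>w. c * T f w)"
  using assms by (auto simp: lin_op_def)

lemma lin_op_zero: "lin_op T \<Longrightarrow> T (\<lambda>w. 0) = (\<lambda>w. 0)"
  using lin_op_scale[of T "\<lambda>w. 0" 0] M_zero by simp

lemma lin_op_restrict: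
  assumes "\<And>f. f \<in> M \<Longrightarrow> T f \<in> M" "\<And>f g. T (\<lambda>w. f w + g w) = (\<lambda>w. T f w + T g w)"
    "\<And>f c. T (\<lambda>w. c * f w) = (\<lambda>w. c * T f w)"
  shows "lin_op (restrict T M)"
  using assms M_add M_scale by (simp add: lin_op_def)

lemma end_alg_eqI: "\<lbrakk>S \<in> extensional M; T \<in> extensional M; \<And>f w. f \<in> M \<Longrightarrow> S f w = T f w\<rbrakk> \<Longrightarrow> S = T"
  by (rule extensionalityI) (auto simp: fun_eq_iff)

lemma kalg_end_alg: "kalg end_alg"
proof -
  note L = lin_op_ext lin_op_mem lin_op_add lin_op_scale lin_op_zero M_add M_scale M_zero
  have cl: "lin_op (\<lambda>f\<in>M. T (S f))" "lin_op (\<lambda>f\<in>M. \<lambda>w. S f w + T f w)" "lin_op (\<lambda>f\<in>M. \<lambda>w. c * S f w)"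
    if "lin_op S" "lin_op T" for S T c
    using that by (simp_all add: lin_op_def M_add M_scale Pi_iff algebra_simps)
  have id: "lin_op (\<lambda>f\<in>M. f)" and z: "lin_op (\<lambda>f\<in>M. \<lambda>w. 0)"
    by (simp_all add: lin_op_def M_add M_scale M_zero)
  have "Ring.ring end_alg"
  proof (rule ringI)
    show "abelian_group end_alg"
    proof (rule abelian_groupI)
      fix T assume "T \<in> carrier end_alg"
      then show "\<exists>S\<in>carrier end_alg. S \<oplus>\<^bsub>end_alg\<^esub> T = \<zero>\<^bsub>end_alg\<^esub>"
        using cl(3)[of T T "-1"]
        by (intro bexI[of _ "\<lambda>f\<in>M. \<lambda>w. (-1) * T f w"] end_alg_eqI) auto
    qed (auto intro!: end_alg_eqI simp: cl z add_ac L)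
    show "Group.monoid end_alg"
      by (rule monoidI) (auto intro!: end_alg_eqI simp: cl id L)
  qed (auto intro!: end_alg_eqI simp: L)
  then show ?thesis
    by (intro kalg.intro kalg_axioms.intro) (auto intro!: end_alg_eqI simp: cl L algebra_simps)
qed

end

lemma (in kalg) qcomm_swap:
  assumes car: "x \<in> carrier A" "y \<in> carrier A" "k \<in> carrier A"
    and kx: "k \<otimes> x = \<alpha> \<odot> (x \<otimes> k)" and ky: "k \<otimes> y = \<beta> \<odot> (y \<otimes> k)"
  shows "k \<otimes> qcomm A c x y n = (\<alpha> ^ n * \<beta>) \<odot> (qcomm A c x y n \<otimes> k)"
proof (induction n)
  case (Suc n)
  show ?case using car
    by (simp add: r_distr l_distr smult_r_distr swap_assoc[OF kx] swap_assoc[OF Suc] Suc kx m_assoc mult_ac)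
qed (simp add: ky)

context cartan_q begin

text \<open>The functions on words form the dual of the Verma module with basis the words in the \<open>F\<^sub>i\<close> and
  highest weight \<open>l\<close>; the generators act on it from the right. The smallest submodule containing the
  functional dual to the highest weight vector is the dual of the simple quotient, on which the Serre
  elements vanish because those in the \<open>F\<^sub>i\<close> commute with all \<open>E\<^sub>i\<close>.\<close>

definition wt :: "('i \<Rightarrow> int) \<Rightarrow> 'i \<Rightarrow> 'i list \<Rightarrow> int" where
  "wt l j u = int (d j) * l j - (\<Sum>i\<leftarrow>u. int (d j) * a j i)"

text \<open>The value of \<open>f\<close> at \<open>E i\<close> applied to the basis vector of the
  word: \<open>E i\<close> is moved to the right through the letters, each \<open>F i\<close>
  contributing the commutator evaluated on the rest of the word, until it annihilates the highest
  weight vector.\<close>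

primrec vermaE :: "('i \<Rightarrow> int) \<Rightarrow> 'i \<Rightarrow> 'i list \<Rightarrow> ('i list \<Rightarrow> 'k) \<Rightarrow> 'k" where
  "vermaE l i [] f = 0"
| "vermaE l i (k # u) f = vermaE l i u (\<lambda>u. f (k # u)) +
     (if i = k then kq i * (q powi wt l i u - q powi (- wt l i u)) * f u else 0)"

definition verma_op :: "('i \<Rightarrow> int) \<Rightarrow> 'i gen \<Rightarrow> ('i list \<Rightarrow> 'k) \<Rightarrow> 'i list \<Rightarrow> 'k" where
  "verma_op l g f u = (case g of gE i \<Rightarrow> vermaE l i u f | gF i \<Rightarrow> f (i # u)
     | gK i \<Rightarrow> q powi wt l i u * f u | gKbar i \<Rightarrow> q powi (- wt l i u) * f u | gJ \<Rightarrow> f u)"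

definition vac :: "'i list \<Rightarrow> 'k" where "vac u = (if u = [] then 1 else 0)"

text \<open>Closure under the \<open>F i\<close> is not a clause but is proved in
  \<open>verma_dual_F\<close>. Inductions thus start at \<open>vac\<close>, which every
  \<open>F i\<close> kills, and meet only operators that the Serre elements in the
  \<open>F i\<close> can be moved past.\<close>

inductive_set verma_dual :: "('i \<Rightarrow> int) \<Rightarrow> ('i list \<Rightarrow> 'k) set" for l where
  vac: "vac \<in> verma_dual l"
| E: "f \<in> verma_dual l \<Longrightarrow> verma_op l (gE i) f \<in> verma_dual l"
| K: "f \<in> verma_dual l \<Longrightarrow> verma_op l (gK i) f \<in> verma_dual l"
| L: "f \<in> verma_dual l \<Longrightarrow> verma_op l (gKbar i) f \<in> verma_dual l"
| add: "f \<in> verma_dual l \<Longrightarrow> g \<in> verma_dual l \<Longrightarrow> (\<lambda>w. f w + g w) \<in> verma_dual l"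
| scale: "f \<in> verma_dual l \<Longrightarrow> (\<lambda>w. c * f w) \<in> verma_dual l"

lemma verma_op_simps:
  "verma_op l (gE i) f = (\<lambda>u. vermaE l i u f)" "verma_op l (gF i) f = (\<lambda>u. f (i # u))"
  "verma_op l (gK i) f = (\<lambda>u. q powi wt l i u * f u)" "verma_op l (gKbar i) f = (\<lambda>u. q powi (- wt l i u) * f u)"
  "verma_op l gJ f = f"
  by (simp_all add: verma_op_def fun_eq_iff)

lemma vermaE_add: "vermaE l i u (\<lambda>w. f w + g w) = vermaE l i u f + vermaE l i u g"
  by (induction u arbitrary: f g) (simp_all add: algebra_simps)

lemma vermaE_scale: "vermaE l i u (\<lambda>w. c * f w) = c * vermaE l i u f"
  by (induction u arbitrary: f) (simp_all add: algebra_simps)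

lemma verma_op_lin:
  "verma_op l g (\<lambda>w. f w + h w) = (\<lambda>w. verma_op l g f w + verma_op l g h w)"
  "verma_op l g (\<lambda>w. c * f w) = (\<lambda>w. c * verma_op l g f w)"
  by (cases g; simp add: verma_op_simps vermaE_add vermaE_scale algebra_simps)+

lemma wt_Cons: "wt l j (i # u) = wt l j u - int (d j) * a j i"
  by (simp add: wt_def)

lemma q_wt_Cons: "q powi wt l j (i # u) = inverse (P i j) * q powi wt l j u"
  "q powi (- wt l j (i # u)) = P i j * q powi (- wt l j u)"
proof -
  have P: "P i j = q powi (int (d j) * a j i)" by (simp add: P_powi d_sym[of i j])
  have "wt l j (i # u) = - (int (d j) * a j i) + wt l j u" "- wt l j (i # u) = int (d j) * a j i + (- wt l j u)"
    by (simp_all add: wt_Cons)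
  then show "q powi wt l j (i # u) = inverse (P i j) * q powi wt l j u"
    "q powi (- wt l j (i # u)) = P i j * q powi (- wt l j u)"
    using q0 by (simp_all only: P power_int_add power_int_minus simp_thms)
qed

lemma P_cancel: "P i j * (inverse (P i j) * x) = x"
  by (simp add: mult.assoc[symmetric])

lemma vermaE_K: "vermaE l i u (\<lambda>u. q powi wt l j u * f u) = P i j * (q powi wt l j u * vermaE l i u f)"
proof (induction u arbitrary: f)
  case (Cons k u)
  have "vermaE l i u (\<lambda>u. q powi wt l j (k # u) * f (k # u))
      = inverse (P k j) * vermaE l i u (\<lambda>u. q powi wt l j u * f (k # u))"
    by (simp add: q_wt_Cons vermaE_scale[symmetric] mult.assoc)
  then show ?case unfolding vermaE.simps Cons.IH q_wt_Cons by (simp add: algebra_simps P_cancel)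
qed simp

lemma vermaE_L: "vermaE l i u (\<lambda>u. q powi (- wt l j u) * f u) = inverse (P i j) * (q powi (- wt l j u) * vermaE l i u f)"
proof (induction u arbitrary: f)
  case (Cons k u)
  have "vermaE l i u (\<lambda>u. q powi (- wt l j (k # u)) * f (k # u))
      = P k j * vermaE l i u (\<lambda>u. q powi (- wt l j u) * f (k # u))"
    by (simp only: q_wt_Cons vermaE_scale[symmetric] mult.assoc)
  then show ?case unfolding vermaE.simps Cons.IH q_wt_Cons by (simp add: algebra_simps P_cancel)
qed simp

text \<open>The recursion for \<open>vermaE\<close> is the commutator relation itself, read on one
  letter.\<close>

lemma verma_EF:
  "verma_op l (gF j) (verma_op l (gE i) f) = (\<lambda>u. verma_op l (gE i) (verma_op l (gF j) f) u +
     (if i = j then kq i * verma_op l (gK i) f u + (- kq i) * verma_op l (gKbar i) f u else 0))"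
  by (auto simp: verma_op_simps fun_eq_iff algebra_simps)

text \<open>\<open>vac\<close> is killed by \<open>F j\<close>, and \<open>F j\<close> moves past
  the other operators up to scalars and terms in \<open>K j\<close> and \<open>L j\<close>.\<close>

lemma verma_dual_F: "f \<in> verma_dual l \<Longrightarrow> verma_op l (gF j) f \<in> verma_dual l"
proof (induction rule: verma_dual.induct)
  case vac
  have "verma_op l (gF j) vac = (\<lambda>w. 0 * vac w)" by (simp add: verma_op_simps vac_def)
  then show ?case using verma_dual.vac verma_dual.scale by metis
next
  case (E f i)
  then have "(\<lambda>u. verma_op l (gE i) (verma_op l (gF j) f) u + (kq i * verma_op l (gK i) f u + (- kq i) * verma_op l (gKbar i) f u)) \<in> verma_dual l"
    by (intro verma_dual.intros)
  moreover have "verma_op l (gE i) (verma_op l (gF j) f) \<in> verma_dual l" using E by (intro verma_dual.intros)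
  ultimately show ?case unfolding verma_EF by (cases "i = j") simp_all
next
  case (K f i)
  have "verma_op l (gF j) (verma_op l (gK i) f) = (\<lambda>u. inverse (P j i) * verma_op l (gK i) (verma_op l (gF j) f) u)"
    by (simp add: verma_op_simps q_wt_Cons mult.assoc)
  then show ?case using K by (simp add: verma_dual.intros)
next
  case (L f i)
  have "verma_op l (gF j) (verma_op l (gKbar i) f) = (\<lambda>u. P j i * verma_op l (gKbar i) (verma_op l (gF j) f) u)"
    by (simp add: verma_op_simps q_wt_Cons(2) mult.assoc)
  then show ?case using L by (simp add: verma_dual.intros)
qed (simp_all add: verma_op_lin verma_dual.intros)

lemma verma_dual_op: "f \<in> verma_dual l \<Longrightarrow> verma_op l g f \<in> verma_dual l"
  by (cases g) (simp_all add: verma_dual_F verma_dual.intros, simp add: verma_op_simps)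

end

locale verma = cartan_q a d q \<kappa> \<kappa>'
  for a :: "'i::finite \<Rightarrow> 'i \<Rightarrow> int" and d and q :: "'k::field" and \<kappa> \<kappa>' +
  fixes l :: "'i \<Rightarrow> int"
begin

sublocale V: fun_subspace "verma_dual l"
  by unfold_locales (auto intro: verma_dual.intros)

definition act :: "'i gen \<Rightarrow> ('i list \<Rightarrow> 'k) \<Rightarrow> 'i list \<Rightarrow> 'k" where
  "act g = restrict (verma_op l g) (verma_dual l)"

lemma act_eq [simp]: "f \<in> verma_dual l \<Longrightarrow> act g f = verma_op l g f"
  by (simp add: act_def)

lemma act_closed: "act g \<in> carrier V.end_alg"
  unfolding act_def by (simp add: V.lin_op_restrict verma_dual_op verma_op_lin)

lemma wpre_act: "wpre a d q \<kappa> \<kappa>' V.end_alg act"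
proof -
  have q: "q powi x * (q powi - x * y) = y" "q powi - x * (q powi x * y) = y" for x y
    using q0 by (simp_all add: power_int_minus)
  show ?thesis
    by (intro wpre.intro wpre_axioms.intro cartan_q_axioms V.kalg_end_alg act_closed,
      auto intro!: V.end_alg_eqI simp: verma_dual_op verma_EF,
      simp_all add: verma_op_simps vermaE_K vermaE_L q_wt_Cons(1) q_wt_Cons(2) q,
      simp_all add: act_def mult_ac)
qed

sublocale act: wpre a d q \<kappa> \<kappa>' V.end_alg act
  by (rule wpre_act)

text \<open>The element kills \<open>vac\<close> and commutes, up to scalars, with the operators
  that generate the module from \<open>vac\<close>.\<close>

lemma serre_F_zero:
  assumes ij: "i \<noteq> j" and f: "f \<in> verma_dual l"
  shows "qcomm V.end_alg (serre_coeff (q ^ d i) (ms i j)) (act (gF i)) (act (gF j)) (ms i j) f = (\<lambda>w. 0)"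
proof -
  let ?S = "qcomm V.end_alg (serre_coeff (q ^ d i) (ms i j)) (act (gF i)) (act (gF j))"
  have S: "V.lin_op (?S n)" for n
    using act.qcomm_closed[of "act (gF i)" "act (gF j)"] act_closed by simp
  note S0 = V.lin_op_zero[OF S]
  have vac0: "verma_op l (gF j) vac = (\<lambda>w. 0)" for j by (simp add: verma_op_simps vac_def)
  have F0: "verma_op l g (\<lambda>w. 0) = (\<lambda>w. 0)" for g
    using verma_op_lin(2)[of l g 0 "\<lambda>w. 0"] by simp
  show ?thesis using f
  proof (induction rule: verma_dual.induct)
    case vac
    have "?S n vac = (\<lambda>w. 0)" for n
    proof (induction n)
      case (Suc n)
      then show ?case by (simp add: verma_dual.vac vac0 S0 V.M_zero F0)
    qed (simp add: verma_dual.vac vac0)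
    then show ?case .
  next
    case (E f k)
    have "(act (gE k) \<otimes>\<^bsub>V.end_alg\<^esub> ?S (ms i j)) f = (?S (ms i j) \<otimes>\<^bsub>V.end_alg\<^esub> act (gE k)) f"
      using act.E_commutes_serre_F[OF ij] by simp
    then show ?case using E by (simp add: V.M_zero F0)
  next
    case (K f k)
    have "(act (gK k) \<otimes>\<^bsub>V.end_alg\<^esub> ?S (ms i j)) f = ((inverse (P i k) ^ ms i j * inverse (P j k)) \<odot>\<^bsub>V.end_alg\<^esub> (?S (ms i j) \<otimes>\<^bsub>V.end_alg\<^esub> act (gK k))) f"
      using act.qcomm_swap[OF act.e_closed act.e_closed act.e_closed act.KF act.KF] by (rule fun_cong)
    then show ?case using K by (simp add: V.M_zero F0)
  next
    case (L f k)
    have "(act (gKbar k) \<otimes>\<^bsub>V.end_alg\<^esub> ?S (ms i j)) f = ((P i k ^ ms i j * P j k) \<odot>\<^bsub>V.end_alg\<^esub> (?S (ms i j) \<otimes>\<^bsub>V.end_alg\<^esub> act (gKbar k))) f"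
      using act.qcomm_swap[OF act.e_closed act.e_closed act.e_closed act.LF act.LF] by (rule fun_cong)
    then show ?case using L by (simp add: V.M_zero F0)
  next
    case (add f g) then show ?case using V.lin_op_add[OF S] by simp
  next
    case (scale f c) then show ?case using V.lin_op_scale[OF S] by simp
  qed
qed

text \<open>A functional in the image of some \<open>E i\<close> vanishes at the empty word. Letters
  of a longer word are split off by the operators \<open>F k\<close>, with which the Serre element
  commutes.\<close>

lemma serre_E_zero:
  assumes ij: "i \<noteq> j" and f: "f \<in> verma_dual l"
  shows "qcomm V.end_alg (serre_coeff (q ^ d i) (ms i j)) (act (gE i)) (act (gE j)) (ms i j) f u = 0"
proof -
  let ?S = "qcomm V.end_alg (serre_coeff (q ^ d i) (ms i j)) (act (gE i)) (act (gE j))"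
  have S: "V.lin_op (?S n)" for n
    using act.qcomm_closed[of "act (gE i)" "act (gE j)"] act_closed by simp
  show ?thesis using f
  proof (induction u arbitrary: f)
    case Nil
    have "?S n f [] = 0" if "f \<in> verma_dual l" for n f
      using that
    proof (induction n arbitrary: f)
      case (Suc n)
      then show ?case by (simp add: verma_dual.E V.lin_op_mem[OF S]) (simp add: verma_op_simps)
    qed (simp add: verma_op_simps)
    then show ?case using Nil by simp
  next
    case (Cons k u)
    have "(act (gF k) \<otimes>\<^bsub>V.end_alg\<^esub> ?S (ms i j)) f u = (?S (ms i j) \<otimes>\<^bsub>V.end_alg\<^esub> act (gF k)) f u"
      using act.F_commutes_serre_E[OF ij] by simp
    then have "?S (ms i j) (verma_op l (gF k) f) u = verma_op l (gF k) (?S (ms i j) f) u"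
      using Cons.prems V.lin_op_mem[OF S] by simp
    moreover have "?S (ms i j) (verma_op l (gF k) f) u = 0"
      by (rule Cons.IH[OF verma_dual_F[OF Cons.prems]])
    ultimately show ?case by (simp add: verma_op_simps(2))
  qed
qed

lemma wrel_act: "wrel a d q \<kappa> \<kappa>' V.end_alg act"
proof (intro wrel.intro wpre_act wrel_axioms.intro)
  fix i j :: 'i assume ij: "i \<noteq> j"
  show "qcomm V.end_alg (serre_coeff (q ^ d i) (ms i j)) (act (gE i)) (act (gE j)) (ms i j) = \<zero>\<^bsub>V.end_alg\<^esub>"
    "qcomm V.end_alg (serre_coeff (q ^ d i) (ms i j)) (act (gF i)) (act (gF j)) (ms i j) = \<zero>\<^bsub>V.end_alg\<^esub>"
    using V.lin_op_ext act.qcomm_closed[of "act _" "act _"] act_closed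
    by (auto intro!: V.end_alg_eqI simp: serre_E_zero[OF ij] serre_F_zero[OF ij])
qed

end

section \<open>Group-like words\<close>

locale weak_quantum = cartan_q a d q \<kappa> \<kappa>'
  for a :: "'i::finite \<Rightarrow> 'i \<Rightarrow> int" and d and q :: "'k::field" and \<kappa> \<kappa>'
begin

sublocale wrel a d q \<kappa> \<kappa>' W w
  by (rule wrel_W)

abbreviation mW (infixl \<open>\<star>\<close> 70) where "x \<star> y \<equiv> x \<otimes>\<^bsub>W\<^esub> y"
abbreviation "wc \<equiv> word_class rels"
abbreviation lfun :: "(('i, 'k) w_elem \<Rightarrow> 'k) set" where "lfun \<equiv> klin W base_alg"

lemma wc_closed [simp]: "wc u \<in> carrier W"
  by (simp add: w_alg_def)

lemma wc_Nil [simp]: "wc [] = \<one>\<^bsub>W\<^esub>"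
  by (simp add: w_alg_def word_class_Nil)

lemma wc_Cons: "wc (x # u) = w x \<star> wc u"
  by (simp add: w_alg_def w_gen_def word_class_Cons)

lemma wc_single: "wc [x] = w x"
  by (simp add: wc_Cons)

lemma wc_append: "wc (u @ v) = wc u \<star> wc v"
  by (simp add: w_alg_def word_class_append)

lemma hom_from_W:
  assumes "wrel a d q \<kappa> \<kappa>' C f"
  shows "extend_hom rels C f \<in> alg_hom W C" "extend_hom rels C f (wc u) = word_prod C f u"
    "extend_hom rels C f (w x) = f x"
proof -
  interpret h: presented_hom C rels f by (rule wrel.presented_hom[OF assms])
  show "extend_hom rels C f \<in> alg_hom W C" using h.extend_alg_hom by (simp add: w_alg_def)
  show "extend_hom rels C f (wc u) = word_prod C f u" by (rule h.extend_word_class)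
  show "extend_hom rels C f (w x) = f x" by (simp add: w_gen_def)
qed

definition isK :: "'i gen \<Rightarrow> bool" where
  "isK g \<longleftrightarrow> (case g of gE i \<Rightarrow> False | gF i \<Rightarrow> False | _ \<Rightarrow> True)"

definition kword :: "'i gen list \<Rightarrow> bool" where "kword u \<longleftrightarrow> list_all isK u"

text \<open>\<open>gJ\<close> has exponent zero, so exponents do not distinguish \<open>[gJ]\<close>
  from the empty word; these are kept apart by emptiness.\<close>

definition letter_expo :: "'i gen \<Rightarrow> 'i \<Rightarrow> int" where
  "letter_expo g j = (case g of gK i \<Rightarrow> of_bool (i = j) | gKbar i \<Rightarrow> - of_bool (i = j) | _ \<Rightarrow> 0)"

definition expo :: "'i gen list \<Rightarrow> 'i \<Rightarrow> int" where "expo u j = (\<Sum>x\<leftarrow>u. letter_expo x j)"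

lemma isK_simps [simp]: "isK (gK i)" "isK (gKbar i)" "isK gJ" "\<not> isK (gE i)" "\<not> isK (gF i)"
  by (simp_all add: isK_def)

lemma kword_simps [simp]: "kword []" "kword (x # u) \<longleftrightarrow> isK x \<and> kword u" "kword (u @ v) \<longleftrightarrow> kword u \<and> kword v"
  by (simp_all add: kword_def)

lemma expo_simps [simp]: "expo [] j = 0" "expo (x # u) j = letter_expo x j + expo u j" "expo (u @ v) j = expo u j + expo v j"
  by (simp_all add: expo_def)

lemma letter_expo_simps [simp]:
  "letter_expo (gK i) j = of_bool (i = j)" "letter_expo (gKbar i) j = - of_bool (i = j)" "letter_expo gJ j = 0"
  "letter_expo (gE i) j = 0" "letter_expo (gF i) j = 0"
  by (simp_all add: letter_expo_def)

lemma K_letters_commute: "isK x \<Longrightarrow> isK y \<Longrightarrow> w x \<star> w y = w y \<star> w x"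
  by (cases x; cases y; simp add: KK[of _ "_ :: 'i"] LL[of _ "_ :: 'i"] LK)

lemma K_letter_kword: "isK x \<Longrightarrow> kword u \<Longrightarrow> w x \<star> wc u = wc u \<star> w x"
proof (induction u)
  case (Cons y u)
  have "w x \<star> wc (y # u) = (w x \<star> w y) \<star> wc u" by (simp add: wc_Cons m_assoc)
  also have "\<dots> = w y \<star> (w x \<star> wc u)" using K_letters_commute[of x y] Cons by (simp add: m_assoc)
  finally show ?case using Cons by (simp add: wc_Cons m_assoc)
qed simp

lemma kwords_commute: "kword u \<Longrightarrow> kword v \<Longrightarrow> wc u \<star> wc v = wc v \<star> wc u"
proof (induction u)
  case (Cons x u)
  have "wc (x # u) \<star> wc v = w x \<star> (wc v \<star> wc u)" using Cons by (simp add: wc_Cons m_assoc)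
  also have "\<dots> = (wc v \<star> w x) \<star> wc u" using K_letter_kword[of x v] Cons by (simp add: m_assoc[symmetric])
  finally show ?case by (simp add: wc_Cons m_assoc)
qed simp

lemma J_letter: "isK x \<Longrightarrow> J \<star> w x = w x"
  by (cases x) simp_all

lemma J_kword: "kword u \<Longrightarrow> u \<noteq> [] \<Longrightarrow> wc (gJ # u) = wc u"
  by (cases u) (simp_all add: wc_Cons J_letter m_assoc[symmetric])

lemma expo_neg_mem: "kword u \<Longrightarrow> expo u i < 0 \<Longrightarrow> gKbar i \<in> set u"
proof (induction u)
  case (Cons x u) then show ?case by (cases x) (auto simp: of_bool_def split: if_splits)
qed simp

lemma expo_pos_mem: "kword u \<Longrightarrow> expo u i > 0 \<Longrightarrow> gK i \<in> set u"
proof (induction u)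
  case (Cons x u) then show ?case by (cases x) (auto simp: of_bool_def split: if_splits)
qed simp

text \<open>The leading \<open>J\<close> covers the case in which nothing else remains after the
  cancellation.\<close>

lemma kword_cancel:
  assumes "kword v1" "isK x" "isK y" "w x \<star> w y = J"
  shows "wc (gJ # x # v1 @ y # v2) = wc (gJ # v1 @ v2)"
proof -
  have "wc (gJ # x # v1 @ y # v2) = J \<star> (w x \<star> ((wc v1 \<star> w y) \<star> wc v2))"
    by (simp add: wc_Cons wc_append m_assoc)
  also have "wc v1 \<star> w y = w y \<star> wc v1" using K_letter_kword assms by simp
  also have "J \<star> (w x \<star> ((w y \<star> wc v1) \<star> wc v2)) = J \<star> ((w x \<star> w y) \<star> (wc v1 \<star> wc v2))"
    by (simp add: m_assoc)
  also have "\<dots> = (J \<star> J) \<star> (wc v1 \<star> wc v2)" by (simp only: assms(4) m_assoc wc_closed w_closed m_closed)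
  finally show ?thesis by (simp add: wc_Cons wc_append)
qed

lemma kword_expo_zero: "kword u \<Longrightarrow> (\<And>j. expo u j = 0) \<Longrightarrow> wc (gJ # u) = J"
proof (induction "length u" arbitrary: u rule: less_induct)
  case less
  show ?case
  proof (cases u)
    case Nil then show ?thesis by (simp add: wc_single)
  next
    case (Cons x v)
    have xv: "isK x" "kword v" using less.prems Cons by auto
    consider "x = gJ" | i where "x = gK i" | i where "x = gKbar i" using xv by (cases x) auto
    then show ?thesis
    proof cases
      case 1
      have "wc (gJ # v) = J" using less.prems xv Cons 1 by (intro less.hyps) auto
      then show ?thesis using Cons 1 by (simp add: wc_Cons m_assoc[symmetric])
    next
      case 2
      have "expo v i < 0" using less.prems(2)[of i] Cons 2 by simp
      then obtain v1 v2 where v: "v = v1 @ gKbar i # v2" using expo_neg_mem xv split_list by metis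
      have "wc (gJ # v1 @ v2) = J"
        using less.prems xv Cons 2 v by (intro less.hyps) auto
      then show ?thesis using kword_cancel[of v1 x "gKbar i" v2] xv v Cons 2 KL by simp
    next
      case 3
      have "expo v i > 0" using less.prems(2)[of i] Cons 3 by simp
      then obtain v1 v2 where v: "v = v1 @ gK i # v2" using expo_pos_mem xv split_list by metis
      have "wc (gJ # v1 @ v2) = J"
        using less.prems xv Cons 3 v by (intro less.hyps) auto
      then show ?thesis using kword_cancel[of v1 x "gK i" v2] xv v Cons 3 LK_eq by simp
    qed
  qed
qed

text \<open>In the presence of \<open>J\<close> each letter has an inverse, so the first letter of
  \<open>u\<close> is moved to the other side as its inverse.\<close>

lemma kword_expo_J:
  "kword u \<Longrightarrow> kword u' \<Longrightarrow> (\<And>j. expo u j = expo u' j) \<Longrightarrow> wc (gJ # u) = wc (gJ # u')"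
proof (induction u arbitrary: u')
  case Nil
  then show ?case using kword_expo_zero[of u'] by (simp add: wc_single)
next
  case (Cons x u)
  consider "x = gJ" | i where "x = gK i" | i where "x = gKbar i" using Cons.prems by (cases x) auto
  then show ?case
  proof cases
    case 1
    have "wc (gJ # u) = wc (gJ # u')"
      by (rule Cons.IH) (use Cons.prems 1 in \<open>simp_all\<close>)
    moreover have "wc (gJ # gJ # u) = wc (gJ # u)" by (simp add: wc_Cons m_assoc[symmetric])
    ultimately show ?thesis using 1 by simp
  next
    case 2
    have "wc (gJ # u) = wc (gJ # gKbar i # u')"
    proof (rule Cons.IH)
      show "expo u j = expo (gKbar i # u') j" for j using Cons.prems(3)[of j] 2 by simp
    qed (use Cons.prems in auto)
    have "wc (gJ # x # u) = K i \<star> wc (gJ # u)" using 2 by (simp add: wc_Cons m_assoc[symmetric])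
    also have "\<dots> = J \<star> (K i \<star> (L i \<star> wc u'))"
      unfolding \<open>wc (gJ # u) = _\<close> by (simp add: wc_Cons assoc_rules)
    also have "\<dots> = wc (gJ # u')" by (simp add: wc_Cons assoc_rules)
    finally show ?thesis .
  next
    case 3
    have "wc (gJ # u) = wc (gJ # gK i # u')"
    proof (rule Cons.IH)
      show "expo u j = expo (gK i # u') j" for j using Cons.prems(3)[of j] 3 by simp
    qed (use Cons.prems in auto)
    have "wc (gJ # x # u) = L i \<star> wc (gJ # u)" using 3 by (simp add: wc_Cons m_assoc[symmetric])
    also have "\<dots> = wc (gJ # u')"
      unfolding \<open>wc (gJ # u) = _\<close> by (simp add: wc_Cons assoc_rules)
    finally show ?thesis .
  qed
qed

lemma kword_expo_eq:
  "\<lbrakk>kword u; kword u'; u \<noteq> []; u' \<noteq> []; \<And>j. expo u j = expo u' j\<rbrakk> \<Longrightarrow> wc u = wc u'"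
  using kword_expo_J[of u u'] J_kword by simp

subsection \<open>Linear functionals\<close>

lemma lfun_simps:
  assumes "\<theta> \<in> lfun"
  shows "x \<in> carrier W \<Longrightarrow> y \<in> carrier W \<Longrightarrow> \<theta> (x \<oplus>\<^bsub>W\<^esub> y) = \<theta> x + \<theta> y"
    "x \<in> carrier W \<Longrightarrow> \<theta> (c \<odot>\<^bsub>W\<^esub> x) = c * \<theta> x" "\<theta> \<zero>\<^bsub>W\<^esub> = 0"
  using klin_add[OF assms] klin_smult[OF assms] klin_zero[OF assms kalg_W kalg_base_alg] by simp_all

lemma lfunI:
  "\<lbrakk>\<And>x y. x \<in> carrier W \<Longrightarrow> y \<in> carrier W \<Longrightarrow> \<theta> (x \<oplus>\<^bsub>W\<^esub> y) = \<theta> x + \<theta> y;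
    \<And>c x. x \<in> carrier W \<Longrightarrow> \<theta> (c \<odot>\<^bsub>W\<^esub> x) = c * \<theta> x\<rbrakk> \<Longrightarrow> \<theta> \<in> lfun"
  by (rule klinI) simp_all

lemma lfun_comb: "\<theta> \<in> lfun \<Longrightarrow> \<theta>' \<in> lfun \<Longrightarrow> (\<lambda>x. b * \<theta> x + c * \<theta>' x) \<in> lfun"
  by (rule lfunI) (simp_all add: lfun_simps algebra_simps)

lemma lfun_mult_l: "\<theta> \<in> lfun \<Longrightarrow> x \<in> carrier W \<Longrightarrow> (\<lambda>y. \<theta> (x \<star> y)) \<in> lfun"
  by (rule lfunI) (simp_all add: lfun_simps r_distr)

text \<open>The scalar product of the weight with coordinates \<open>l\<close> in the fundamental
  weights and the vector with coordinates \<open>x\<close> in the simple roots.\<close>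

definition pairing :: "('i \<Rightarrow> int) \<Rightarrow> ('i \<Rightarrow> int) \<Rightarrow> int" where
  "pairing l x = (\<Sum>j\<in>UNIV. int (d j) * l j * x j)"

text \<open>The matrix coefficient at the highest weight vector. It is only linear on the algebra,
  but multiplicative on words in the \<open>K i\<close>, \<open>L i\<close> and
  \<open>J\<close>.\<close>

definition theta :: "('i \<Rightarrow> int) \<Rightarrow> ('i, 'k) w_elem \<Rightarrow> 'k" where
  "theta l X = extend_hom rels (fun_subspace.end_alg (verma_dual l)) (verma.act a d q l) X vac []"

lemma theta_lfun: "theta l \<in> lfun"
  and theta_kword: "kword u \<Longrightarrow> theta l (wc u) = q powi pairing l (expo u)"
proof -
  interpret v: verma a d q \<kappa> \<kappa>' l by unfold_locales
  note h = hom_from_W[OF v.wrel_act]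
  have hk: "extend_hom rels v.V.end_alg v.act \<in> klin W v.V.end_alg" using h(1) alg_hom_klin by blast
  show "theta l \<in> lfun"
    by (rule lfunI) (simp_all add: theta_def klin_add[OF hk] klin_smult[OF hk] verma_dual.vac)
  \<comment> \<open>\<open>vac\<close> is an eigenvector of each letter \<open>K j\<close>,
    \<open>L j\<close> and \<open>J\<close>: it is supported on the empty word, where the weight is
    \<open>int (d j) * l j\<close>.\<close>
  have "word_prod v.V.end_alg v.act u vac = (\<lambda>x. q powi pairing l (expo u) * vac x)" if "kword u"
    using that
  proof (induction u)
    case Nil
    show ?case by (simp add: verma_dual.vac pairing_def)
  next
    case (Cons x u)
    have lin: "v.V.lin_op (word_prod v.V.end_alg v.act u)"
      using kalg.word_prod_closed[OF v.V.kalg_end_alg, of v.act u] v.act_closed by simp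
    have x: "verma_op l x vac = (\<lambda>y. q powi pairing l (letter_expo x) * vac y)"
    proof (cases x)
      case (gK j)
      have "pairing l (letter_expo x) = int (d j) * l j" by (simp add: pairing_def gK of_bool_def if_distrib cong: if_cong)
      then show ?thesis using gK by (auto simp: verma_op_simps vac_def wt_def fun_eq_iff)
    next
      case (gKbar j)
      have "pairing l (letter_expo x) = - (int (d j) * l j)" by (simp add: pairing_def gKbar of_bool_def if_distrib cong: if_cong)
      then show ?thesis using gKbar by (auto simp: verma_op_simps vac_def wt_def fun_eq_iff)
    qed (use Cons in \<open>auto simp: verma_op_simps pairing_def\<close>)
    have "pairing l (\<lambda>j. letter_expo x j + expo u j) = pairing l (letter_expo x) + pairing l (expo u)"
      by (simp add: pairing_def sum.distrib[symmetric] distrib_left)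
    then show ?case
      using Cons q0 by (simp add: verma_dual.vac x v.V.lin_op_scale[OF lin] power_int_add mult.assoc)
  qed
  then show "kword u \<Longrightarrow> theta l (wc u) = q powi pairing l (expo u)"
    by (simp add: theta_def h(2) vac_def)
qed

text \<open>The character killing every generator; unlike the counit and the functionals
  \<open>theta\<close>, it separates the unit from \<open>J\<close>.\<close>

definition chi0 :: "('i, 'k) w_elem \<Rightarrow> 'k" where
  "chi0 = extend_hom rels base_alg (\<lambda>_. 0)"

lemma chi0_lfun: "chi0 \<in> lfun" and chi0_wc: "chi0 (wc u) = of_bool (u = [])"
proof -
  have "qcomm (base_alg :: ('k, 'k) module) c 0 0 n = 0" for c n by (induction n) simp_all
  then have "wrel a d q \<kappa> \<kappa>' base_alg (\<lambda>_. 0)"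
    by (intro wrel.intro wpre.intro wpre_axioms.intro wrel_axioms.intro cartan_q_axioms kalg_base_alg) simp_all
  note h = hom_from_W[OF this]
  show "chi0 \<in> lfun" unfolding chi0_def using h(1) alg_hom_klin by blast
  show "chi0 (wc u) = of_bool (u = [])" unfolding chi0_def h(2) by (cases u) simp_all
qed

lemma chi0_one [simp]: "chi0 \<one>\<^bsub>W\<^esub> = 1"
  using chi0_wc[of "[]"] by simp

lemma wc_kword_inj:
  assumes "kword u" "kword u'" "wc u = wc u'"
  shows "expo u = expo u'" "u = [] \<longleftrightarrow> u' = []"
proof
  fix j :: 'i
  \<comment> \<open>The fundamental weight at \<open>j\<close>: its pairing reads off
    \<open>d j\<close> times the exponent at \<open>j\<close>.\<close>
  let ?l = "\<lambda>i. of_bool (i = j) :: int"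
  have p: "pairing ?l x = int (d j) * x j" for x
    by (simp add: pairing_def of_bool_def if_distrib if_distribR cong: if_cong)
  have "theta ?l (wc u) = theta ?l (wc u')" using assms by simp
  then have "int (d j) * expo u j = int (d j) * expo u' j"
    using theta_kword[OF assms(1), of ?l] theta_kword[OF assms(2), of ?l] q_powi_inj p by metis
  then show "expo u j = expo u' j" using d_pos[of j] by simp
next
  have "chi0 (wc u) = chi0 (wc u')" using assms by simp
  then show "u = [] \<longleftrightarrow> u' = []" by (cases "u = []"; cases "u' = []"; simp add: chi0_wc)
qed

section \<open>Functionals separating the words in the \<open>K i\<close>, \<open>L i\<close> and
  \<open>J\<close>\<close>

inductive_set char_span :: "(('i \<Rightarrow> int) \<Rightarrow> 'k) set" where
  char: "(\<lambda>x. q powi pairing m x) \<in> char_span"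
| comb: "f \<in> char_span \<Longrightarrow> g \<in> char_span \<Longrightarrow> (\<lambda>x. b * f x + c * g x) \<in> char_span"

lemma char_span_mult: "f \<in> char_span \<Longrightarrow> (\<lambda>x. q powi pairing m x * f x) \<in> char_span"
proof (induction rule: char_span.induct)
  case (char m')
  have "q powi pairing m x * q powi pairing m' x = q powi pairing (\<lambda>i. m i + m' i) x" for x
    using q0 by (simp add: pairing_def power_int_add[symmetric] sum.distrib[symmetric] algebra_simps)
  then show ?case by (simp add: char_span.char)
next
  case (comb f g b c)
  then show ?case
    using char_span.comb[OF comb.IH, of b c] by (simp add: algebra_simps)
qed

text \<open>Interpolation: a function that works for the smaller set is multiplied by the normalised
  difference of a character and its value at the new point.\<close>

lemma char_span_dual:
  assumes "finite \<Lambda>" "x0 \<notin> \<Lambda>"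
  shows "\<exists>f\<in>char_span. f x0 = 1 \<and> (\<forall>x\<in>\<Lambda>. f x = 0)"
  using assms
proof (induction \<Lambda>)
  case empty
  show ?case using char_span.char[of "\<lambda>_. 0"] by (intro bexI) (simp_all add: pairing_def)
next
  case (insert \<mu> \<Lambda>)
  then obtain f where f: "f \<in> char_span" "f x0 = 1" "\<forall>x\<in>\<Lambda>. f x = 0" by auto
  have "\<mu> \<noteq> x0" using insert.prems by auto
  then obtain j where j: "\<mu> j \<noteq> x0 j" by (auto simp: fun_eq_iff)
  define m where "m i = (of_bool (i = j) :: int)" for i
  have p: "pairing m x = int (d j) * x j" for x
    by (simp add: pairing_def m_def of_bool_def if_distrib if_distribR cong: if_cong)
  let ?D = "q powi pairing m x0 - q powi pairing m \<mu>"
  have D: "?D \<noteq> 0"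
    using q_powi_inj[of "pairing m x0" "pairing m \<mu>"] j d_pos[of j] by (auto simp: p)
  let ?g = "\<lambda>x. (1 / ?D) * (q powi pairing m x * f x) + (- (q powi pairing m \<mu>) / ?D) * f x"
  have "?g \<in> char_span" by (rule char_span.comb[OF char_span_mult[OF f(1)] f(1)])
  moreover have "?g x0 = 1" using D f(2) by (simp add: diff_divide_distrib[symmetric])
  moreover have "\<forall>x\<in>insert \<mu> \<Lambda>. ?g x = 0" using f(3) by simp
  ultimately show ?case by (intro bexI[of _ ?g] conjI)
qed

text \<open>The interpolation multiplies functions of the exponent vector, for which products are
  available; only the resulting linear combination of characters is lifted to a functional on the
  algebra.\<close>

lemma char_span_realised: "f \<in> char_span \<Longrightarrow> \<exists>\<theta>\<in>lfun. \<forall>u. kword u \<longrightarrow> \<theta> (wc u) = f (expo u)"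
proof (induction rule: char_span.induct)
  case (char m)
  then show ?case using theta_lfun theta_kword by blast
next
  case (comb f g b c)
  then obtain \<theta> \<theta>' where "\<theta> \<in> lfun" "\<theta>' \<in> lfun" "\<And>u. kword u \<Longrightarrow> \<theta> (wc u) = f (expo u)"
    "\<And>u. kword u \<Longrightarrow> \<theta>' (wc u) = g (expo u)" by blast
  then show ?case by (intro bexI[OF _ lfun_comb[of \<theta> \<theta>' b c]]) auto
qed

lemma kword_dual:
  assumes u: "kword u" and H: "finite H" "\<And>h. h \<in> H \<Longrightarrow> kword h" "\<And>h. h \<in> H \<Longrightarrow> wc h \<noteq> wc u"
  shows "\<exists>\<theta>\<in>lfun. \<theta> (wc u) = 1 \<and> (\<forall>h\<in>H. \<theta> (wc h) = 0)"
proof (cases "u = []")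
  case True
  have "\<forall>h\<in>H. h \<noteq> []" using H True by blast
  then show ?thesis using True chi0_wc[of "[]"] by (intro bexI[OF _ chi0_lfun]) (auto simp: chi0_wc)
next
  case False
  let ?\<Lambda> = "expo ` (H - {[]})"
  have "expo u \<notin> ?\<Lambda>"
  proof
    assume "expo u \<in> ?\<Lambda>"
    then obtain h where h: "expo u = expo h" "h \<in> H - {[]}" by (rule imageE)
    then have "h \<in> H" "h \<noteq> []" by simp_all
    then have "wc h = wc u" using h(1) by (intro kword_expo_eq[OF H(2) u _ False]) simp_all
    then show False using H(3)[OF \<open>h \<in> H\<close>] by simp
  qed
  then obtain f where f: "f \<in> char_span" "f (expo u) = 1" "\<forall>x\<in>?\<Lambda>. f x = 0"
    using char_span_dual[of ?\<Lambda> "expo u", OF finite_imageI[OF finite_Diff[OF H(1)]]] by blast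
  obtain \<theta> where \<theta>: "\<theta> \<in> lfun" "\<And>u. kword u \<Longrightarrow> \<theta> (wc u) = f (expo u)"
    using char_span_realised[OF f(1)] by blast
  \<comment> \<open>\<theta> need not vanish on the empty word, whose exponents may agree with those
    of \<open>u\<close>; subtracting a multiple of \<open>chi0\<close> corrects this and changes the
    value at no other word.\<close>
  have "(\<lambda>x. 1 * \<theta> x + (- \<theta> (wc [])) * chi0 x) \<in> lfun" by (rule lfun_comb[OF \<theta>(1) chi0_lfun])
  moreover have "1 * \<theta> (wc u) + (- \<theta> (wc [])) * chi0 (wc u) = 1"
    using False f(2) \<theta>(2)[OF u] chi0_wc[of u] by simp
  moreover have "1 * \<theta> (wc h) + (- \<theta> (wc [])) * chi0 (wc h) = 0" if "h \<in> H" for h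
  proof (cases "h = []")
    case True then show ?thesis using chi0_wc[of "[]"] by simp
  next
    case False
    then have "f (expo h) = 0" using f(3) that by simp
    then show ?thesis using False \<theta>(2)[OF H(2)[OF that]] chi0_wc[of h] by simp
  qed
  ultimately show ?thesis
    by (intro bexI[of _ "\<lambda>x. 1 * \<theta> x + (- \<theta> (wc [])) * chi0 x"] conjI ballI)
qed

lemma J_neq_one: "J \<noteq> \<one>\<^bsub>W\<^esub>"
  using wc_kword_inj(2)[of "[gJ]" "[]"] by (auto simp: wc_single)

lemma K_neq_L: "K i \<noteq> L i"
proof
  assume "K i = L i"
  then have "expo [gK i] i = expo [gKbar i] i" using wc_kword_inj(1)[of "[gK i]" "[gKbar i]"] by (simp add: wc_single)
  then show False by simp
qed

text \<open>Otherwise the commutator of \<open>E i\<close> and \<open>F i\<close>, multiplied by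
  \<open>J\<close>, would give \<open>K i = L i\<close>.\<close>

lemma EJ_nonzero: "E i \<star> J \<noteq> \<zero>\<^bsub>W\<^esub>" and FJ_nonzero: "F i \<star> J \<noteq> \<zero>\<^bsub>W\<^esub>"
proof -
  have ne: "kq i \<odot>\<^bsub>W\<^esub> K i \<oplus>\<^bsub>W\<^esub> (- kq i) \<odot>\<^bsub>W\<^esub> L i \<noteq> \<zero>\<^bsub>W\<^esub>"
  proof
    assume "kq i \<odot>\<^bsub>W\<^esub> K i \<oplus>\<^bsub>W\<^esub> (- kq i) \<odot>\<^bsub>W\<^esub> L i = \<zero>\<^bsub>W\<^esub>"
    then have "kq i \<odot>\<^bsub>W\<^esub> (K i \<ominus>\<^bsub>W\<^esub> L i) = \<zero>\<^bsub>W\<^esub>" by (simp add: minus_smult smult_r_distr)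
    then show False using kq_nonzero[of i] K_neq_L[of i] by (simp add: smult_eq_zero_iff minus_eq_zero_iff)
  qed
  have eq: "E i \<star> F i \<star> J = F i \<star> E i \<star> J \<oplus>\<^bsub>W\<^esub> (kq i \<odot>\<^bsub>W\<^esub> K i \<oplus>\<^bsub>W\<^esub> (- kq i) \<odot>\<^bsub>W\<^esub> L i)"
    by (simp add: EF_eq l_distr)
  show "E i \<star> J \<noteq> \<zero>\<^bsub>W\<^esub>"
  proof
    assume z: "E i \<star> J = \<zero>\<^bsub>W\<^esub>"
    have "E i \<star> F i \<star> J = E i \<star> J \<star> F i" "F i \<star> E i \<star> J = F i \<star> (E i \<star> J)" by (simp_all add: m_assoc JF)
    then show False using eq z ne by simp
  qed
  show "F i \<star> J \<noteq> \<zero>\<^bsub>W\<^esub>"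
  proof
    assume z: "F i \<star> J = \<zero>\<^bsub>W\<^esub>"
    have "E i \<star> F i \<star> J = E i \<star> (F i \<star> J)" "F i \<star> E i \<star> J = F i \<star> J \<star> E i" by (simp_all add: m_assoc JE)
    then show False using eq z ne by simp
  qed
qed

end

section \<open>The filtration by the number of letters E and F\<close>

lemma vector_space_poly_mapping:
  "vector_space (\<lambda>c. Poly_Mapping.map ((*) c) :: ('u \<Rightarrow>\<^sub>0 'k::field) \<Rightarrow> ('u \<Rightarrow>\<^sub>0 'k))"
  by unfold_locales (auto intro!: poly_mapping_eqI simp: lookup_add algebra_simps)

lemma vector_space_base: "vector_space ((*) :: 'k::field \<Rightarrow> 'k \<Rightarrow> 'k)"
  by unfold_locales (simp_all add: algebra_simps)

text \<open>A basis of \<open>S\<close> stays independent when \<open>x\<close> is added, so values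
  on it can be prescribed. The vector space is a full type here; functionals on the quotient algebra
  come from it by descent.\<close>

lemma exists_separating_functional:
  fixes S :: "('u \<Rightarrow>\<^sub>0 'k::field) set"
  assumes S: "0 \<in> S" "\<And>p r. p \<in> S \<Longrightarrow> r \<in> S \<Longrightarrow> p + r \<in> S" "\<And>c p. p \<in> S \<Longrightarrow> Poly_Mapping.map ((*) c) p \<in> S"
    and x: "x \<notin> S"
  shows "\<exists>f :: ('u \<Rightarrow>\<^sub>0 'k) \<Rightarrow> 'k. (\<forall>p r. f (p + r) = f p + f r) \<and> (\<forall>c p. f (Poly_Mapping.map ((*) c) p) = c * f p)
    \<and> f x = 1 \<and> (\<forall>p\<in>S. f p = 0)"
proof -
  interpret V: vector_space "\<lambda>c. Poly_Mapping.map ((*) c) :: ('u \<Rightarrow>\<^sub>0 'k) \<Rightarrow> ('u \<Rightarrow>\<^sub>0 'k)"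
    by (rule vector_space_poly_mapping)
  interpret VK: vector_space_pair "\<lambda>c. Poly_Mapping.map ((*) c) :: ('u \<Rightarrow>\<^sub>0 'k) \<Rightarrow> ('u \<Rightarrow>\<^sub>0 'k)" "(*) :: 'k \<Rightarrow> 'k \<Rightarrow> 'k"
    by (intro vector_space_pair.intro vector_space_poly_mapping vector_space_base)
  have sub: "V.subspace S" using S by (simp add: V.subspace_def)
  obtain B where B: "B \<subseteq> S" "V.independent B" "S \<subseteq> V.span B"
    using V.maximal_independent_subset[of S] by blast
  have "V.span B \<subseteq> S" using B(1) sub V.span_minimal by blast
  then have xB: "x \<notin> V.span B" using x by blast
  then have "V.independent (insert x B)" using B(2) V.independent_insertI by blast
  then obtain g where g: "Vector_Spaces.linear (\<lambda>c. Poly_Mapping.map ((*) c)) (*) g"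
    "\<forall>y\<in>insert x B. g y = (if y = x then 1 else 0)"
    using VK.linear_independent_extend[of "insert x B" "\<lambda>y. if y = x then 1 else 0"] by blast
  have "x \<notin> B" using xB V.span_base by blast
  then have "g y = 0" if "y \<in> B" for y using g(2) that by auto
  then have "g p = 0" if "p \<in> V.span B" for p
    using VK.linear_eq_0_on_span[OF g(1)] that by blast
  moreover have "g (p + r) = g p + g r" "g (Poly_Mapping.map ((*) c) p) = c * g p" for p r c
    using VK.linear_add[OF g(1)] VK.linear_scale[OF g(1)] by auto
  ultimately show ?thesis using g(2) B(3) by (intro exI[of _ g]) auto
qed

context weak_quantum begin

abbreviation "pc \<equiv> poly_class rels"

lemma pc_hom: "pc \<in> alg_hom free_alg W"
  using poly_class_alg_hom[of rels] by (simp add: w_alg_def)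

lemma pc_closed [simp]: "pc p \<in> carrier W"
  using alg_hom_closed[OF pc_hom] by simp

lemma pc_simps: "pc (p + r) = pc p \<oplus>\<^bsub>W\<^esub> pc r" "pc (Poly_Mapping.map ((*) c) p) = c \<odot>\<^bsub>W\<^esub> pc p"
  "pc (Poly_Mapping.single u c) = c \<odot>\<^bsub>W\<^esub> wc u"
  using alg_hom_add[OF pc_hom] alg_hom_smult[OF pc_hom] poly_class_single[of rels u c] by (simp_all add: w_alg_def)

lemma pc_zero: "pc 0 = \<zero>\<^bsub>W\<^esub>"
  using pc_simps(3)[of undefined 0] by simp

lemma W_carrier: "carrier W = range pc"
  using presented_alg_carrier[of rels] by (simp add: w_alg_def)

lemma lfun_pc: "\<theta> \<in> lfun \<Longrightarrow> \<theta> (pc p) = (\<Sum>u\<in>Poly_Mapping.keys p. Poly_Mapping.lookup p u * \<theta> (wc u))"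
  using klin_poly_class[of \<theta> rels base_alg p] kalg_base_alg by (simp add: w_alg_def lin_ext_base)

text \<open>\<open>S\<close> is the preimage in the free algebra of the span of the words in
  \<open>U\<close>. It contains the ideal of relations, so a functional killing \<open>S\<close>
  descends to the quotient.\<close>

lemma lfun_separate:
  assumes X: "X \<in> carrier W" and nX: "\<And>p. Poly_Mapping.keys p \<subseteq> U \<Longrightarrow> X \<noteq> pc p"
  shows "\<exists>\<theta>\<in>lfun. \<theta> X = 1 \<and> (\<forall>u\<in>U. \<theta> (wc u) = 0)"
proof -
  define S where "S = {s. \<exists>p. Poly_Mapping.keys p \<subseteq> U \<and> pc s = pc p}"
  obtain x where x: "X = pc x" using X W_carrier by auto
  have "x \<notin> S" using nX x by (auto simp: S_def)
  moreover have "0 \<in> S" by (auto simp: S_def intro: exI[of _ 0])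
  moreover have "p + r \<in> S" if "p \<in> S" "r \<in> S" for p r
  proof -
    obtain p' r' where "Poly_Mapping.keys p' \<subseteq> U" "pc p = pc p'" "Poly_Mapping.keys r' \<subseteq> U" "pc r = pc r'"
      using \<open>p \<in> S\<close> \<open>r \<in> S\<close> unfolding S_def by blast
    then show ?thesis unfolding S_def by (intro CollectI exI[of _ "p' + r'"]) (simp add: keys_add_subset pc_simps)
  qed
  moreover have "Poly_Mapping.map ((*) c) p \<in> S" if "p \<in> S" for c p
  proof -
    obtain p' where "Poly_Mapping.keys p' \<subseteq> U" "pc p = pc p'" using \<open>p \<in> S\<close> unfolding S_def by blast
    then show ?thesis unfolding S_def using keys_scale[of c p']
      by (intro CollectI exI[of _ "Poly_Mapping.map ((*) c) p'"]) (auto simp: pc_simps)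
  qed
  ultimately obtain f :: "('i gen list \<Rightarrow>\<^sub>0 'k) \<Rightarrow> 'k" where f: "\<And>p r. f (p + r) = f p + f r"
    "\<And>c p. f (Poly_Mapping.map ((*) c) p) = c * f p" "f x = 1" "\<forall>p\<in>S. f p = 0"
    using exists_separating_functional[of S x] by auto
  let ?I = "Idl\<^bsub>free_alg\<^esub> rels" and ?A = "free_alg :: ('k, 'i gen list \<Rightarrow>\<^sub>0 'k) module"
  interpret F: kalg ?A by (rule kalg_free_alg)
  have fk: "f \<in> klin ?A base_alg" by (rule klinI) (simp_all add: f)
  have "\<forall>p\<in>?I. f p = \<zero>\<^bsub>base_alg\<^esub>"
  proof
    fix p assume "p \<in> ?I"
    then have "pc p = \<zero>\<^bsub>W\<^esub>"
      using alg_hom_Idl[OF kalg_free_alg kalg_W pc_hom, of rels p] poly_class_rel[of _ rels] by (simp add: w_alg_def)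
    then have "p \<in> S" unfolding S_def by (intro CollectI exI[of _ 0]) (simp add: pc_zero)
    then show "f p = \<zero>\<^bsub>base_alg\<^esub>" using f(4) by simp
  qed
  note d = F.descend_klin[OF ideal_free fk kalg_base_alg this] F.descend_eq[OF ideal_free fk kalg_base_alg this]
  let ?\<theta> = "\<lambda>X\<in>carrier (quot_alg ?A ?I). f (SOME p. p \<in> X)"
  have W: "W = quot_alg ?A ?I" by (simp add: w_alg_def presented_alg_def)
  have \<theta>pc: "?\<theta> (pc p) = f p" for p using d(2)[of p] unfolding poly_class_def by simp
  have "?\<theta> \<in> lfun" using d(1) unfolding W .
  moreover have "?\<theta> X = 1" unfolding x \<theta>pc by (rule f(3))
  moreover have "\<forall>u\<in>U. ?\<theta> (wc u) = 0"
  proof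
    fix u assume "u \<in> U"
    then have "Poly_Mapping.single u 1 \<in> S" unfolding S_def by (intro CollectI exI[of _ "Poly_Mapping.single u 1"]) simp
    then show "?\<theta> (wc u) = 0" unfolding poly_class_word[symmetric] \<theta>pc using f(4) by simp
  qed
  ultimately show ?thesis by (intro bexI[of _ ?\<theta>] conjI)
qed

section \<open>The coproduct of words, tested by pairs of functionals\<close>

abbreviation "TW \<equiv> tensor_alg W W"
abbreviation "tW \<equiv> pure_tensor W W"
abbreviation "\<Delta> \<equiv> w_comult a d q \<kappa> \<kappa>'"

lemma comult_eq: "\<Delta> = extend_hom rels TW comult_gen"
proof -
  have "comult_gen = (\<lambda>g. case g of
      gE i \<Rightarrow> tW (if \<kappa> i then \<one>\<^bsub>W\<^esub> else J) (E i) \<oplus>\<^bsub>TW\<^esub> tW (E i) (K i)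
    | gF i \<Rightarrow> tW (F i) (if \<kappa>' i then \<one>\<^bsub>W\<^esub> else J) \<oplus>\<^bsub>TW\<^esub> tW (L i) (F i)
    | gK i \<Rightarrow> tW (K i) (K i) | gKbar i \<Rightarrow> tW (L i) (L i) | gJ \<Rightarrow> tW J J)"
    by (rule ext) (simp add: comult_gen_def gl_def gl'_def split: gen.split)
  then show ?thesis by (simp add: w_comult_def Let_def)
qed

lemma comult_hom: "\<Delta> \<in> alg_hom W TW" and comult_w: "\<Delta> (w g) = comult_gen g"
  unfolding comult_eq by (rule hom_from_W[OF wrel_comult])+

lemma comult_Cons: "\<Delta> (wc (x # u)) = comult_gen x \<otimes>\<^bsub>TW\<^esub> \<Delta> (wc u)"
  using alg_hom_mult[OF comult_hom] by (simp add: wc_Cons comult_w)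

lemma comult_closed [simp]: "x \<in> carrier W \<Longrightarrow> \<Delta> x \<in> carrier TW"
  by (rule alg_hom_closed[OF comult_hom])

definition tfun :: "(('i, 'k) w_elem \<Rightarrow> 'k) \<Rightarrow> (('i, 'k) w_elem \<Rightarrow> 'k) \<Rightarrow> (('i, 'k) w_elem \<times> ('i, 'k) w_elem \<Rightarrow>\<^sub>0 'k) set \<Rightarrow> 'k" where
  "tfun \<theta>1 \<theta>2 = tensor_lin W W base_alg (\<lambda>x y. \<theta>1 x * \<theta>2 y)"

lemma
  assumes "\<theta>1 \<in> lfun" "\<theta>2 \<in> lfun"
  shows tfun_klin: "tfun \<theta>1 \<theta>2 \<in> klin TW base_alg"
    and tfun_pure: "x \<in> carrier W \<Longrightarrow> y \<in> carrier W \<Longrightarrow> tfun \<theta>1 \<theta>2 (tW x y) = \<theta>1 x * \<theta>2 y"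
proof -
  have "bilinear_map W W base_alg (\<lambda>x y. \<theta>1 x * \<theta>2 y)"
    unfolding bilinear_map_def using assms
    by (auto intro!: klinI simp: lfun_simps algebra_simps)
  note h = TT.tensor_lin_klin[OF kalg_base_alg this] TT.tensor_lin_pure[OF kalg_base_alg this]
  show "tfun \<theta>1 \<theta>2 \<in> klin TW base_alg" unfolding tfun_def by (rule h(1))
  show "x \<in> carrier W \<Longrightarrow> y \<in> carrier W \<Longrightarrow> tfun \<theta>1 \<theta>2 (tW x y) = \<theta>1 x * \<theta>2 y"
    unfolding tfun_def by (rule h(2))
qed

lemma tfun_add:
  assumes "\<theta>1 \<in> lfun" "\<theta>2 \<in> lfun" "X \<in> carrier TW" "Y \<in> carrier TW"
  shows "tfun \<theta>1 \<theta>2 (X \<oplus>\<^bsub>TW\<^esub> Y) = tfun \<theta>1 \<theta>2 X + tfun \<theta>1 \<theta>2 Y"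
  using klin_add[OF tfun_klin[OF assms(1,2)] assms(3,4)] by simp

lemma tfun_mult:
  assumes \<theta>: "\<theta>1 \<in> lfun" "\<theta>2 \<in> lfun" and x: "x \<in> carrier W" and y: "y \<in> carrier W" and Y: "Y \<in> carrier TW"
  shows "tfun \<theta>1 \<theta>2 (tW x y \<otimes>\<^bsub>TW\<^esub> Y) = tfun (\<lambda>z. \<theta>1 (x \<star> z)) (\<lambda>z. \<theta>2 (y \<star> z)) Y"
proof (rule TT.klin_eq_on_T[where f = "\<lambda>Y. tfun \<theta>1 \<theta>2 (tW x y \<otimes>\<^bsub>TW\<^esub> Y)" and C = base_alg])
  note k = tfun_klin[OF \<theta>]
  show "(\<lambda>Y. tfun \<theta>1 \<theta>2 (tW x y \<otimes>\<^bsub>TW\<^esub> Y)) \<in> klin TW base_alg"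
    using x y klin_add[OF k] klin_smult[OF k] by (intro klinI) (simp_all add: TT.T.r_distr)
  show "tfun (\<lambda>z. \<theta>1 (x \<star> z)) (\<lambda>z. \<theta>2 (y \<star> z)) \<in> klin TW base_alg"
    by (intro tfun_klin lfun_mult_l \<theta> x y)
  fix a b assume ab: "a \<in> carrier W" "b \<in> carrier W"
  then show "tfun \<theta>1 \<theta>2 (tW x y \<otimes>\<^bsub>TW\<^esub> tW a b) = tfun (\<lambda>z. \<theta>1 (x \<star> z)) (\<lambda>z. \<theta>2 (y \<star> z)) (tW a b)"
    using x y tfun_pure[OF \<theta>] tfun_pure[OF lfun_mult_l[OF \<theta>(1) x] lfun_mult_l[OF \<theta>(2) y] ab] by simp
qed (use kalg_base_alg Y in auto)

text \<open>Modulo lower terms, \<open>\<Delta> u = lw u \<otimes> u\<close> in the second and \<open>\<Delta> u = u \<otimes> rw u\<close> in the first factor.\<close>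

definition lx :: "'i gen \<Rightarrow> 'i gen list" where
  "lx g = (case g of gE i \<Rightarrow> (if \<kappa> i then [] else [gJ]) | gF i \<Rightarrow> [gKbar i] | _ \<Rightarrow> [g])"

definition rx :: "'i gen \<Rightarrow> 'i gen list" where
  "rx g = (case g of gE i \<Rightarrow> [gK i] | gF i \<Rightarrow> (if \<kappa>' i then [] else [gJ]) | _ \<Rightarrow> [g])"

definition "lw u = concat (map lx u)"
definition "rw u = concat (map rx u)"

definition deg :: "'i gen list \<Rightarrow> nat" where "deg u = length (filter (\<lambda>g. \<not> isK g) u)"

lemma deg_simps [simp]: "deg [] = 0" "deg (x # u) = (if isK x then deg u else Suc (deg u))" "deg (u @ v) = deg u + deg v"
  by (simp_all add: deg_def)

lemma deg_kword: "deg u = 0 \<longleftrightarrow> kword u"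
  by (induction u) auto

lemma lw_rw_simps [simp]: "lw [] = []" "rw [] = []" "lw (x # u) = lx x @ lw u" "rw (x # u) = rx x @ rw u"
  by (simp_all add: lw_def rw_def)

lemma kword_lx_rx [simp]: "kword (lx x)" "kword (rx x)"
  by (cases x; simp add: lx_def rx_def)+

lemma kword_lw_rw [simp]: "kword (lw u)" "kword (rw u)"
  by (induction u) simp_all

lemma gl_wc: "gl i = wc (lx (gE i))" "gl' i = wc (rx (gF i))"
  by (simp_all add: gl_def gl'_def lx_def rx_def wc_single)

text \<open>These are the functionals on the quotient by the filtration part below \<open>n\<close>;
  for \<open>n = 0\<close> there is no condition.\<close>

definition vanish :: "nat \<Rightarrow> (('i, 'k) w_elem \<Rightarrow> 'k) \<Rightarrow> bool" where
  "vanish n \<theta> \<longleftrightarrow> (\<forall>u. deg u < n \<longrightarrow> \<theta> (wc u) = 0)"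

lemma vanishD: "vanish n \<theta> \<Longrightarrow> deg u < n \<Longrightarrow> \<theta> (wc u) = 0"
  by (simp add: vanish_def)

lemma vanish_mult:
  "vanish (Suc n) \<theta> \<Longrightarrow> vanish n (\<lambda>z. \<theta> (w x \<star> z))"
  "vanish n \<theta> \<Longrightarrow> isK x \<Longrightarrow> vanish n (\<lambda>z. \<theta> (w x \<star> z))"
  "vanish n \<theta> \<Longrightarrow> kword u \<Longrightarrow> vanish n (\<lambda>z. \<theta> (wc u \<star> z))"
  unfolding vanish_def using deg_kword[of u]
  by (auto simp: wc_Cons[symmetric] wc_append[symmetric])

text \<open>Of the two terms in the coproduct of a letter \<open>E i\<close> or \<open>F i\<close>,
  one keeps the letter out of the second tensor factor. The degree there is then too small for
  \<open>\<theta>2\<close>, and the term contributes nothing.\<close>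

lemma tfun_comult_left:
  "\<theta>1 \<in> lfun \<Longrightarrow> \<theta>2 \<in> lfun \<Longrightarrow> vanish (deg u) \<theta>2 \<Longrightarrow> tfun \<theta>1 \<theta>2 (\<Delta> (wc u)) = \<theta>1 (wc (lw u)) * \<theta>2 (wc u)"
proof (induction u arbitrary: \<theta>1 \<theta>2)
  case Nil
  then show ?case using alg_hom_one[OF comult_hom] by (simp add: TT.pure_one tfun_pure)
next
  case (Cons x u)
  note \<theta> = Cons.prems(1,2)
  have step: "tfun \<theta>1 \<theta>2 (tW y z \<otimes>\<^bsub>TW\<^esub> \<Delta> (wc u)) = \<theta>1 (y \<star> wc (lw u)) * \<theta>2 (z \<star> wc u)"
    if "y \<in> carrier W" "z \<in> carrier W" "vanish (deg u) (\<lambda>v. \<theta>2 (z \<star> v))" for y z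
    using that Cons.IH[OF lfun_mult_l[OF \<theta>(1) that(1)] lfun_mult_l[OF \<theta>(2) that(2)] that(3)] tfun_mult[OF \<theta>] by simp
  show ?case
  proof (cases "isK x")
    case True
    then have "comult_gen x = tW (w x) (w x)" "lx x = [x]" by (cases x; simp add: lx_def)+
    then show ?thesis using step[of "w x" "w x"] Cons.prems(3) True
      unfolding comult_Cons by (simp add: vanish_mult(2) wc_Cons)
  next
    case False
    then have v: "vanish (Suc (deg u)) \<theta>2" using Cons.prems(3) by simp
    then have v': "vanish (deg u) \<theta>2" by (simp add: vanish_def)
    have "\<exists>y. \<exists>z. kword z \<and> y \<in> carrier W \<and> comult_gen x \<otimes>\<^bsub>TW\<^esub> \<Delta> (wc u) =
        tW (wc (lx x)) (w x) \<otimes>\<^bsub>TW\<^esub> \<Delta> (wc u) \<oplus>\<^bsub>TW\<^esub> tW y (wc z) \<otimes>\<^bsub>TW\<^esub> \<Delta> (wc u)"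
    proof (cases x)
      case (gE i)
      then show ?thesis by (intro exI[of _ "E i"] exI[of _ "[gK i]"]) (simp add: gl_wc TT.T.l_distr wc_single)
    next
      case (gF i)
      then show ?thesis
        by (intro exI[of _ "F i"] exI[of _ "rx (gF i)"]) (simp add: gl_wc TT.T.l_distr wc_single lx_def TT.T.a_comm)
    qed (use False in auto)
    then obtain y z where yz: "kword z" "y \<in> carrier W" "comult_gen x \<otimes>\<^bsub>TW\<^esub> \<Delta> (wc u) =
        tW (wc (lx x)) (w x) \<otimes>\<^bsub>TW\<^esub> \<Delta> (wc u) \<oplus>\<^bsub>TW\<^esub> tW y (wc z) \<otimes>\<^bsub>TW\<^esub> \<Delta> (wc u)" by blast
    have "\<theta>2 (wc z \<star> wc u) = 0"
      using vanishD[OF v, of "z @ u"] yz(1) deg_kword[of z] by (simp add: wc_append)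
    then show ?thesis
      using step[of "wc (lx x)" "w x"] step[of y "wc z"] yz v v'
      unfolding comult_Cons by (simp add: tfun_add[OF \<theta>] vanish_mult wc_Cons wc_append)
  qed
qed

lemma tfun_comult_right:
  "\<theta>1 \<in> lfun \<Longrightarrow> \<theta>2 \<in> lfun \<Longrightarrow> vanish (deg u) \<theta>1 \<Longrightarrow> tfun \<theta>1 \<theta>2 (\<Delta> (wc u)) = \<theta>1 (wc u) * \<theta>2 (wc (rw u))"
proof (induction u arbitrary: \<theta>1 \<theta>2)
  case Nil
  then show ?case using alg_hom_one[OF comult_hom] by (simp add: TT.pure_one tfun_pure)
next
  case (Cons x u)
  note \<theta> = Cons.prems(1,2)
  have step: "tfun \<theta>1 \<theta>2 (tW y z \<otimes>\<^bsub>TW\<^esub> \<Delta> (wc u)) = \<theta>1 (y \<star> wc u) * \<theta>2 (z \<star> wc (rw u))"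
    if "y \<in> carrier W" "z \<in> carrier W" "vanish (deg u) (\<lambda>v. \<theta>1 (y \<star> v))" for y z
    using that Cons.IH[OF lfun_mult_l[OF \<theta>(1) that(1)] lfun_mult_l[OF \<theta>(2) that(2)] that(3)] tfun_mult[OF \<theta>] by simp
  show ?case
  proof (cases "isK x")
    case True
    then have "comult_gen x = tW (w x) (w x)" "rx x = [x]" by (cases x; simp add: rx_def)+
    then show ?thesis using step[of "w x" "w x"] Cons.prems(3) True
      unfolding comult_Cons by (simp add: vanish_mult(2) wc_Cons)
  next
    case False
    then have v: "vanish (Suc (deg u)) \<theta>1" using Cons.prems(3) by simp
    then have v': "vanish (deg u) \<theta>1" by (simp add: vanish_def)
    have "\<exists>y. \<exists>z. kword z \<and> y \<in> carrier W \<and> comult_gen x \<otimes>\<^bsub>TW\<^esub> \<Delta> (wc u) =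
        tW (w x) (wc (rx x)) \<otimes>\<^bsub>TW\<^esub> \<Delta> (wc u) \<oplus>\<^bsub>TW\<^esub> tW (wc z) y \<otimes>\<^bsub>TW\<^esub> \<Delta> (wc u)"
    proof (cases x)
      case (gE i)
      then show ?thesis by (intro exI[of _ "E i"] exI[of _ "lx (gE i)"]) (simp add: gl_wc TT.T.l_distr wc_single rx_def TT.T.a_comm)
    next
      case (gF i)
      then show ?thesis
        by (intro exI[of _ "F i"] exI[of _ "[gKbar i]"]) (simp add: gl_wc TT.T.l_distr wc_single)
    qed (use False in auto)
    then obtain y z where yz: "kword z" "y \<in> carrier W" "comult_gen x \<otimes>\<^bsub>TW\<^esub> \<Delta> (wc u) =
        tW (w x) (wc (rx x)) \<otimes>\<^bsub>TW\<^esub> \<Delta> (wc u) \<oplus>\<^bsub>TW\<^esub> tW (wc z) y \<otimes>\<^bsub>TW\<^esub> \<Delta> (wc u)" by blast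
    have "\<theta>1 (wc z \<star> wc u) = 0"
      using vanishD[OF v, of "z @ u"] yz(1) deg_kword[of z] by (simp add: wc_append)
    then show ?thesis
      using step[of "w x" "wc (rx x)"] step[of "wc z" y] yz v v'
      unfolding comult_Cons by (simp add: tfun_add[OF \<theta>] vanish_mult wc_Cons wc_append)
  qed
qed

end

section \<open>Group-like and skew-primitive elements\<close>

lemma poly_mapping_split:
  fixes p :: "'u \<Rightarrow>\<^sub>0 'k::ab_group_add"
  obtains r s where "p = r + s" "Poly_Mapping.keys r \<subseteq> Poly_Mapping.keys p \<inter> S" "Poly_Mapping.keys s \<subseteq> Poly_Mapping.keys p - S"
proof -
  define r where "r = (\<Sum>u\<in>Poly_Mapping.keys p \<inter> S. Poly_Mapping.single u (Poly_Mapping.lookup p u))"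
  have r: "Poly_Mapping.lookup r u = (if u \<in> S then Poly_Mapping.lookup p u else 0)" for u
  proof -
    have "Poly_Mapping.lookup r u = (\<Sum>v\<in>Poly_Mapping.keys p \<inter> S. if v = u then Poly_Mapping.lookup p u else 0)"
      unfolding r_def lookup_sum by (rule sum.cong) (auto simp: lookup_single when_def)
    also have "\<dots> = (if u \<in> Poly_Mapping.keys p \<inter> S then Poly_Mapping.lookup p u else 0)" by (rule sum.delta) simp
    finally show ?thesis by (auto simp: in_keys_iff)
  qed
  show thesis
    by (rule that[of r "p - r"]) (auto simp: in_keys_iff r lookup_minus split: if_splits)
qed

context weak_quantum begin

lemma lfun_zero: assumes "X \<in> carrier W" "\<And>\<theta>. \<theta> \<in> lfun \<Longrightarrow> \<theta> X = 0" shows "X = \<zero>\<^bsub>W\<^esub>"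
proof (rule ccontr)
  assume "X \<noteq> \<zero>\<^bsub>W\<^esub>"
  then have "X \<noteq> pc p" if "Poly_Mapping.keys p \<subseteq> {}" for p using that pc_zero by auto
  then obtain \<theta> where "\<theta> \<in> lfun" "\<theta> X = 1" using lfun_separate[OF assms(1), of "{}"] by blast
  then show False using assms(2)[OF \<open>\<theta> \<in> lfun\<close>] by simp
qed

lemma lfun_minus: "\<theta> \<in> lfun \<Longrightarrow> x \<in> carrier W \<Longrightarrow> y \<in> carrier W \<Longrightarrow> \<theta> (x \<ominus>\<^bsub>W\<^esub> y) = \<theta> x - \<theta> y"
  by (simp add: minus_smult lfun_simps)

lemma lfun_eq: assumes "X \<in> carrier W" "Y \<in> carrier W" "\<And>\<theta>. \<theta> \<in> lfun \<Longrightarrow> \<theta> X = \<theta> Y" shows "X = Y"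
proof -
  have "X \<ominus>\<^bsub>W\<^esub> Y = \<zero>\<^bsub>W\<^esub>" using assms by (intro lfun_zero) (simp_all add: lfun_minus)
  then show ?thesis using assms by (simp add: minus_eq_zero_iff)
qed

lemma tfun_comult_lfun: "\<theta>1 \<in> lfun \<Longrightarrow> \<theta>2 \<in> lfun \<Longrightarrow> (\<lambda>X. tfun \<theta>1 \<theta>2 (\<Delta> X)) \<in> lfun"
  using klin_comp[of \<Delta> W TW] comult_hom alg_hom_klin tfun_klin by blast

lemma vanish_mono: "vanish n \<theta> \<Longrightarrow> m \<le> n \<Longrightarrow> vanish m \<theta>"
  by (simp add: vanish_def)

lemma tfun_comult_left_pc:
  assumes "\<theta>1 \<in> lfun" "\<theta>2 \<in> lfun" "vanish n \<theta>2" "Poly_Mapping.keys p \<subseteq> {u. deg u \<le> n}"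
  shows "tfun \<theta>1 \<theta>2 (\<Delta> (pc p)) = (\<Sum>u\<in>Poly_Mapping.keys p. Poly_Mapping.lookup p u * (\<theta>1 (wc (lw u)) * \<theta>2 (wc u)))"
  unfolding lfun_pc[OF tfun_comult_lfun[OF assms(1,2)]]
  using assms by (intro sum.cong) (auto simp: tfun_comult_left vanish_mono[OF assms(3)])

lemma tfun_comult_right_pc:
  assumes "\<theta>1 \<in> lfun" "\<theta>2 \<in> lfun" "vanish n \<theta>1" "Poly_Mapping.keys p \<subseteq> {u. deg u \<le> n}"
  shows "tfun \<theta>1 \<theta>2 (\<Delta> (pc p)) = (\<Sum>u\<in>Poly_Mapping.keys p. Poly_Mapping.lookup p u * (\<theta>1 (wc u) * \<theta>2 (wc (rw u))))"
  unfolding lfun_pc[OF tfun_comult_lfun[OF assms(1,2)]]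
  using assms by (intro sum.cong) (auto simp: tfun_comult_right vanish_mono[OF assms(3)])

lemma separate_degree:
  assumes X: "X \<in> carrier W" and "\<nexists>p. Poly_Mapping.keys p \<subseteq> {u. deg u < n} \<and> X = pc p"
  obtains \<theta> where "\<theta> \<in> lfun" "\<theta> X = 1" "vanish n \<theta>"
proof -
  have "X \<noteq> pc p" if "Poly_Mapping.keys p \<subseteq> {u. deg u < n}" for p using assms(2) that by blast
  from lfun_separate[OF X this] obtain \<theta> where "\<theta> \<in> lfun" "\<theta> X = 1" "\<forall>u\<in>{u. deg u < n}. \<theta> (wc u) = 0" by blast
  then show thesis using that by (simp add: vanish_def)
qed

text \<open>Words whose left factor differs from \<open>g\<close> contribute only lower terms.
  Otherwise some \<open>\<theta>2\<close> detects their part \<open>r'\<close> at the top, while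
  \<open>\<theta>1\<close>, dual to \<open>g\<close>, removes that part from the coproduct;
  comparison with the assumption gives \<open>\<theta>2 (pc r') = 0\<close>.\<close>

lemma filter_left:
  assumes p: "Poly_Mapping.keys p \<subseteq> {u. deg u \<le> n}" and g: "kword g"
    and X: "\<And>\<theta>1 \<theta>2. \<theta>1 \<in> lfun \<Longrightarrow> \<theta>2 \<in> lfun \<Longrightarrow> vanish n \<theta>2 \<Longrightarrow> tfun \<theta>1 \<theta>2 (\<Delta> (pc p)) = \<theta>1 (wc g) * \<theta>2 (pc p)"
  obtains r s where "pc p = pc (r + s)" "Poly_Mapping.keys r \<subseteq> Poly_Mapping.keys p \<inter> {u. wc (lw u) = wc g}"
    "Poly_Mapping.keys s \<subseteq> {u. deg u < n}"
proof -
  obtain r r' where rr: "p = r + r'" "Poly_Mapping.keys r \<subseteq> Poly_Mapping.keys p \<inter> {u. wc (lw u) = wc g}"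
    "Poly_Mapping.keys r' \<subseteq> Poly_Mapping.keys p - {u. wc (lw u) = wc g}" by (rule poly_mapping_split)
  have "\<exists>s. Poly_Mapping.keys s \<subseteq> {u. deg u < n} \<and> pc r' = pc s"
  proof (rule ccontr)
    assume "\<not> ?thesis"
    then obtain \<theta>2 where \<theta>2: "\<theta>2 \<in> lfun" "\<theta>2 (pc r') = 1" "vanish n \<theta>2"
      by (rule separate_degree[OF pc_closed])
    have "\<exists>\<theta>\<in>lfun. \<theta> (wc g) = 1 \<and> (\<forall>h\<in>lw ` Poly_Mapping.keys r'. \<theta> (wc h) = 0)"
      using rr(3) by (intro kword_dual[OF g]) auto
    then obtain \<theta>1 where \<theta>1: "\<theta>1 \<in> lfun" "\<theta>1 (wc g) = 1" "\<forall>u\<in>Poly_Mapping.keys r'. \<theta>1 (wc (lw u)) = 0" by auto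
    have d: "Poly_Mapping.keys r \<subseteq> {u. deg u \<le> n}" "Poly_Mapping.keys r' \<subseteq> {u. deg u \<le> n}" using rr p by auto
    note tl = tfun_comult_left_pc[OF \<theta>1(1) \<theta>2(1,3)]
    have "tfun \<theta>1 \<theta>2 (\<Delta> (pc p)) = tfun \<theta>1 \<theta>2 (\<Delta> (pc r)) + tfun \<theta>1 \<theta>2 (\<Delta> (pc r'))"
      unfolding rr(1) using lfun_simps(1)[OF tfun_comult_lfun[OF \<theta>1(1) \<theta>2(1)]] by (simp add: pc_simps)
    also have "tfun \<theta>1 \<theta>2 (\<Delta> (pc r')) = 0"
      unfolding tl[OF d(2)] using \<theta>1(3) by (intro sum.neutral) simp
    also have "tfun \<theta>1 \<theta>2 (\<Delta> (pc r)) = \<theta>2 (pc r)"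
      unfolding tl[OF d(1)] lfun_pc[OF \<theta>2(1)] using rr(2) \<theta>1(2) by (intro sum.cong) auto
    finally have "\<theta>2 (pc p) = \<theta>2 (pc r)" using X[OF \<theta>1(1) \<theta>2(1,3)] \<theta>1(2) by simp
    then show False using \<theta>2 unfolding rr(1) by (simp add: pc_simps lfun_simps)
  qed
  then obtain s where "Poly_Mapping.keys s \<subseteq> {u. deg u < n}" "pc r' = pc s" by blast
  then show thesis using rr by (intro that[of r s]) (simp_all add: pc_simps)
qed

lemma filter_right:
  assumes p: "Poly_Mapping.keys p \<subseteq> {u. deg u \<le> n}" and h: "kword h"
    and X: "\<And>\<theta>1 \<theta>2. \<theta>1 \<in> lfun \<Longrightarrow> \<theta>2 \<in> lfun \<Longrightarrow> vanish n \<theta>1 \<Longrightarrow> tfun \<theta>1 \<theta>2 (\<Delta> (pc p)) = \<theta>1 (pc p) * \<theta>2 (wc h)"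
  obtains r s where "pc p = pc (r + s)" "Poly_Mapping.keys r \<subseteq> Poly_Mapping.keys p \<inter> {u. wc (rw u) = wc h}"
    "Poly_Mapping.keys s \<subseteq> {u. deg u < n}"
proof -
  obtain r r' where rr: "p = r + r'" "Poly_Mapping.keys r \<subseteq> Poly_Mapping.keys p \<inter> {u. wc (rw u) = wc h}"
    "Poly_Mapping.keys r' \<subseteq> Poly_Mapping.keys p - {u. wc (rw u) = wc h}" by (rule poly_mapping_split)
  have "\<exists>s. Poly_Mapping.keys s \<subseteq> {u. deg u < n} \<and> pc r' = pc s"
  proof (rule ccontr)
    assume "\<not> ?thesis"
    then obtain \<theta>1 where \<theta>1: "\<theta>1 \<in> lfun" "\<theta>1 (pc r') = 1" "vanish n \<theta>1"
      by (rule separate_degree[OF pc_closed])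
    have "\<exists>\<theta>\<in>lfun. \<theta> (wc h) = 1 \<and> (\<forall>g\<in>rw ` Poly_Mapping.keys r'. \<theta> (wc g) = 0)"
      using rr(3) by (intro kword_dual[OF h]) auto
    then obtain \<theta>2 where \<theta>2: "\<theta>2 \<in> lfun" "\<theta>2 (wc h) = 1" "\<forall>u\<in>Poly_Mapping.keys r'. \<theta>2 (wc (rw u)) = 0" by auto
    have d: "Poly_Mapping.keys r \<subseteq> {u. deg u \<le> n}" "Poly_Mapping.keys r' \<subseteq> {u. deg u \<le> n}" using rr p by auto
    note tl = tfun_comult_right_pc[OF \<theta>1(1) \<theta>2(1) \<theta>1(3)]
    have "tfun \<theta>1 \<theta>2 (\<Delta> (pc p)) = tfun \<theta>1 \<theta>2 (\<Delta> (pc r)) + tfun \<theta>1 \<theta>2 (\<Delta> (pc r'))"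
      unfolding rr(1) using lfun_simps(1)[OF tfun_comult_lfun[OF \<theta>1(1) \<theta>2(1)]] by (simp add: pc_simps)
    also have "tfun \<theta>1 \<theta>2 (\<Delta> (pc r')) = 0"
      unfolding tl[OF d(2)] using \<theta>2(3) by (intro sum.neutral) simp
    also have "tfun \<theta>1 \<theta>2 (\<Delta> (pc r)) = \<theta>1 (pc r)"
      unfolding tl[OF d(1)] lfun_pc[OF \<theta>1(1)] using rr(2) \<theta>2(2) by (intro sum.cong) auto
    finally have "\<theta>1 (pc p) = \<theta>1 (pc r)" using X[OF \<theta>1(1) \<theta>2(1) \<theta>1(3)] \<theta>2(2) by simp
    then show False using \<theta>1 unfolding rr(1) by (simp add: pc_simps lfun_simps)
  qed
  then obtain s where "Poly_Mapping.keys s \<subseteq> {u. deg u < n}" "pc r' = pc s" by blast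
  then show thesis using rr by (intro that[of r s]) (simp_all add: pc_simps)
qed

text \<open>Modulo lower terms each of the two summands of the coproduct controls one side: the
  first fixes the left factor \<open>g\<close>, the second the right factor
  \<open>h\<close>.\<close>

lemma skew_primitive_top:
  assumes p: "Poly_Mapping.keys p \<subseteq> {u. deg u \<le> n}" and n: "n > 0" and g: "kword g" and h: "kword h"
    and \<Delta>: "\<Delta> (pc p) = tW (wc g) (pc p) \<oplus>\<^bsub>TW\<^esub> tW (pc p) (wc h)"
  obtains r s where "pc p = pc (r + s)" "Poly_Mapping.keys s \<subseteq> {u. deg u < n}"
    "Poly_Mapping.keys r \<subseteq> {u. deg u = n \<and> wc (lw u) = wc g \<and> wc (rw u) = wc h}"
proof -
  have tf: "tfun \<theta>1 \<theta>2 (\<Delta> (pc p)) = \<theta>1 (wc g) * \<theta>2 (pc p) + \<theta>1 (pc p) * \<theta>2 (wc h)"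
    if "\<theta>1 \<in> lfun" "\<theta>2 \<in> lfun" for \<theta>1 \<theta>2
    unfolding \<Delta> using that by (simp add: tfun_add tfun_pure)
  \<comment> \<open>As \<open>n\<close> is positive, a functional vanishing below degree
    \<open>n\<close> kills \<open>g\<close> and \<open>h\<close>. So one of the two summands
    disappears, which is the hypothesis of the filter lemmas.\<close>
  have v0: "\<theta> (wc g) = 0" "\<theta> (wc h) = 0" if "vanish n \<theta>" for \<theta>
    using vanishD[OF that, of g] vanishD[OF that, of h] g h n deg_kword[of g] deg_kword[of h] by simp_all
  obtain r s where 1: "pc p = pc (r + s)" "Poly_Mapping.keys r \<subseteq> Poly_Mapping.keys p \<inter> {u. wc (lw u) = wc g}"
    "Poly_Mapping.keys s \<subseteq> {u. deg u < n}"
    by (rule filter_left[OF p g]) (auto simp: tf v0)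
  have p': "Poly_Mapping.keys (r + s) \<subseteq> {u. deg u \<le> n}" using 1(2,3) p by (intro keys_add_subset) auto
  obtain r' s' where 2: "pc (r + s) = pc (r' + s')" "Poly_Mapping.keys r' \<subseteq> Poly_Mapping.keys (r + s) \<inter> {u. wc (rw u) = wc h}"
    "Poly_Mapping.keys s' \<subseteq> {u. deg u < n}"
    by (rule filter_right[OF p' h]) (auto simp: tf v0 1(1)[symmetric])
  \<comment> \<open>\<open>r'\<close> may still contain lower words coming from \<open>s\<close>,
    about whose left factor nothing is known; they are split off.\<close>
  obtain x y where 3: "r' = x + y" "Poly_Mapping.keys x \<subseteq> Poly_Mapping.keys r' \<inter> {u. deg u = n}"
    "Poly_Mapping.keys y \<subseteq> Poly_Mapping.keys r' - {u. deg u = n}" by (rule poly_mapping_split)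
  have rs: "Poly_Mapping.keys (r + s) \<subseteq> Poly_Mapping.keys r \<union> Poly_Mapping.keys s" by (rule Poly_Mapping.keys_add)
  show thesis
  proof (rule that[of x "y + s'"])
    show "pc p = pc (x + (y + s'))" using 1(1) 2(1) 3(1) by (simp add: add.assoc)
    have "Poly_Mapping.keys y \<subseteq> {u. deg u < n}" using 3(3) 2(2) p' by fastforce
    then show "Poly_Mapping.keys (y + s') \<subseteq> {u. deg u < n}" using 2(3) by (rule keys_add_subset)
    show "Poly_Mapping.keys x \<subseteq> {u. deg u = n \<and> wc (lw u) = wc g \<and> wc (rw u) = wc h}"
      using 3(2) 2(2) rs 1(2,3) by fastforce
  qed
qed

text \<open>Minimality is claimed only for \<open>n > 0\<close>: no word has degree below
  \<open>0\<close>, and the zero element gets degree \<open>0\<close> as well.\<close>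

lemma minimal_degree:
  assumes "X \<in> carrier W"
  obtains n p where "X = pc p" "Poly_Mapping.keys p \<subseteq> {u. deg u \<le> n}"
    "n > 0 \<longrightarrow> (\<nexists>p. Poly_Mapping.keys p \<subseteq> {u. deg u < n} \<and> X = pc p)"
proof -
  let ?P = "\<lambda>n. \<exists>p. X = pc p \<and> Poly_Mapping.keys p \<subseteq> {u. deg u \<le> n}"
  obtain p where p: "X = pc p" using assms W_carrier by auto
  have "?P (Max (deg ` Poly_Mapping.keys p))"
    using p by (intro exI[of _ p]) auto
  then have P: "?P (LEAST n. ?P n)" by (rule LeastI)
  define m where "m = (LEAST n. ?P n)"
  from P obtain r where r: "X = pc r" "Poly_Mapping.keys r \<subseteq> {u. deg u \<le> m}" unfolding m_def by blast
  have "m > 0 \<longrightarrow> (\<nexists>p. Poly_Mapping.keys p \<subseteq> {u. deg u < m} \<and> X = pc p)"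
  proof (intro impI notI)
    assume m: "m > 0" and "\<exists>p. Poly_Mapping.keys p \<subseteq> {u. deg u < m} \<and> X = pc p"
    then have "?P (m - 1)" by fastforce
    then have "m \<le> m - 1" unfolding m_def by (rule Least_le)
    then show False using m by simp
  qed
  with r show thesis by (rule that)
qed

text \<open>In positive degree \<open>n\<close>, a functional \<theta> vanishing below
  \<open>n\<close> with \<open>\<theta> X = 1\<close> would evaluate \<open>\<Delta> X\<close> to
  \<open>1\<close> by group-likeness and to \<open>0\<close> by the left factors, which it kills. In
  degree zero a dual functional in the first tensor factor isolates one word.\<close>

theorem grouplike:
  assumes X: "X \<in> carrier W" "X \<noteq> \<zero>\<^bsub>W\<^esub>" and \<Delta>: "\<Delta> X = tW X X"
  obtains u where "kword u" "X = wc u"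
proof -
  have tf: "tfun \<theta>1 \<theta>2 (\<Delta> X) = \<theta>1 X * \<theta>2 X" if "\<theta>1 \<in> lfun" "\<theta>2 \<in> lfun" for \<theta>1 \<theta>2
    unfolding \<Delta> using that X by (simp add: tfun_pure)
  obtain n p where p: "X = pc p" "Poly_Mapping.keys p \<subseteq> {u. deg u \<le> n}"
    and min: "n > 0 \<longrightarrow> (\<nexists>p. Poly_Mapping.keys p \<subseteq> {u. deg u < n} \<and> X = pc p)"
    by (rule minimal_degree[OF X(1)])
  have n: "n = 0"
  proof (rule ccontr)
    assume "n \<noteq> 0"
    then have "\<nexists>p. Poly_Mapping.keys p \<subseteq> {u. deg u < n} \<and> X = pc p" using min by simp
    then obtain \<theta> where \<theta>: "\<theta> \<in> lfun" "\<theta> X = 1" "vanish n \<theta>" by (rule separate_degree[OF X(1)])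
    have "\<theta> (wc (lw u)) = 0" for u
      using vanishD[OF \<theta>(3), of "lw u"] \<open>n \<noteq> 0\<close> deg_kword[of "lw u"] by simp
    then have "tfun \<theta> \<theta> (\<Delta> (pc p)) = 0"
      unfolding tfun_comult_left_pc[OF \<theta>(1,1,3) p(2)] by simp
    then show False using tf[OF \<theta>(1,1)] \<theta>(2) p(1) by simp
  qed
  then have kw: "\<forall>u\<in>Poly_Mapping.keys p. kword u" using p(2) deg_kword by blast
  have "\<exists>\<theta>\<in>lfun. \<theta> X \<noteq> 0" using lfun_zero[OF X(1)] X(2) by fastforce
  then obtain \<theta> where \<theta>: "\<theta> \<in> lfun" "\<theta> X \<noteq> 0" by blast
  let ?K = "Poly_Mapping.keys p" and ?l = "Poly_Mapping.lookup p"
  \<comment> \<open>Different words may be the same element, so coefficients are collected by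
    classes; some class \<open>y\<close> has a nonzero total \<open>c\<close>.\<close>
  have "\<theta> X = (\<Sum>y\<in>wc ` ?K. \<Sum>u\<in>{u \<in> ?K. wc u = y}. ?l u * \<theta> (wc u))"
    unfolding p(1) lfun_pc[OF \<theta>(1)] by (rule sum.image_gen) simp
  with \<theta>(2) have "(\<Sum>y\<in>wc ` ?K. \<Sum>u\<in>{u \<in> ?K. wc u = y}. ?l u * \<theta> (wc u)) \<noteq> 0" by simp
  then obtain y where y: "y \<in> wc ` ?K" "(\<Sum>u\<in>{u \<in> ?K. wc u = y}. ?l u * \<theta> (wc u)) \<noteq> 0"
    by (rule sum.not_neutral_contains_not_neutral)
  obtain v where v: "v \<in> ?K" "y = wc v" using y by auto
  define c where "c = (\<Sum>u\<in>{u \<in> ?K. wc u = y}. ?l u)"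
  have "(\<Sum>u\<in>{u \<in> ?K. wc u = y}. ?l u * \<theta> (wc u)) = c * \<theta> y"
    unfolding c_def sum_distrib_right by (rule sum.cong) auto
  then have c: "c \<noteq> 0" using y(2) by auto
  have "\<exists>\<theta>\<in>lfun. \<theta> (wc v) = 1 \<and> (\<forall>h\<in>?K - {u. wc u = y}. \<theta> (wc h) = 0)"
    by (rule kword_dual) (use kw v finite_keys[of p] in blast)+
  then obtain \<theta>1 where \<theta>1: "\<theta>1 \<in> lfun" "\<theta>1 (wc v) = 1" "\<forall>u\<in>?K - {u. wc u = y}. \<theta>1 (wc u) = 0" by blast
  have val: "(\<Sum>u\<in>?K. ?l u * (\<theta>1 (wc u) * f (wc u))) = c * f y" for f :: "_ \<Rightarrow> 'k"
  proof -
    have "(\<Sum>u\<in>?K. ?l u * (\<theta>1 (wc u) * f (wc u))) = (\<Sum>u\<in>{u \<in> ?K. wc u = y}. ?l u * (\<theta>1 (wc u) * f (wc u)))"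
      using \<theta>1(3) by (intro sum.mono_neutral_right) auto
    also have "\<dots> = c * f y" unfolding c_def sum_distrib_right using \<theta>1(2) v by (intro sum.cong) auto
    finally show ?thesis .
  qed
  have "X = wc v"
  proof (rule lfun_eq[OF X(1) wc_closed])
    fix \<theta>2 assume \<theta>2: "\<theta>2 \<in> lfun"
    have lwu: "lw u = u" if "kword u" for u
      using that by (induction u) (auto simp: lx_def isK_def split: gen.split_asm)
    have v0: "vanish 0 \<theta>2" by (simp add: vanish_def)
    have d0: "?K \<subseteq> {u. deg u \<le> 0}" using p(2) n by simp
    \<comment> \<open>Applying \<open>\<theta>1\<close> to the first tensor factor turns
      group-likeness into the equation \<open>c X = c y\<close>, tested by
      \<open>\<theta>2\<close>.\<close>
    have "tfun \<theta>1 \<theta>2 (\<Delta> (pc p)) = (\<Sum>u\<in>?K. ?l u * (\<theta>1 (wc u) * \<theta>2 (wc u)))"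
      unfolding tfun_comult_left_pc[OF \<theta>1(1) \<theta>2 v0 d0] by (rule sum.cong) (simp_all add: lwu kw)
    then have "\<theta>1 X * \<theta>2 X = c * \<theta>2 (wc v)"
      using tf[OF \<theta>1(1) \<theta>2] p(1) val[of \<theta>2] v(2) by simp
    moreover have "\<theta>1 X = c" using val[of "\<lambda>_. 1"] unfolding p(1) lfun_pc[OF \<theta>1(1)] by simp
    ultimately show "\<theta>2 X = \<theta>2 (wc v)" using c by simp
  qed
  then show thesis using that[of v] bspec[OF kw v(1)] by simp
qed

subsection \<open>Words of degree one\<close>

text \<open>The left factor replaces \<open>F j\<close> by \<open>L j\<close>, the right factor
  replaces \<open>E j\<close> by \<open>K j\<close>. The two exponent vectors together thus count
  the letters of each index.\<close>

lemma expo_lw: "expo (lw u) j = expo u j - int (count_list u (gF j))"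
proof (induction u)
  case (Cons x u) then show ?case by (cases x) (auto simp: lx_def)
qed simp

lemma expo_rw: "expo (rw u) j = expo u j + int (count_list u (gE j))"
proof (induction u)
  case (Cons x u) then show ?case by (cases x) (auto simp: rx_def)
qed simp

lemma deg_count: "deg u = (\<Sum>j\<in>UNIV. count_list u (gE j) + count_list u (gF j))"
proof (induction u)
  case (Cons x u)
  have "(\<Sum>j\<in>UNIV. count_list (x # u) (gE j) + count_list (x # u) (gF j))
     = (\<Sum>j\<in>UNIV. (count_list u (gE j) + count_list u (gF j)) + (of_bool (x = gE j) + of_bool (x = gF j)))"
    by (rule sum.cong) auto
  also have "\<dots> = deg u + (\<Sum>j\<in>UNIV. of_bool (x = gE j) + of_bool (x = gF j))"
    by (simp only: sum.distrib Cons.IH)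
  also have "(\<Sum>j\<in>UNIV. of_bool (x = gE j) + of_bool (x = gF j)) = (if isK x then 0 else 1 :: nat)"
    by (cases x) (simp_all add: sum.distrib of_bool_def)
  finally show ?case by simp
qed simp

lemma deg_one_split:
  assumes "deg u = 1"
  obtains x y g where "u = x @ g # y" "kword x" "kword y" "\<not> isK g"
proof -
  have "\<not> kword u" using assms deg_kword[of u] by simp
  then obtain x g y where u: "u = x @ g # y" "\<not> isK g" "\<forall>z\<in>set x. isK z"
    unfolding kword_def list_all_iff using split_list_first_prop[of u "\<lambda>g. \<not> isK g"] by blast
  then have "kword x" by (simp add: kword_def list_all_iff)
  moreover have "kword y" using assms u \<open>kword x\<close> deg_kword[of x] deg_kword[of y] by simp
  ultimately show thesis using that u by blast
qed

lemma K_letter_swap_E: "isK x \<Longrightarrow> \<exists>c. w x \<star> E i = c \<odot>\<^bsub>W\<^esub> (E i \<star> w x)"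
proof (cases x)
  case gJ
  have "J \<star> E i = 1 \<odot>\<^bsub>W\<^esub> (E i \<star> J)" by (simp add: JE)
  then show ?thesis using gJ by blast
qed (use KE LE in \<open>simp; blast\<close>)+

lemma K_letter_swap_F: "isK x \<Longrightarrow> \<exists>c. w x \<star> F i = c \<odot>\<^bsub>W\<^esub> (F i \<star> w x)"
proof (cases x)
  case gJ
  have "J \<star> F i = 1 \<odot>\<^bsub>W\<^esub> (F i \<star> J)" by (simp add: JF)
  then show ?thesis using gJ by blast
qed (use KF LF in \<open>simp; blast\<close>)+

lemma kword_swap:
  assumes y: "y \<in> carrier W" and sw: "\<And>x. isK x \<Longrightarrow> \<exists>c. w x \<star> y = c \<odot>\<^bsub>W\<^esub> (y \<star> w x)" and "kword u"
  shows "\<exists>c. wc u \<star> y = c \<odot>\<^bsub>W\<^esub> (y \<star> wc u)"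
  using \<open>kword u\<close>
proof (induction u)
  case Nil
  show ?case using y by (intro exI[of _ 1]) simp
next
  case (Cons x u)
  then obtain c where c: "wc u \<star> y = c \<odot>\<^bsub>W\<^esub> (y \<star> wc u)" by (simp, blast)
  obtain c' where c': "w x \<star> y = c' \<odot>\<^bsub>W\<^esub> (y \<star> w x)" using sw[of x] Cons.prems by auto
  have "wc (x # u) \<star> y = c \<odot>\<^bsub>W\<^esub> (w x \<star> (y \<star> wc u))" using y by (simp add: wc_Cons m_assoc c)
  also have "\<dots> = (c * c') \<odot>\<^bsub>W\<^esub> (y \<star> wc (x # u))" using y by (simp add: wc_Cons swap_assoc[OF c'])
  finally show ?case by blast
qed

text \<open>The letters around \<open>g\<close> move to its right up to a scalar; in the presence of
  \<open>J\<close> they depend only on their exponents.\<close>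

lemma degree_one_word:
  assumes y: "kword x" "kword z" and g: "g = gE i \<or> g = gF i" and v: "kword v" "v \<noteq> []"
    and e: "\<And>j. expo (x @ z) j = expo v j"
  shows "\<exists>c. wc (x @ g # z) \<star> J = c \<odot>\<^bsub>W\<^esub> (w g \<star> wc v)"
proof -
  obtain c where c: "wc x \<star> w g = c \<odot>\<^bsub>W\<^esub> (w g \<star> wc x)"
    using kword_swap[OF w_closed K_letter_swap_E y(1)] kword_swap[OF w_closed K_letter_swap_F y(1)] g by blast
  have "wc (x @ g # z) \<star> J = c \<odot>\<^bsub>W\<^esub> (w g \<star> (wc x \<star> (wc z \<star> J)))"
    by (simp add: wc_append wc_Cons m_assoc[symmetric] c)
  also have "wc x \<star> (wc z \<star> J) = wc (x @ z @ [gJ])" by (simp add: wc_append wc_single m_assoc)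
  also have "\<dots> = wc v" using y v e by (intro kword_expo_eq) auto
  finally show ?thesis by blast
qed

end

section \<open>Skew-primitive elements of low degree\<close>

context weak_quantum begin

lemma comult_kword: "kword u \<Longrightarrow> \<Delta> (wc u) = tW (wc u) (wc u)"
proof (induction u)
  case Nil
  show ?case using alg_hom_one[OF comult_hom] by (simp add: TT.pure_one)
next
  case (Cons x u)
  then have "comult_gen x = tW (w x) (w x)" by (cases x) simp_all
  then show ?case using Cons unfolding comult_Cons by (simp add: wc_Cons)
qed

text \<open>A representative of least degree is used, so that the top part \<open>r\<close> cannot
  be empty.\<close>

lemma skew_degree:
  assumes X: "X \<in> carrier W" and g: "kword g" and h: "kword h"
    and \<Delta>: "\<Delta> X = tW (wc g) X \<oplus>\<^bsub>TW\<^esub> tW X (wc h)"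
    and ns: "\<nexists>p. Poly_Mapping.keys p \<subseteq> {u. deg u < 1} \<and> X = pc p"
  obtains n r s where "n > 0" "X = pc (r + s)" "Poly_Mapping.keys s \<subseteq> {u. deg u < n}" "Poly_Mapping.keys r \<noteq> {}"
    "Poly_Mapping.keys r \<subseteq> {u. deg u = n \<and> wc (lw u) = wc g \<and> wc (rw u) = wc h}"
proof -
  obtain n p where p: "X = pc p" "Poly_Mapping.keys p \<subseteq> {u. deg u \<le> n}"
    and min: "n > 0 \<longrightarrow> (\<nexists>p. Poly_Mapping.keys p \<subseteq> {u. deg u < n} \<and> X = pc p)"
    by (rule minimal_degree[OF X])
  have n: "n > 0" using ns p by (cases n) auto
  obtain r s where rs: "pc p = pc (r + s)" "Poly_Mapping.keys s \<subseteq> {u. deg u < n}"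
    "Poly_Mapping.keys r \<subseteq> {u. deg u = n \<and> wc (lw u) = wc g \<and> wc (rw u) = wc h}"
    by (rule skew_primitive_top[OF p(2) n g h \<Delta>[unfolded p(1)]])
  have "Poly_Mapping.keys r \<noteq> {}"
  proof
    assume "Poly_Mapping.keys r = {}"
    then have "X = pc s" using rs(1) p(1) by simp
    then show False using min n rs(2) by blast
  qed
  from that[OF n _ rs(2) this rs(3)] p(1) rs(1) show thesis by simp
qed

lemma expo_top:
  assumes "kword g" "kword h" "wc (lw u) = wc g" "wc (rw u) = wc h"
  shows "expo g j = expo u j - int (count_list u (gF j))" "expo h j = expo u j + int (count_list u (gE j))"
  using wc_kword_inj(1)[OF kword_lw_rw(1) assms(1,3)] wc_kword_inj(1)[OF kword_lw_rw(2) assms(2,4)]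
    expo_lw[of u j] expo_rw[of u j] by simp_all

text \<open>The difference of the exponents of \<open>h\<close> and \<open>g\<close> at
  \<open>j\<close> is the number of letters \<open>E j\<close> and \<open>F j\<close> in
  \<open>u\<close>; all positivity of exponents below comes from here.\<close>

lemma skew_expo:
  assumes "kword g" "kword h" "wc (lw u) = wc g" "wc (rw u) = wc h"
  shows "expo h j - expo g j \<ge> 0" "(\<Sum>j\<in>UNIV. expo h j - expo g j) = int (deg u)"
proof -
  have eq: "expo h j - expo g j = int (count_list u (gE j) + count_list u (gF j))" for j
    using expo_top[OF assms, of j] by linarith
  show "expo h j - expo g j \<ge> 0" "(\<Sum>j\<in>UNIV. expo h j - expo g j) = int (deg u)"
    unfolding eq by (simp_all add: deg_count)
qed

lemma degree_zero_commute:
  assumes "Poly_Mapping.keys p \<subseteq> {u. deg u < 1}" "kword v"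
  shows "wc v \<star> pc p = pc p \<star> wc v"
  using assms(1)
proof (induction p rule: poly_mapping_induct_on)
  case zero show ?case by (simp add: pc_zero)
next
  case (add u c p)
  then have "kword u" using deg_kword[of u] by simp
  then show ?case using add kwords_commute[OF assms(2), of u] by (simp add: pc_simps r_distr l_distr)
qed

text \<open>\<open>J\<close> is absorbed by every nonempty word of degree zero, so multiplication by
  it loses only the coefficient of the empty word.\<close>

lemma degree_zero_J:
  assumes "Poly_Mapping.keys p \<subseteq> {u. deg u < 1}"
  shows "\<exists>c. pc p = pc p \<star> J \<oplus>\<^bsub>W\<^esub> c \<odot>\<^bsub>W\<^esub> (\<one>\<^bsub>W\<^esub> \<ominus>\<^bsub>W\<^esub> J)"
  using assms
proof (induction p rule: poly_mapping_induct_on)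
  case zero
  show ?case by (intro exI[of _ 0]) (simp add: pc_zero)
next
  case (add u c p)
  then obtain c' where c': "pc p = pc p \<star> J \<oplus>\<^bsub>W\<^esub> c' \<odot>\<^bsub>W\<^esub> (\<one>\<^bsub>W\<^esub> \<ominus>\<^bsub>W\<^esub> J)" by blast
  have u: "kword u" using add deg_kword[of u] by simp
  have "wc u = wc u \<star> J \<oplus>\<^bsub>W\<^esub> of_bool (u = []) \<odot>\<^bsub>W\<^esub> (\<one>\<^bsub>W\<^esub> \<ominus>\<^bsub>W\<^esub> J)"
  proof (cases "u = []")
    case True
    have "J \<oplus>\<^bsub>W\<^esub> (\<one>\<^bsub>W\<^esub> \<ominus>\<^bsub>W\<^esub> J) = \<one>\<^bsub>W\<^esub>" by (simp add: a_minus_def a_comm[of "\<one>\<^bsub>W\<^esub>" "\<ominus>\<^bsub>W\<^esub> J"] r_neg2)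
    then show ?thesis using True by simp
  next
    case False
    have "wc u \<star> J = wc u"
      using J_kword[OF u False] kwords_commute[OF u, of "[gJ]"] by (simp add: wc_Cons)
    then show ?thesis using False by simp
  qed
  then have 1: "c \<odot>\<^bsub>W\<^esub> wc u = c \<odot>\<^bsub>W\<^esub> (wc u \<star> J) \<oplus>\<^bsub>W\<^esub> (c * of_bool (u = [])) \<odot>\<^bsub>W\<^esub> (\<one>\<^bsub>W\<^esub> \<ominus>\<^bsub>W\<^esub> J)"
    by (rule arg_cong[where f = "\<lambda>x. c \<odot>\<^bsub>W\<^esub> x", THEN trans]) (simp add: smult_r_distr)
  have "pc (Poly_Mapping.single u c + p) = c \<odot>\<^bsub>W\<^esub> wc u \<oplus>\<^bsub>W\<^esub> pc p" by (simp add: pc_simps)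
  also have "\<dots> = (c \<odot>\<^bsub>W\<^esub> (wc u \<star> J) \<oplus>\<^bsub>W\<^esub> (c * of_bool (u = [])) \<odot>\<^bsub>W\<^esub> (\<one>\<^bsub>W\<^esub> \<ominus>\<^bsub>W\<^esub> J)) \<oplus>\<^bsub>W\<^esub> (pc p \<star> J \<oplus>\<^bsub>W\<^esub> c' \<odot>\<^bsub>W\<^esub> (\<one>\<^bsub>W\<^esub> \<ominus>\<^bsub>W\<^esub> J))"
    by (rule arg_cong2[OF 1 c'])
  also have "\<dots> = pc (Poly_Mapping.single u c + p) \<star> J \<oplus>\<^bsub>W\<^esub> (c * of_bool (u = []) + c') \<odot>\<^bsub>W\<^esub> (\<one>\<^bsub>W\<^esub> \<ominus>\<^bsub>W\<^esub> J)"
    by (simp add: pc_simps l_distr smult_l_distr a_ac)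
  finally show ?case by blast
qed

text \<open>By the exponents of \<open>g\<close> and \<open>h\<close>, the one letter of positive
  degree in each word is \<open>E s\<close> or \<open>F s\<close>. The other letters have the
  exponents of \<open>g\<close>, raised by one at \<open>s\<close> in the case of
  \<open>F s\<close>, whose left factor is \<open>L s\<close>.\<close>

lemma degree_one_pc:
  assumes r: "Poly_Mapping.keys r \<subseteq> {u. deg u = 1 \<and> wc (lw u) = wc g \<and> wc (rw u) = wc h}"
    and gh: "kword g" "kword h" "\<And>j. expo h j - expo g j = of_bool (j = s)"
    and vE: "kword vE" "vE \<noteq> []" "\<And>j. expo vE j = expo g j"
    and vF: "kword vF" "vF \<noteq> []" "\<And>j. expo vF j = expo g j + of_bool (j = s)"
  shows "\<exists>\<alpha> \<beta>. pc r \<star> J = \<alpha> \<odot>\<^bsub>W\<^esub> (E s \<star> wc vE) \<oplus>\<^bsub>W\<^esub> \<beta> \<odot>\<^bsub>W\<^esub> (F s \<star> wc vF)"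
  using r
proof (induction r rule: poly_mapping_induct_on)
  case zero
  show ?case by (intro exI[of _ 0]) (simp add: pc_zero)
next
  case (add u c r)
  then obtain \<alpha> \<beta> where IH: "pc r \<star> J = \<alpha> \<odot>\<^bsub>W\<^esub> (E s \<star> wc vE) \<oplus>\<^bsub>W\<^esub> \<beta> \<odot>\<^bsub>W\<^esub> (F s \<star> wc vF)" by blast
  have u: "deg u = 1" "wc (lw u) = wc g" "wc (rw u) = wc h" using add by auto
  have cnt: "int (count_list u (gE j)) + int (count_list u (gF j)) = of_bool (j = s)" for j
    using gh(3)[of j] expo_top[OF gh(1,2) u(2,3), of j] by simp
  obtain x y g0 where xy: "u = x @ g0 # y" "kword x" "kword y" "\<not> isK g0" by (rule deg_one_split[OF u(1)])
  have "\<exists>\<alpha> \<beta>. wc u \<star> J = \<alpha> \<odot>\<^bsub>W\<^esub> (E s \<star> wc vE) \<oplus>\<^bsub>W\<^esub> \<beta> \<odot>\<^bsub>W\<^esub> (F s \<star> wc vF)"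
  proof (cases g0)
    case (gE t)
    have "count_list u (gE t) > 0" using xy(1) gE by simp
    then have t: "t = s" using cnt[of t] by (auto simp: of_bool_def split: if_splits)
    have "count_list u (gF j) = 0" for j
      using cnt[of j] \<open>count_list u (gE t) > 0\<close> t by (cases "j = s") auto
    then have "expo (x @ y) j = expo vE j" for j
      using expo_top(1)[OF gh(1,2) u(2,3), of j] vE(3)[of j] xy(1) gE by simp
    then obtain c where "wc u \<star> J = c \<odot>\<^bsub>W\<^esub> (E s \<star> wc vE)"
      using degree_one_word[OF xy(2,3) _ vE(1,2), of g0 s] gE t xy(1) by auto
    then have "wc u \<star> J = c \<odot>\<^bsub>W\<^esub> (E s \<star> wc vE) \<oplus>\<^bsub>W\<^esub> 0 \<odot>\<^bsub>W\<^esub> (F s \<star> wc vF)" by simp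
    then show ?thesis by blast
  next
    case (gF t)
    have p: "count_list u (gF t) > 0" using xy(1) gF by simp
    then have t: "t = s" using cnt[of t] by (auto simp: of_bool_def split: if_splits)
    have "int (count_list u (gF j)) = of_bool (j = s)" for j
      using cnt[of j] p t by (cases "j = s") auto
    then have "expo (x @ y) j = expo vF j" for j
      using expo_top(1)[OF gh(1,2) u(2,3), of j] vF(3)[of j] xy(1) gF by simp
    then obtain c where "wc u \<star> J = c \<odot>\<^bsub>W\<^esub> (F s \<star> wc vF)"
      using degree_one_word[OF xy(2,3) _ vF(1,2), of g0 s] gF t xy(1) by auto
    then have "wc u \<star> J = 0 \<odot>\<^bsub>W\<^esub> (E s \<star> wc vE) \<oplus>\<^bsub>W\<^esub> c \<odot>\<^bsub>W\<^esub> (F s \<star> wc vF)" by simp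
    then show ?thesis by blast
  qed (use xy(4) in auto)
  then obtain \<alpha>' \<beta>' where "wc u \<star> J = \<alpha>' \<odot>\<^bsub>W\<^esub> (E s \<star> wc vE) \<oplus>\<^bsub>W\<^esub> \<beta>' \<odot>\<^bsub>W\<^esub> (F s \<star> wc vF)" by blast
  then have "pc (Poly_Mapping.single u c + r) \<star> J =
      (c * \<alpha>' + \<alpha>) \<odot>\<^bsub>W\<^esub> (E s \<star> wc vE) \<oplus>\<^bsub>W\<^esub> (c * \<beta>' + \<beta>) \<odot>\<^bsub>W\<^esub> (F s \<star> wc vF)"
    by (simp add: pc_simps l_distr IH smult_r_distr smult_l_distr a_ac)
  then show ?case by blast
qed

text \<open>Every letter other than an \<open>E t\<close> of type 1 has a nonempty left factor. This
  serves type 1, where the left factor of the coproduct is the unit.\<close>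

lemma lw_Nil_degree_one:
  assumes "deg u = 1" "lw u = []" shows "\<exists>t. \<kappa> t \<and> u = [gE t]"
proof -
  obtain x y g where u: "u = x @ g # y" "kword x" "kword y" "\<not> isK g" by (rule deg_one_split[OF assms(1)])
  have k: "lw v = v" if "kword v" for v
    using that by (induction v) (auto simp: lx_def isK_def split: gen.split_asm)
  have "lw u = lw x @ lx g @ lw y" by (simp add: u(1) lw_def)
  then have "x = []" "y = []" "lx g = []" using assms(2) k[OF u(2)] k[OF u(3)] by simp_all
  then show ?thesis using u by (cases g) (auto simp: lx_def split: if_splits)
qed

lemma rw_Nil_degree_one:
  assumes "deg u = 1" "rw u = []" shows "\<exists>t. \<kappa>' t \<and> u = [gF t]"
proof -
  obtain x y g where u: "u = x @ g # y" "kword x" "kword y" "\<not> isK g" by (rule deg_one_split[OF assms(1)])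
  have k: "rw v = v" if "kword v" for v
    using that by (induction v) (auto simp: rx_def isK_def split: gen.split_asm)
  have "rw u = rw x @ rx g @ rw y" by (simp add: u(1) rw_def)
  then have "x = []" "y = []" "rx g = []" using assms(2) k[OF u(2)] k[OF u(3)] by simp_all
  then show ?thesis using u by (cases g) (auto simp: rx_def split: if_splits)
qed

text \<open>Conjugation by \<open>K s\<close> separates the components of different weight.\<close>

lemma weight_components:
  assumes car: "A \<in> carrier W" "B \<in> carrier W" "Z \<in> carrier W"
    and KA: "K s \<star> A = v1 \<odot>\<^bsub>W\<^esub> (A \<star> K s)" and KB: "K s \<star> B = r1 \<odot>\<^bsub>W\<^esub> (B \<star> K s)" and KZ: "K s \<star> Z = Z \<star> K s"
    and J: "A \<star> J = A" "B \<star> J = B" "Z \<star> J = Z"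
    and KX: "K s \<star> (A \<oplus>\<^bsub>W\<^esub> B \<oplus>\<^bsub>W\<^esub> Z) = v \<odot>\<^bsub>W\<^esub> ((A \<oplus>\<^bsub>W\<^esub> B \<oplus>\<^bsub>W\<^esub> Z) \<star> K s)"
    and ne: "v1 \<noteq> 1" "r1 \<noteq> 1" "v1 \<noteq> r1" "v \<noteq> 1" "v \<noteq> r1"
  shows "B = \<zero>\<^bsub>W\<^esub>" "Z = \<zero>\<^bsub>W\<^esub>" "v \<noteq> v1 \<Longrightarrow> A = \<zero>\<^bsub>W\<^esub>"
proof -
  \<comment> \<open>Conjugation by \<open>K s\<close>, with \<open>L s\<close> in place of an
    inverse; on elements that absorb \<open>J\<close> it acts by the weight.\<close>
  define Ad where "Ad y = K s \<star> (y \<star> L s)" for y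
  have KL': "y \<star> K s \<star> L s = y" if "y \<in> carrier W" "y \<star> J = y" for y
    using that by (simp add: m_assoc KL)
  let ?X = "A \<oplus>\<^bsub>W\<^esub> B \<oplus>\<^bsub>W\<^esub> Z"
  have Ad_eq: "Ad y = (K s \<star> y) \<star> L s" if "y \<in> carrier W" for y
    using that by (simp add: Ad_def m_assoc)
  have XJ: "?X \<star> J = ?X" using car J by (simp add: l_distr)
  have Ad: "Ad A = v1 \<odot>\<^bsub>W\<^esub> A" "Ad B = r1 \<odot>\<^bsub>W\<^esub> B" "Ad Z = Z"
    using car KL'[OF _ J(1)] KL'[OF _ J(2)] KL'[OF _ J(3)] by (simp_all add: Ad_eq KA KB KZ)
  have AdX: "Ad ?X = v \<odot>\<^bsub>W\<^esub> ?X"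
  proof -
    have X: "?X \<in> carrier W" using car by simp
    have "Ad ?X = v \<odot>\<^bsub>W\<^esub> (?X \<star> K s \<star> L s)" unfolding Ad_eq[OF X] KX using X by (intro mult_smult_l) auto
    then show ?thesis using KL'[OF X XJ] by simp
  qed
  have lin: "Ad (x \<oplus>\<^bsub>W\<^esub> y) = Ad x \<oplus>\<^bsub>W\<^esub> Ad y" "Ad (c \<odot>\<^bsub>W\<^esub> x) = c \<odot>\<^bsub>W\<^esub> Ad x" if "x \<in> carrier W" "y \<in> carrier W" for x y c
    using that by (simp_all add: Ad_def l_distr r_distr)
  have 1: "v \<odot>\<^bsub>W\<^esub> ?X = v1 \<odot>\<^bsub>W\<^esub> A \<oplus>\<^bsub>W\<^esub> r1 \<odot>\<^bsub>W\<^esub> B \<oplus>\<^bsub>W\<^esub> Z"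
    unfolding AdX[symmetric] using car by (simp add: lin Ad)
  have 2: "(v * v) \<odot>\<^bsub>W\<^esub> ?X = (v1 * v1) \<odot>\<^bsub>W\<^esub> A \<oplus>\<^bsub>W\<^esub> (r1 * r1) \<odot>\<^bsub>W\<^esub> B \<oplus>\<^bsub>W\<^esub> Z"
  proof -
    have "Ad (v \<odot>\<^bsub>W\<^esub> ?X) = Ad (v1 \<odot>\<^bsub>W\<^esub> A \<oplus>\<^bsub>W\<^esub> r1 \<odot>\<^bsub>W\<^esub> B \<oplus>\<^bsub>W\<^esub> Z)" by (simp only: 1)
    then show ?thesis using car by (simp add: lin(2) AdX) (simp add: lin Ad)
  qed
  have 3: "(v * v * v) \<odot>\<^bsub>W\<^esub> ?X = (v1 * v1 * v1) \<odot>\<^bsub>W\<^esub> A \<oplus>\<^bsub>W\<^esub> (r1 * r1 * r1) \<odot>\<^bsub>W\<^esub> B \<oplus>\<^bsub>W\<^esub> Z"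
  proof -
    have "Ad ((v * v) \<odot>\<^bsub>W\<^esub> ?X) = Ad ((v1 * v1) \<odot>\<^bsub>W\<^esub> A \<oplus>\<^bsub>W\<^esub> (r1 * r1) \<odot>\<^bsub>W\<^esub> B \<oplus>\<^bsub>W\<^esub> Z)" by (simp only: 2)
    then show ?thesis using car by (simp add: lin(2) AdX) (simp add: lin Ad)
  qed
  have key: "\<theta> B = 0 \<and> \<theta> Z = 0 \<and> (v \<noteq> v1 \<longrightarrow> \<theta> A = 0)" if \<theta>: "\<theta> \<in> lfun" for \<theta>
  proof -
    define x y z where "x = \<theta> A" and "y = \<theta> B" and "z = \<theta> Z"
    have e: "v * (x + y + z) = v1 * x + r1 * y + z" "v * v * (x + y + z) = v1 * v1 * x + r1 * r1 * y + z"
      "v * v * v * (x + y + z) = v1 * v1 * v1 * x + r1 * r1 * r1 * y + z"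
      using arg_cong[OF 1, of \<theta>] arg_cong[OF 2, of \<theta>] arg_cong[OF 3, of \<theta>] \<theta> car
      by (simp_all add: lfun_simps x_def y_def z_def)
    \<comment> \<open>The three equations become a homogeneous Vandermonde system for
      \<open>x'\<close>, \<open>y'\<close>, \<open>z'\<close> with the distinct nodes
      \<open>v1\<close>, \<open>r1\<close>, \<open>1\<close>. The factors relating these to
      \<open>x\<close>, \<open>y\<close>, \<open>z\<close> are nonzero except possibly
      \<open>v1 - v\<close>.\<close>
    define x' y' z' where "x' = (v1 - v) * x" and "y' = (r1 - v) * y" and "z' = (1 - v) * z"
    have "x' + y' + z' = (v1 * x + r1 * y + z) - v * (x + y + z)"
      by (simp add: x'_def y'_def z'_def algebra_simps)
    then have 4: "x' + y' + z' = 0" using e(1) by simp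
    have "v1 * x' + r1 * y' + z' = (v1 * v1 * x + r1 * r1 * y + z) - v * (v1 * x + r1 * y + z)"
      by (simp add: x'_def y'_def z'_def algebra_simps)
    then have 5: "v1 * x' + r1 * y' + z' = 0" unfolding e(1)[symmetric] e(2)[symmetric] by simp
    have "v1 * v1 * x' + r1 * r1 * y' + z' = (v1 * v1 * v1 * x + r1 * r1 * r1 * y + z) - v * (v1 * v1 * x + r1 * r1 * y + z)"
      by (simp add: x'_def y'_def z'_def algebra_simps)
    then have 6: "v1 * v1 * x' + r1 * r1 * y' + z' = 0" unfolding e(2)[symmetric] e(3)[symmetric] by simp
    have "(r1 - v1) * ((r1 - 1) * y') = (v1 * v1 * x' + r1 * r1 * y' + z') - (v1 * x' + r1 * y' + z')
        - v1 * ((v1 * x' + r1 * y' + z') - (x' + y' + z'))" by (simp add: algebra_simps)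
    then have 7: "(r1 - v1) * ((r1 - 1) * y') = 0" unfolding 4 5 6 by simp
    have "(v1 - 1) * x' + (r1 - 1) * y' = (v1 * x' + r1 * y' + z') - (x' + y' + z')" by (simp add: algebra_simps)
    then have 8: "(v1 - 1) * x' + (r1 - 1) * y' = 0" unfolding 4 5 by simp
    have "y' = 0" using 7 ne by simp
    moreover from this have "x' = 0" using 8 ne by simp
    ultimately have "y' = 0" "x' = 0" "z' = 0" using 4 by auto
    then show ?thesis using ne by (auto simp: x'_def y'_def z'_def x_def y_def z_def)
  qed
  show "B = \<zero>\<^bsub>W\<^esub>" by (rule lfun_zero[OF car(2)]) (simp add: key)
  show "Z = \<zero>\<^bsub>W\<^esub>" by (rule lfun_zero[OF car(3)]) (simp add: key)
  show "v \<noteq> v1 \<Longrightarrow> A = \<zero>\<^bsub>W\<^esub>" by (rule lfun_zero[OF car(1)]) (simp add: key)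
qed

text \<open>The exponent of \<open>q\<close> is \<open>2 (d i + d j)\<close>. So the weights
  \<open>P i i\<close> and \<open>inverse (P j j)\<close> differ, which keeps the image of an
  \<open>E i\<close> free of \<open>F j\<close>.\<close>

lemma P_diag_prod_neq_1: "P i i * P j j \<noteq> 1"
proof
  assume "P i i * P j j = 1"
  then have "q powi (int (d i) * 2 + int (d j) * 2) = q powi 0"
    using q0 by (simp add: P_powi a_diag power_int_add)
  then show False using q_powi_inj d_pos[of i] by fastforce
qed

abbreviation "T \<equiv> w_antipode a d q \<kappa> \<kappa>'"

lemma antipode_hom: "T \<in> alg_hom W (opp W)" and antipode_w: "T (w g) = antipode_gen g"
proof -
  have "antipode_gen = (\<lambda>g. case g of gE i \<Rightarrow> \<ominus>\<^bsub>W\<^esub> (E i \<star> L i) | gF i \<Rightarrow> \<ominus>\<^bsub>W\<^esub> (K i \<star> F i)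
       | gK i \<Rightarrow> L i | gKbar i \<Rightarrow> K i | gJ \<Rightarrow> J)"
    by (rule ext) (simp add: antipode_gen_def)
  then have "T = extend_hom rels (opp W) antipode_gen"
    using extend_antihom_eq[OF kalg_W antipode_gen_closed, of rels] by (simp add: w_antipode_def Let_def)
  then show "T \<in> alg_hom W (opp W)" "T (w g) = antipode_gen g"
    using hom_from_W[OF wrel_antipode] by auto
qed

lemma antipode_lin:
  "x \<in> carrier W \<Longrightarrow> y \<in> carrier W \<Longrightarrow> T (x \<oplus>\<^bsub>W\<^esub> y) = T x \<oplus>\<^bsub>W\<^esub> T y"
  "x \<in> carrier W \<Longrightarrow> T (c \<odot>\<^bsub>W\<^esub> x) = c \<odot>\<^bsub>W\<^esub> T x" "T \<one>\<^bsub>W\<^esub> = \<one>\<^bsub>W\<^esub>"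
  using alg_hom_add[OF antipode_hom] alg_hom_smult[OF antipode_hom] alg_hom_one[OF antipode_hom] by simp_all

lemma antipode_one_minus_J: "T (\<one>\<^bsub>W\<^esub> \<ominus>\<^bsub>W\<^esub> J) = \<one>\<^bsub>W\<^esub> \<ominus>\<^bsub>W\<^esub> J"
  by (simp add: minus_smult antipode_lin antipode_w)

end

section \<open>Automorphisms\<close>

context weak_quantum begin

lemma K_inj: "K i = K j \<Longrightarrow> i = j"
  using wc_kword_inj(1)[of "[gK i]" "[gK j]"] by (auto simp: wc_single fun_eq_iff dest: spec[of _ i])

lemma scalar_eq:
  assumes "x \<in> carrier W" "x \<noteq> \<zero>\<^bsub>W\<^esub>" "b \<odot>\<^bsub>W\<^esub> x = c \<odot>\<^bsub>W\<^esub> x" shows "b = c"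
proof -
  have "(b + - c) \<odot>\<^bsub>W\<^esub> x = \<zero>\<^bsub>W\<^esub>"
    unfolding smult_l_distr[OF assms(1)] assms(3) by (rule smult_cancel(1)[OF assms(1)])
  then show ?thesis using assms(1,2) by (simp add: smult_eq_zero_iff)
qed

lemma add_cancel:
  "\<lbrakk>x \<oplus>\<^bsub>W\<^esub> y = x \<oplus>\<^bsub>W\<^esub> z; x \<in> carrier W; y \<in> carrier W; z \<in> carrier W\<rbrakk> \<Longrightarrow> y = z"
  using r_neg1[of x y] r_neg1[of x z] by simp

lemma J_kword_right: "kword u \<Longrightarrow> u \<noteq> [] \<Longrightarrow> wc u \<star> J = wc u"
  using J_kword[of u] kwords_commute[of u "[gJ]"] by (simp add: wc_Cons)

lemma type1_form:
  assumes "X = pc (r + p)" "Poly_Mapping.keys p \<subseteq> {u. deg u < 1}" "pc p \<star> J = \<zero>\<^bsub>W\<^esub>"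
    "\<forall>u \<in> Poly_Mapping.keys r. u = [g]"
  obtains c e0 where "X = c \<odot>\<^bsub>W\<^esub> w g \<oplus>\<^bsub>W\<^esub> e0 \<odot>\<^bsub>W\<^esub> (\<one>\<^bsub>W\<^esub> \<ominus>\<^bsub>W\<^esub> J)"
proof -
  have "Poly_Mapping.lookup r k = 0" if "k \<noteq> [g]" for k
    using assms(4) that by (metis in_keys_iff)
  then have "r = Poly_Mapping.single [g] (Poly_Mapping.lookup r [g])"
    by (intro poly_mapping_eqI) (auto simp: lookup_single when_def)
  then obtain c where c: "r = Poly_Mapping.single [g] c" by blast
  obtain e0 where "pc p = pc p \<star> J \<oplus>\<^bsub>W\<^esub> e0 \<odot>\<^bsub>W\<^esub> (\<one>\<^bsub>W\<^esub> \<ominus>\<^bsub>W\<^esub> J)"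
    using degree_zero_J[OF assms(2)] by blast
  then have "pc p = e0 \<odot>\<^bsub>W\<^esub> (\<one>\<^bsub>W\<^esub> \<ominus>\<^bsub>W\<^esub> J)" using assms(3) by simp
  then show thesis using that[of c e0] assms(1) by (simp add: pc_simps c wc_single)
qed

text \<open>The skew-primitive elements include the multiples of \<open>1 - J\<close>; the antipode excludes them.\<close>

lemma antipode_drop:
  assumes "Y \<in> carrier W" "k \<in> carrier W" "J \<star> k = k"
    and X: "X = Y \<oplus>\<^bsub>W\<^esub> e0 \<odot>\<^bsub>W\<^esub> (\<one>\<^bsub>W\<^esub> \<ominus>\<^bsub>W\<^esub> J)"
    and T: "T X = c \<odot>\<^bsub>W\<^esub> (X \<star> k)" "T Y = c \<odot>\<^bsub>W\<^esub> (Y \<star> k)"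
  shows "X = Y"
proof -
  have jl: "(\<one>\<^bsub>W\<^esub> \<ominus>\<^bsub>W\<^esub> J) \<star> k = \<zero>\<^bsub>W\<^esub>"
    using assms(2,3) smult_cancel(1)[of k 1] by (simp add: minus_smult l_distr)
  have "X \<star> k = Y \<star> k" unfolding X using assms(1,2) by (simp add: l_distr jl)
  then have "T X = c \<odot>\<^bsub>W\<^esub> (Y \<star> k)" using T(1) by simp
  \<comment> \<open>\<open>T\<close> fixes \<open>1 - J\<close>, whereas multiplication by
    \<open>k\<close> kills it, so the two expressions for \<open>T X\<close> differ exactly by the
    unwanted term.\<close>
  moreover have "T X = c \<odot>\<^bsub>W\<^esub> (Y \<star> k) \<oplus>\<^bsub>W\<^esub> e0 \<odot>\<^bsub>W\<^esub> (\<one>\<^bsub>W\<^esub> \<ominus>\<^bsub>W\<^esub> J)"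
    unfolding X using assms(1) by (simp add: antipode_lin antipode_one_minus_J T(2))
  ultimately have "c \<odot>\<^bsub>W\<^esub> (Y \<star> k) \<oplus>\<^bsub>W\<^esub> e0 \<odot>\<^bsub>W\<^esub> (\<one>\<^bsub>W\<^esub> \<ominus>\<^bsub>W\<^esub> J) = c \<odot>\<^bsub>W\<^esub> (Y \<star> k) \<oplus>\<^bsub>W\<^esub> \<zero>\<^bsub>W\<^esub>"
    using assms(1,2) by simp
  then have "e0 \<odot>\<^bsub>W\<^esub> (\<one>\<^bsub>W\<^esub> \<ominus>\<^bsub>W\<^esub> J) = \<zero>\<^bsub>W\<^esub>"
    using add_cancel[of "c \<odot>\<^bsub>W\<^esub> (Y \<star> k)" "e0 \<odot>\<^bsub>W\<^esub> (\<one>\<^bsub>W\<^esub> \<ominus>\<^bsub>W\<^esub> J)" "\<zero>\<^bsub>W\<^esub>"] assms(1,2) by simp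
  then show ?thesis using X assms(1) by simp
qed

end

section \<open>The shape of an automorphism\<close>

locale weak_aut = weak_quantum a d q \<kappa> \<kappa>'
  for a :: "'i::finite \<Rightarrow> 'i \<Rightarrow> int" and d and q :: "'k::field" and \<kappa> \<kappa>' +
  fixes \<phi> \<psi> :: "('i, 'k) w_elem \<Rightarrow> ('i, 'k) w_elem"
  assumes homs: "\<phi> \<in> alg_hom W W" "\<psi> \<in> alg_hom W W"
    and comults: "\<And>x. x \<in> carrier W \<Longrightarrow> tensor_map W W \<phi> \<phi> (\<Delta> x) = \<Delta> (\<phi> x)"
      "\<And>x. x \<in> carrier W \<Longrightarrow> tensor_map W W \<psi> \<psi> (\<Delta> x) = \<Delta> (\<psi> x)"
    and antipodes: "\<And>x. x \<in> carrier W \<Longrightarrow> \<phi> (T x) = T (\<phi> x)" "\<And>x. x \<in> carrier W \<Longrightarrow> \<psi> (T x) = T (\<psi> x)"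
    and inverses: "\<And>x. x \<in> carrier W \<Longrightarrow> \<psi> (\<phi> x) = x" "\<And>x. x \<in> carrier W \<Longrightarrow> \<phi> (\<psi> x) = x"
begin

text \<open>The assumptions are symmetric in \<phi> and its inverse \<psi>, so every result applies
  to both; positivity of exponents and preservation of types are used in both directions.\<close>

lemma swapped: "weak_aut a d q \<kappa> \<kappa>' \<psi> \<phi>"
  by (intro weak_aut.intro weak_quantum_axioms weak_aut_axioms.intro homs comults antipodes inverses)

lemma phi_closed [simp]: "x \<in> carrier W \<Longrightarrow> \<phi> x \<in> carrier W"
  by (rule alg_hom_closed[OF homs(1)])

lemmas phi_add = alg_hom_add[OF homs(1)] and phi_mult = alg_hom_mult[OF homs(1)]
  and phi_smult = alg_hom_smult[OF homs(1)] and phi_one = alg_hom_one[OF homs(1)]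

lemma phi_zero: "\<phi> \<zero>\<^bsub>W\<^esub> = \<zero>\<^bsub>W\<^esub>"
  using klin_zero[OF subsetD[OF alg_hom_klin homs(1)] kalg_W kalg_W] .

lemma phi_inj: "x \<in> carrier W \<Longrightarrow> y \<in> carrier W \<Longrightarrow> \<phi> x = \<phi> y \<Longrightarrow> x = y"
  using inverses(1) by metis

lemma comult_image:
  assumes "x \<in> carrier W" "\<Delta> x = tW y z \<oplus>\<^bsub>TW\<^esub> tW y' z'"
    and "y \<in> carrier W" "z \<in> carrier W" "y' \<in> carrier W" "z' \<in> carrier W"
  shows "\<Delta> (\<phi> x) = tW (\<phi> y) (\<phi> z) \<oplus>\<^bsub>TW\<^esub> tW (\<phi> y') (\<phi> z')"
proof -
  have "\<Delta> (\<phi> x) = tensor_map W W \<phi> \<phi> (tW y z \<oplus>\<^bsub>TW\<^esub> tW y' z')"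
    using comults(1)[OF assms(1)] assms(2) by simp
  then show ?thesis
    using assms alg_hom_add[OF tensor_map_alg_hom[OF kalg_W kalg_W homs(1,1)]]
    by (simp add: tensor_map_pure[OF kalg_W kalg_W homs(1,1)])
qed

lemma image_kword:
  assumes "kword v"
  obtains u where "kword u" "\<phi> (wc v) = wc u"
proof -
  have "\<Delta> (\<phi> (wc v)) = tW (\<phi> (wc v)) (\<phi> (wc v))"
    using comults(1)[OF wc_closed, of v] comult_kword[OF assms]
    by (simp add: tensor_map_pure[OF kalg_W kalg_W homs(1,1)])
  moreover have "\<phi> (wc v) \<noteq> \<zero>\<^bsub>W\<^esub>"
  proof
    assume "\<phi> (wc v) = \<zero>\<^bsub>W\<^esub>"
    then have "wc v = \<zero>\<^bsub>W\<^esub>" using phi_inj[of "wc v" "\<zero>\<^bsub>W\<^esub>"] phi_zero by simp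
    then have "theta (\<lambda>_. 0) (wc v) = 0" using lfun_simps(3)[OF theta_lfun] by simp
    then show False using theta_kword[OF assms] q0 by simp
  qed
  ultimately show thesis using grouplike[of "\<phi> (wc v)"] that by auto
qed

text \<open>The image is an idempotent word, so its exponents vanish and it is the unit or
  \<open>J\<close>; injectivity excludes the unit.\<close>

lemma image_J: "\<phi> J = J"
proof -
  obtain u where u: "kword u" "\<phi> J = wc u" using image_kword[of "[gJ]"] by (auto simp: wc_single)
  have "wc (u @ u) = wc u" using phi_mult[of J J] u by (simp add: wc_append)
  then have "expo (u @ u) = expo u" using wc_kword_inj(1)[of "u @ u" u] u by simp
  then have e: "expo u j = 0" for j by (metis add_cancel_right_right expo_simps(3))
  have "u \<noteq> []"
  proof
    assume "u = []"
    then have "\<phi> J = \<phi> \<one>\<^bsub>W\<^esub>" using u phi_one by simp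
    then show False using phi_inj[of J "\<one>\<^bsub>W\<^esub>"] J_neq_one by simp
  qed
  then have "wc u = wc [gJ]" using u e by (intro kword_expo_eq) auto
  then show ?thesis using u by (simp add: wc_single)
qed

text \<open>\<open>Mx\<close> is the matrix of \<phi> on exponent vectors; by
  \<open>wc_kword_inj\<close> it does not depend on the word that \<open>U\<close> picks.\<close>

definition U where "U i = (SOME u. kword u \<and> \<phi> (K i) = wc u)"
definition Mx where "Mx i = expo (U i)"

lemma U: "kword (U i)" "\<phi> (K i) = wc (U i)"
proof -
  obtain u where "kword u \<and> \<phi> (K i) = wc u" using image_kword[of "[gK i]"] by (auto simp: wc_single)
  then have "kword (U i) \<and> \<phi> (K i) = wc (U i)" unfolding U_def by (rule someI)
  then show "kword (U i)" "\<phi> (K i) = wc (U i)" by auto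
qed

lemma sum_of_bool_mult: "(\<Sum>k\<in>UNIV. of_bool (i = k) * f k) = (f i :: int)" for i :: 'i
proof -
  have "(\<Sum>k\<in>UNIV. of_bool (i = k) * f k) = (\<Sum>k\<in>UNIV. if i = k then f k else 0)" by (rule sum.cong) auto
  then show ?thesis by simp
qed

text \<open>For \<open>L i\<close> the exponents follow from \<open>K i\<close> and the fact that
  \<phi> fixes the product \<open>J\<close> of the two.\<close>

lemma expo_letter_image:
  assumes "isK x" "kword y" "\<phi> (w x) = wc y"
  shows "expo y j = (\<Sum>i\<in>UNIV. letter_expo x i * Mx i j)"
proof (cases x)
  case (gK i)
  then have "expo y = expo (U i)" using wc_kword_inj(1)[OF assms(2) U(1)[of i]] U(2) assms(3) by simp
  then show ?thesis using gK by (simp add: Mx_def sum_of_bool_mult)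
next
  case (gKbar i)
  have "wc (U i @ y) = wc [gJ]"
    using phi_mult[of "K i" "L i"] KL[of i] image_J assms(3) U(2)[of i] gKbar by (simp add: wc_append wc_single)
  then have "expo (U i @ y) = expo [gJ]" using wc_kword_inj(1)[of "U i @ y" "[gJ]"] U(1) assms(2) by simp
  then have "expo (U i) j + expo y j = 0" by (metis add.right_neutral expo_simps letter_expo_simps(3))
  then show ?thesis using gKbar by (simp add: Mx_def sum_of_bool_mult sum_negf)
next
  case gJ
  then have "expo y = expo [gJ]" using wc_kword_inj(1)[OF assms(2), of "[gJ]"] image_J assms(3) by (simp add: wc_single)
  then have "expo y j = expo [gJ] j" by simp
  then show ?thesis using gJ by simp
qed (use assms in simp_all)

lemma expo_image:
  "kword v \<Longrightarrow> kword u \<Longrightarrow> \<phi> (wc v) = wc u \<Longrightarrow> expo u j = (\<Sum>i\<in>UNIV. expo v i * Mx i j)"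
proof (induction v arbitrary: u)
  case Nil
  then have "expo u = expo []" using wc_kword_inj(1)[of u "[]"] phi_one by simp
  then have "expo u j = expo [] j" by simp
  then show ?case by simp
next
  case (Cons x v)
  then have kx: "isK x" "kword v" by simp_all
  obtain y where y: "kword y" "\<phi> (w x) = wc y" using image_kword[of "[x]"] kx by (auto simp: wc_single)
  obtain z where z: "kword z" "\<phi> (wc v) = wc z" by (rule image_kword[OF kx(2)])
  have "wc u = wc (y @ z)"
    using Cons.prems(3) phi_mult[of "w x" "wc v"] y z by (simp add: wc_Cons wc_append)
  then have "expo u = expo (y @ z)" using wc_kword_inj(1)[of u "y @ z"] Cons.prems(2) y z by simp
  then have "expo u j = expo (y @ z) j" by simp
  also have "\<dots> = (\<Sum>i\<in>UNIV. letter_expo x i * Mx i j) + (\<Sum>i\<in>UNIV. expo v i * Mx i j)"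
    using expo_letter_image[OF kx(1) y, of j] Cons.IH[OF kx(2) z] by simp
  finally show ?case by (simp add: sum.distrib[symmetric] distrib_right)
qed

lemma image_gl: "\<phi> (gl i) = gl i" "\<phi> (gl' i) = gl' i"
  by (simp_all add: gl_def gl'_def image_J phi_one)

text \<open>Elements of degree zero commute with the word that is the image of \<open>K i\<close>.
  But \<open>w g\<close> and \<open>K i\<close> do not commute: the scalar between them is not
  \<open>1\<close>, and \<open>w g \<star> J\<close> is nonzero.\<close>

lemma image_not_degree_zero:
  assumes "g = gE i \<or> g = gF i"
  shows "\<nexists>p. Poly_Mapping.keys p \<subseteq> {u. deg u < 1} \<and> \<phi> (w g) = pc p"
proof
  assume "\<exists>p. Poly_Mapping.keys p \<subseteq> {u. deg u < 1} \<and> \<phi> (w g) = pc p"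
  then have "\<phi> (K i) \<star> \<phi> (w g) = \<phi> (w g) \<star> \<phi> (K i)"
    using degree_zero_commute[OF _ U(1)[of i]] U(2)[of i] by auto
  then have "\<phi> (K i \<star> w g) = \<phi> (w g \<star> K i)" by (simp add: phi_mult)
  then have c: "K i \<star> w g = w g \<star> K i" by (rule phi_inj[rotated 2]) simp_all
  obtain p where p: "K i \<star> w g = p \<odot>\<^bsub>W\<^esub> (w g \<star> K i)" "p \<noteq> 1"
    using assms KE[of i i] KF[of i i] P_diag_neq_1[of i] inverse_eq_1_iff[of "P i i"] by metis
  have "(p + - 1) \<odot>\<^bsub>W\<^esub> (w g \<star> K i) = p \<odot>\<^bsub>W\<^esub> (w g \<star> K i) \<oplus>\<^bsub>W\<^esub> (- 1) \<odot>\<^bsub>W\<^esub> (w g \<star> K i)"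
    by (rule smult_l_distr) simp
  also have "\<dots> = 1 \<odot>\<^bsub>W\<^esub> (w g \<star> K i) \<oplus>\<^bsub>W\<^esub> (- 1) \<odot>\<^bsub>W\<^esub> (w g \<star> K i)"
    using p(1) c by simp
  also have "\<dots> = \<zero>\<^bsub>W\<^esub>" by (rule smult_cancel(1)) simp
  finally have "w g \<star> K i = \<zero>\<^bsub>W\<^esub>" using p(2) by (simp add: smult_eq_zero_iff)
  then have "w g \<star> K i \<star> L i = \<zero>\<^bsub>W\<^esub>" by simp
  then have "w g \<star> J = \<zero>\<^bsub>W\<^esub>" by (simp add: m_assoc KL)
  then show False using assms EJ_nonzero FJ_nonzero by auto
qed

lemma comult_image_E: "\<Delta> (\<phi> (E i)) = tW (wc (lx (gE i))) (\<phi> (E i)) \<oplus>\<^bsub>TW\<^esub> tW (\<phi> (E i)) (wc (U i))"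
  using comult_image[of "E i" "gl i" "E i" "E i" "K i"] image_gl(1)[of i] U(2)[of i] by (simp add: comult_w gl_wc)

lemma Mx_nonneg: "Mx i j \<ge> 0" and Mx_sum: "(\<Sum>j\<in>UNIV. Mx i j) \<ge> 1"
proof -
  obtain n r s where n: "n > 0" "\<phi> (E i) = pc (r + s)" "Poly_Mapping.keys s \<subseteq> {u. deg u < n}" "Poly_Mapping.keys r \<noteq> {}"
    "Poly_Mapping.keys r \<subseteq> {u. deg u = n \<and> wc (lw u) = wc (lx (gE i)) \<and> wc (rw u) = wc (U i)}"
    by (rule skew_degree[OF _ _ U(1) comult_image_E image_not_degree_zero]) auto
  from n(4) obtain u where "u \<in> Poly_Mapping.keys r" by blast
  with n(5) have u: "deg u = n" "wc (lw u) = wc (lx (gE i))" "wc (rw u) = wc (U i)" by auto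
  \<comment> \<open>The left factor is the unit or \<open>J\<close>, so the difference of exponents
    in \<open>skew_expo\<close> is the row of \<open>Mx\<close> itself.\<close>
  have e: "expo (lx (gE i)) j = 0" for j by (simp add: lx_def)
  show "Mx i j \<ge> 0" "(\<Sum>j\<in>UNIV. Mx i j) \<ge> 1"
    using skew_expo[OF kword_lx_rx(1) U(1) u(2,3)] u(1) n(1) by (simp_all add: e Mx_def)
qed

lemma Mx_inverse: "(\<Sum>k\<in>UNIV. Mx i k * weak_aut.Mx a d q \<kappa> \<kappa>' \<psi> k j) = of_bool (i = j)"
proof -
  interpret s: weak_aut a d q \<kappa> \<kappa>' \<psi> \<phi> by (rule swapped)
  have "\<psi> (wc (U i)) = wc [gK i]" using inverses(1)[of "K i"] U(2)[of i] by (simp add: wc_single)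
  from s.expo_image[OF U(1) _ this, of j] show ?thesis by (simp add: Mx_def)
qed

text \<open>The rows of the inverse matrix have sum at least \<open>1\<close>, so a row sum of
  \<open>Mx\<close> is at most that of the product of the two matrices, which is \<open>1\<close>. A
  nonnegative integral row of sum \<open>1\<close> is a unit vector.\<close>

lemma Mx_unit: "\<exists>s. \<forall>j. Mx i j = of_bool (j = s)"
proof -
  interpret s: weak_aut a d q \<kappa> \<kappa>' \<psi> \<phi> by (rule swapped)
  have "(\<Sum>k\<in>UNIV. Mx i k) \<le> (\<Sum>k\<in>UNIV. Mx i k * (\<Sum>j\<in>UNIV. s.Mx k j))"
  proof (rule sum_mono)
    fix k show "Mx i k \<le> Mx i k * (\<Sum>j\<in>UNIV. s.Mx k j)"
      using mult_left_mono[OF s.Mx_sum[of k] Mx_nonneg[of i k]] by simp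
  qed
  also have "\<dots> = (\<Sum>j\<in>UNIV. \<Sum>k\<in>UNIV. Mx i k * s.Mx k j)"
    unfolding sum_distrib_left by (rule sum.swap)
  also have "\<dots> = 1" by (simp add: Mx_inverse)
  finally have 1: "(\<Sum>k\<in>UNIV. Mx i k) = 1" using Mx_sum[of i] by simp
  then have "\<exists>s. Mx i s \<noteq> 0" by (metis sum.neutral zero_neq_one)
  then obtain s where s: "Mx i s \<ge> 1" using Mx_nonneg[of i] by (metis int_one_le_iff_zero_less order_le_less)
  have rest: "(\<Sum>k\<in>UNIV. Mx i k) = Mx i s + (\<Sum>k\<in>UNIV - {s}. Mx i k)" by (rule sum.remove) simp_all
  have pos: "(\<Sum>k\<in>UNIV - {s}. Mx i k) \<ge> 0" by (rule sum_nonneg) (rule Mx_nonneg)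
  have "Mx i s = 1" "(\<Sum>k\<in>UNIV - {s}. Mx i k) = 0" using 1 rest pos s by linarith+
  then have "Mx i j = 0" if "j \<noteq> s" for j
    using sum_nonneg_eq_0_iff[of "UNIV - {s}" "Mx i"] Mx_nonneg that by auto
  then show ?thesis using \<open>Mx i s = 1\<close> by (intro exI[of _ s]) auto
qed

definition sg where "sg i = (SOME s. \<forall>j. Mx i j = of_bool (j = s))"

lemma Mx_eq: "Mx i j = of_bool (j = sg i)"
  using someI_ex[OF Mx_unit[of i]] unfolding sg_def by blast

lemma image_K: "\<phi> (K i) = K (sg i)"
proof -
  have e: "expo (U i) j = of_bool (sg i = j)" for j using Mx_eq[of i j] by (auto simp: Mx_def)
  \<comment> \<open>Exponents determine a word only if it is known to be nonempty.\<close>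
  then have "expo (U i) (sg i) = 1" by simp
  then have "U i \<noteq> []" by auto
  then have "wc (U i) = wc [gK (sg i)]" using U(1) e by (intro kword_expo_eq) auto
  then show ?thesis using U(2) by (simp add: wc_single)
qed

lemma image_L: "\<phi> (L i) = L (sg i)"
proof -
  obtain y where y: "kword y" "\<phi> (L i) = wc y" using image_kword[of "[gKbar i]"] by (auto simp: wc_single)
  have e: "expo y j = - of_bool (sg i = j)" for j
    using expo_letter_image[OF _ y, of j] Mx_eq[of i j] by (auto simp: sum_of_bool_mult sum_negf)
  then have "expo y (sg i) = - 1" by simp
  then have "y \<noteq> []" by auto
  then have "wc y = wc [gKbar (sg i)]" using y e by (intro kword_expo_eq) auto
  then show ?thesis using y(2) by (simp add: wc_single)
qed

lemma sg_inverse: "weak_aut.sg a d q \<kappa> \<kappa>' \<psi> (sg i) = i"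
proof -
  interpret s: weak_aut a d q \<kappa> \<kappa>' \<psi> \<phi> by (rule swapped)
  have "K (s.sg (sg i)) = K i" using inverses(1)[of "K i"] image_K s.image_K by simp
  then show ?thesis by (rule K_inj)
qed

lemma bij_sg: "bij sg"
proof -
  interpret s: weak_aut a d q \<kappa> \<kappa>' \<psi> \<phi> by (rule swapped)
  show ?thesis by (rule o_bij[of s.sg]) (auto simp: fun_eq_iff sg_inverse s.sg_inverse)
qed

text \<open>Treats the images of \<open>E i\<close> and \<open>F i\<close> together. The exponents
  force degree one; after multiplication by \<open>J\<close>, conjugation by \<open>K s\<close>
  separates an \<open>E s\<close> part, an \<open>F s\<close> part and a part of weight
  \<open>1\<close>, and only a part of weight \<open>v\<close> survives.\<close>

lemma skew_weight:
  assumes X: "X \<in> carrier W" "\<Delta> X = tW (wc g) X \<oplus>\<^bsub>TW\<^esub> tW X (wc h)"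
    and ns: "\<nexists>p. Poly_Mapping.keys p \<subseteq> {u. deg u < 1} \<and> X = pc p"
    and gh: "kword g" "kword h" "\<And>j. expo h j - expo g j = of_bool (j = s)"
    and vE: "kword vE" "vE \<noteq> []" "\<And>j. expo vE j = expo g j"
    and vF: "kword vF" "vF \<noteq> []" "\<And>j. expo vF j = expo g j + of_bool (j = s)"
    and KX: "K s \<star> X = v \<odot>\<^bsub>W\<^esub> (X \<star> K s)" and v: "v \<noteq> 1"
  obtains r p \<alpha> \<beta> where "X = pc (r + p)" "Poly_Mapping.keys p \<subseteq> {u. deg u < 1}" "pc p \<star> J = \<zero>\<^bsub>W\<^esub>"
    "Poly_Mapping.keys r \<noteq> {}" "Poly_Mapping.keys r \<subseteq> {u. deg u = 1 \<and> wc (lw u) = wc g \<and> wc (rw u) = wc h}"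
    "X \<star> J = \<alpha> \<odot>\<^bsub>W\<^esub> (E s \<star> wc vE) \<oplus>\<^bsub>W\<^esub> \<beta> \<odot>\<^bsub>W\<^esub> (F s \<star> wc vF)"
    "v \<noteq> P s s \<longrightarrow> \<alpha> \<odot>\<^bsub>W\<^esub> (E s \<star> wc vE) = \<zero>\<^bsub>W\<^esub>" "v \<noteq> inverse (P s s) \<longrightarrow> \<beta> \<odot>\<^bsub>W\<^esub> (F s \<star> wc vF) = \<zero>\<^bsub>W\<^esub>"
proof -
  obtain n r p where n: "n > 0" "X = pc (r + p)" "Poly_Mapping.keys p \<subseteq> {u. deg u < n}" "Poly_Mapping.keys r \<noteq> {}"
    "Poly_Mapping.keys r \<subseteq> {u. deg u = n \<and> wc (lw u) = wc g \<and> wc (rw u) = wc h}"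
    by (rule skew_degree[OF X(1) gh(1,2) X(2) ns])
  from n(4) obtain u where "u \<in> Poly_Mapping.keys r" by blast
  with n(5) have u: "deg u = n" "wc (lw u) = wc g" "wc (rw u) = wc h" by auto
  have n1: "n = 1" using skew_expo(2)[OF gh(1,2) u(2,3)] u(1) by (simp add: gh(3))
  obtain \<alpha> \<beta> where ab: "pc r \<star> J = \<alpha> \<odot>\<^bsub>W\<^esub> (E s \<star> wc vE) \<oplus>\<^bsub>W\<^esub> \<beta> \<odot>\<^bsub>W\<^esub> (F s \<star> wc vF)"
    using degree_one_pc[OF n(5)[unfolded n1] gh vE vF] by blast
  define A B Z where "A = \<alpha> \<odot>\<^bsub>W\<^esub> (E s \<star> wc vE)" and "B = \<beta> \<odot>\<^bsub>W\<^esub> (F s \<star> wc vF)" and "Z = pc p \<star> J"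
  have car: "A \<in> carrier W" "B \<in> carrier W" "Z \<in> carrier W" by (simp_all add: A_def B_def Z_def)
  have XJ: "X \<star> J = A \<oplus>\<^bsub>W\<^esub> B \<oplus>\<^bsub>W\<^esub> Z"
    using n(2) ab by (simp add: pc_simps l_distr A_def B_def Z_def wc_single)
  have kc: "K s \<star> wc u = wc u \<star> K s" if "kword u" for u
    using kwords_commute[OF _ that, of "[gK s]"] by (simp add: wc_single)
  have sc: "K s \<star> pc p = pc p \<star> K s"
    using degree_zero_commute[OF n(3)[unfolded n1], of "[gK s]"] by (simp add: wc_single)
  have KXJ: "K s \<star> (X \<star> J) = v \<odot>\<^bsub>W\<^esub> ((X \<star> J) \<star> K s)"
    using X(1) by (simp add: m_assoc[symmetric] KX) (simp add: m_assoc)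
  have invP: "inverse (P s s) \<noteq> 1" "P s s \<noteq> inverse (P s s)"
    using P_diag_neq_1[of s] P_diag_prod_neq_1[of s s] by (auto simp: field_simps inverse_eq_1_iff)
  have KAB: "K s \<star> A = P s s \<odot>\<^bsub>W\<^esub> (A \<star> K s)" "K s \<star> B = inverse (P s s) \<odot>\<^bsub>W\<^esub> (B \<star> K s)"
    by (simp_all add: A_def B_def K_rules m_assoc mult.commute kc[OF vE(1)] kc[OF vF(1)])
  have KZ: "K s \<star> Z = Z \<star> K s"
  proof -
    have "K s \<star> Z = pc p \<star> K s \<star> J" by (simp add: Z_def m_assoc[symmetric] sc)
    then show ?thesis by (simp add: Z_def m_assoc)
  qed
  have J: "A \<star> J = A" "B \<star> J = B" "Z \<star> J = Z"
    by (simp_all add: A_def B_def Z_def m_assoc J_kword_right[OF vE(1,2)] J_kword_right[OF vF(1,2)])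
  have XJ': "X \<star> J = B \<oplus>\<^bsub>W\<^esub> A \<oplus>\<^bsub>W\<^esub> Z" using XJ car by (simp add: a_comm)
  \<comment> \<open>\<open>weight_components\<close> leaves only its first component open, so the
    two candidates are exchanged when \<open>v\<close> is the weight of \<open>F s\<close>.\<close>
  have *: "Z = \<zero>\<^bsub>W\<^esub> \<and> (v \<noteq> P s s \<longrightarrow> A = \<zero>\<^bsub>W\<^esub>) \<and> (v \<noteq> inverse (P s s) \<longrightarrow> B = \<zero>\<^bsub>W\<^esub>)"
  proof (cases "v = inverse (P s s)")
    case True
    then show ?thesis
      using weight_components[OF car(2,1,3) KAB(2,1) KZ J(2,1,3) KXJ[unfolded XJ']] invP v P_diag_neq_1[of s] by auto
  next
    case False
    then show ?thesis
      using weight_components[OF car KAB KZ J KXJ[unfolded XJ]] invP v P_diag_neq_1[of s] by auto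
  qed
  show thesis
    by (rule that[OF n(2) n(3)[unfolded n1] _ n(4) n(5)[unfolded n1], of \<alpha> \<beta>])
      (use * XJ car in \<open>auto simp: A_def[symmetric] B_def[symmetric] Z_def[symmetric]\<close>)
qed

lemma image_EJ_nonzero: "\<phi> (E i) \<star> J \<noteq> \<zero>\<^bsub>W\<^esub>" and image_FJ_nonzero: "\<phi> (F i) \<star> J \<noteq> \<zero>\<^bsub>W\<^esub>"
proof -
  have "\<phi> (x \<star> J) \<noteq> \<zero>\<^bsub>W\<^esub>" if "x \<in> carrier W" "x \<star> J \<noteq> \<zero>\<^bsub>W\<^esub>" for x
    using phi_inj[of "x \<star> J" "\<zero>\<^bsub>W\<^esub>"] that phi_zero by auto
  from this[of "E i"] this[of "F i"] show "\<phi> (E i) \<star> J \<noteq> \<zero>\<^bsub>W\<^esub>" "\<phi> (F i) \<star> J \<noteq> \<zero>\<^bsub>W\<^esub>"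
    using EJ_nonzero[of i] FJ_nonzero[of i] by (simp_all add: phi_mult image_J)
qed

lemma K_image: "K (sg j) \<star> \<phi> (E i) = P i j \<odot>\<^bsub>W\<^esub> (\<phi> (E i) \<star> K (sg j))"
  "K (sg j) \<star> \<phi> (F i) = inverse (P i j) \<odot>\<^bsub>W\<^esub> (\<phi> (F i) \<star> K (sg j))"
proof -
  have "\<phi> (K j \<star> E i) = \<phi> (P i j \<odot>\<^bsub>W\<^esub> (E i \<star> K j))" "\<phi> (K j \<star> F i) = \<phi> (inverse (P i j) \<odot>\<^bsub>W\<^esub> (F i \<star> K j))"
    by (simp_all add: KE KF)
  then show "K (sg j) \<star> \<phi> (E i) = P i j \<odot>\<^bsub>W\<^esub> (\<phi> (E i) \<star> K (sg j))"
    "K (sg j) \<star> \<phi> (F i) = inverse (P i j) \<odot>\<^bsub>W\<^esub> (\<phi> (F i) \<star> K (sg j))"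
    by (simp_all add: phi_mult phi_smult image_K)
qed

text \<open>The weight \<open>P i i\<close> excludes the \<open>F\<close> part, and nonvanishing
  forces it to equal the weight of \<open>E (sg i)\<close>. For type 1 the left factor is the unit,
  so the only word of top degree is the single letter; the rest is a multiple of
  \<open>1 - J\<close>, which the antipode removes.\<close>

lemma image_E_J:
  obtains \<alpha> where "\<phi> (E i) \<star> J = \<alpha> \<odot>\<^bsub>W\<^esub> (E (sg i) \<star> J)" "P i i = P (sg i) (sg i)" "\<alpha> \<noteq> 0"
    "\<kappa> i \<Longrightarrow> \<kappa> (sg i) \<and> \<phi> (E i) = \<alpha> \<odot>\<^bsub>W\<^esub> E (sg i)"
proof -
  let ?X = "\<phi> (E i)" and ?s = "sg i"
  have e: "expo (lx (gE i)) j = 0" "expo (U i) j = of_bool (j = ?s)" for j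
    using Mx_eq[of i j] by (simp_all add: lx_def Mx_def)
  have x: "expo (U i) j - expo (lx (gE i)) j = of_bool (j = ?s)" "expo [gJ] j = expo (lx (gE i)) j"
    "expo [gK ?s] j = expo (lx (gE i)) j + of_bool (j = ?s)" for j
    unfolding e by auto
  have k: "kword [gJ]" "[gJ] \<noteq> []" "kword [gK ?s]" "[gK ?s] \<noteq> []" by simp_all
  obtain r p \<alpha> \<beta> where r: "?X = pc (r + p)" "Poly_Mapping.keys p \<subseteq> {u. deg u < 1}" "pc p \<star> J = \<zero>\<^bsub>W\<^esub>"
    "Poly_Mapping.keys r \<noteq> {}" "Poly_Mapping.keys r \<subseteq> {u. deg u = 1 \<and> wc (lw u) = wc (lx (gE i)) \<and> wc (rw u) = wc (U i)}"
    and ab: "?X \<star> J = \<alpha> \<odot>\<^bsub>W\<^esub> (E ?s \<star> wc [gJ]) \<oplus>\<^bsub>W\<^esub> \<beta> \<odot>\<^bsub>W\<^esub> (F ?s \<star> wc [gK ?s])"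
    "P i i \<noteq> P ?s ?s \<longrightarrow> \<alpha> \<odot>\<^bsub>W\<^esub> (E ?s \<star> wc [gJ]) = \<zero>\<^bsub>W\<^esub>"
    "P i i \<noteq> inverse (P ?s ?s) \<longrightarrow> \<beta> \<odot>\<^bsub>W\<^esub> (F ?s \<star> wc [gK ?s]) = \<zero>\<^bsub>W\<^esub>"
    by (rule skew_weight[OF phi_closed[OF w_closed] comult_image_E image_not_degree_zero[OF disjI1[OF refl]]
          kword_lx_rx(1) U(1) x(1) k(1,2) x(2) k(3,4) x(3) K_image(1)[of i i] P_diag_neq_1[of i]]) blast
  have "P i i \<noteq> inverse (P ?s ?s)" using P_diag_prod_neq_1[of i ?s] by (auto simp: field_simps)
  then have XJ: "?X \<star> J = \<alpha> \<odot>\<^bsub>W\<^esub> (E ?s \<star> J)" using ab(1,3) by (simp add: wc_single)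
  then have A0: "\<alpha> \<odot>\<^bsub>W\<^esub> (E ?s \<star> J) \<noteq> \<zero>\<^bsub>W\<^esub>" using image_EJ_nonzero[of i] by simp
  then have \<alpha>: "\<alpha> \<noteq> 0" by auto
  have PP: "P i i = P ?s ?s" using ab(2) A0 by (auto simp: wc_single)
  have t1: "\<kappa> ?s \<and> ?X = \<alpha> \<odot>\<^bsub>W\<^esub> E ?s" if \<kappa>: "\<kappa> i"
  proof -
    have "\<kappa> ?s \<and> u = [gE ?s]" if u: "u \<in> Poly_Mapping.keys r" for u
    proof -
      have u': "deg u = 1" "wc (lw u) = wc (lx (gE i))" "wc (rw u) = wc (U i)" using u r(5) by auto
      have "lw u = []" using u'(2) wc_kword_inj(2)[of "lw u" "[]"] \<kappa> by (auto simp: lx_def)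
      then obtain t where t: "\<kappa> t" "u = [gE t]" using lw_Nil_degree_one[OF u'(1)] by blast
      have "expo (U i) t = expo u t + int (count_list u (gE t))" by (rule expo_top(2)[OF kword_lx_rx(1) U(1) u'(2,3)])
      then have "t = ?s" using t(2) e(2)[of t] by (auto split: if_splits)
      then show ?thesis using t by simp
    qed
    then have kr: "\<forall>u \<in> Poly_Mapping.keys r. \<kappa> ?s \<and> u = [gE ?s]" by blast
    then have \<kappa>s: "\<kappa> ?s" using r(4) by blast
    obtain c e0 where X: "?X = c \<odot>\<^bsub>W\<^esub> E ?s \<oplus>\<^bsub>W\<^esub> e0 \<odot>\<^bsub>W\<^esub> (\<one>\<^bsub>W\<^esub> \<ominus>\<^bsub>W\<^esub> J)"
      by (rule type1_form[OF r(1-3), of "gE ?s"]) (use kr in blast)+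
    have "T ?X = \<phi> (T (E i))" using antipodes(1)[of "E i"] by simp
    also have "\<dots> = (- 1) \<odot>\<^bsub>W\<^esub> (?X \<star> L ?s)" by (simp add: antipode_w phi_smult phi_mult image_L)
    finally have "?X = c \<odot>\<^bsub>W\<^esub> E ?s"
      by (intro antipode_drop[OF _ _ _ X, of "L ?s" "- 1"]) (simp_all add: antipode_lin antipode_w)
    moreover from this have "c \<odot>\<^bsub>W\<^esub> (E ?s \<star> J) = \<alpha> \<odot>\<^bsub>W\<^esub> (E ?s \<star> J)" using XJ by simp
    then have "c = \<alpha>" using scalar_eq[of "E ?s \<star> J" c \<alpha>] EJ_nonzero[of ?s] by simp
    ultimately show ?thesis using \<kappa>s by simp
  qed
  show thesis by (rule that[of \<alpha>]) (use XJ PP \<alpha> t1 in auto)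
qed

lemma comult_image_F: "\<Delta> (\<phi> (F i)) = tW (wc [gKbar (sg i)]) (\<phi> (F i)) \<oplus>\<^bsub>TW\<^esub> tW (\<phi> (F i)) (wc (rx (gF i)))"
  using comult_image[of "F i" "F i" "gl' i" "L i" "F i"] image_gl(2)[of i]
  by (simp add: comult_w gl_wc image_L wc_single TT.T.a_comm)

text \<open>Type 1 is now detected by the right factor. The equality of diagonal weights from
  \<open>image_E_J\<close> gives \<open>T\<close> the same scalar on \<open>\<phi> (F i)\<close> and
  on \<open>F (sg i)\<close>, as \<open>antipode_drop\<close> demands.\<close>

lemma image_F_J:
  obtains \<beta> where "\<phi> (F i) \<star> J = \<beta> \<odot>\<^bsub>W\<^esub> (F (sg i) \<star> J)" "\<beta> \<noteq> 0"
    "\<kappa>' i \<Longrightarrow> \<kappa>' (sg i) \<and> \<phi> (F i) = \<beta> \<odot>\<^bsub>W\<^esub> F (sg i)"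
proof -
  let ?X = "\<phi> (F i)" and ?s = "sg i"
  have x: "expo (rx (gF i)) j - expo [gKbar ?s] j = of_bool (j = ?s)"
    "expo [gJ] j = expo [gKbar ?s] j + of_bool (j = ?s)" for j
    by (auto simp: rx_def)
  have k: "kword [gKbar ?s]" "[gKbar ?s] \<noteq> []" "kword [gJ]" "[gJ] \<noteq> []" by simp_all
  have PP: "P i i = P ?s ?s" by (rule image_E_J[of i])
  have inv1: "inverse (P i i) \<noteq> 1" using P_diag_neq_1[of i] by (simp add: inverse_eq_1_iff)
  obtain r p \<alpha> \<beta> where r: "?X = pc (r + p)" "Poly_Mapping.keys p \<subseteq> {u. deg u < 1}" "pc p \<star> J = \<zero>\<^bsub>W\<^esub>"
    "Poly_Mapping.keys r \<noteq> {}" "Poly_Mapping.keys r \<subseteq> {u. deg u = 1 \<and> wc (lw u) = wc [gKbar ?s] \<and> wc (rw u) = wc (rx (gF i))}"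
    and ab: "?X \<star> J = \<alpha> \<odot>\<^bsub>W\<^esub> (E ?s \<star> wc [gKbar ?s]) \<oplus>\<^bsub>W\<^esub> \<beta> \<odot>\<^bsub>W\<^esub> (F ?s \<star> wc [gJ])"
    "inverse (P i i) \<noteq> P ?s ?s \<longrightarrow> \<alpha> \<odot>\<^bsub>W\<^esub> (E ?s \<star> wc [gKbar ?s]) = \<zero>\<^bsub>W\<^esub>"
    by (rule skew_weight[OF phi_closed[OF w_closed] comult_image_F image_not_degree_zero[OF disjI2[OF refl]]
          k(1) kword_lx_rx(2) x(1) k(1,2) refl k(3,4) x(2) K_image(2)[of i i] inv1]) blast
  have "inverse (P i i) \<noteq> P ?s ?s" using P_diag_prod_neq_1[of i ?s] by (auto simp: field_simps)
  then have XJ: "?X \<star> J = \<beta> \<odot>\<^bsub>W\<^esub> (F ?s \<star> J)" using ab by (simp add: wc_single)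
  then have "\<beta> \<odot>\<^bsub>W\<^esub> (F ?s \<star> J) \<noteq> \<zero>\<^bsub>W\<^esub>" using image_FJ_nonzero[of i] by simp
  then have \<beta>: "\<beta> \<noteq> 0" by auto
  have t1: "\<kappa>' ?s \<and> ?X = \<beta> \<odot>\<^bsub>W\<^esub> F ?s" if \<kappa>: "\<kappa>' i"
  proof -
    have "\<kappa>' ?s \<and> u = [gF ?s]" if u: "u \<in> Poly_Mapping.keys r" for u
    proof -
      have u': "deg u = 1" "wc (lw u) = wc [gKbar ?s]" "wc (rw u) = wc (rx (gF i))" using u r(5) by auto
      have "rw u = []" using u'(3) wc_kword_inj(2)[of "rw u" "[]"] \<kappa> by (auto simp: rx_def)
      then obtain t where t: "\<kappa>' t" "u = [gF t]" using rw_Nil_degree_one[OF u'(1)] by blast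
      have "expo [gKbar ?s] t = expo u t - int (count_list u (gF t))"
        by (rule expo_top(1)[OF _ kword_lx_rx(2) u'(2,3)]) simp
      then have "t = ?s" using t(2) by (auto split: if_splits)
      then show ?thesis using t by simp
    qed
    then have kr: "\<forall>u \<in> Poly_Mapping.keys r. \<kappa>' ?s \<and> u = [gF ?s]" by blast
    then have \<kappa>s: "\<kappa>' ?s" using r(4) by blast
    obtain c e0 where X: "?X = c \<odot>\<^bsub>W\<^esub> F ?s \<oplus>\<^bsub>W\<^esub> e0 \<odot>\<^bsub>W\<^esub> (\<one>\<^bsub>W\<^esub> \<ominus>\<^bsub>W\<^esub> J)"
      by (rule type1_form[OF r(1-3), of "gF ?s"]) (use kr in blast)+
    have "T ?X = \<phi> (T (F i))" using antipodes(1)[of "F i"] by simp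
    also have "\<dots> = (- inverse (P ?s ?s)) \<odot>\<^bsub>W\<^esub> (?X \<star> K ?s)" by (simp add: antipode_w phi_smult phi_mult image_K PP)
    finally have "?X = c \<odot>\<^bsub>W\<^esub> F ?s"
      by (intro antipode_drop[OF _ _ _ X, of "K ?s" "- inverse (P ?s ?s)"]) (simp_all add: antipode_lin antipode_w mult.commute)
    moreover from this have "c \<odot>\<^bsub>W\<^esub> (F ?s \<star> J) = \<beta> \<odot>\<^bsub>W\<^esub> (F ?s \<star> J)" using XJ by simp
    then have "c = \<beta>" using scalar_eq[of "F ?s \<star> J" c \<beta>] FJ_nonzero[of ?s] by simp
    ultimately show ?thesis using \<kappa>s by simp
  qed
  show thesis by (rule that[of \<beta>]) (use XJ \<beta> t1 in auto)
qed

text \<open>Type 1 passes from \<open>i\<close> to \<open>sg i\<close> by the form of the images;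
  the inverse automorphism gives the converse.\<close>

lemma types: "\<kappa> (sg i) = \<kappa> i" "\<kappa>' (sg i) = \<kappa>' i"
proof -
  interpret s: weak_aut a d q \<kappa> \<kappa>' \<psi> \<phi> by (rule swapped)
  have "\<kappa> i \<Longrightarrow> \<kappa> (sg i)" using image_E_J[of i] by metis
  moreover have "\<kappa> (sg i) \<Longrightarrow> \<kappa> i" using s.image_E_J[of "sg i"] sg_inverse[of i] by metis
  ultimately show "\<kappa> (sg i) = \<kappa> i" by blast
  have "\<kappa>' i \<Longrightarrow> \<kappa>' (sg i)" using image_F_J[of i] by metis
  moreover have "\<kappa>' (sg i) \<Longrightarrow> \<kappa>' i" using s.image_F_J[of "sg i"] sg_inverse[of i] by metis
  ultimately show "\<kappa>' (sg i) = \<kappa>' i" by blast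
qed

text \<open>Generators of type 2 absorb \<open>J\<close>, so for them the formula after
  multiplication by \<open>J\<close> is already the formula itself.\<close>

lemma image_E: obtains \<alpha> where "\<alpha> \<noteq> 0" "\<phi> (E i) = \<alpha> \<odot>\<^bsub>W\<^esub> E (sg i)"
proof -
  obtain \<alpha> where a: "\<phi> (E i) \<star> J = \<alpha> \<odot>\<^bsub>W\<^esub> (E (sg i) \<star> J)" "\<alpha> \<noteq> 0" "\<kappa> i \<Longrightarrow> \<phi> (E i) = \<alpha> \<odot>\<^bsub>W\<^esub> E (sg i)"
    by (rule image_E_J[of i]) blast
  have "\<phi> (E i) = \<alpha> \<odot>\<^bsub>W\<^esub> E (sg i)" if "\<not> \<kappa> i"
    using a(1) E2[OF that] E2[of "sg i"] types(1)[of i] that phi_mult[of "E i" J] by (simp add: image_J)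
  then show thesis using that a by blast
qed

lemma image_F: obtains \<beta> where "\<beta> \<noteq> 0" "\<phi> (F i) = \<beta> \<odot>\<^bsub>W\<^esub> F (sg i)"
proof -
  obtain \<beta> where a: "\<phi> (F i) \<star> J = \<beta> \<odot>\<^bsub>W\<^esub> (F (sg i) \<star> J)" "\<beta> \<noteq> 0" "\<kappa>' i \<Longrightarrow> \<phi> (F i) = \<beta> \<odot>\<^bsub>W\<^esub> F (sg i)"
    by (rule image_F_J[of i]) blast
  have "\<phi> (F i) = \<beta> \<odot>\<^bsub>W\<^esub> F (sg i)" if "\<not> \<kappa>' i"
    using a(1) F2[OF that] F2[of "sg i"] types(2)[of i] that phi_mult[of "F i" J] by (simp add: image_J)
  then show thesis using that a by blast
qed

text \<open>The scalar between an \<open>E\<close> and a \<open>K\<close> is computed in two ways,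
  before and after applying \<phi>.\<close>

lemma P_image: "P (sg i) (sg j) = P i j"
proof -
  obtain \<alpha> where a: "\<alpha> \<noteq> 0" "\<phi> (E i) = \<alpha> \<odot>\<^bsub>W\<^esub> E (sg i)" by (rule image_E)
  have "(\<alpha> * P (sg i) (sg j)) \<odot>\<^bsub>W\<^esub> (E (sg i) \<star> K (sg j)) = (\<alpha> * P i j) \<odot>\<^bsub>W\<^esub> (E (sg i) \<star> K (sg j))"
    using K_image(1)[of j i] unfolding a(2) by (simp add: KE mult.commute)
  moreover have "E (sg i) \<star> K (sg j) \<noteq> \<zero>\<^bsub>W\<^esub>"
  proof
    assume "E (sg i) \<star> K (sg j) = \<zero>\<^bsub>W\<^esub>"
    then have "E (sg i) \<star> K (sg j) \<star> L (sg j) = \<zero>\<^bsub>W\<^esub>" by simp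
    then show False using EJ_nonzero[of "sg i"] by (simp add: m_assoc KL)
  qed
  ultimately have "\<alpha> * P (sg i) (sg j) = \<alpha> * P i j"
    using scalar_eq[of "E (sg i) \<star> K (sg j)" "\<alpha> * P (sg i) (sg j)" "\<alpha> * P i j"] by simp
  then show ?thesis using a(1) by simp
qed

lemma cartan_image: "int (d i) * a i j = int (d (sg i)) * a (sg i) (sg j)"
  using q_powi_inj P_image[of i j] unfolding P_powi by metis

lemma d_image: "d (sg i) = d i"
  using cartan_image[of i i] by (simp add: a_diag)

text \<open>The commutator of the images of \<open>E i\<close> and \<open>F i\<close> carries the
  product of the two coefficients, while its value in terms of \<open>K\<close> and \<open>L\<close>
  carries none; so the product is \<open>1\<close>.\<close>

theorem automorphism_form:
  obtains b where "\<And>i. b i \<noteq> 0" "\<And>i. \<phi> (E i) = b (sg i) \<odot>\<^bsub>W\<^esub> E (sg i)" "\<And>i. \<phi> (F i) = inverse (b (sg i)) \<odot>\<^bsub>W\<^esub> F (sg i)"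
proof -
  interpret s: weak_aut a d q \<kappa> \<kappa>' \<psi> \<phi> by (rule swapped)
  have "\<exists>\<alpha>. \<alpha> \<noteq> 0 \<and> \<phi> (E i) = \<alpha> \<odot>\<^bsub>W\<^esub> E (sg i)" for i by (rule image_E[of i]) blast
  then obtain c where c: "\<And>i. c i \<noteq> 0" "\<And>i. \<phi> (E i) = c i \<odot>\<^bsub>W\<^esub> E (sg i)" by metis
  have "\<phi> (F i) = inverse (c i) \<odot>\<^bsub>W\<^esub> F (sg i)" for i
  proof -
    obtain \<beta> where b: "\<phi> (F i) = \<beta> \<odot>\<^bsub>W\<^esub> F (sg i)" by (rule image_F)
    let ?s = "sg i"
    let ?D = "kq i \<odot>\<^bsub>W\<^esub> K ?s \<oplus>\<^bsub>W\<^esub> (- kq i) \<odot>\<^bsub>W\<^esub> L ?s"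
    have kq: "kq ?s = kq i" by (simp add: kq_def d_image)
    have D0: "?D \<noteq> \<zero>\<^bsub>W\<^esub>"
    proof
      assume "?D = \<zero>\<^bsub>W\<^esub>"
      then have "kq i \<odot>\<^bsub>W\<^esub> (K ?s \<ominus>\<^bsub>W\<^esub> L ?s) = \<zero>\<^bsub>W\<^esub>" by (simp add: minus_smult smult_r_distr)
      then show False using kq_nonzero[of i] K_neq_L[of ?s] by (simp add: smult_eq_zero_iff minus_eq_zero_iff)
    qed
    have "\<phi> (E i \<star> F i) = \<phi> (F i \<star> E i \<oplus>\<^bsub>W\<^esub> (kq i \<odot>\<^bsub>W\<^esub> K i \<oplus>\<^bsub>W\<^esub> (- kq i) \<odot>\<^bsub>W\<^esub> L i))" by (simp add: EF_eq)
    then have 1: "(c i * \<beta>) \<odot>\<^bsub>W\<^esub> (E ?s \<star> F ?s) = (c i * \<beta>) \<odot>\<^bsub>W\<^esub> (F ?s \<star> E ?s) \<oplus>\<^bsub>W\<^esub> ?D"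
      by (simp add: phi_mult phi_add phi_smult image_K image_L c(2) b mult.commute)
    have "E ?s \<star> F ?s = F ?s \<star> E ?s \<oplus>\<^bsub>W\<^esub> ?D" using EF_eq[of ?s] kq by simp
    then have "(c i * \<beta>) \<odot>\<^bsub>W\<^esub> (E ?s \<star> F ?s) = (c i * \<beta>) \<odot>\<^bsub>W\<^esub> (F ?s \<star> E ?s \<oplus>\<^bsub>W\<^esub> ?D)" by (rule arg_cong)
    also have "\<dots> = (c i * \<beta>) \<odot>\<^bsub>W\<^esub> (F ?s \<star> E ?s) \<oplus>\<^bsub>W\<^esub> (c i * \<beta>) \<odot>\<^bsub>W\<^esub> ?D"
      by (rule smult_r_distr) simp_all
    finally have 2: "(c i * \<beta>) \<odot>\<^bsub>W\<^esub> (E ?s \<star> F ?s) = (c i * \<beta>) \<odot>\<^bsub>W\<^esub> (F ?s \<star> E ?s) \<oplus>\<^bsub>W\<^esub> (c i * \<beta>) \<odot>\<^bsub>W\<^esub> ?D" .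
    have "(c i * \<beta>) \<odot>\<^bsub>W\<^esub> ?D = ?D" by (rule add_cancel[OF trans[OF 2[symmetric] 1]]) simp_all
    then have "(c i * \<beta>) \<odot>\<^bsub>W\<^esub> ?D = 1 \<odot>\<^bsub>W\<^esub> ?D" by (subst smult_one) simp_all
    then have "c i * \<beta> = 1" by (rule scalar_eq[rotated 2]) (use D0 in simp_all)
    then show ?thesis using b by (simp add: inverse_unique)
  qed
  \<comment> \<open>Coefficients are indexed by the target of \<open>sg\<close>, because the
    diagonal map is applied after the diagram map.\<close>
  then show thesis
    by (intro that[of "\<lambda>j. c (s.sg j)"]) (simp_all add: sg_inverse c)
qed

end

section \<open>The automorphisms given by scalars and diagram symmetries, and their group\<close>

lemma restrict_alg_hom:
  fixes A :: "('k::field, 'a) module" and B :: "('k, 'b) module"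
  assumes "kalg A" "h \<in> alg_hom A B" shows "restrict h (carrier A) \<in> alg_hom A B"
proof -
  interpret kalg A by fact
  show ?thesis using assms(2) by (auto simp: alg_hom_iff klin_def)
qed

lemma opp_alg_hom:
  fixes A :: "('k::field, 'a) module" and B :: "('k, 'b) module"
  shows "h \<in> alg_hom A B \<Longrightarrow> h \<in> alg_hom (opp A) (opp B)"
  by (auto simp: alg_hom_iff klin_def)

lemma id_alg_hom: "(\<lambda>x. x) \<in> alg_hom A (A :: ('k::field, 'a) module)"
  by (auto simp: alg_hom_iff klin_def)

context weak_quantum begin

abbreviation "dg \<equiv> diag_aut a d q \<kappa> \<kappa>'"
abbreviation "dm \<equiv> diagram_aut a d q \<kappa> \<kappa>'"
abbreviation "symm \<equiv> carrier (diagram_group a d \<kappa> \<kappa>')"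
abbreviation (input) "nz b \<equiv> (\<forall>i. b i \<noteq> 0)"
abbreviation "auts \<equiv> weak_hopf_auts a d q \<kappa> \<kappa>'"
abbreviation "\<epsilon> \<equiv> w_counit a d q \<kappa> \<kappa>'"

lemma hom_eqI:
  assumes "f \<in> alg_hom W B" "g \<in> alg_hom W B" "kalg B" "\<And>x. f (w x) = g (w x)" "X \<in> carrier W"
  shows "f X = g X"
  using alg_hom_eq_on_presented[of f rels B g X] assms by (simp add: w_alg_def w_gen_def)

lemma symm_iff: "\<sigma> \<in> symm \<longleftrightarrow> bij \<sigma> \<and> (\<forall>i j. int (d i) * a i j = int (d (\<sigma> i)) * a (\<sigma> i) (\<sigma> j))
    \<and> (\<forall>i. \<kappa> (\<sigma> i) = \<kappa> i \<and> \<kappa>' (\<sigma> i) = \<kappa>' i)"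
  unfolding diagram_group_def dynkin_auts_def by simp

lemma symmD:
  assumes "\<sigma> \<in> symm"
  shows "bij \<sigma>" "int (d (\<sigma> i)) * a (\<sigma> i) (\<sigma> j) = int (d i) * a i j" "\<kappa> (\<sigma> i) = \<kappa> i" "\<kappa>' (\<sigma> i) = \<kappa>' i"
    "inv_into UNIV \<sigma> (\<sigma> i) = i" "\<sigma> (inv_into UNIV \<sigma> i) = i"
proof -
  show b: "bij \<sigma>" and "int (d (\<sigma> i)) * a (\<sigma> i) (\<sigma> j) = int (d i) * a i j" "\<kappa> (\<sigma> i) = \<kappa> i" "\<kappa>' (\<sigma> i) = \<kappa>' i"
    using assms[unfolded symm_iff] by metis+
  show "inv_into UNIV \<sigma> (\<sigma> i) = i" "\<sigma> (inv_into UNIV \<sigma> i) = i"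
    using b by (simp_all add: bij_is_inj bij_is_surj surj_f_inv_f)
qed

lemma symm_comp: assumes "\<sigma> \<in> symm" "\<sigma>' \<in> symm" shows "\<sigma> \<circ> \<sigma>' \<in> symm"
  unfolding symm_iff using symmD(1)[OF assms(1)] symmD(1)[OF assms(2)]
  by (simp add: bij_comp symmD(2-4)[OF assms(1)] symmD(2-4)[OF assms(2)])

lemma symm_id: "id \<in> symm"
  by (simp add: symm_iff)

lemma symm_inv: assumes "\<sigma> \<in> symm" shows "inv_into UNIV \<sigma> \<in> symm"
  unfolding symm_iff
  using bij_imp_bij_inv[OF symmD(1)[OF assms]] symmD(2-4)[OF assms, of "inv_into UNIV \<sigma> _"]
    symmD(2)[OF assms, of "inv_into UNIV \<sigma> _" "inv_into UNIV \<sigma> _"]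
  by (simp add: symmD(6)[OF assms])

lemma symm_P: "\<sigma> \<in> symm \<Longrightarrow> P (\<sigma> i) (\<sigma> j) = P i j"
  by (simp only: P_powi symmD(2))

lemma diag_aut_hom: assumes "nz b"
  shows "dg b \<in> alg_hom W W" "dg b (w g) = diag_gen b g"
proof -
  have "diag_gen b = (\<lambda>g. case g of gE i \<Rightarrow> b i \<odot>\<^bsub>W\<^esub> E i | gF i \<Rightarrow> inverse (b i) \<odot>\<^bsub>W\<^esub> F i
      | gK i \<Rightarrow> K i | gKbar i \<Rightarrow> L i | gJ \<Rightarrow> J)"
    by (rule ext) (simp add: diag_gen_def)
  then have "dg b = extend_hom rels W (diag_gen b)" by (simp add: diag_aut_def Let_def)
  then show "dg b \<in> alg_hom W W" "dg b (w g) = diag_gen b g"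
    using hom_from_W[OF wrel_diag[of b]] assms by simp_all
qed

lemma diagram_aut_hom: assumes "\<sigma> \<in> symm"
  shows "dm \<sigma> \<in> alg_hom W W" "dm \<sigma> (w g) = w (map_gen \<sigma> g)"
proof -
  have "wrel a d q \<kappa> \<kappa>' W (\<lambda>g. w (map_gen \<sigma> g))"
    by (rule wrel_diagram) (simp_all only: symmD(1-4)[OF assms])
  then show "dm \<sigma> \<in> alg_hom W W" "dm \<sigma> (w g) = w (map_gen \<sigma> g)"
    unfolding diagram_aut_def by (rule hom_from_W)+
qed

lemma aut_extensional: "dg b \<in> extensional (carrier W)" "dm \<sigma> \<in> extensional (carrier W)"
  by (simp_all add: diag_aut_def diagram_aut_def Let_def extend_hom_def w_alg_def)

text \<open>Composed on the carrier only, so that the result is extensional, as membership in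
  \<open>Bij\<close> requires.\<close>

definition comb where "comb b \<sigma> = compose (carrier W) (dg b) (dm \<sigma>)"

lemma comb_hom: "nz b \<Longrightarrow> \<sigma> \<in> symm \<Longrightarrow> comb b \<sigma> \<in> alg_hom W W"
  unfolding comb_def compose_def by (rule restrict_alg_hom[OF kalg_W alg_hom_comp[OF diagram_aut_hom(1) diag_aut_hom(1)]])

lemma comb_w: "nz b \<Longrightarrow> \<sigma> \<in> symm \<Longrightarrow> comb b \<sigma> (w g) = diag_gen b (map_gen \<sigma> g)"
  by (simp add: comb_def compose_def diag_aut_hom diagram_aut_hom)

lemma comb_extensional: "comb b \<sigma> \<in> extensional (carrier W)"
  by (simp add: comb_def)

lemma comb_closed: "nz b \<Longrightarrow> \<sigma> \<in> symm \<Longrightarrow> x \<in> carrier W \<Longrightarrow> comb b \<sigma> x \<in> carrier W"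
  using alg_hom_closed[OF comb_hom] .

text \<open>Moving \<sigma> past the diagonal map of \<open>b'\<close> permutes its entries by
  \<open>inv_into UNIV \<sigma>\<close>; this is the multiplication of the semidirect
  product.\<close>

lemma comb_mult:
  assumes b: "nz b" "nz b'" and s: "\<sigma> \<in> symm" "\<sigma>' \<in> symm" and x: "x \<in> carrier W"
  shows "comb b \<sigma> (comb b' \<sigma>' x) = comb (\<lambda>i. b i * b' (inv_into UNIV \<sigma> i)) (\<sigma> \<circ> \<sigma>') x"
proof (rule hom_eqI[OF alg_hom_comp[OF comb_hom[OF b(2) s(2)] comb_hom[OF b(1) s(1)]] comb_hom kalg_W _ x])
  show nz: "nz (\<lambda>i. b i * b' (inv_into UNIV \<sigma> i))" using b by simp
  show ss: "\<sigma> \<circ> \<sigma>' \<in> symm" using symm_comp s .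
  have i: "inv_into UNIV \<sigma> (\<sigma> i) = i" for i using symmD(5)[OF s(1)] .
  note h = alg_hom_smult[OF comb_hom[OF b(1) s(1)]]
  show "comb b \<sigma> (comb b' \<sigma>' (w g)) = comb (\<lambda>i. b i * b' (inv_into UNIV \<sigma> i)) (\<sigma> \<circ> \<sigma>') (w g)" for g
    by (cases g) (simp_all add: comb_w[OF nz ss] comb_w[OF b(1) s(1)] comb_w[OF b(2) s(2)] h i mult.commute)
qed

lemma comb_one: assumes "x \<in> carrier W" shows "comb (\<lambda>i. 1) id x = x"
proof (rule hom_eqI[OF comb_hom id_alg_hom kalg_W _ assms])
  show nz: "nz (\<lambda>i. 1 :: 'k)" and id: "id \<in> symm" using symm_id by simp_all
  show "comb (\<lambda>i. 1) id (w g) = w g" for g by (cases g) (simp_all add: comb_w[OF nz id])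
qed

text \<open>The scalars \<open>c\<close> are the solution of
  \<open>b i * c (\<tau> i) = 1\<close>.\<close>

lemma comb_inverse:
  assumes b: "nz b" and s: "\<sigma> \<in> symm" and x: "x \<in> carrier W"
  defines "\<tau> \<equiv> inv_into UNIV \<sigma>" and "c \<equiv> (\<lambda>i. inverse (b (\<sigma> i)))"
  shows "comb b \<sigma> (comb c \<tau> x) = x" "comb c \<tau> (comb b \<sigma> x) = x"
proof -
  have bij: "bij \<sigma>" by (rule symmD(1)[OF s])
  have t: "\<tau> \<in> symm" "\<sigma> \<circ> \<tau> = id" "\<tau> \<circ> \<sigma> = id" "inv_into UNIV \<tau> = \<sigma>" "\<And>i. \<sigma> (\<tau> i) = i"
    using symm_inv[OF s] symmD(5,6)[OF s] inv_inv_eq[OF bij] by (simp_all add: \<tau>_def fun_eq_iff)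
  have c: "nz c" using b by (simp add: c_def)
  have e1: "(\<lambda>i. b i * c (inv_into UNIV \<sigma> i)) = (\<lambda>i. 1)" "(\<lambda>i. c i * b (inv_into UNIV \<tau> i)) = (\<lambda>i. 1)"
    using b t(5) unfolding t(4) by (auto simp: c_def \<tau>_def)
  show "comb b \<sigma> (comb c \<tau> x) = x" unfolding comb_mult[OF b c s t(1) x] e1 t(2) by (rule comb_one[OF x])
  show "comb c \<tau> (comb b \<sigma> x) = x" unfolding comb_mult[OF c b t(1) s x] e1 t(3) by (rule comb_one[OF x])
qed

lemma comb_Bij: assumes b: "nz b" and s: "\<sigma> \<in> symm" shows "comb b \<sigma> \<in> Bij (carrier W)"
proof -
  have "nz (\<lambda>i. inverse (b (\<sigma> i)))" using b by simp
  note c = comb_closed[OF this symm_inv[OF s]]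
  have "bij_betw (comb b \<sigma>) (carrier W) (carrier W)"
    by (rule bij_betw_byWitness[where f' = "comb (\<lambda>i. inverse (b (\<sigma> i))) (inv_into UNIV \<sigma>)"])
      (use comb_inverse[OF b s] comb_closed[OF b s] c in auto)
  then show ?thesis by (simp add: Bij_def comb_extensional)
qed

lemma counit_hom: "\<epsilon> \<in> alg_hom W base_alg"
  "\<epsilon> (w g) = (case g of gE i \<Rightarrow> 0 | gF i \<Rightarrow> 0 | gK i \<Rightarrow> 1 | gKbar i \<Rightarrow> 1 | gJ \<Rightarrow> 1)"
  unfolding w_counit_def by (rule hom_from_W[OF wrel_counit])+

lemma auts_iff: "\<phi> \<in> auts \<longleftrightarrow> \<phi> \<in> alg_hom W W \<and> \<phi> \<in> Bij (carrier W) \<and>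
    (\<forall>x\<in>carrier W. tensor_map W W \<phi> \<phi> (\<Delta> x) = \<Delta> (\<phi> x) \<and> \<epsilon> x = \<epsilon> (\<phi> x) \<and> \<phi> (T x) = T (\<phi> x))"
  by (simp add: weak_hopf_auts_def Let_def)

text \<open>Each compatibility is an equality of two homomorphisms and is checked on generators, the
  one with the antipode in the opposite algebra. Preservation of types enters the coproduct through
  the factors \<open>gl\<close> and \<open>gl'\<close>.\<close>

lemma comb_auts: assumes b: "nz b" and s: "\<sigma> \<in> symm" shows "comb b \<sigma> \<in> auts"
proof -
  let ?h = "comb b \<sigma>"
  note h = comb_hom[OF b s] and hw = comb_w[OF b s]
  note hs = alg_hom_mult[OF h] alg_hom_smult[OF h]
  note tm = tensor_map_alg_hom[OF kalg_W kalg_W h h] and tp = tensor_map_pure[OF kalg_W kalg_W h h]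
  have gl: "?h (gl i) = gl (\<sigma> i)" "?h (gl' i) = gl' (\<sigma> i)" for i
    using hw[of gJ] alg_hom_one[OF h] by (simp_all add: gl_def gl'_def symmD(3,4)[OF s])
  have "tensor_map W W ?h ?h (\<Delta> x) = \<Delta> (?h x)" if "x \<in> carrier W" for x
  proof (rule hom_eqI[OF alg_hom_comp[OF comult_hom tm] alg_hom_comp[OF h comult_hom] TT.kalg_T _ that])
    show "tensor_map W W ?h ?h (\<Delta> (w g)) = \<Delta> (?h (w g))" for g
      by (cases g) (simp_all add: comult_w hw tp alg_hom_add[OF tm] alg_hom_smult[OF comult_hom] gl TT.T.smult_r_distr)
  qed
  moreover have "\<epsilon> x = \<epsilon> (?h x)" if "x \<in> carrier W" for x
  proof (rule hom_eqI[OF counit_hom(1) alg_hom_comp[OF h counit_hom(1)] kalg_base_alg _ that])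
    show "\<epsilon> (w g) = \<epsilon> (?h (w g))" for g
      by (cases g) (simp_all add: counit_hom hw alg_hom_smult[OF counit_hom(1)])
  qed
  moreover have "?h (T x) = T (?h x)" if "x \<in> carrier W" for x
  proof (rule hom_eqI[OF alg_hom_comp[OF antipode_hom opp_alg_hom[OF h]] alg_hom_comp[OF h antipode_hom] kalg_opp[OF kalg_W] _ that])
    show "?h (T (w g)) = T (?h (w g))" for g
      by (cases g) (simp_all add: antipode_w hw hs antipode_lin symm_P[OF s] mult.commute)
  qed
  ultimately show ?thesis unfolding auts_iff using h comb_Bij[OF b s] by blast
qed

text \<open>Applying the tensor square of the inverse to the coproduct condition for \<phi> yields
  the condition for the inverse.\<close>

lemma weak_aut_inverse:
  assumes "\<phi> \<in> auts"
  shows "weak_aut a d q \<kappa> \<kappa>' \<phi> (inv_into (carrier W) \<phi>)"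
proof -
  let ?\<psi> = "inv_into (carrier W) \<phi>"
  have \<phi>: "\<phi> \<in> alg_hom W W" "bij_betw \<phi> (carrier W) (carrier W)"
    "\<And>x. x \<in> carrier W \<Longrightarrow> tensor_map W W \<phi> \<phi> (\<Delta> x) = \<Delta> (\<phi> x)" "\<And>x. x \<in> carrier W \<Longrightarrow> \<phi> (T x) = T (\<phi> x)"
    using assms unfolding auts_iff Bij_def by blast+
  have inv: "?\<psi> (\<phi> x) = x" "\<phi> (?\<psi> x) = x" "?\<psi> x \<in> carrier W" if "x \<in> carrier W" for x
    using \<phi>(2) that unfolding bij_betw_def by (simp_all add: f_inv_into_f inv_into_into)
  have cl: "\<phi> x \<in> carrier W" if "x \<in> carrier W" for x using alg_hom_closed[OF \<phi>(1) that] .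
  have eq: "?\<psi> y = x" if "x \<in> carrier W" "y = \<phi> x" for x y using inv that by simp
  have \<psi>: "?\<psi> \<in> alg_hom W W"
    unfolding alg_hom_iff
  proof (intro conjI ballI klinI)
    fix x y c assume x: "x \<in> carrier W"
    show "?\<psi> x \<in> carrier W" using inv x by simp
    show "?\<psi> (c \<odot>\<^bsub>W\<^esub> x) = c \<odot>\<^bsub>W\<^esub> ?\<psi> x" using inv x by (intro eq) (simp_all add: alg_hom_smult[OF \<phi>(1)])
    assume y: "y \<in> carrier W"
    show "?\<psi> (x \<oplus>\<^bsub>W\<^esub> y) = ?\<psi> x \<oplus>\<^bsub>W\<^esub> ?\<psi> y" using inv x y by (intro eq) (simp_all add: alg_hom_add[OF \<phi>(1)])
    show "?\<psi> (x \<otimes>\<^bsub>W\<^esub> y) = ?\<psi> x \<otimes>\<^bsub>W\<^esub> ?\<psi> y" using inv x y by (intro eq) (simp_all add: alg_hom_mult[OF \<phi>(1)])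
  next
    show "?\<psi> \<one>\<^bsub>W\<^esub> = \<one>\<^bsub>W\<^esub>" by (intro eq) (simp_all add: alg_hom_one[OF \<phi>(1)])
  qed
  have tm: "tensor_map W W ?\<psi> ?\<psi> (tensor_map W W \<phi> \<phi> X) = X" if X: "X \<in> carrier TW" for X
  proof (rule TT.klin_eq_on_T[OF _ _ TT.kalg_T _ X])
    note hom = tensor_map_alg_hom[OF kalg_W kalg_W \<phi>(1) \<phi>(1)] tensor_map_alg_hom[OF kalg_W kalg_W \<psi> \<psi>]
    show "(\<lambda>X. tensor_map W W ?\<psi> ?\<psi> (tensor_map W W \<phi> \<phi> X)) \<in> klin TW TW"
      using alg_hom_comp[OF hom] alg_hom_klin by blast
    show "(\<lambda>X. X) \<in> klin TW TW" using id_alg_hom alg_hom_klin by blast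
    show "tensor_map W W ?\<psi> ?\<psi> (tensor_map W W \<phi> \<phi> (tW x y)) = tW x y" if "x \<in> carrier W" "y \<in> carrier W" for x y
      using that by (simp add: tensor_map_pure[OF kalg_W kalg_W \<phi>(1) \<phi>(1)] tensor_map_pure[OF kalg_W kalg_W \<psi> \<psi>] inv cl)
  qed
  have c: "tensor_map W W ?\<psi> ?\<psi> (\<Delta> x) = \<Delta> (?\<psi> x)" if "x \<in> carrier W" for x
    using tm[of "\<Delta> (?\<psi> x)"] \<phi>(3)[of "?\<psi> x"] inv[OF that] by simp
  have "T x \<in> carrier W" if "x \<in> carrier W" for x using alg_hom_closed[OF antipode_hom that] by simp
  then have t: "?\<psi> (T x) = T (?\<psi> x)" if "x \<in> carrier W" for x
    using \<phi>(4)[of "?\<psi> x"] inv[OF that] by (intro eq) simp_all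
  show ?thesis
    by (intro weak_aut.intro weak_quantum_axioms weak_aut_axioms.intro) (simp_all add: \<phi> \<psi> c t inv)
qed

lemma auts_comb:
  assumes "\<phi> \<in> auts" obtains b \<sigma> where "nz b" "\<sigma> \<in> symm" "\<phi> = comb b \<sigma>"
proof -
  interpret A: weak_aut a d q \<kappa> \<kappa>' \<phi> "inv_into (carrier W) \<phi>" by (rule weak_aut_inverse[OF assms])
  obtain b where b: "\<And>i. b i \<noteq> 0" "\<And>i. \<phi> (E i) = b (A.sg i) \<odot>\<^bsub>W\<^esub> E (A.sg i)"
    "\<And>i. \<phi> (F i) = inverse (b (A.sg i)) \<odot>\<^bsub>W\<^esub> F (A.sg i)" by (rule A.automorphism_form) blast
  have nz: "nz b" using b(1) by blast
  have s: "A.sg \<in> symm" unfolding symm_iff using A.bij_sg A.cartan_image A.types by blast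
  have "\<phi> = comb b A.sg"
  proof (rule extensionalityI[of _ "carrier W"])
    show "\<phi> \<in> extensional (carrier W)" using assms unfolding auts_iff Bij_def by blast
    show "\<phi> x = comb b A.sg x" if "x \<in> carrier W" for x
    proof (rule hom_eqI[OF A.homs(1) comb_hom[OF nz s] kalg_W _ that])
      show "\<phi> (w g) = comb b A.sg (w g)" for g
        by (cases g) (simp_all add: comb_w[OF nz s] b(2,3) A.image_K A.image_L A.image_J)
    qed
  qed (rule comb_extensional)
  then show thesis using that nz s by blast
qed

text \<open>The images of the \<open>K i\<close> determine \<sigma>, and then those of the
  \<open>E i\<close> determine \<open>b\<close>.\<close>

lemma comb_inj:
  assumes b: "nz b" "nz b'" and s: "\<sigma> \<in> symm" "\<sigma>' \<in> symm" and eq: "comb b \<sigma> = comb b' \<sigma>'"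
  shows "b = b'" "\<sigma> = \<sigma>'"
proof -
  have e: "diag_gen b (map_gen \<sigma> g) = diag_gen b' (map_gen \<sigma>' g)" for g
    using arg_cong[OF eq, of "\<lambda>f. f (w g)"] by (simp add: comb_w[OF b(1) s(1)] comb_w[OF b(2) s(2)])
  show \<sigma>: "\<sigma> = \<sigma>'" 
  proof
    fix i show "\<sigma> i = \<sigma>' i" using e[of "gK i"] by (intro K_inj) simp
  qed
  have "b (\<sigma> i) = b' (\<sigma> i)" for i
  proof (rule scalar_eq[of "E (\<sigma> i)"])
    show "E (\<sigma> i) \<noteq> \<zero>\<^bsub>W\<^esub>"
    proof
      assume "E (\<sigma> i) = \<zero>\<^bsub>W\<^esub>"
      then have "E (\<sigma> i) \<star> J = \<zero>\<^bsub>W\<^esub>" by (simp only: l_null w_closed)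
      then show False using EJ_nonzero by blast
    qed
    show "b (\<sigma> i) \<odot>\<^bsub>W\<^esub> E (\<sigma> i) = b' (\<sigma> i) \<odot>\<^bsub>W\<^esub> E (\<sigma> i)" using e[of "gE i"] unfolding \<sigma>[symmetric] by simp
  qed simp
  moreover have "surj \<sigma>" using symmD(1)[OF s(1)] by (rule bij_is_surj)
  ultimately show "b = b'" by (metis (full_types) ext surj_def)
qed

abbreviation "Aut \<equiv> Aut_w a d q \<kappa> \<kappa>'"

lemma Aut_simps:
  "carrier Aut = auts" "\<phi> \<otimes>\<^bsub>Aut\<^esub> \<psi> = \<phi> \<otimes>\<^bsub>BijGroup (carrier W)\<^esub> \<psi>"
  by (simp_all add: Aut_w_def)

lemma auts_Bij: "\<phi> \<in> auts \<Longrightarrow> \<phi> \<in> Bij (carrier W)"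
  unfolding auts_iff by blast

lemma BijGroup_mult:
  "\<phi> \<in> Bij S \<Longrightarrow> \<psi> \<in> Bij S \<Longrightarrow> \<phi> \<otimes>\<^bsub>BijGroup S\<^esub> \<psi> = compose S \<phi> \<psi>"
  by (simp add: BijGroup_def)

lemma comb_product:
  assumes b: "nz b" "nz b'" and s: "\<sigma> \<in> symm" "\<sigma>' \<in> symm"
  shows "comb b \<sigma> \<otimes>\<^bsub>Aut\<^esub> comb b' \<sigma>' = comb (\<lambda>i. b i * b' (inv_into UNIV \<sigma> i)) (\<sigma> \<circ> \<sigma>')"
  unfolding Aut_simps BijGroup_mult[OF comb_Bij[OF b(1) s(1)] comb_Bij[OF b(2) s(2)]]
  by (rule extensionalityI[OF compose_extensional comb_extensional]) (simp add: compose_def comb_mult[OF b s])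

lemma comb_diag: assumes "nz b" shows "comb b id = dg b"
proof (rule extensionalityI[OF comb_extensional aut_extensional(1)])
  show "comb b id x = dg b x" if "x \<in> carrier W" for x
    by (rule hom_eqI[OF comb_hom[OF assms symm_id] diag_aut_hom(1)[OF assms] kalg_W _ that])
      (simp add: comb_w[OF assms symm_id] diag_aut_hom(2)[OF assms] gen.map_id)
qed

lemma comb_diagram: assumes "\<sigma> \<in> symm" shows "comb (\<lambda>i. 1) \<sigma> = dm \<sigma>"
proof (rule extensionalityI[OF comb_extensional aut_extensional(2)])
  have nz: "nz (\<lambda>i. 1 :: 'k)" by simp
  show "comb (\<lambda>i. 1) \<sigma> x = dm \<sigma> x" if "x \<in> carrier W" for x
  proof (rule hom_eqI[OF comb_hom[OF nz assms] diagram_aut_hom(1)[OF assms] kalg_W _ that])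
    show "comb (\<lambda>i. 1) \<sigma> (w g) = dm \<sigma> (w g)" for g
      by (cases g) (simp_all add: comb_w[OF nz assms] diagram_aut_hom(2)[OF assms])
  qed
qed

lemma diag_diagram: assumes "nz b" "\<sigma> \<in> symm" shows "dg b \<otimes>\<^bsub>Aut\<^esub> dm \<sigma> = comb b \<sigma>"
proof -
  have nz: "nz (\<lambda>i. 1 :: 'k)" by simp
  show ?thesis
    using comb_product[OF assms(1) nz symm_id assms(2)] comb_diag[OF assms(1)] comb_diagram[OF assms(2)] by simp
qed

text \<open>Every automorphism is some \<open>comb b \<sigma>\<close>, so closure under products and
  inverses is read off from the explicit formulas.\<close>

lemma group_Aut: "group Aut"
proof -
  interpret B: group "BijGroup (carrier W)" by (rule group_BijGroup)
  have "subgroup auts (BijGroup (carrier W))"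
  proof (rule B.subgroupI)
    show "auts \<subseteq> carrier (BijGroup (carrier W))" using auts_Bij by (auto simp: BijGroup_def)
    have "comb (\<lambda>i. 1) id \<in> auts" by (rule comb_auts[OF _ symm_id]) simp
    then show "auts \<noteq> {}" by blast
  next
    fix \<phi> assume \<phi>: "\<phi> \<in> auts"
    obtain b \<sigma> where f: "nz b" "\<sigma> \<in> symm" "\<phi> = comb b \<sigma>" by (rule auts_comb[OF \<phi>])
    let ?\<psi> = "comb (\<lambda>i. inverse (b (\<sigma> i))) (inv_into UNIV \<sigma>)"
    have \<psi>: "?\<psi> \<in> auts" using f(1) by (intro comb_auts symm_inv[OF f(2)]) simp
    have "?\<psi> \<otimes>\<^bsub>BijGroup (carrier W)\<^esub> \<phi> = \<one>\<^bsub>BijGroup (carrier W)\<^esub>"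
      unfolding BijGroup_mult[OF auts_Bij[OF \<psi>] auts_Bij[OF \<phi>]] unfolding f(3)
      using comb_inverse(2)[OF f(1,2)] by (simp add: BijGroup_def compose_def restrict_def fun_eq_iff)
    then have "inv\<^bsub>BijGroup (carrier W)\<^esub> \<phi> = ?\<psi>"
      using auts_Bij[OF \<phi>] auts_Bij[OF \<psi>] by (intro B.inv_equality) (simp_all add: BijGroup_def)
    then show "inv\<^bsub>BijGroup (carrier W)\<^esub> \<phi> \<in> auts" using \<psi> by simp
  next
    fix \<phi> \<psi> assume "\<phi> \<in> auts" "\<psi> \<in> auts"
    then obtain b \<sigma> b' \<sigma>' where f: "nz b" "\<sigma> \<in> symm" "\<phi> = comb b \<sigma>" "nz b'" "\<sigma>' \<in> symm" "\<psi> = comb b' \<sigma>'"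
      by (metis auts_comb)
    show "\<phi> \<otimes>\<^bsub>BijGroup (carrier W)\<^esub> \<psi> \<in> auts"
      using comb_product[OF f(1,4,2,5)] f(1,4) comb_auts[OF _ symm_comp[OF f(2,5)]]
      by (simp add: f(3,6) Aut_simps)
  qed
  then show ?thesis unfolding Aut_w_def by (rule B.subgroup_imp_group)
qed

lemma Aut_iso:
  "(\<lambda>(b, \<sigma>). dg b \<otimes>\<^bsub>Aut\<^esub> dm \<sigma>)
    \<in> iso (semidirect_product diag_group (diagram_group a d \<kappa> \<kappa>') (\<lambda>\<sigma>. perm_action (inv_into UNIV \<sigma>))) Aut"
  (is "?f \<in> iso ?S _")
proof -
  have car: "carrier ?S = {b. nz b} \<times> symm" by (simp add: semidirect_product_def diag_group_def)
  have f: "?f (b, \<sigma>) = comb b \<sigma>" if "nz b" "\<sigma> \<in> symm" for b \<sigma> using diag_diagram[OF that] by simp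
  have "?f x \<in> auts" if "x \<in> carrier ?S" for x
    using that comb_auts f unfolding car by force
  moreover have "?f (x \<otimes>\<^bsub>?S\<^esub> y) = ?f x \<otimes>\<^bsub>Aut\<^esub> ?f y" if "x \<in> carrier ?S" "y \<in> carrier ?S" for x y
  proof -
    obtain b \<sigma> b' \<sigma>' where x: "x = (b, \<sigma>)" and y: "y = (b', \<sigma>')" by (metis surj_pair)
    have xy: "x = (b, \<sigma>)" "y = (b', \<sigma>')" "nz b" "\<sigma> \<in> symm" "nz b'" "\<sigma>' \<in> symm"
      using that x y unfolding car by simp_all
    let ?c = "\<lambda>i. b i * b' (inv_into UNIV \<sigma> i)"
    have m: "x \<otimes>\<^bsub>?S\<^esub> y = (?c, \<sigma> \<circ> \<sigma>')"
      by (simp add: xy(1,2) semidirect_product_def diag_group_def diagram_group_def perm_action_def)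
    have "nz ?c" using xy by simp
    from f[OF this symm_comp[OF xy(4,6)]] show ?thesis
      unfolding m using comb_product[OF xy(3,5,4,6)] f[OF xy(3,4)] f[OF xy(5,6)] xy(1,2) by metis
  qed
  moreover have "inj_on ?f (carrier ?S)"
  proof (rule inj_onI)
    fix x y assume c: "x \<in> carrier ?S" "y \<in> carrier ?S" and e: "?f x = ?f y"
    obtain b \<sigma> b' \<sigma>' where x: "x = (b, \<sigma>)" and y: "y = (b', \<sigma>')" by (metis surj_pair)
    have xy: "x = (b, \<sigma>)" "y = (b', \<sigma>')" "nz b" "\<sigma> \<in> symm" "nz b'" "\<sigma>' \<in> symm"
      using c x y unfolding car by simp_all
    have "comb b \<sigma> = comb b' \<sigma>'" using e unfolding xy(1,2) f[OF xy(3,4)] f[OF xy(5,6)] .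
    from comb_inj[OF xy(3,5,4,6) this] show "x = y" by (simp add: xy(1,2))
  qed
  moreover have "auts \<subseteq> ?f ` carrier ?S"
  proof
    fix \<phi> assume "\<phi> \<in> auts"
    then obtain b \<sigma> where "nz b" "\<sigma> \<in> symm" "\<phi> = comb b \<sigma>" by (rule auts_comb)
    then show "\<phi> \<in> ?f ` carrier ?S" using f[of b \<sigma>] unfolding car by (intro image_eqI[of _ _ "(b, \<sigma>)"]) auto
  qed
  ultimately show ?thesis by (auto simp: iso_def hom_def bij_betw_def Aut_simps)
qed

end

section \<open>From root systems to symmetrised Cartan matrices\<close>

lemma independent_family:
  fixes \<alpha> :: "'i::finite \<Rightarrow> 'v::real_vector"
  assumes "inj \<alpha>" "independent (range \<alpha>)" "(\<Sum>i\<in>UNIV. u i *\<^sub>R \<alpha> i) = 0"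
  shows "u i = 0"
proof -
  have "(\<Sum>v\<in>range \<alpha>. u (inv_into UNIV \<alpha> v) *\<^sub>R v) = 0"
    using assms(1,3) by (simp add: sum.reindex)
  then have "u (inv_into UNIV \<alpha> (\<alpha> i)) = 0"
    using independentD[OF assms(2), of "range \<alpha>" "\<lambda>v. u (inv_into UNIV \<alpha> v)" "\<alpha> i"] by simp
  then show ?thesis using assms(1) by simp
qed

text \<open>Scalar products give all conditions on \<open>a\<close> and \<open>d\<close> except the
  sign off the diagonal. For that, the reflection of one simple root in another is a root with
  coefficient \<open>1\<close> at \<open>j\<close> and \<open>- a i j\<close> at \<open>i\<close>,
  and the coefficients of a root do not have opposite signs.\<close>

lemma cartan_data_cartan_q:
  fixes a :: "'i::finite \<Rightarrow> 'i \<Rightarrow> int" and q :: "'k::field"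
  assumes C: "cartan_data R \<alpha> a d" and q: "q \<noteq> 0" "\<forall>m>0. q ^ m \<noteq> 1"
  shows "cartan_q a d q"
proof
  have R: "irreducible_root_system R" and S: "inj \<alpha>" "range \<alpha> \<subseteq> R" "independent (range \<alpha>)"
    "\<And>\<beta>. \<beta> \<in> R \<Longrightarrow> \<exists>c :: 'i \<Rightarrow> int. \<beta> = (\<Sum>i\<in>UNIV. of_int (c i) *\<^sub>R \<alpha> i) \<and> ((\<forall>i. 0 \<le> c i) \<or> (\<forall>i. c i \<le> 0))"
    and A: "of_int (a i j) = 2 * (\<alpha> i \<bullet> \<alpha> j) / (\<alpha> i \<bullet> \<alpha> i)" and D: "of_nat (d i) = (\<alpha> i \<bullet> \<alpha> i) / 2" for i j
    using C by (auto simp: cartan_data_def simple_roots_def)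
  have \<alpha>R: "\<alpha> i \<in> R" and "0 \<notin> R"
    and refl: "\<forall>\<gamma>\<in>R. \<forall>\<beta>\<in>R. \<beta> - (2 * (\<gamma> \<bullet> \<beta>) / (\<gamma> \<bullet> \<gamma>)) *\<^sub>R \<gamma> \<in> R" for i
    using R S(2) by (auto simp: irreducible_root_system_def)
  then have "\<alpha> i \<noteq> 0" for i by metis
  then have pos: "\<alpha> i \<bullet> \<alpha> i > 0" for i by simp
  show "d i > 0" for i using D[of i] pos[of i] by (metis half_gt_zero of_nat_0_less_iff)
  have da: "real_of_int (int (d i) * a i j) = \<alpha> i \<bullet> \<alpha> j" for i j
    unfolding of_int_mult of_int_of_nat_eq A D using pos[of i] by simp
  show "int (d i) * a i j = int (d j) * a j i" for i j
    using da[of i j] da[of j i] inner_commute[of "\<alpha> i" "\<alpha> j"] of_int_eq_iff by metis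
  show "a i i = 2" for i
  proof -
    have "of_int (a i i) = (2 :: real)" using A[of i i] pos[of i] by simp
    then show ?thesis by simp
  qed
  show "a i j \<le> 0" if ij: "i \<noteq> j" for i j
  proof (rule ccontr)
    assume n: "\<not> a i j \<le> 0"
    have r: "\<alpha> j - of_int (a i j) *\<^sub>R \<alpha> i \<in> R"
      unfolding A by (rule refl[rule_format, OF \<alpha>R \<alpha>R])
    obtain c :: "'i \<Rightarrow> int" where c: "\<alpha> j - of_int (a i j) *\<^sub>R \<alpha> i = (\<Sum>k\<in>UNIV. of_int (c k) *\<^sub>R \<alpha> k)"
      "(\<forall>k. 0 \<le> c k) \<or> (\<forall>k. c k \<le> 0)" using S(4)[OF r] by blast
    \<comment> \<open>The difference of two expansions of the reflected root in simple roots;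
      independence makes it zero.\<close>
    define u :: "'i \<Rightarrow> real" where "u k = (if k = j then 1 else 0) - (if k = i then of_int (a i j) else 0) - of_int (c k)" for k
    have "(\<Sum>k\<in>UNIV. u k *\<^sub>R \<alpha> k) = (\<Sum>k\<in>UNIV. (if k = j then \<alpha> k else 0) - (if k = i then of_int (a i j) *\<^sub>R \<alpha> k else 0)
        - of_int (c k) *\<^sub>R \<alpha> k)"
      by (rule sum.cong) (auto simp: u_def algebra_simps)
    also have "\<dots> = 0" by (simp add: sum_subtractf c(1)[symmetric])
    finally have "u i = 0" "u j = 0" using independent_family[OF S(1,3)] by blast+
    then have "real_of_int (c i) = of_int (- a i j)" "real_of_int (c j) = of_int 1" using ij by (simp_all add: u_def)
    then have "c i = - a i j" "c j = 1" unfolding of_int_eq_iff by simp_all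
    moreover have "0 \<le> c i \<or> c j \<le> 0" using c(2) by blast
    ultimately show False using n by simp
  qed
  show "q \<noteq> 0" by (rule q(1))
  show "q ^ m \<noteq> 1" if "m > 0" for m using q(2) that by blast
qed

theorem theorem5p4:
  fixes R :: "'v::euclidean_space set"
    and \<alpha> :: "'i::finite \<Rightarrow> 'v"
    and a :: "'i \<Rightarrow> 'i \<Rightarrow> int"
    and d :: "'i \<Rightarrow> nat"
    and q :: "'k::field_char_0"
    and \<kappa> \<kappa>' :: "'i \<Rightarrow> bool"
  assumes "cartan_data R \<alpha> a d"
    and "\<forall>i. q ^ d i \<noteq> 0 \<and> q ^ d i \<noteq> 1 \<and> q ^ d i \<noteq> -1"
    and "\<forall>m>0. q ^ m \<noteq> 1"
  shows "group (Aut_w a d q \<kappa> \<kappa>') \<and>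
    (\<lambda>(b, \<sigma>). diag_aut a d q \<kappa> \<kappa>' b \<otimes>\<^bsub>Aut_w a d q \<kappa> \<kappa>'\<^esub> diagram_aut a d q \<kappa> \<kappa>' \<sigma>)
      \<in> iso (semidirect_product diag_group (diagram_group a d \<kappa> \<kappa>') (\<lambda>\<sigma>. perm_action (inv_into UNIV \<sigma>)))
             (Aut_w a d q \<kappa> \<kappa>')"
proof -
  \<comment> \<open>If \<open>q\<close> were zero, \<open>q ^ d i \<noteq> 0\<close> would force
    \<open>d i = 0\<close>, and then the power is \<open>1\<close>, which is excluded.\<close>
  have "q \<noteq> 0"
  proof
    assume "q = 0"
    then have "\<forall>i. d i = 0" using assms(2) by (metis power_eq_0_iff gr0I)
    then show False using assms(2) by simp
  qed
  then interpret weak_quantum a d q \<kappa> \<kappa>'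
    unfolding weak_quantum_def using assms by (intro cartan_data_cartan_q) auto
  show ?thesis using group_Aut Aut_iso by blast
qed

end
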